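(* Let $\rho_1,\rho_2$ be two boundary-preserving isomorphic Fuchsian representations of $G=\pi_1S$ satisfying the extended Schottky condition. Let $(\Sigma^+,\sigma)$ be the associated countable Markov shift and $\tau,\kappa:\Sigma^+\to\mathbb{R}$ the associated geometric potentials. Let $a,b\ge 0$ be not both zero, and let $p\in G$ be a parabolic element. Then $$P_\sigma(-t(a\tau+b\kappa))\ \text{ is infinite for } t<\delta^{a,b}_{\langle p\rangle},\qquad\text{and is (finite and) real analytic in } t \text{ for } t>\delta^{a,b}_{\langle p\rangle}.$$
   Context: $\mathbb{H}$ is the hyperbolic plane (Poincaré disk model), $\partial_\infty\mathbb{H}=S^1$ its boundary, $d$ its distance; $\mathrm{PSL}(2,\mathbb{R})$ acts by isometries. $S$ is a surface with negative Euler characteristic and $G=\pi_1S$. A Fuchsian representation is a discrete faithful representation $\rho:G\to\mathrm{PSL}(2,\mathbb{R})$. Extended Schottky condition: $\rho(G)$ is generated by hyperbolic isometries $h_1,\dots,h_{N_1}$ and parabolic isometries $p_1,\dots,p_{N_2}$ with $N_2\ge1$, $N_1+N_2\ge3$, such that: (C1) for each $i$ there are compact neighborhoods $C_{h_i}$, $C_{h_i^{-1}}$ in $S^1$ of the attracting and repelling fixed points of $h_i$ with $h_i(S^1\setminus C_{h_i^{-1}})\subset C_{h_i}$; (C2) for each $i$ there is a compact neighborhood $C_{p_i}$ in $S^1$ of the fixed point of $p_i$ with $p_i^n(S^1\setminus C_{p_i})\subset C_{p_i}$ for all $n\in\mathbb{Z}\setminus\{0\}$; (C3) these $2N_1+N_2$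 neighborhoods are pairwise disjoint. Such a group is free on these generators. Boundary-preserving isomorphic: the isomorphism $\iota=\rho_2\circ\rho_1^{-1}:\rho_1(G)\to\rho_2(G)$ sends hyperbolic elements to hyperbolic elements and parabolic elements to parabolic elements, and $\gamma\in\rho_1(G)$ corresponds to a geodesic boundary of $S_1=\rho_1(G)\backslash\mathbb{H}$ iff $\iota(\gamma)$ corresponds to a geodesic boundary of $S_2=\rho_2(G)\backslash\mathbb{H}$. One calls $g\in G$ hyperbolic (parabolic) if $\rho_1(g)$ and $\rho_2(g)$ are. Generators $\mathcal{A}=\{h_1,\dots,h_{N_1},p_1,\dots,p_{N_2}\}$ of $G$ are fixed so that for $i=1,2$ the elements $\rho_i(h_j)$ are hyperbolic, $\rho_i(p_k)$ are parabolic, and they are extended Schottky generators of $\rho_i(G)$. Markov shift: $\Sigma^+=\{(a_i^{n_i})_{i\ge1}:a_i\in\mathcal{A},\ n_i\in\mathbb{Z}\setminus\{0\},\ a_i\ne a_{i+1}\}$ with alphabet $\{a^n:a\in\mathcal{A},n\in\mathbb{Z}\setminus\{0\}\}$, and $\sigma$ the left shift. Geometric potentials: let $\Lambda_i^0$ be the limit set of $\rho_i(G)$ minus the $\rho_i(G)$-orbits of fixed points of $\rho_i(\alpha)$, $\alpha\in\mathcal{A}$. There is a bijection $\omega_i:\Lambda_i^0\to\Sigma^+$ with $\omega_i^{-1}(x)=\lim_k\rho_i(a_1^{n_1}\cdots a_k^{n_k})o$ for $x=a_1^{n_1}a_2^{n_2}\cdots$ ($o$ the origin of the disk). With the Busemann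 function $B_\xi(x,y)=\lim_{z\to\xi}\big(d(x,z)-d(y,z)\big)$, put $\tau(x)=B_{\omega_1^{-1}(x)}(o,\rho_1(a_1^{n_1})o)$ and $\kappa(x)=B_{\omega_2^{-1}(x)}(o,\rho_2(a_1^{n_1})o)$. (The paper also writes $\tau,\kappa$ for cohomologous locally Hölder functions bounded away from $0$; this does not change pressures.) Gurevich pressure: $P_\sigma(g)=\lim_{n\to\infty}\frac1n\log\sum_{x:\sigma^nx=x}e^{S_ng(x)}\chi_{[s]}(x)$ with $S_ng=\sum_{i=0}^{n-1}g\circ\sigma^i$ and $[s]$ the set of sequences whose first symbol is $s$; it is independent of the symbol $s$. Fix $o=(o_1,o_2)\in\mathbb{H}\times\mathbb{H}$, $d^{a,b}(o,\gamma o)=a\,d(o_1,\rho_1(\gamma)o_1)+b\,d(o_2,\rho_2(\gamma)o_2)$. For $g\in G$, $Q^{a,b}_{\langle g\rangle}(t)=\sum_{n\in\mathbb{Z}}e^{-t\,d^{a,b}(o,g^no)}$ and $\delta^{a,b}_{\langle g\rangle}=\inf\{t\in\mathbb{R}:Q^{a,b}_{\langle g\rangle}(t)<\infty\}$. (The introduction of the paper states this lemma with $\delta^{a,b}_{\langle p\rangle}$ replaced by its value $\frac{1}{2(a+b)}$.) *)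

theory Defs
  imports "HOL-Analysis.Analysis" "HOL-Algebra.Coset" "HOL-Algebra.Generated_Groups" "HOL-Homology.Homology"
begin

section \<open>Surfaces, Euler characteristic, fundamental group\<close>

text \<open>Connected topological 2-manifolds, possibly with boundary; compactness is not required.\<close>

definition surface :: "'s::topological_space set \<Rightarrow> bool" where
  "surface S \<longleftrightarrow> S \<noteq> {} \<and> connected S \<and>
     Hausdorff_space (top_of_set S) \<and> second_countable (top_of_set S) \<and>
     (\<forall>x\<in>S. \<exists>U V. openin (top_of_set S) U \<and> x \<in> U \<and>
        openin (top_of_set {z::complex. 0 \<le> Im z}) V \<and> U homeomorphic V)"

definition indep_family :: "('c, 'm) monoid_scheme \<Rightarrow> 'c set \<Rightarrow> bool" where
  "indep_family A B \<longleftrightarrow> finite B \<and> B \<subseteq> carrier A \<and>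
     (\<forall>c :: 'c \<Rightarrow> int. finprod A (\<lambda>x. x [^]\<^bsub>A\<^esub> c x) B = \<one>\<^bsub>A\<^esub> \<longrightarrow> (\<forall>x\<in>B. c x = 0))"

definition has_rank :: "('c, 'm) monoid_scheme \<Rightarrow> nat \<Rightarrow> bool" where
  "has_rank A r \<longleftrightarrow> (\<exists>B. indep_family A B \<and> card B = r) \<and> (\<forall>B. indep_family A B \<longrightarrow> card B \<le> r)"

definition has_euler_characteristic :: "'s::topological_space set \<Rightarrow> int \<Rightarrow> bool" where
  "has_euler_characteristic S c \<longleftrightarrow>
     (\<exists>\<beta> :: nat \<Rightarrow> nat. (\<forall>n. has_rank (homology_group (int n) (top_of_set S)) (\<beta> n)) \<and>
        finite {n. \<beta> n \<noteq> 0} \<and> c = (\<Sum>n | \<beta> n \<noteq> 0. (- 1) ^ n * int (\<beta> n)))"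

definition loops :: "'s::topological_space set \<Rightarrow> 's \<Rightarrow> (real \<Rightarrow> 's) set" where
  "loops S s = {c. path c \<and> path_image c \<subseteq> S \<and> pathstart c = s \<and> pathfinish c = s}"

definition loop_homotopy :: "'s::topological_space set \<Rightarrow> 's \<Rightarrow> ((real \<Rightarrow> 's) \<times> (real \<Rightarrow> 's)) set" where
  "loop_homotopy S s = {(c, c'). c \<in> loops S s \<and> c' \<in> loops S s \<and> homotopic_paths S c c'}"

definition fundamental_group :: "'s::topological_space set \<Rightarrow> 's \<Rightarrow> (real \<Rightarrow> 's) set monoid" where
  "fundamental_group S s =
     \<lparr>carrier = loops S s // loop_homotopy S s,
      mult = (\<lambda>X Y. \<Union>c\<in>X. \<Union>c'\<in>Y. loop_homotopy S s `` {c +++ c'}),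
      one = loop_homotopy S s `` {\<lambda>_. s}\<rparr>"


section \<open>The Poincare disk and the action of PSL(2,R)\<close>

text \<open>The hyperbolic plane is \<^term>\<open>ball (0::complex) 1\<close>, its boundary at infinity is
  \<^term>\<open>sphere (0::complex) 1\<close>, and the origin \<open>o\<close> is \<^term>\<open>0::complex\<close>.
  The metric has curvature -1.\<close>

definition hdist :: "complex \<Rightarrow> complex \<Rightarrow> real" where
  "hdist z w = arcosh (1 + 2 * (norm (z - w))\<^sup>2 / ((1 - (norm z)\<^sup>2) * (1 - (norm w)\<^sup>2)))"

definition busemann :: "complex \<Rightarrow> complex \<Rightarrow> complex \<Rightarrow> real" where
  "busemann \<xi> x y = Lim (at \<xi> within ball 0 1) (\<lambda>z. hdist x z - hdist y z)"

definition SL2R :: "(real^2^2) monoid" where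
  "SL2R = \<lparr>carrier = {A. det A = 1}, mult = (**), one = mat 1\<rparr>"

text \<open>Elements of PSL(2,R) are the cosets \<open>{A, -A}\<close>.\<close>

definition PSL2R :: "(real^2^2) set monoid" where
  "PSL2R = SL2R Mod {mat 1, - mat 1}"

text \<open>The Moebius action of a real matrix on the upper half plane, conjugated by the Cayley map
  \<open>w \<mapsto> (w - i) / (w + i)\<close> onto the disk (see \<open>mobius_disk_cayley\<close> below).
  For determinant 1 the formula also gives the action on the boundary circle.\<close>

definition mobius_disk :: "real^2^2 \<Rightarrow> complex \<Rightarrow> complex" where
  "mobius_disk A z =
     (let \<alpha> = Complex (A$1$1 + A$2$2) (A$1$2 - A$2$1);
          \<beta> = Complex (A$1$1 - A$2$2) (- (A$1$2 + A$2$1))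
      in (\<alpha> * z + \<beta>) / (cnj \<beta> * z + cnj \<alpha>))"

definition psl_act :: "(real^2^2) set \<Rightarrow> complex \<Rightarrow> complex" where
  "psl_act X = mobius_disk (SOME A. A \<in> X)"

lemma mobius_disk_uminus: "mobius_disk (- A) z = mobius_disk A z"
proof -
  have 1: "Complex (- x) (- y) = - Complex x y" for x y by (simp add: complex_eq_iff)
  have a: "Complex ((-A)$1$1 + (-A)$2$2) ((-A)$1$2 - (-A)$2$1) = - Complex (A$1$1 + A$2$2) (A$1$2 - A$2$1)"
    and b: "Complex ((-A)$1$1 - (-A)$2$2) (- ((-A)$1$2 + (-A)$2$1)) = - Complex (A$1$1 - A$2$2) (- (A$1$2 + A$2$1))"
    by (simp_all add: complex_eq_iff)
  have c: "(- \<alpha> * z + - \<beta>) / (cnj (- \<beta>) * z + cnj (- \<alpha>)) = (\<alpha> * z + \<beta>) / (cnj \<beta> * z + cnj \<alpha>)" for \<alpha> \<beta>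
  proof -
    have "- \<alpha> * z + - \<beta> = - (\<alpha> * z + \<beta>)" "cnj (- \<beta>) * z + cnj (- \<alpha>) = - (cnj \<beta> * z + cnj \<alpha>)"
      by simp_all
    then show ?thesis by (simp only: minus_divide_divide)
  qed
  show ?thesis unfolding mobius_disk_def Let_def a b c ..
qed

lemma mobius_disk_cayley:
  fixes w :: complex
  assumes "det A = 1" "Im w > 0"
  defines "Aw \<equiv> (A$1$1 * w + A$1$2) / (A$2$1 * w + A$2$2)"
  shows "mobius_disk A ((w - \<i>) / (w + \<i>)) = (Aw - \<i>) / (Aw + \<i>)"
proof -
  define p q r s where "p = A$1$1" and "q = A$1$2" and "r = A$2$1" and "s = A$2$2"
  have d: "p * s - q * r = 1" using assms(1) by (simp add: det_2 p_def q_def r_def s_def)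
  have w: "w + \<i> \<noteq> 0" using assms(2) by (auto simp: complex_eq_iff)
  have n: "of_real r * w + of_real s \<noteq> 0"
  proof
    assume h: "of_real r * w + of_real s = 0"
    from h have "r * Im w = 0" by (simp add: complex_eq_iff)
    with assms(2) have "r = 0" by simp
    with h have "s = 0" by simp
    with \<open>r = 0\<close> d show False by simp
  qed
  define \<alpha> where "\<alpha> = Complex (p + s) (q - r)"
  define \<beta> where "\<beta> = Complex (p - s) (- (q + r))"
  have num: "\<alpha> * (w - \<i>) + \<beta> * (w + \<i>) = 2 * ((of_real p * w + of_real q) - \<i> * (of_real r * w + of_real s))"
    and den: "cnj \<beta> * (w - \<i>) + cnj \<alpha> * (w + \<i>) = 2 * ((of_real p * w + of_real q) + \<i> * (of_real r * w + of_real s))"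
    by (simp_all add: \<alpha>_def \<beta>_def complex_eq_iff algebra_simps)
  have "mobius_disk A ((w - \<i>) / (w + \<i>)) =
      (\<alpha> * ((w - \<i>) / (w + \<i>)) + \<beta>) / (cnj \<beta> * ((w - \<i>) / (w + \<i>)) + cnj \<alpha>)"
    by (simp add: mobius_disk_def Let_def \<alpha>_def \<beta>_def p_def q_def r_def s_def)
  also have "\<alpha> * ((w - \<i>) / (w + \<i>)) + \<beta> = (\<alpha> * (w - \<i>) + \<beta> * (w + \<i>)) / (w + \<i>)"
    using w by (simp add: field_simps)
  also have "cnj \<beta> * ((w - \<i>) / (w + \<i>)) + cnj \<alpha> = (cnj \<beta> * (w - \<i>) + cnj \<alpha> * (w + \<i>)) / (w + \<i>)"
    using w by (simp add: field_simps)
  also have "(\<alpha> * (w - \<i>) + \<beta> * (w + \<i>)) / (w + \<i>) / ((cnj \<beta> * (w - \<i>) + cnj \<alpha> * (w + \<i>)) / (w + \<i>))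
     = (\<alpha> * (w - \<i>) + \<beta> * (w + \<i>)) / (cnj \<beta> * (w - \<i>) + cnj \<alpha> * (w + \<i>))"
    using w by simp
  also have "\<dots> = ((of_real p * w + of_real q) - \<i> * (of_real r * w + of_real s)) /
       ((of_real p * w + of_real q) + \<i> * (of_real r * w + of_real s))"
    unfolding num den by (rule mult_divide_mult_cancel_left) simp
  also have "\<dots> = (((of_real p * w + of_real q) - \<i> * (of_real r * w + of_real s)) / (of_real r * w + of_real s)) /
       (((of_real p * w + of_real q) + \<i> * (of_real r * w + of_real s)) / (of_real r * w + of_real s))"
    using n by simp
  also have "\<dots> = (Aw - \<i>) / (Aw + \<i>)"
    using n by (simp add: Aw_def p_def q_def r_def s_def diff_divide_distrib add_divide_distrib)
  finally show ?thesis .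
qed

lemma group_SL2R: "group SL2R"
proof (rule groupI)
  fix A assume A: "A \<in> carrier SL2R"
  then have "invertible A" by (simp add: SL2R_def invertible_det_nz)
  then obtain B where B: "A ** B = mat 1" "B ** A = mat 1" by (auto simp: invertible_def)
  from B(2) have "det B * det A = 1" by (metis det_I det_mul)
  with A B show "\<exists>B\<in>carrier SL2R. B \<otimes>\<^bsub>SL2R\<^esub> A = \<one>\<^bsub>SL2R\<^esub>"
    by (auto simp: SL2R_def)
qed (auto simp: SL2R_def det_mul matrix_mul_assoc)

lemma group_PSL2R: "group PSL2R"
proof -
  interpret group SL2R by (rule group_SL2R)
  have m: "A ** (- mat 1) = - A" "(- mat 1) ** A = - A" for A :: "real^2^2"
    by (simp_all add: vec_eq_iff matrix_matrix_mult_def mat_def sum_2 forall_2)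
  have dm: "det (- mat 1 :: real^2^2) = 1"
    by (simp add: det_2 mat_def)
  have mm: "(- mat 1) ** (- mat 1) = (mat 1 :: real^2^2)" by (simp add: m)
  have inv: "inv\<^bsub>SL2R\<^esub> (- mat 1) = - mat 1"
    using mm dm by (intro inv_equality) (auto simp: SL2R_def)
  have s: "subgroup {mat 1, - mat 1} SL2R"
  proof (rule subgroupI)
    fix a assume "a \<in> {mat 1, - mat 1 :: real^2^2}"
    then show "inv\<^bsub>SL2R\<^esub> a \<in> {mat 1, - mat 1}"
      using inv inv_one by (auto simp: SL2R_def)
  qed (use dm mm in \<open>auto simp: SL2R_def\<close>)
  have "{mat 1, - mat 1} \<lhd> SL2R"
    by (rule normalI[OF s]) (auto simp: r_coset_def l_coset_def SL2R_def m)
  then show ?thesis unfolding PSL2R_def by (rule normal.factorgroup_is_group)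
qed

definition boundary_fix :: "(real^2^2) set \<Rightarrow> complex set" where
  "boundary_fix X = {\<xi> \<in> sphere 0 1. psl_act X \<xi> = \<xi>}"

text \<open>The identity has infinitely many boundary fixed points, hence \<^const>\<open>card\<close> gives 0 for it.\<close>

definition is_hyperbolic :: "(real^2^2) set \<Rightarrow> bool" where
  "is_hyperbolic X \<longleftrightarrow> X \<in> carrier PSL2R \<and> card (boundary_fix X) = 2"

definition is_parabolic :: "(real^2^2) set \<Rightarrow> bool" where
  "is_parabolic X \<longleftrightarrow> X \<in> carrier PSL2R \<and> card (boundary_fix X) = 1"

text \<open>For hyperbolic \<open>X\<close>; the repelling fixed point is the attracting one of the inverse.\<close>

definition attracting_fixpoint :: "(real^2^2) set \<Rightarrow> complex" where
  "attracting_fixpoint X = (THE \<xi>. \<xi> \<in> boundary_fix X \<and>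
     (\<forall>z\<in>ball 0 1. (\<lambda>n::nat. psl_act (X [^]\<^bsub>PSL2R\<^esub> n) z) \<longlonglongrightarrow> \<xi>))"

definition repelling_fixpoint :: "(real^2^2) set \<Rightarrow> complex" where
  "repelling_fixpoint X = attracting_fixpoint (inv\<^bsub>PSL2R\<^esub> X)"


section \<open>Fuchsian representations\<close>

text \<open>Discreteness in the quotient PSL(2,R) is discreteness of the preimage in SL(2,R), a set of
  matrices.\<close>

definition fuchsian_rep :: "('g, 'm) monoid_scheme \<Rightarrow> ('g \<Rightarrow> (real^2^2) set) \<Rightarrow> bool" where
  "fuchsian_rep G \<rho> \<longleftrightarrow> \<rho> \<in> hom G PSL2R \<and> inj_on \<rho> (carrier G) \<and> discrete (\<Union> (\<rho> ` carrier G))"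

definition limit_set :: "(real^2^2) set set \<Rightarrow> complex set" where
  "limit_set \<Gamma> = {\<xi> \<in> sphere 0 1. \<xi> islimpt (\<lambda>X. psl_act X 0) ` \<Gamma>}"

definition hconvex :: "complex set \<Rightarrow> bool" where
  "hconvex K \<longleftrightarrow> (\<forall>x\<in>K. \<forall>y\<in>K. \<forall>z\<in>ball 0 1. hdist x z + hdist z y = hdist x y \<longrightarrow> z \<in> K)"

text \<open>The smallest closed convex subset of the disk with the limit set in its closure at infinity;
  its quotient by \<open>\<Gamma>\<close> is the convex core of the quotient surface, whose boundary consists of the
  boundary geodesics.\<close>

definition limit_hull :: "(real^2^2) set set \<Rightarrow> complex set" where
  "limit_hull \<Gamma> = ball 0 1 \<inter>
     \<Inter> {K. K \<subseteq> ball 0 1 \<and> closedin (top_of_set (ball 0 1)) K \<and> hconvex K \<and> limit_set \<Gamma> \<subseteq> closure K}"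

text \<open>The axis of a hyperbolic isometry: the points of minimal displacement.\<close>

definition haxis :: "(real^2^2) set \<Rightarrow> complex set" where
  "haxis X = {x \<in> ball 0 1. \<forall>y \<in> ball 0 1. hdist x (psl_act X x) \<le> hdist y (psl_act X y)}"

definition geodesic_boundary :: "(real^2^2) set set \<Rightarrow> (real^2^2) set \<Rightarrow> bool" where
  "geodesic_boundary \<Gamma> X \<longleftrightarrow> X \<in> \<Gamma> \<and> is_hyperbolic X \<and> haxis X \<subseteq> frontier (limit_hull \<Gamma>)"

definition boundary_preserving ::
    "('g, 'm) monoid_scheme \<Rightarrow> ('g \<Rightarrow> (real^2^2) set) \<Rightarrow> ('g \<Rightarrow> (real^2^2) set) \<Rightarrow> bool" where
  "boundary_preserving G \<rho>\<^sub>1 \<rho>\<^sub>2 \<longleftrightarrow>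
     (let \<iota> = \<rho>\<^sub>2 \<circ> inv_into (carrier G) \<rho>\<^sub>1; \<Gamma>\<^sub>1 = \<rho>\<^sub>1 ` carrier G; \<Gamma>\<^sub>2 = \<rho>\<^sub>2 ` carrier G
      in \<forall>X\<in>\<Gamma>\<^sub>1. (is_hyperbolic X \<longrightarrow> is_hyperbolic (\<iota> X)) \<and>
                (is_parabolic X \<longrightarrow> is_parabolic (\<iota> X)) \<and>
                (geodesic_boundary \<Gamma>\<^sub>1 X \<longleftrightarrow> geodesic_boundary \<Gamma>\<^sub>2 (\<iota> X)))"

text \<open>The generators are indexed by \<open>i < N\<^sub>1\<close> and \<open>j < N\<^sub>2\<close>; \<open>Ca i\<close>, \<open>Cr i\<close> and \<open>Cp j\<close> are the
  neighborhoods of the attracting and the repelling fixed point of \<open>h i\<close> and of the fixed point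
  of \<open>p j\<close>. The last conjunct runs over the \<open>2 N\<^sub>1 + N\<^sub>2\<close> indices.\<close>

definition extended_schottky ::
    "(real^2^2) set set \<Rightarrow> nat \<Rightarrow> (nat \<Rightarrow> (real^2^2) set) \<Rightarrow> nat \<Rightarrow> (nat \<Rightarrow> (real^2^2) set) \<Rightarrow> bool" where
  "extended_schottky \<Gamma> N\<^sub>1 h N\<^sub>2 p \<longleftrightarrow>
     N\<^sub>2 \<ge> 1 \<and> N\<^sub>1 + N\<^sub>2 \<ge> 3 \<and>
     (\<forall>i<N\<^sub>1. is_hyperbolic (h i)) \<and> (\<forall>j<N\<^sub>2. is_parabolic (p j)) \<and>
     \<Gamma> = generate PSL2R (h ` {..<N\<^sub>1} \<union> p ` {..<N\<^sub>2}) \<and>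
     (\<exists>Ca Cr Cp :: nat \<Rightarrow> complex set.
        (\<forall>i<N\<^sub>1. compact (Ca i) \<and> Ca i \<subseteq> sphere 0 1 \<and>
           attracting_fixpoint (h i) \<in> (top_of_set (sphere 0 1)) interior_of (Ca i) \<and>
           compact (Cr i) \<and> Cr i \<subseteq> sphere 0 1 \<and>
           repelling_fixpoint (h i) \<in> (top_of_set (sphere 0 1)) interior_of (Cr i) \<and>
           psl_act (h i) ` (sphere 0 1 - Cr i) \<subseteq> Ca i) \<and>
        (\<forall>j<N\<^sub>2. compact (Cp j) \<and> Cp j \<subseteq> sphere 0 1 \<and>
           boundary_fix (p j) \<subseteq> (top_of_set (sphere 0 1)) interior_of (Cp j) \<and>
           (\<forall>n::int. n \<noteq> 0 \<longrightarrow> psl_act (p j [^]\<^bsub>PSL2R\<^esub> n) ` (sphere 0 1 - Cp j) \<subseteq> Cp j)) \<and>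
        disjoint_family_on (case_sum Ca (case_sum Cr Cp)) ({..<N\<^sub>1} <+> {..<N\<^sub>1} <+> {..<N\<^sub>2}))"


section \<open>The Markov shift and the Gurevich pressure\<close>

text \<open>The symbol \<open>a\<^sup>n\<close> is the pair \<open>(a, n)\<close>; sequences are indexed from 0.\<close>

definition alphabet :: "'g set \<Rightarrow> ('g \<times> int) set" where
  "alphabet \<A> = {(a, n). a \<in> \<A> \<and> n \<noteq> 0}"

definition markov_shift :: "'g set \<Rightarrow> (nat \<Rightarrow> 'g \<times> int) set" where
  "markov_shift \<A> = {x. \<forall>i. x i \<in> alphabet \<A> \<and> fst (x i) \<noteq> fst (x (Suc i))}"

definition shift :: "(nat \<Rightarrow> 's) \<Rightarrow> (nat \<Rightarrow> 's)" where
  "shift x = (\<lambda>i. x (Suc i))"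

definition birkhoff_sum :: "((nat \<Rightarrow> 's) \<Rightarrow> real) \<Rightarrow> nat \<Rightarrow> (nat \<Rightarrow> 's) \<Rightarrow> real" where
  "birkhoff_sum g n x = (\<Sum>i<n. g ((shift ^^ i) x))"

definition partition_sum ::
    "(nat \<Rightarrow> 's) set \<Rightarrow> ((nat \<Rightarrow> 's) \<Rightarrow> real) \<Rightarrow> 's \<Rightarrow> nat \<Rightarrow> ennreal" where
  "partition_sum \<Sigma> g s n =
     (\<Sum>\<^sub>\<infinity>x\<in>{x\<in>\<Sigma>. (shift ^^ n) x = x}. ennreal (exp (birkhoff_sum g n x)) * indicator {x. x 0 = s} x)"

definition ln_ennreal :: "ennreal \<Rightarrow> ereal" where
  "ln_ennreal z = (if z = 0 then - \<infinity> else if z = \<infinity> then \<infinity> else ereal (ln (enn2real z)))"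

text \<open>\<open>P\<close> is the Gurevich pressure of \<open>g\<close>: the defining limit exists in the extended reals and
  equals \<open>P\<close> whichever symbol is used.\<close>

definition has_gurevich_pressure ::
    "'g set \<Rightarrow> ((nat \<Rightarrow> 'g \<times> int) \<Rightarrow> real) \<Rightarrow> ereal \<Rightarrow> bool" where
  "has_gurevich_pressure \<A> g P \<longleftrightarrow>
     (\<forall>s\<in>alphabet \<A>.
        (\<lambda>n. ereal (1 / real n) * ln_ennreal (partition_sum (markov_shift \<A>) g s n)) \<longlonglongrightarrow> P)"

definition real_analytic_on :: "(real \<Rightarrow> real) \<Rightarrow> real set \<Rightarrow> bool" where
  "real_analytic_on f S \<longleftrightarrow>
     (\<forall>x\<in>S. \<exists>r>0. \<exists>c :: nat \<Rightarrow> real. \<forall>y. \<bar>y - x\<bar> < r \<longrightarrow> (\<lambda>n. c n * (y - x) ^ n) sums f y)"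


section \<open>Geometric potentials and critical exponents\<close>

primrec word_prod :: "('g, 'm) monoid_scheme \<Rightarrow> (nat \<Rightarrow> 'g \<times> int) \<Rightarrow> nat \<Rightarrow> 'g" where
  "word_prod G x 0 = \<one>\<^bsub>G\<^esub>"
| "word_prod G x (Suc k) = word_prod G x k \<otimes>\<^bsub>G\<^esub> (fst (x k) [^]\<^bsub>G\<^esub> snd (x k))"

text \<open>The inverse of the coding map: the limit point with itinerary \<open>x\<close>.\<close>

definition coded_point ::
    "('g, 'm) monoid_scheme \<Rightarrow> ('g \<Rightarrow> (real^2^2) set) \<Rightarrow> (nat \<Rightarrow> 'g \<times> int) \<Rightarrow> complex" where
  "coded_point G \<rho> x = lim (\<lambda>k. psl_act (\<rho> (word_prod G x k)) 0)"

definition geometric_potential ::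
    "('g, 'm) monoid_scheme \<Rightarrow> ('g \<Rightarrow> (real^2^2) set) \<Rightarrow> (nat \<Rightarrow> 'g \<times> int) \<Rightarrow> real" where
  "geometric_potential G \<rho> x =
     busemann (coded_point G \<rho> x) 0 (psl_act (\<rho> (fst (x 0) [^]\<^bsub>G\<^esub> snd (x 0))) 0)"

definition orbit_dist ::
    "('g \<Rightarrow> (real^2^2) set) \<Rightarrow> ('g \<Rightarrow> (real^2^2) set) \<Rightarrow> real \<Rightarrow> real \<Rightarrow> complex \<Rightarrow> complex \<Rightarrow> 'g \<Rightarrow> real" where
  "orbit_dist \<rho>\<^sub>1 \<rho>\<^sub>2 a b o\<^sub>1 o\<^sub>2 g =
     a * hdist o\<^sub>1 (psl_act (\<rho>\<^sub>1 g) o\<^sub>1) + b * hdist o\<^sub>2 (psl_act (\<rho>\<^sub>2 g) o\<^sub>2)"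

definition cyclic_poincare_series ::
    "('g, 'm) monoid_scheme \<Rightarrow> ('g \<Rightarrow> real) \<Rightarrow> 'g \<Rightarrow> real \<Rightarrow> ennreal" where
  "cyclic_poincare_series G D g t = (\<Sum>\<^sub>\<infinity>n\<in>(UNIV::int set). ennreal (exp (- t * D (g [^]\<^bsub>G\<^esub> n))))"

definition cyclic_critical_exponent ::
    "('g, 'm) monoid_scheme \<Rightarrow> ('g \<Rightarrow> real) \<Rightarrow> 'g \<Rightarrow> real" where
  "cyclic_critical_exponent G D g = Inf {t. cyclic_poincare_series G D g t < \<infinity>}"

end

theory Submission
  imports Defs "HOL-Complex_Analysis.Complex_Analysis"
begin

text \<open>Every finite word in the letters \<open>g\<^sup>n\<close> acts on both boundary circles, and ping-pong keeps the pole of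
  its derivative a definite distance away from the points to which the word may be applied. Hence the
  word maps contract, the logarithm \<open>\<Phi>\<close> of their stretch is uniformly Lipschitz, and the pressure is the growth rate of the
  sums \<open>Z\<close> of \<open>exp (- t \<Phi>)\<close> over words. Since a parabolic power \<open>p\<^sup>n\<close> stretches like \<open>\<bar>n\<bar>\<close>, and any power
  of a generator at least like \<open>\<bar>n\<bar>\<close>, the sum over one letter, and with it the pressure, is finite exactly when
  \<open>2 t (a + b) > 1\<close>; the same threshold governs the Poincare series of \<open>p\<close>.

  For analyticity, perturb \<open>t\<close> by a small complex \<open>z\<close>. The quotient of the perturbed and the unperturbed sum over \<open>k + 1\<close> blocks of \<open>n\<close>
  letters is the image of the one over \<open>k\<close> blocks under a perturbed Markov kernel, which contracts Lipschitz seminorms; so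
  the ratio of consecutive quotients stays in \<open>ball 1 (1 / 2)\<close>. The averaged logarithms of these ratios are bounded
  holomorphic functions, and by Montel's theorem their limit, the pressure, is analytic.\<close>

section \<open>Sums over words\<close>

text \<open>A letter may be applied only to points whose label is not its own generator, so points
  in different neighborhoods see different words and their sums cannot be compared term by term.
  Every such comparison goes through a connecting letter of a third generator; this is where three
  generators enter. No eigenfunction of the transfer operator is constructed. The sums
  \<open>Z\<close> themselves normalise the kernels, which then depend on the number of letters
  still to come, but with all constants uniform in that number. Likewise zeros of the perturbed sums
  are excluded by a seminorm bound relative to the value at a base point: the contraction leaves
  enough slack to absorb both the perturbation and the drift of that value. Because the alphabet is
  infinite, the perturbation is controlled by exponential moments of \<Phi>, which exist only above
  the critical exponent; this limits the admissible disk for \<open>z\<close>. Contraction of long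
  words rests on discreteness: different reduced words are different group elements, and only
  finitely many of these have bounded stretch. Both circles are kept in one state space because the
  same word acts through both representations.\<close>

lemma infsum_dominated:
  fixes f :: "'i \<Rightarrow> 'b::banach" and p :: "'i \<Rightarrow> real"
  assumes p: "p summable_on I" and le: "\<And>i. i \<in> I \<Longrightarrow> norm (f i) \<le> U * p i"
  shows "f summable_on I" "norm (infsum f I) \<le> U * infsum p I"
proof -
  have Up: "(\<lambda>i. U * p i) summable_on I" using p by (rule summable_on_cmult_right)
  have "(\<lambda>i. norm (f i)) summable_on I"
    by (rule summable_on_comparison_test[OF Up le]) auto
  then show s: "f summable_on I" by (rule abs_summable_summable)
  have "((\<lambda>i. U * p i) has_sum (U * infsum p I)) I"
    using p by (intro has_sum_cmult_right) (simp add: has_sum_infsum)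
  from norm_infsum_le[OF has_sum_infsum[OF s] this le] show "norm (infsum f I) \<le> U * infsum p I" .
qed

lemma infsum_pos:
  fixes f :: "'i \<Rightarrow> real"
  assumes "f summable_on I" "\<And>i. i \<in> I \<Longrightarrow> 0 \<le> f i" "j \<in> I" "0 < f j"
  shows "0 < infsum f I"
proof -
  have "sum f {j} \<le> infsum f I"
    using assms by (intro finite_sum_le_infsum) auto
  with assms(4) show ?thesis by simp
qed

text \<open>Lower bounds for word sums arise in this form: an injective modification of words that
  costs at most a constant factor of weight.\<close>

lemma infsum_inj_le:
  fixes p :: "'i \<Rightarrow> real" and f :: "'j \<Rightarrow> real"
  assumes "inj_on g I" "g ` I \<subseteq> J" "f summable_on J" "\<And>j. j \<in> J \<Longrightarrow> 0 \<le> f j"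
    and p: "p summable_on I" "\<And>i. i \<in> I \<Longrightarrow> c * p i \<le> f (g i)"
  shows "c * infsum p I \<le> infsum f J"
proof -
  have s: "f summable_on g ` I" using assms by (blast intro: summable_on_subset)
  then have s': "(\<lambda>i. f (g i)) summable_on I" using summable_on_reindex[OF assms(1), of f] by (simp add: o_def)
  have "c * infsum p I = (\<Sum>\<^sub>\<infinity>i\<in>I. c * p i)" by (rule infsum_cmult_right[symmetric]) (rule p)
  also have "\<dots> \<le> (\<Sum>\<^sub>\<infinity>i\<in>I. f (g i))" by (intro infsum_mono summable_on_cmult_right p s')
  also have "\<dots> = infsum f (g ` I)" using infsum_reindex[OF assms(1), of f] by (simp add: o_def)
  also have "\<dots> \<le> infsum f J" using assms s by (intro infsum_mono2) auto
  finally show ?thesis .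
qed

text \<open>The quotients at \<open>m\<close> and at \<open>n\<close> are both compared with the one
  at \<open>m * n\<close>, which is reached from either side by iterating near additivity.\<close>

lemma quasi_additive_limit:
  fixes a :: "nat \<Rightarrow> real"
  assumes b: "\<And>m n. \<bar>a (m + n) - a m - a n\<bar> \<le> b"
  shows "convergent (\<lambda>n. a n / real n)"
proof -
  have b0: "0 \<le> b" using b[of 0 0] by linarith
  \<comment> \<open>The factor is \<open>Suc k\<close> rather than \<open>k\<close> because
    \<open>a 0\<close> is itself only known to be bounded by \<open>b\<close>.\<close>
  have mult: "\<bar>a (k * m) - real k * a m\<bar> \<le> real (Suc k) * b" for k m
  proof (induction k)
    case 0
    show ?case using b[of 0 0] by simp
  next
    case (Suc k)
    have "\<bar>a (m + k * m) - a m - a (k * m)\<bar> \<le> b" by (rule b)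
    with Suc show ?case by (simp add: algebra_simps abs_le_iff)
  qed
  have half: "\<bar>a (k * m) / real (k * m) - a m / real m\<bar> \<le> 2 * b / real m" if "0 < k" "0 < m" for k m
  proof -
    have "a (k * m) / real (k * m) - a m / real m = (a (k * m) - real k * a m) / (real k * real m)"
      using that by (simp add: field_simps)
    also have "\<bar>\<dots>\<bar> = \<bar>a (k * m) - real k * a m\<bar> / (real k * real m)" by (simp add: abs_mult)
    also have "\<dots> \<le> real (Suc k) * b / (real k * real m)"
      using that by (intro divide_right_mono mult) auto
    also have "\<dots> \<le> (2 * real k) * b / (real k * real m)"
      using that b0 by (intro divide_right_mono mult_right_mono) auto
    also have "\<dots> = 2 * b / real m" using that by simp
    finally show ?thesis .
  qed
  have near: "\<bar>a n / real n - a m / real m\<bar> \<le> 2 * b / real n + 2 * b / real m" if "0 < n" "0 < m" for n m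
    using half[OF that] half[OF that(2,1)] by (simp add: mult.commute abs_le_iff)
  have "Cauchy (\<lambda>n. a n / real n)"
  proof (rule metric_CauchyI)
    fix e :: real assume e: "0 < e"
    obtain N :: nat where N: "4 * b / e < real N" using reals_Archimedean2 by blast
    with b0 e have N0: "0 < N" by (cases N) (auto simp: field_simps)
    have "2 * b / real n < e / 2" if "n \<ge> N" for n
    proof -
      have "4 * b < real N * e" using N e by (simp add: field_simps)
      also have "\<dots> \<le> real n * e" using that e by (intro mult_right_mono) auto
      finally show ?thesis using that N0 by (simp add: field_simps)
    qed
    note small = this
    have "dist (a m / real m) (a n / real n) < e" if "m \<ge> N" "n \<ge> N" for m n
    proof -
      have "0 < m" "0 < n" using that N0 by auto
      from near[OF this] small[OF that(1)] small[OF that(2)] show ?thesis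
        unfolding dist_real_def by linarith
    qed
    then show "\<exists>N. \<forall>m\<ge>N. \<forall>n\<ge>N. dist (a m / real m) (a n / real n) < e" by blast
  qed
  then show ?thesis by (simp add: Cauchy_convergent_iff)
qed

section \<open>Words, admissibility and cocycles\<close>

primrec lead :: "('e \<Rightarrow> 'a) \<Rightarrow> 'e list \<Rightarrow> 'a \<Rightarrow> 'a" where
  "lead gen [] l = l"
| "lead gen (e # w) l = gen e"

text \<open>Words act through \<open>foldr\<close>, so the last letter acts first, on a point with
  label \<open>l\<close>; \<open>lead\<close> is then the label of the image. Each letter has to
  differ in generator from the label of the point it is applied to.\<close>

primrec adm :: "'e set \<Rightarrow> ('e \<Rightarrow> 'a) \<Rightarrow> 'e list \<Rightarrow> 'a \<Rightarrow> bool" where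
  "adm E gen [] l = True"
| "adm E gen (e # w) l = (e \<in> E \<and> gen e \<noteq> lead gen w l \<and> adm E gen w l)"

text \<open>The chain rule: if \<open>\<phi> e\<close> is the logarithmic stretch of a letter, this
  is the one of the composed map.\<close>

primrec cocycle :: "('e \<Rightarrow> 'x \<Rightarrow> 'x) \<Rightarrow> ('e \<Rightarrow> 'x \<Rightarrow> real) \<Rightarrow> 'e list \<Rightarrow> 'x \<Rightarrow> real" where
  "cocycle act \<phi> [] x = 0"
| "cocycle act \<phi> (e # w) x = \<phi> e (foldr act w x) + cocycle act \<phi> w x"

lemma cocycle_append:
  "cocycle act \<phi> (u @ v) x = cocycle act \<phi> u (foldr act v x) + cocycle act \<phi> v x"
  by (induction u) simp_all

lemma lead_append: "lead gen (u @ v) l = lead gen u (lead gen v l)"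
  by (cases u) simp_all

lemma adm_append: "adm E gen (u @ v) l \<longleftrightarrow> adm E gen u (lead gen v l) \<and> adm E gen v l"
  by (induction u) (auto simp: lead_append)

text \<open>The label constrains only the letter that acts first, which is the last of the
  list.\<close>

lemma adm_change_label:
  "u \<noteq> [] \<Longrightarrow> adm E gen u l \<Longrightarrow> gen (last u) \<noteq> l' \<Longrightarrow> adm E gen u l'"
proof (induction u)
  case (Cons e u)
  then show ?case by (cases u) auto
qed simp

definition words :: "'e set \<Rightarrow> ('e \<Rightarrow> 'a) \<Rightarrow> nat \<Rightarrow> 'a \<Rightarrow> 'e list set" where
  "words E gen n l = {w. length w = n \<and> adm E gen w l}"

lemma words_0 [simp]: "words E gen 0 l = {[]}"
  by (auto simp: words_def)

lemma words_1: "words E gen (Suc 0) l = (\<lambda>e. [e]) ` {e \<in> E. gen e \<noteq> l}"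
  by (auto simp: words_def length_Suc_conv)

text \<open>In a pair, \<open>v\<close> acts first and \<open>u\<close> acts on the image, which
  explains the label for \<open>u\<close>.\<close>

lemma words_split:
  "bij_betw (\<lambda>(v, u). u @ v) (SIGMA v:words E gen n l. words E gen m (lead gen v l)) (words E gen (m + n) l)"
proof (rule bij_betw_imageI)
  show "inj_on (\<lambda>(v, u). u @ v) (SIGMA v:words E gen n l. words E gen m (lead gen v l))"
    by (auto simp: inj_on_def words_def)
  show "(\<lambda>(v, u). u @ v) ` (SIGMA v:words E gen n l. words E gen m (lead gen v l)) = words E gen (m + n) l"
  proof (intro equalityI subsetI)
    fix w assume w: "w \<in> words E gen (m + n) l"
    then have "w = take m w @ drop m w" "length (take m w) = m" "length (drop m w) = n"
      by (auto simp: words_def)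
    moreover from w this(1) have "adm E gen (take m w) (lead gen (drop m w) l) \<and> adm E gen (drop m w) l"
      by (metis (mono_tags, lifting) adm_append mem_Collect_eq words_def)
    ultimately have "(drop m w, take m w) \<in> (SIGMA v:words E gen n l. words E gen m (lead gen v l))"
      by (auto simp: words_def)
    then show "w \<in> (\<lambda>(v, u). u @ v) ` (SIGMA v:words E gen n l. words E gen m (lead gen v l))"
      by (rule rev_image_eqI) simp
  qed (auto simp: words_def adm_append)
qed

lemma infsum_words_split:
  fixes h :: "'e list \<Rightarrow> 'b::banach"
  assumes "h summable_on words E gen (m + n) l"
  shows "infsum h (words E gen (m + n) l) =
    (\<Sum>\<^sub>\<infinity>v\<in>words E gen n l. \<Sum>\<^sub>\<infinity>u\<in>words E gen m (lead gen v l). h (u @ v))"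
proof -
  let ?S = "SIGMA v:words E gen n l. words E gen m (lead gen v l)"
  have b: "bij_betw (\<lambda>(v, u). u @ v) ?S (words E gen (m + n) l)" by (rule words_split)
  have "(\<lambda>p. h (case p of (v, u) \<Rightarrow> u @ v)) summable_on ?S"
    using assms unfolding summable_on_reindex_bij_betw[OF b, of h] .
  then have "(\<lambda>(v, u). h (u @ v)) summable_on ?S" by (simp add: case_prod_unfold)
  then have "(\<Sum>\<^sub>\<infinity>v\<in>words E gen n l. \<Sum>\<^sub>\<infinity>u\<in>words E gen m (lead gen v l). h (u @ v)) = infsum (\<lambda>(v, u). h (u @ v)) ?S"
    by (rule infsum_Sigma'_banach)
  also have "\<dots> = infsum (\<lambda>p. h (case p of (v, u) \<Rightarrow> u @ v)) ?S"
    by (simp add: case_prod_unfold)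
  also have "\<dots> = infsum h (words E gen (m + n) l)"
    by (rule infsum_reindex_bij_betw[OF b, of h])
  finally show ?thesis ..
qed

text \<open>The interface between the geometry and the thermodynamic argument. \<open>K\<close> is
  the state space; \<open>lab\<close> names the neighborhood of a point and is constant at distances
  below \<open>r0\<close>. The set \<open>F\<close> supplies connecting letters that avoid any two
  given generators, and its finiteness makes the bounds of \<open>letter_bound\<close> uniform on
  it. \<open>Phi_Lipschitz\<close> also compares points with different labels, provided the word may
  be applied to both, and its constant is independent of the word. \<open>letter_sum\<close> says
  that the transfer operator is bounded above the critical value \<delta>.\<close>

locale word_system =
  fixes K :: "'x::metric_space set" and E :: "'e set" and gen :: "'e \<Rightarrow> 'a" and lab :: "'x \<Rightarrow> 'a"
    and act :: "'e \<Rightarrow> 'x \<Rightarrow> 'x" and \<phi> :: "'e \<Rightarrow> 'x \<Rightarrow> real"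
    and F :: "'e set" and \<delta> M c0 r0 \<Delta> :: real
  assumes K_ne: "K \<noteq> {}"
    and K_bdd: "\<And>x y. x \<in> K \<Longrightarrow> y \<in> K \<Longrightarrow> dist x y \<le> \<Delta>"
    and act_K: "\<And>e x. x \<in> K \<Longrightarrow> e \<in> E \<Longrightarrow> gen e \<noteq> lab x \<Longrightarrow> act e x \<in> K"
    and lab_act: "\<And>e x. x \<in> K \<Longrightarrow> e \<in> E \<Longrightarrow> gen e \<noteq> lab x \<Longrightarrow> lab (act e x) = gen e"
    and r0: "0 < r0" "\<And>x y. x \<in> K \<Longrightarrow> y \<in> K \<Longrightarrow> dist x y < r0 \<Longrightarrow> lab x = lab y"
    and F: "finite F" "F \<subseteq> E" "\<And>a b. \<exists>e\<in>F. gen e \<noteq> a \<and> gen e \<noteq> b"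
    and \<delta>: "0 \<le> \<delta>"
    and Phi_Lipschitz: "\<And>w x y. x \<in> K \<Longrightarrow> y \<in> K \<Longrightarrow> adm E gen w (lab x) \<Longrightarrow> adm E gen w (lab y) \<Longrightarrow>
       \<bar>cocycle act \<phi> w x - cocycle act \<phi> w y\<bar> \<le> M * dist x y"
    and Phi_lower: "\<And>w x. x \<in> K \<Longrightarrow> adm E gen w (lab x) \<Longrightarrow> - c0 \<le> cocycle act \<phi> w x"
    and contracting: "\<And>\<theta>. 0 < \<theta> \<Longrightarrow> \<exists>N. \<forall>w x y. length w \<ge> N \<longrightarrow> x \<in> K \<longrightarrow> y \<in> K \<longrightarrow>
       adm E gen w (lab x) \<longrightarrow> adm E gen w (lab y) \<longrightarrow> dist (foldr act w x) (foldr act w y) \<le> \<theta> * dist x y"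
    and letter_sum: "\<And>t. \<delta> < t \<Longrightarrow> \<exists>C. \<forall>x\<in>K. (\<lambda>e. exp (- t * \<phi> e x)) summable_on {e \<in> E. gen e \<noteq> lab x} \<and>
       (\<Sum>\<^sub>\<infinity>e\<in>{e \<in> E. gen e \<noteq> lab x}. exp (- t * \<phi> e x)) \<le> C"
    and letter_bound: "\<And>e. e \<in> E \<Longrightarrow> \<exists>U. \<forall>x\<in>K. gen e \<noteq> lab x \<longrightarrow> \<phi> e x \<le> U"
begin

abbreviation "\<Phi> \<equiv> cocycle act \<phi>"
abbreviation "W n x \<equiv> words E gen n (lab x)"

text \<open>The \<open>n\<close>-th iterate of the transfer operator with weight
  \<open>exp (- t * \<phi>)\<close>, applied to the constant 1 and evaluated at
  \<open>x\<close>.\<close>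

definition Z :: "real \<Rightarrow> nat \<Rightarrow> 'x \<Rightarrow> real" where
  "Z t n x = (\<Sum>\<^sub>\<infinity>w\<in>W n x. exp (- t * \<Phi> w x))"

lemma foldr_act_K: "x \<in> K \<Longrightarrow> adm E gen w (lab x) \<Longrightarrow> foldr act w x \<in> K \<and> lab (foldr act w x) = lead gen w (lab x)"
  by (induction w) (auto simp: act_K lab_act)

text \<open>Peel off the letter that acts last: it acts on a point of \<open>K\<close>, so its
  weights sum to at most \<open>C1\<close> whatever the rest of the word, and the bounds
  multiply.\<close>

lemma weight_summable:
  assumes t: "\<delta> < t"
  shows "\<exists>C. \<forall>x\<in>K. (\<lambda>w. exp (- t * \<Phi> w x)) summable_on W n x \<and> Z t n x \<le> C"
proof (induction n)
  case 0
  show ?case by (auto simp: Z_def)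
next
  case (Suc n)
  obtain C1 where C1: "\<And>x. x \<in> K \<Longrightarrow> (\<lambda>e. exp (- t * \<phi> e x)) summable_on {e \<in> E. gen e \<noteq> lab x}"
    "\<And>x. x \<in> K \<Longrightarrow> (\<Sum>\<^sub>\<infinity>e\<in>{e \<in> E. gen e \<noteq> lab x}. exp (- t * \<phi> e x)) \<le> C1"
    using letter_sum[OF t] by blast
  from Suc obtain C where C: "\<And>x. x \<in> K \<Longrightarrow> (\<lambda>w. exp (- t * \<Phi> w x)) summable_on W n x"
    "\<And>x. x \<in> K \<Longrightarrow> Z t n x \<le> C" by blast
  obtain x0 where "x0 \<in> K" using K_ne by blast
  have C1': "C1 \<ge> 0" using C1(2)[OF \<open>x0 \<in> K\<close>] infsum_nonneg[of "{e \<in> E. gen e \<noteq> lab x0}" "\<lambda>e. exp (- t * \<phi> e x0)"]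
    by (meson exp_ge_zero order_trans)
  {
    fix x assume x: "x \<in> K"
    define g where "g w = (\<Sum>\<^sub>\<infinity>u\<in>words E gen 1 (lead gen w (lab x)). exp (- t * \<Phi> (u @ w) x))" for w
    have g: "(\<lambda>u. exp (- t * \<Phi> (u @ w) x)) summable_on words E gen 1 (lead gen w (lab x))"
       "0 \<le> g w" "g w \<le> C1 * exp (- t * \<Phi> w x)"
      if w: "w \<in> W n x" for w
    proof -
      let ?y = "foldr act w x"
      have y: "?y \<in> K" "lab ?y = lead gen w (lab x)"
        using foldr_act_K[OF x, of w] w by (simp_all add: words_def)
      have inj: "inj_on (\<lambda>e. [e]) {e \<in> E. gen e \<noteq> lab ?y}" by (auto simp: inj_on_def)
      have eq: "exp (- t * \<Phi> ([e] @ w) x) = exp (- t * \<phi> e ?y) * exp (- t * \<Phi> w x)" for e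
        by (simp add: algebra_simps exp_add[symmetric])
      have 1: "(\<lambda>e. exp (- t * \<phi> e ?y) * exp (- t * \<Phi> w x)) summable_on {e \<in> E. gen e \<noteq> lab ?y}"
        by (intro summable_on_cmult_left C1 y)
      then show "(\<lambda>u. exp (- t * \<Phi> (u @ w) x)) summable_on words E gen 1 (lead gen w (lab x))"
        unfolding One_nat_def words_1 y(2)[symmetric] summable_on_reindex[OF inj] o_def eq .
      have "g w = (\<Sum>\<^sub>\<infinity>e\<in>{e \<in> E. gen e \<noteq> lab ?y}. exp (- t * \<phi> e ?y) * exp (- t * \<Phi> w x))"
        unfolding g_def One_nat_def words_1 y(2)[symmetric] infsum_reindex[OF inj] o_def eq ..
      also have "\<dots> = (\<Sum>\<^sub>\<infinity>e\<in>{e \<in> E. gen e \<noteq> lab ?y}. exp (- t * \<phi> e ?y)) * exp (- t * \<Phi> w x)"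
        by (rule infsum_cmult_left) (use C1 y in blast)
      also have "\<dots> \<le> C1 * exp (- t * \<Phi> w x)"
        using C1(2)[OF y(1)] by (intro mult_right_mono) auto
      finally show "g w \<le> C1 * exp (- t * \<Phi> w x)" .
      show "0 \<le> g w" unfolding g_def by (intro infsum_nonneg) simp
    qed
    have "(\<lambda>w. C1 * exp (- t * \<Phi> w x)) summable_on W n x"
      by (intro summable_on_cmult_right C x)
    then have gs: "g summable_on W n x"
      by (rule summable_on_comparison_test[OF _ g(3) g(2)])
    have "(\<lambda>(v, u). exp (- t * \<Phi> (u @ v) x)) summable_on (SIGMA v:W n x. words E gen 1 (lead gen v (lab x)))"
      by (rule summable_on_SigmaI[where g = g]) (use g gs in \<open>auto simp: g_def intro!: has_sum_infsum\<close>)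
    then have "(\<lambda>p. exp (- t * \<Phi> (case p of (v, u) \<Rightarrow> u @ v) x)) summable_on (SIGMA v:W n x. words E gen 1 (lead gen v (lab x)))"
      by (simp add: case_prod_unfold)
    have b: "bij_betw (\<lambda>(v, u). u @ v) (SIGMA v:W n x. words E gen 1 (lead gen v (lab x))) (W (1 + n) x)"
      by (rule words_split)
    have s: "(\<lambda>w. exp (- t * \<Phi> w x)) summable_on W (1 + n) x"
      using \<open>(\<lambda>p. exp (- t * \<Phi> (case p of (v, u) \<Rightarrow> u @ v) x)) summable_on _\<close>
      unfolding summable_on_reindex_bij_betw[OF b, of "\<lambda>w. exp (- t * \<Phi> w x)"] .
    have "Z t (1 + n) x = infsum g (W n x)"
      unfolding Z_def infsum_words_split[OF s] g_def ..
    also have "\<dots> \<le> C1 * Z t n x"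
      unfolding Z_def infsum_cmult_right[symmetric, OF C(1)[OF x]]
      by (rule infsum_mono) (use g in \<open>auto intro!: gs summable_on_cmult_right C(1)[OF x, simplified]\<close>)
    also have "\<dots> \<le> C1 * C" using C(2)[OF x] C1' by (rule mult_left_mono)
    finally have "Z t (1 + n) x \<le> C1 * C" .
    note s this
  }
  then show ?case by (intro exI[of _ "C1 * C"]) auto
qed

lemma summable:
  assumes "\<delta> < t" "x \<in> K"
  shows "(\<lambda>w. exp (- t * \<Phi> w x)) summable_on W n x"
proof -
  obtain C where "\<forall>x\<in>K. (\<lambda>w. exp (- t * \<Phi> w x)) summable_on W n x \<and> Z t n x \<le> C"
    using weight_summable[OF assms(1)] by (rule exE)
  from bspec[OF this assms(2)] show ?thesis ..
qed

text \<open>Each new letter is a connector in \<open>F\<close> avoiding both the label reached so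
  far and the forbidden generator \<open>a\<close>.\<close>

lemma word_exists: "\<exists>w\<in>words E gen n l. lead gen w l \<noteq> a" if "n > 0"
  using that
proof (induction n)
  case (Suc n)
  show ?case
  proof (cases "n = 0")
    case True
    obtain e where "e \<in> F" "gen e \<noteq> a" "gen e \<noteq> l" using F(3) by metis
    then show ?thesis using F(2) True by (intro bexI[of _ "[e]"]) (auto simp: words_def)
  next
    case False
    then obtain w where w: "w \<in> words E gen n l" using Suc by blast
    obtain e where "e \<in> F" "gen e \<noteq> a" "gen e \<noteq> lead gen w l" using F(3) by metis
    then show ?thesis using F(2) w by (intro bexI[of _ "e # w"]) (auto simp: words_def)
  qed
qed simp

lemma words_ne: "words E gen n l \<noteq> {}"
  using word_exists[of n l undefined] by (cases "n = 0") auto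

lemma Z_pos: "0 < Z t n x" if "\<delta> < t" "x \<in> K"
proof -
  obtain w where "w \<in> W n x" using words_ne by blast
  then show ?thesis unfolding Z_def
    by (intro infsum_pos[OF summable[OF that]]) auto
qed

text \<open>The semigroup law for the iterates of the transfer operator.\<close>

lemma Z_split:
  assumes t: "\<delta> < t" and x: "x \<in> K"
  shows "Z t (m + n) x = (\<Sum>\<^sub>\<infinity>w\<in>W n x. exp (- t * \<Phi> w x) * Z t m (foldr act w x))"
proof -
  have "Z t (m + n) x = (\<Sum>\<^sub>\<infinity>w\<in>W n x. \<Sum>\<^sub>\<infinity>u\<in>words E gen m (lead gen w (lab x)). exp (- t * \<Phi> (u @ w) x))"
    unfolding Z_def by (rule infsum_words_split) (rule summable[OF t x])
  also have "\<dots> = (\<Sum>\<^sub>\<infinity>w\<in>W n x. exp (- t * \<Phi> w x) * Z t m (foldr act w x))"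
  proof (rule infsum_cong)
    fix w assume w: "w \<in> W n x"
    let ?y = "foldr act w x"
    have y: "?y \<in> K" "lab ?y = lead gen w (lab x)"
      using foldr_act_K[OF x, of w] w by (auto simp: words_def)
    have eq: "exp (- t * \<Phi> (u @ w) x) = exp (- t * \<Phi> w x) * exp (- t * \<Phi> u ?y)" for u
      by (simp add: cocycle_append algebra_simps exp_add[symmetric])
    show "(\<Sum>\<^sub>\<infinity>u\<in>words E gen m (lead gen w (lab x)). exp (- t * \<Phi> (u @ w) x)) = exp (- t * \<Phi> w x) * Z t m ?y"
      unfolding eq Z_def y(2)[symmetric] by (rule infsum_cmult_right) (rule summable[OF t y(1)])
  qed
  finally show ?thesis .
qed

lemma Phi_Lipschitz': "x \<in> K \<Longrightarrow> y \<in> K \<Longrightarrow> adm E gen w (lab x) \<Longrightarrow> adm E gen w (lab y) \<Longrightarrow> 0 \<le> t \<Longrightarrow>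
   exp (- t * \<Phi> w x) \<le> exp (t * M * dist x y) * exp (- t * \<Phi> w y)"
  using mult_left_mono[OF abs_le_D2[OF Phi_Lipschitz[of x y w]], of t]
  by (simp add: exp_add[symmetric] algebra_simps)

lemma M\<Delta>: "x \<in> K \<Longrightarrow> y \<in> K \<Longrightarrow> M * dist x y \<le> \<bar>M\<bar> * \<Delta>"
  by (rule mult_mono) (use K_bdd in auto)

end

section \<open>Comparison of the sums at different points and the growth rate\<close>

context word_system begin

lemma t_nonneg: "\<delta> < t \<Longrightarrow> 0 \<le> t" using \<delta> by simp

lemma F_upper: "\<exists>U. \<forall>e\<in>F. \<forall>x\<in>K. gen e \<noteq> lab x \<longrightarrow> \<phi> e x \<le> U"
proof -
  have "\<forall>e\<in>F. \<exists>U. \<forall>x\<in>K. gen e \<noteq> lab x \<longrightarrow> \<phi> e x \<le> U"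
    using letter_bound F(2) by blast
  from bchoice[OF this] obtain u
    where u: "\<And>e. e \<in> F \<Longrightarrow> \<forall>x\<in>K. gen e \<noteq> lab x \<longrightarrow> \<phi> e x \<le> u e"
    by blast
  have "\<phi> e x \<le> Max (u ` F)" if "e \<in> F" "x \<in> K" "gen e \<noteq> lab x" for e x
  proof -
    have "\<phi> e x \<le> u e" using u[OF that(1)] that by blast
    also have "\<dots> \<le> Max (u ` F)" using F(1) that(1) by simp
    finally show ?thesis .
  qed
  then show ?thesis by blast
qed

lemma F_weight: "0 \<le> t \<Longrightarrow> \<exists>\<omega>>0. \<forall>e\<in>F. \<forall>x\<in>K. gen e \<noteq> lab x \<longrightarrow> \<omega> \<le> exp (- t * \<phi> e x)"
proof -
  assume t: "0 \<le> t"
  obtain U where "\<And>e x. e \<in> F \<Longrightarrow> x \<in> K \<Longrightarrow> gen e \<noteq> lab x \<Longrightarrow> \<phi> e x \<le> U"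
    using F_upper by blast
  then have "exp (- t * U) \<le> exp (- t * \<phi> e x)" if "e \<in> F" "x \<in> K" "gen e \<noteq> lab x" for e x
    using that t by (simp add: mult_left_mono)
  then show ?thesis by (intro exI[of _ "exp (- t * U)"]) auto
qed

lemma Phi_compare: "x \<in> K \<Longrightarrow> y \<in> K \<Longrightarrow> adm E gen w (lab x) \<Longrightarrow> adm E gen w (lab y) \<Longrightarrow> 0 \<le> t \<Longrightarrow>
   exp (- t * (\<bar>M\<bar> * \<Delta>)) * exp (- t * \<Phi> w x) \<le> exp (- t * \<Phi> w y)"
proof -
  assume *: "x \<in> K" "y \<in> K" "adm E gen w (lab x)" "adm E gen w (lab y)" "0 \<le> t"
  have "\<Phi> w y \<le> \<Phi> w x + \<bar>M\<bar> * \<Delta>"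
    using Phi_Lipschitz[OF *(1-4)] M\<Delta>[OF *(1,2)] by linarith
  then have "t * \<Phi> w y \<le> t * (\<Phi> w x + \<bar>M\<bar> * \<Delta>)" using *(5) by (rule mult_left_mono)
  then show ?thesis by (simp add: exp_add[symmetric] algebra_simps)
qed

text \<open>A word that may follow \<open>e\<close> at \<open>x\<close> need not be applicable at
  \<open>y\<close>. Letting a connector act before it, one that avoids both \<open>lab y\<close> and
  the generator acting next, makes it applicable. This costs a bounded factor of weight, and the
  word can still be read off.\<close>

lemma Z_drop_letter:
  assumes t: "\<delta> < t"
  shows "\<exists>C>0. \<forall>m. \<forall>x\<in>K. \<forall>y\<in>K. \<forall>e\<in>E. gen e \<noteq> lab x \<longrightarrow> Z t m (act e x) \<le> C * Z t (Suc m) y"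
proof -
  obtain \<omega> where \<omega>: "0 < \<omega>" "\<And>e x. e \<in> F \<Longrightarrow> x \<in> K \<Longrightarrow> gen e \<noteq> lab x \<Longrightarrow> \<omega> \<le> exp (- t * \<phi> e x)"
    using F_weight[OF t_nonneg[OF t]] by blast
  define c where "c = \<omega> * exp (- t * (\<bar>M\<bar> * \<Delta>))"
  have c: "0 < c" using \<omega> by (simp add: c_def)
  {
    fix m x y e assume *: "x \<in> K" "y \<in> K" "e \<in> E" "gen e \<noteq> lab x"
    \<comment> \<open>The connector depends on \<open>u\<close>. For the empty \<open>u\<close> the
      value of \<open>last u\<close> is unspecified, and avoiding its generator does no
      harm.\<close>
    define f where "f u = (SOME e'. e' \<in> F \<and> gen e' \<noteq> lab y \<and> gen e' \<noteq> gen (last u))" for u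
    have f: "f u \<in> F \<and> gen (f u) \<noteq> lab y \<and> gen (f u) \<noteq> gen (last u)" for u
      unfolding f_def by (rule someI_ex) (use F(3)[of "lab y" "gen (last u)"] in blast)
    have ex: "act e x \<in> K" using * by (simp add: act_K)
    have fy: "act (f u) y \<in> K" "lab (act (f u) y) = gen (f u)" for u
      using f[of u] * F(2) by (auto simp: act_K lab_act)
    have adm: "adm E gen u (gen (f u))" if "u \<in> W m (act e x)" for u
    proof (cases "u = []")
      case False
      then show ?thesis using that f[of u] by (auto simp: words_def intro: adm_change_label)
    qed simp
    have "c * Z t m (act e x) \<le> Z t (Suc m) y"
      unfolding Z_def
    proof (rule infsum_inj_le[where g = "\<lambda>u. u @ [f u]"])
      show "inj_on (\<lambda>u. u @ [f u]) (W m (act e x))" by (auto simp: inj_on_def)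
      show "(\<lambda>u. u @ [f u]) ` W m (act e x) \<subseteq> W (Suc m) y"
        using f subsetD[OF F(2)] adm by (auto simp: words_def adm_append)
      fix u assume u: "u \<in> W m (act e x)"
      have "c * exp (- t * \<Phi> u (act e x)) = \<omega> * (exp (- t * (\<bar>M\<bar> * \<Delta>)) * exp (- t * \<Phi> u (act e x)))"
        by (simp add: c_def)
      also have "\<dots> \<le> exp (- t * \<phi> (f u) y) * exp (- t * \<Phi> u (act (f u) y))"
        by (intro mult_mono \<omega> Phi_compare)
          (use u f fy ex t_nonneg[OF t] * adm in \<open>auto simp: words_def\<close>)
      also have "\<dots> = exp (- t * \<Phi> (u @ [f u]) y)"
        by (simp add: cocycle_append exp_add[symmetric] algebra_simps)
      finally show "c * exp (- t * \<Phi> u (act e x)) \<le> exp (- t * \<Phi> (u @ [f u]) y)" .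
    qed (use summable[OF t] * ex in auto)
    then have "Z t m (act e x) \<le> (1 / c) * Z t (Suc m) y" using c by (simp add: field_simps)
  }
  then show ?thesis using c by (intro exI[of _ "1 / c"]) auto
qed

lemma Z_0 [simp]: "Z t 0 x = 1" by (simp add: Z_def)

lemma foldr_act_W: "x \<in> K \<Longrightarrow> w \<in> W n x \<Longrightarrow> foldr act w x \<in> K"
  using foldr_act_K by (auto simp: words_def)

lemma Z_split_le:
  assumes t: "\<delta> < t" and x: "x \<in> K" and D: "\<And>w. w \<in> W n x \<Longrightarrow> Z t m (foldr act w x) \<le> D"
  shows "Z t (m + n) x \<le> D * Z t n x"
proof -
  have 1: "(\<lambda>w. D * exp (- t * \<Phi> w x)) summable_on W n x"
    by (intro summable_on_cmult_right summable[OF t x])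
  have le: "exp (- t * \<Phi> w x) * Z t m (foldr act w x) \<le> D * exp (- t * \<Phi> w x)" if "w \<in> W n x" for w
    using mult_right_mono[OF D[OF that], of "exp (- t * \<Phi> w x)"] by (simp add: mult.commute)
  have 2: "(\<lambda>w. exp (- t * \<Phi> w x) * Z t m (foldr act w x)) summable_on W n x"
    by (rule summable_on_comparison_test[OF 1 le])
      (use Z_pos[OF t] foldr_act_W[OF x] in \<open>auto intro!: mult_nonneg_nonneg less_imp_le\<close>)
  show ?thesis
    unfolding Z_split[OF t x] unfolding Z_def[of t n] infsum_cmult_right[symmetric, OF summable[OF t x]]
    by (rule infsum_mono[OF 2 1 le])
qed

lemma Z_split_ge:
  assumes t: "\<delta> < t" and x: "x \<in> K" and D: "\<And>w. w \<in> W n x \<Longrightarrow> D \<le> Z t m (foldr act w x) \<and> Z t m (foldr act w x) \<le> D'"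
  shows "D * Z t n x \<le> Z t (m + n) x"
proof -
  have 1: "(\<lambda>w. D * exp (- t * \<Phi> w x)) summable_on W n x" for D
    by (intro summable_on_cmult_right summable[OF t x])
  have le: "D * exp (- t * \<Phi> w x) \<le> exp (- t * \<Phi> w x) * Z t m (foldr act w x)"
    "exp (- t * \<Phi> w x) * Z t m (foldr act w x) \<le> D' * exp (- t * \<Phi> w x)" if "w \<in> W n x" for w
    using mult_right_mono[OF conjunct1[OF D[OF that]], of "exp (- t * \<Phi> w x)"]
      mult_right_mono[OF conjunct2[OF D[OF that]], of "exp (- t * \<Phi> w x)"] by (simp_all add: mult.commute)
  have 2: "(\<lambda>w. exp (- t * \<Phi> w x) * Z t m (foldr act w x)) summable_on W n x"
    by (rule summable_on_comparison_test[OF 1 le(2)])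
      (use Z_pos[OF t] foldr_act_W[OF x] in \<open>auto intro!: mult_nonneg_nonneg less_imp_le\<close>)
  show ?thesis
    unfolding Z_split[OF t x] unfolding Z_def[of t n] infsum_cmult_right[symmetric, OF summable[OF t x]]
    by (rule infsum_mono[OF 1 2 le(1)])
qed

text \<open>Expand by the letter that acts first at \<open>x\<close>. By
  \<open>Z_drop_letter\<close> each remaining sum is bounded by the sum of the original length at
  \<open>y\<close>, and the weights of the expanded letter sum to at most \<open>C1\<close>.\<close>

lemma Z_comparable:
  assumes t: "\<delta> < t"
  shows "\<exists>B\<ge>1. \<forall>m. \<forall>x\<in>K. \<forall>y\<in>K. Z t m x \<le> B * Z t m y"
proof -
  obtain C where C: "C > 0" "\<And>m x y e. x \<in> K \<Longrightarrow> y \<in> K \<Longrightarrow> e \<in> E \<Longrightarrow> gen e \<noteq> lab x \<Longrightarrow> Z t m (act e x) \<le> C * Z t (Suc m) y"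
    using Z_drop_letter[OF t] by blast
  obtain C1 where C1: "\<And>x. x \<in> K \<Longrightarrow> Z t 1 x \<le> C1" using weight_summable[OF t, of 1] by blast
  have *: "Z t (Suc m) x \<le> (C * C1) * Z t (Suc m) y" if "x \<in> K" "y \<in> K" for m x y
  proof -
    have "Z t (m + 1) x \<le> (C * Z t (Suc m) y) * Z t 1 x"
      by (rule Z_split_le[OF t that(1)]) (use C(2)[OF that] in \<open>auto simp: words_1\<close>)
    also have "\<dots> \<le> (C * Z t (Suc m) y) * C1"
      using C1[OF that(1)] C(1) Z_pos[OF t that(2)] by (intro mult_left_mono) (auto intro: less_imp_le)
    finally show ?thesis by (simp add: mult_ac)
  qed
  \<comment> \<open>The maximum covers \<open>m = 0\<close>, where both sums are 1 and there is no
    letter to drop.\<close>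
  have "Z t m x \<le> max 1 (C * C1) * Z t m y" if "x \<in> K" "y \<in> K" for m x y
  proof (cases m)
    case (Suc k)
    have "(C * C1) * Z t (Suc k) y \<le> max 1 (C * C1) * Z t (Suc k) y"
      using Z_pos[OF t that(2), of "Suc k"] by (intro mult_right_mono) auto
    with *[OF that, of k] Suc show ?thesis by simp
  qed simp
  then show ?thesis by (intro exI[of _ "max 1 (C * C1)"]) auto
qed

text \<open>Comparability replaces the points reached by the words with the single point
  \<open>y\<close>, which turns the semigroup law into a product up to the factor
  \<open>B\<close>.\<close>

lemma Z_quasi_multiplicative:
  assumes t: "\<delta> < t" and B: "B \<ge> 1" "\<And>m x y. x \<in> K \<Longrightarrow> y \<in> K \<Longrightarrow> Z t m x \<le> B * Z t m y"
    and "x \<in> K" "y \<in> K"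
  shows "Z t (m + n) x \<le> B * Z t m y * Z t n x" "Z t m y * Z t n x \<le> B * Z t (m + n) x"
proof -
  show "Z t (m + n) x \<le> B * Z t m y * Z t n x"
    by (rule Z_split_le[OF t]) (use assms foldr_act_W in auto)
  have "Z t m y / B * Z t n x \<le> Z t (m + n) x"
    by (rule Z_split_ge[OF t, where D' = "B * Z t m y"])
      (use assms foldr_act_W in \<open>auto simp: field_simps\<close>)
  then show "Z t m y * Z t n x \<le> B * Z t (m + n) x" using B(1) by (simp add: field_simps)
qed

text \<open>By \<open>pressure_limit\<close> every point of \<open>K\<close> gives the same limit,
  so the choice of base point is immaterial.\<close>

definition pressure :: "real \<Rightarrow> real" where
  "pressure t = lim (\<lambda>n. ln (Z t n (SOME x. x \<in> K)) / real n)"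

text \<open>The logarithms of \<open>Z\<close> are quasi-additive with error \<open>ln B\<close>,
  and changing the base point changes them by at most \<open>ln B\<close> as well.\<close>

lemma pressure_limit:
  assumes t: "\<delta> < t" and x: "x \<in> K"
  shows "(\<lambda>n. ln (Z t n x) / real n) \<longlonglongrightarrow> pressure t"
proof -
  obtain B where B: "B \<ge> 1" "\<And>m x y. x \<in> K \<Longrightarrow> y \<in> K \<Longrightarrow> Z t m x \<le> B * Z t m y"
    using Z_comparable[OF t] by blast
  define x0 where "x0 = (SOME x. x \<in> K)"
  have x0: "x0 \<in> K" unfolding x0_def using K_ne by (simp add: some_in_eq)
  note pos = Z_pos[OF t x0]
  have nz: "Z t n x0 \<noteq> 0" for n using pos[of n] by simp
  have "\<bar>ln (Z t (m + n) x0) - ln (Z t m x0) - ln (Z t n x0)\<bar> \<le> ln B" for m n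
  proof -
    have "ln (Z t (m + n) x0) \<le> ln (B * Z t m x0 * Z t n x0)"
      "ln (Z t m x0 * Z t n x0) \<le> ln (B * Z t (m + n) x0)"
      using Z_quasi_multiplicative[OF t B x0 x0, of m n] pos B(1) by (auto intro!: ln_mono)
    then show ?thesis using nz B(1) by (simp add: ln_mult abs_le_iff)
  qed
  then have "convergent (\<lambda>n. ln (Z t n x0) / real n)"
    by (rule quasi_additive_limit)
  then have 0: "(\<lambda>n. ln (Z t n x0) / real n) \<longlonglongrightarrow> pressure t"
    unfolding pressure_def x0_def by (simp add: convergent_LIMSEQ_iff)
  have d: "\<bar>ln (Z t n x) - ln (Z t n x0)\<bar> \<le> ln B" for n
  proof -
    have "ln (Z t n x) \<le> ln (B * Z t n x0)" "ln (Z t n x0) \<le> ln (B * Z t n x)"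
      using B x x0 pos Z_pos[OF t x] by (auto intro!: ln_mono)
    then show ?thesis using nz Z_pos[OF t x, THEN less_imp_neq, of n] B(1) by (simp add: ln_mult abs_le_iff)
  qed
  have "(\<lambda>n. (ln (Z t n x) - ln (Z t n x0)) / real n) \<longlonglongrightarrow> 0"
  proof (rule Lim_null_comparison)
    show "\<forall>\<^sub>F n in sequentially. norm ((ln (Z t n x) - ln (Z t n x0)) / real n) \<le> ln B * inverse (real n)"
      using d by (intro always_eventually) (auto simp: divide_inverse abs_mult intro!: mult_right_mono)
    show "(\<lambda>n. ln B * inverse (real n)) \<longlonglongrightarrow> 0"
      by (rule tendsto_mult_right_zero[OF lim_inverse_n])
  qed
  from tendsto_add[OF 0 this] show ?thesis by (simp add: add_divide_distrib[symmetric])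
qed

text \<open>Two scales. Below \<open>r0\<close> the labels agree, so the same words occur and can be
  compared term by term. Beyond \<open>r0\<close> the constant \<open>B\<close> of
  \<open>Z_comparable\<close> is itself at most \<open>exp (L * r0)\<close>.\<close>

lemma Z_log_Lipschitz:
  assumes t: "\<delta> < t"
  shows "\<exists>L\<ge>0. \<forall>m. \<forall>x\<in>K. \<forall>y\<in>K. Z t m x \<le> exp (L * dist x y) * Z t m y"
proof -
  obtain B where B: "B \<ge> 1" "\<And>m x y. x \<in> K \<Longrightarrow> y \<in> K \<Longrightarrow> Z t m x \<le> B * Z t m y"
    using Z_comparable[OF t] by blast
  define L where "L = max (t * \<bar>M\<bar>) (ln B / r0)"
  have t0: "0 \<le> t" using t_nonneg[OF t] .
  have "Z t m x \<le> exp (L * dist x y) * Z t m y" if "x \<in> K" "y \<in> K" for m x y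
  proof (cases "dist x y < r0")
    case True
    then have l: "lab x = lab y" using r0(2) that by blast
    have "t * M * dist x y \<le> L * dist x y"
      by (rule mult_right_mono) (use t0 in \<open>auto simp: L_def intro!: max.coboundedI1 mult_left_mono\<close>)
    then have e: "exp (t * M * dist x y) \<le> exp (L * dist x y)" by simp
    have "exp (- t * \<Phi> w x) \<le> exp (L * dist x y) * exp (- t * \<Phi> w y)" if "w \<in> W m x" for w
    proof -
      have "exp (- t * \<Phi> w x) \<le> exp (t * M * dist x y) * exp (- t * \<Phi> w y)"
        using Phi_Lipschitz'[of x y w t] \<open>x \<in> K\<close> \<open>y \<in> K\<close> that t0 l by (simp add: words_def)
      also have "\<dots> \<le> exp (L * dist x y) * exp (- t * \<Phi> w y)"
        by (rule mult_right_mono[OF e]) simp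
      finally show ?thesis .
    qed
    then have "Z t m x \<le> (\<Sum>\<^sub>\<infinity>w\<in>W m x. exp (L * dist x y) * exp (- t * \<Phi> w y))"
      unfolding Z_def using that(2) summable[OF t that(2), of m] summable[OF t that(1), of m] l
      by (intro infsum_mono summable_on_cmult_right) auto
    also have "\<dots> = exp (L * dist x y) * Z t m y"
      unfolding Z_def l by (intro infsum_cmult_right summable[OF t] that)
    finally show ?thesis .
  next
    case False
    have "ln B / r0 * r0 \<le> L * dist x y"
    proof (rule mult_mono)
      show "ln B / r0 \<le> L" by (simp add: L_def)
      show "0 \<le> L" using t0 by (simp add: L_def le_max_iff_disj)
    qed (use False r0(1) in auto)
    then have "ln B \<le> L * dist x y" using r0(1) by simp
    then have "exp (ln B) \<le> exp (L * dist x y)" by (simp only: exp_le_cancel_iff)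
    then have "B \<le> exp (L * dist x y)" using B(1) by simp
    then have "B * Z t m y \<le> exp (L * dist x y) * Z t m y"
      using Z_pos[OF t that(2), of m] by (intro mult_right_mono) simp_all
    with B(2)[OF that, of m] show ?thesis by linarith
  qed
  moreover have "0 \<le> L" using t0 by (simp add: L_def le_max_iff_disj)
  ultimately show ?thesis by blast
qed

text \<open>Words whose first acting letter is a connector avoiding both labels are applicable at
  both points. They already carry a fixed proportion of the weight at \<open>x\<close>, since the
  sum over the remaining letters is comparable to the whole.\<close>

lemma word_overlap:
  assumes t: "\<delta> < t"
  shows "\<exists>c>0. \<forall>n. \<forall>x\<in>K. \<forall>y\<in>K. c * Z t n x \<le> (\<Sum>\<^sub>\<infinity>w\<in>W n x \<inter> W n y. exp (- t * \<Phi> w x))"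
proof -
  obtain B where B: "B \<ge> 1" "\<And>m x y. x \<in> K \<Longrightarrow> y \<in> K \<Longrightarrow> Z t m x \<le> B * Z t m y"
    using Z_comparable[OF t] by blast
  obtain C1 where C1: "\<And>x. x \<in> K \<Longrightarrow> Z t 1 x \<le> C1" using weight_summable[OF t, of 1] by blast
  obtain \<omega> where \<omega>: "0 < \<omega>" "\<And>e x. e \<in> F \<Longrightarrow> x \<in> K \<Longrightarrow> gen e \<noteq> lab x \<Longrightarrow> \<omega> \<le> exp (- t * \<phi> e x)"
    using F_weight[OF t_nonneg[OF t]] by blast
  have C1_pos: "0 < C1" using C1 Z_pos[OF t, of _ 1] K_ne by fastforce
  define c where "c = min 1 (\<omega> / (B * C1))"
  have "c * Z t n x \<le> (\<Sum>\<^sub>\<infinity>w\<in>W n x \<inter> W n y. exp (- t * \<Phi> w x))" if xy: "x \<in> K" "y \<in> K" for n x y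
  proof (cases n)
    case 0
    then show ?thesis by (simp add: c_def)
  next
    case (Suc k)
    obtain e where e: "e \<in> F" "gen e \<noteq> lab x" "gen e \<noteq> lab y" using F(3) by metis
    have ex: "act e x \<in> K" "lab (act e x) = gen e" using e F(2) xy by (auto simp: act_K lab_act)
    have "Z t (k + 1) x \<le> B * Z t k (act e x) * Z t 1 x"
      by (rule Z_quasi_multiplicative[OF t B xy(1) ex(1)])
    also have "\<dots> \<le> B * Z t k (act e x) * C1"
      using C1[OF xy(1)] B(1) Z_pos[OF t ex(1), of k] by (intro mult_left_mono) auto
    finally have 1: "Z t n x \<le> B * C1 * Z t k (act e x)" by (simp add: Suc mult_ac)
    have "\<omega> * Z t k (act e x) \<le> (\<Sum>\<^sub>\<infinity>w\<in>W n x \<inter> W n y. exp (- t * \<Phi> w x))"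
      unfolding Z_def
    proof (rule infsum_inj_le[where g = "\<lambda>u. u @ [e]"])
      show "inj_on (\<lambda>u. u @ [e]) (W k (act e x))" by (auto simp: inj_on_def)
      show "(\<lambda>u. u @ [e]) ` W k (act e x) \<subseteq> W n x \<inter> W n y"
        using e F(2) ex Suc by (auto simp: words_def adm_append)
      show "(\<lambda>w. exp (- t * \<Phi> w x)) summable_on W n x \<inter> W n y"
        by (rule summable_on_subset[OF summable[OF t xy(1), of n]]) simp
      fix u assume u: "u \<in> W k (act e x)"
      have "exp (- t * \<Phi> (u @ [e]) x) = exp (- t * \<phi> e x) * exp (- t * \<Phi> u (act e x))"
        by (simp add: cocycle_append exp_add[symmetric] algebra_simps)
      then show "\<omega> * exp (- t * \<Phi> u (act e x)) \<le> exp (- t * \<Phi> (u @ [e]) x)"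
        using \<omega>(2)[OF e(1) xy(1) e(2)] by simp
    qed (use summable[OF t ex(1)] in auto)
    moreover have "c * Z t n x \<le> \<omega> / (B * C1) * (B * C1 * Z t k (act e x))"
      using 1 \<omega>(1) B(1) C1_pos Z_pos[OF t xy(1), of n] by (intro mult_mono) (auto simp: c_def less_imp_le)
    ultimately show ?thesis using B(1) C1_pos by simp
  qed
  moreover have "0 < c" using \<omega> B(1) C1_pos by (simp add: c_def)
  ultimately show ?thesis by blast
qed

end

section \<open>Contraction of the word kernels\<close>

lemma norm_exp_minus_1_le: "norm (exp z - 1) \<le> norm z * exp (norm z)" for z :: complex
proof -
  have "norm (exp z - exp 0) \<le> exp (norm z) * norm (z - 0)"
  proof (rule field_differentiable_bound[where S = "closed_segment 0 z"])
    fix w assume w: "w \<in> closed_segment 0 z"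
    show "(exp has_field_derivative exp w) (at w within closed_segment 0 z)"
      by (rule has_field_derivative_at_within[OF DERIV_exp])
    have "norm (exp w) = exp (Re w)" by simp
    also have "\<dots> \<le> exp (norm z)"
      using complex_Re_le_cmod[of w] segment_bound(1)[OF w] by simp
    finally show "norm (exp w) \<le> exp (norm z)" .
  qed auto
  then show ?thesis by (simp add: mult.commute)
qed

lemma norm_weight_le: "0 \<le> a \<Longrightarrow> norm u \<le> U \<Longrightarrow> norm (of_real a * u :: complex) \<le> U * a"
  by (simp add: norm_mult mult.commute[of U] mult_left_mono)

lemma weighted_mean_near:
  fixes a :: "'i \<Rightarrow> real" and u :: "'i \<Rightarrow> complex"
  assumes a: "a summable_on I" "\<And>i. i \<in> I \<Longrightarrow> 0 \<le> a i"
    and U: "\<And>i. i \<in> I \<Longrightarrow> norm (u i) \<le> U" and D: "\<And>i. i \<in> I \<Longrightarrow> norm (u i - v) \<le> D"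
  shows "(\<lambda>i. of_real (a i) * u i) summable_on I"
    "norm ((\<Sum>\<^sub>\<infinity>i\<in>I. of_real (a i) * u i) - of_real (infsum a I) * v) \<le> D * infsum a I"
proof -
  show s: "(\<lambda>i. of_real (a i) * u i) summable_on I"
    by (rule infsum_dominated(1)[OF a(1), where U = U])
      (use a(2) U in \<open>auto intro: norm_weight_le\<close>)
  have a': "(\<lambda>i. complex_of_real (a i)) summable_on I" using a(1) by (rule summable_on_of_real)
  have av: "(\<lambda>i. complex_of_real (a i) * v) summable_on I"
    by (rule summable_on_cmult_left[OF a'])
  have "(\<Sum>\<^sub>\<infinity>i\<in>I. of_real (a i) * v) = (\<Sum>\<^sub>\<infinity>i\<in>I. complex_of_real (a i)) * v"
    by (rule infsum_cmult_left) (use a' in auto)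
  also have "(\<Sum>\<^sub>\<infinity>i\<in>I. complex_of_real (a i)) = of_real (infsum a I)"
    using a(1) by (intro infsumI has_sum_of_real) (simp add: has_sum_infsum)
  finally have "(\<Sum>\<^sub>\<infinity>i\<in>I. of_real (a i) * u i) - of_real (infsum a I) * v
      = (\<Sum>\<^sub>\<infinity>i\<in>I. of_real (a i) * u i) + (\<Sum>\<^sub>\<infinity>i\<in>I. - (of_real (a i) * v))"
    by (simp add: infsum_uminus)
  also have "\<dots> = (\<Sum>\<^sub>\<infinity>i\<in>I. of_real (a i) * u i + - (of_real (a i) * v))"
    using summable_on_uminus[THEN iffD2, OF av] by (intro infsum_add[symmetric] s)
  also have "\<dots> = (\<Sum>\<^sub>\<infinity>i\<in>I. of_real (a i) * (u i - v))" by (simp add: algebra_simps)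
  finally show "norm ((\<Sum>\<^sub>\<infinity>i\<in>I. of_real (a i) * u i) - of_real (infsum a I) * v) \<le> D * infsum a I"
    using infsum_dominated(2)[OF a(1), of "\<lambda>i. of_real (a i) * (u i - v)" D] norm_weight_le[OF a(2) D]
    by simp
qed

text \<open>Each \<open>v j\<close> is within \<open>D\<close> of the normalised mean of
  \<open>u\<close>; averaging over \<open>j\<close> gives the claim. Normalising requires positive
  mass, hence the separate case.\<close>

lemma weighted_means_near:
  fixes a b :: "'i \<Rightarrow> real" and u v :: "'i \<Rightarrow> complex"
  assumes a: "a summable_on I" "\<And>i. i \<in> I \<Longrightarrow> 0 \<le> a i" "infsum a I = s"
    and b: "b summable_on J" "\<And>j. j \<in> J \<Longrightarrow> 0 \<le> b j" "infsum b J = s"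
    and U: "\<And>i. i \<in> I \<Longrightarrow> norm (u i) \<le> U" "\<And>j. j \<in> J \<Longrightarrow> norm (v j) \<le> U"
    and D: "\<And>i j. i \<in> I \<Longrightarrow> j \<in> J \<Longrightarrow> norm (u i - v j) \<le> D"
  shows "norm ((\<Sum>\<^sub>\<infinity>i\<in>I. of_real (a i) * u i) - (\<Sum>\<^sub>\<infinity>j\<in>J. of_real (b j) * v j)) \<le> s * D"
proof (cases "s = 0")
  case True
  have "norm (\<Sum>\<^sub>\<infinity>i\<in>I. of_real (a i) * u i) \<le> U * infsum a I"
    by (rule infsum_dominated(2)[OF a(1)])
      (use a(2) U in \<open>auto intro: norm_weight_le\<close>)
  moreover have "norm (\<Sum>\<^sub>\<infinity>j\<in>J. of_real (b j) * v j) \<le> U * infsum b J"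
    by (rule infsum_dominated(2)[OF b(1)])
      (use b(2) U in \<open>auto intro: norm_weight_le\<close>)
  ultimately show ?thesis using True a(3) b(3) by simp
next
  case False
  have s: "0 < s" using False infsum_nonneg[of I a] a(2,3) by simp
  let ?X = "\<Sum>\<^sub>\<infinity>i\<in>I. of_real (a i) * u i" and ?Y = "\<Sum>\<^sub>\<infinity>j\<in>J. of_real (b j) * v j"
  have 1: "norm (v j - ?X / of_real s) \<le> D" if j: "j \<in> J" for j
  proof -
    have "norm (?X - of_real s * v j) \<le> D * s"
      using weighted_mean_near(2)[OF a(1,2) U(1) D[OF _ j]] a(3) by simp
    moreover have "v j - ?X / of_real s = - ((?X - of_real s * v j) / of_real s)"
      using s by (simp add: field_simps)
    ultimately show ?thesis using s by (simp add: norm_divide divide_le_eq)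
  qed
  have "norm (?Y - of_real (infsum b J) * (?X / of_real s)) \<le> D * infsum b J"
    by (rule weighted_mean_near(2)[OF b(1,2) U(2) 1])
  then show ?thesis using s b(3) by (simp add: norm_minus_commute mult.commute)
qed

text \<open>A coupling argument: the common part \<open>c\<close> of the weights \<open>p\<close> and \<open>q\<close> is matched along equal indices.\<close>

lemma coupled_means_near:
  fixes p q c :: "'i \<Rightarrow> real" and u v :: "'i \<Rightarrow> complex"
  assumes p: "p summable_on I" "infsum p I = 1"
    and q: "q summable_on J" "infsum q J = 1"
    and pq: "\<And>i. i \<in> I \<Longrightarrow> 0 \<le> p i" "\<And>j. j \<in> J \<Longrightarrow> 0 \<le> q j"
    and c: "\<And>i. i \<in> I \<inter> J \<Longrightarrow> 0 \<le> c i \<and> c i \<le> p i \<and> c i \<le> q i"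
    and U: "\<And>i. i \<in> I \<Longrightarrow> norm (u i) \<le> U" "\<And>j. j \<in> J \<Longrightarrow> norm (v j) \<le> U"
    and D: "\<And>i j. i \<in> I \<Longrightarrow> j \<in> J \<Longrightarrow> norm (u i - v j) \<le> D"
    and D': "\<And>i. i \<in> I \<inter> J \<Longrightarrow> norm (u i - v i) \<le> D'"
  shows "norm ((\<Sum>\<^sub>\<infinity>i\<in>I. of_real (p i) * u i) - (\<Sum>\<^sub>\<infinity>j\<in>J. of_real (q j) * v j))
    \<le> (1 - infsum c (I \<inter> J)) * D + infsum c (I \<inter> J) * D'"
proof -
  \<comment> \<open>The common part extended by zero, so that it can be subtracted on
    \<open>I\<close> and on \<open>J\<close>. What remains has the same mass on both sides and is
    compared without matching indices.\<close>
  define d where "d i = (if i \<in> I \<inter> J then c i else 0)" for i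
  have cs: "c summable_on I \<inter> J"
    by (rule summable_on_comparison_test[OF summable_on_subset[OF p(1)]]) (use c in auto)
  have "d summable_on I \<longleftrightarrow> c summable_on I \<inter> J" "d summable_on J \<longleftrightarrow> c summable_on I \<inter> J"
    by (rule summable_on_cong_neutral; auto simp: d_def)+
  moreover have "infsum d I = infsum c (I \<inter> J)" "infsum d J = infsum c (I \<inter> J)"
    by (rule infsum_cong_neutral; auto simp: d_def)+
  ultimately have dI: "d summable_on I" "infsum d I = infsum c (I \<inter> J)"
    and dJ: "d summable_on J" "infsum d J = infsum c (I \<inter> J)"
    using cs by simp_all
  have sub: "(\<lambda>i. f i - d i) summable_on A \<and> infsum (\<lambda>i. f i - d i) A = 1 - infsum c (I \<inter> J)"
    if "f summable_on A" "infsum f A = 1" "d summable_on A" "infsum d A = infsum c (I \<inter> J)" for f A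
    using that infsum_add[OF that(1) summable_on_uminus[THEN iffD2, OF that(3)]]
      summable_on_add[OF that(1) summable_on_uminus[THEN iffD2, OF that(3)]] by (simp add: infsum_uminus)
  have su: "(\<lambda>i. of_real (f i) * h i) summable_on A" if "f summable_on A" "\<And>i. i \<in> A \<Longrightarrow> 0 \<le> f i" "\<And>i. i \<in> A \<Longrightarrow> norm (h i) \<le> U"
    for f :: "'i \<Rightarrow> real" and h :: "'i \<Rightarrow> complex" and A
    by (rule infsum_dominated(1)[OF that(1), where U = U])
      (use that in \<open>auto intro: norm_weight_le\<close>)
  have p': "\<And>i. i \<in> I \<Longrightarrow> 0 \<le> p i - d i" "\<And>i. i \<in> I \<Longrightarrow> 0 \<le> d i"
    and q': "\<And>i. i \<in> J \<Longrightarrow> 0 \<le> q i - d i" "\<And>i. i \<in> J \<Longrightarrow> 0 \<le> d i"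
    using c pq by (auto simp: d_def)
  let ?S = "\<lambda>f h A. \<Sum>\<^sub>\<infinity>i\<in>A. complex_of_real (f i) * h i"
  have split: "?S f h A = ?S (\<lambda>i. f i - d i) h A + ?S c h (I \<inter> J)"
    if "f summable_on A" "infsum f A = 1" "d summable_on A" "infsum d A = infsum c (I \<inter> J)"
      "\<And>i. i \<in> A \<Longrightarrow> 0 \<le> f i - d i" "\<And>i. i \<in> A \<Longrightarrow> 0 \<le> d i" "\<And>i. i \<in> A \<Longrightarrow> norm (h i) \<le> U" "I \<inter> J \<subseteq> A" for f h A
  proof -
    have "?S f h A = (\<Sum>\<^sub>\<infinity>i\<in>A. of_real (f i - d i) * h i + of_real (d i) * h i)"
      by (simp add: algebra_simps)
    also have "\<dots> = ?S (\<lambda>i. f i - d i) h A + ?S d h A"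
      by (intro infsum_add su) (use that sub[OF that(1-4)] in auto)
    also have "?S d h A = ?S c h (I \<inter> J)"
      by (rule infsum_cong_neutral) (use that(8) in \<open>auto simp: d_def\<close>)
    finally show ?thesis .
  qed
  have "norm (?S (\<lambda>i. p i - d i) u I - ?S (\<lambda>i. q i - d i) v J) \<le> (1 - infsum c (I \<inter> J)) * D"
    by (rule weighted_means_near) (use sub[OF p dI] sub[OF q dJ] p' q' U D in auto)
  moreover have "norm (?S c u (I \<inter> J) - ?S c v (I \<inter> J)) \<le> infsum c (I \<inter> J) * D'"
  proof -
    have "?S c u (I \<inter> J) - ?S c v (I \<inter> J) = ?S c u (I \<inter> J) + (\<Sum>\<^sub>\<infinity>i\<in>I \<inter> J. - (of_real (c i) * v i))"
      by (simp add: infsum_uminus)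
    also have "\<dots> = (\<Sum>\<^sub>\<infinity>i\<in>I \<inter> J. of_real (c i) * u i + - (of_real (c i) * v i))"
      by (intro infsum_add[symmetric] su summable_on_uminus[THEN iffD2] cs) (use c U in auto)
    also have "\<dots> = (\<Sum>\<^sub>\<infinity>i\<in>I \<inter> J. of_real (c i) * (u i - v i))" by (simp add: algebra_simps)
    finally show ?thesis
      using infsum_dominated(2)[OF cs, of "\<lambda>i. of_real (c i) * (u i - v i)" D'] norm_weight_le[OF _ D'] c
      by (simp add: mult.commute)
  qed
  moreover have "?S p u I - ?S q v J =
      (?S (\<lambda>i. p i - d i) u I - ?S (\<lambda>i. q i - d i) v J) + (?S c u (I \<inter> J) - ?S c v (I \<inter> J))"
    using split[OF p dI p' U(1)] split[OF q dJ q' U(2)] by simp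
  ultimately show ?thesis
    using norm_triangle_ineq[of "?S (\<lambda>i. p i - d i) u I - ?S (\<lambda>i. q i - d i) v J" "?S c u (I \<inter> J) - ?S c v (I \<inter> J)"]
    by simp
qed

section \<open>Markov kernels of blocks of letters\<close>

context word_system begin

text \<open>The law of the \<open>n\<close> letters acting first, among the weighted words of length
  \<open>m + n\<close> at \<open>x\<close>. By \<open>Z_split\<close> its mass is exactly 1;
  \<open>m\<close> counts the letters still to come.\<close>

definition kernel :: "real \<Rightarrow> nat \<Rightarrow> nat \<Rightarrow> 'e list \<Rightarrow> 'x \<Rightarrow> real" where
  "kernel t m n w x = exp (- t * \<Phi> w x) * Z t m (foldr act w x) / Z t (m + n) x"

lemma kernel_nonneg: "\<delta> < t \<Longrightarrow> x \<in> K \<Longrightarrow> w \<in> W n x \<Longrightarrow> 0 \<le> kernel t m n w x"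
  unfolding kernel_def
  using Z_pos[of t x "m + n"] Z_pos[of t "foldr act w x" m] foldr_act_W[of x w n] by simp

text \<open>Up to the factor \<open>B\<close>, the \<open>m\<close> later letters contribute equally
  to numerator and denominator, so \<open>m\<close> disappears from the bounds.\<close>

lemma kernel_bounds:
  assumes t: "\<delta> < t" and B: "B \<ge> 1" "\<And>m x y. x \<in> K \<Longrightarrow> y \<in> K \<Longrightarrow> Z t m x \<le> B * Z t m y"
    and x: "x \<in> K" and w: "w \<in> W n x"
  shows "kernel t m n w x \<le> B * exp (- t * \<Phi> w x) / Z t n x"
    "exp (- t * \<Phi> w x) / (B * Z t n x) \<le> kernel t m n w x"
proof -
  let ?e = "exp (- t * \<Phi> w x)"
  note y = foldr_act_W[OF x w]
  note q = Z_quasi_multiplicative[OF t B x y, of m n]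
  note p = Z_pos[OF t x, of n] Z_pos[OF t x, of "m + n"] Z_pos[OF t y, of m]
  have "Z t m (foldr act w x) / Z t (m + n) x \<le> B / Z t n x"
    using q(2) p by (simp add: field_simps)
  from mult_left_mono[OF this, of ?e] show "kernel t m n w x \<le> B * exp (- t * \<Phi> w x) / Z t n x"
    by (simp add: kernel_def mult_ac)
  have "1 / (B * Z t n x) \<le> Z t m (foldr act w x) / Z t (m + n) x"
    using q(1) p B(1) by (simp add: field_simps)
  from mult_left_mono[OF this, of ?e] show "exp (- t * \<Phi> w x) / (B * Z t n x) \<le> kernel t m n w x"
    by (simp add: kernel_def mult_ac)
qed

lemma kernel_sum:
  assumes t: "\<delta> < t" and x: "x \<in> K"
  shows "(\<lambda>w. kernel t m n w x) summable_on W n x" "(\<Sum>\<^sub>\<infinity>w\<in>W n x. kernel t m n w x) = 1"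
proof -
  obtain B where B: "B \<ge> 1" "\<And>m x y. x \<in> K \<Longrightarrow> y \<in> K \<Longrightarrow> Z t m x \<le> B * Z t m y"
    using Z_comparable[OF t] by blast
  have "(\<lambda>w. (B / Z t n x) * exp (- t * \<Phi> w x)) summable_on W n x"
    by (intro summable_on_cmult_right summable[OF t x])
  then show s: "(\<lambda>w. kernel t m n w x) summable_on W n x"
    by (rule summable_on_comparison_test)
      (use kernel_bounds(1)[OF t B x, of _ n m] kernel_nonneg[OF t x] in auto)
  have nz: "Z t (m + n) x \<noteq> 0" using Z_pos[OF t x, of "m + n"] by simp
  have eq: "exp (- t * \<Phi> w x) * Z t m (foldr act w x) = Z t (m + n) x * kernel t m n w x" for w
    using nz by (simp add: kernel_def)
  have "Z t (m + n) x = (\<Sum>\<^sub>\<infinity>w\<in>W n x. exp (- t * \<Phi> w x) * Z t m (foldr act w x))"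
    by (rule Z_split[OF t x])
  also have "\<dots> = (\<Sum>\<^sub>\<infinity>w\<in>W n x. Z t (m + n) x * kernel t m n w x)"
    by (simp only: eq)
  also have "\<dots> = Z t (m + n) x * (\<Sum>\<^sub>\<infinity>w\<in>W n x. kernel t m n w x)"
    by (rule infsum_cmult_right) (use s in auto)
  finally show "(\<Sum>\<^sub>\<infinity>w\<in>W n x. kernel t m n w x) = 1" using nz by simp
qed

end

context word_system begin

text \<open>The three factors of the kernel are treated separately: the weight contributes
  \<open>t * \<bar>M\<bar>\<close>, the numerator and the denominator \<open>L\<close> each.
  Assumption \<open>d\<close> allows the numerator to be measured in
  \<open>dist x y\<close>.\<close>

lemma kernel_Lipschitz:
  assumes t: "\<delta> < t"
    and L: "0 \<le> L" "\<And>m x y. x \<in> K \<Longrightarrow> y \<in> K \<Longrightarrow> Z t m x \<le> exp (L * dist x y) * Z t m y"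
    and x: "x \<in> K" and y: "y \<in> K" and l: "lab x = lab y" and w: "w \<in> W n x"
    and d: "dist (foldr act w x) (foldr act w y) \<le> dist x y"
  shows "kernel t m n w x \<le> exp ((t * \<bar>M\<bar> + 2 * L) * dist x y) * kernel t m n w y"
proof -
  have w': "w \<in> W n y" using w l by simp
  note fx = foldr_act_W[OF x w] and fy = foldr_act_W[OF y w']
  let ?d = "dist x y"
  have 1: "exp (- t * \<Phi> w x) \<le> exp (t * \<bar>M\<bar> * ?d) * exp (- t * \<Phi> w y)"
  proof -
    have "exp (- t * \<Phi> w x) \<le> exp (t * M * ?d) * exp (- t * \<Phi> w y)"
      using Phi_Lipschitz'[of x y w t] x y w l t_nonneg[OF t] by (simp add: words_def)
    also have "t * M * ?d \<le> t * \<bar>M\<bar> * ?d"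
      using t_nonneg[OF t] by (intro mult_right_mono mult_left_mono) auto
    then have "exp (t * M * ?d) * exp (- t * \<Phi> w y) \<le> exp (t * \<bar>M\<bar> * ?d) * exp (- t * \<Phi> w y)"
      by simp
    finally show ?thesis .
  qed
  have 2: "Z t m (foldr act w x) \<le> exp (L * ?d) * Z t m (foldr act w y)"
  proof -
    have "Z t m (foldr act w x) \<le> exp (L * dist (foldr act w x) (foldr act w y)) * Z t m (foldr act w y)"
      by (rule L(2)[OF fx fy])
    also have "\<dots> \<le> exp (L * ?d) * Z t m (foldr act w y)"
      using mult_left_mono[OF d L(1)] Z_pos[OF t fy, of m] by (intro mult_right_mono) auto
    finally show ?thesis .
  qed
  have 3: "inverse (Z t (m + n) x) \<le> exp (L * ?d) * inverse (Z t (m + n) y)"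
    using L(2)[OF y x, of "m + n"] Z_pos[OF t x, of "m + n"] Z_pos[OF t y, of "m + n"]
    by (simp add: field_simps dist_commute)
  have "kernel t m n w x \<le> (exp (t * \<bar>M\<bar> * ?d) * exp (- t * \<Phi> w y)) * (exp (L * ?d) * Z t m (foldr act w y)) *
      (exp (L * ?d) * inverse (Z t (m + n) y))"
    unfolding kernel_def divide_inverse
    using Z_pos[OF t x, of "m + n"] Z_pos[OF t y, of "m + n"] Z_pos[OF t fx, of m] Z_pos[OF t fy, of m]
    by (intro mult_mono 1 2 3) simp_all
  also have "\<dots> = exp (t * \<bar>M\<bar> * ?d + L * ?d + L * ?d) * kernel t m n w y"
    unfolding kernel_def divide_inverse exp_add by (simp only: mult_ac)
  also have "t * \<bar>M\<bar> * ?d + L * ?d + L * ?d = (t * \<bar>M\<bar> + 2 * L) * ?d" by (simp add: algebra_simps)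
  finally show ?thesis .
qed

text \<open>On the common words both kernels dominate a multiple of the normalised weight at
  \<open>x\<close>, and by \<open>word_overlap\<close> these words carry a fixed proportion of
  it.\<close>

lemma kernel_overlap:
  assumes t: "\<delta> < t"
  shows "\<exists>c>0. \<forall>m n. \<forall>x\<in>K. \<forall>y\<in>K. c \<le> (\<Sum>\<^sub>\<infinity>w\<in>W n x \<inter> W n y. min (kernel t m n w x) (kernel t m n w y))"
proof -
  obtain B where B: "B \<ge> 1" "\<And>m x y. x \<in> K \<Longrightarrow> y \<in> K \<Longrightarrow> Z t m x \<le> B * Z t m y"
    using Z_comparable[OF t] by blast
  obtain c where c: "c > 0" "\<And>n x y. x \<in> K \<Longrightarrow> y \<in> K \<Longrightarrow>
      c * Z t n x \<le> (\<Sum>\<^sub>\<infinity>w\<in>W n x \<inter> W n y. exp (- t * \<Phi> w x))"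
    using word_overlap[OF t] by blast
  have \<Delta>0: "0 \<le> \<Delta>" using K_bdd K_ne zero_le_dist order_trans by blast
  \<comment> \<open>One \<open>B\<close> comes from the lower bound for the kernel, the other from
    replacing \<open>Z t n y\<close> by \<open>Z t n x\<close>; the exponential is the loss in
    \<open>Phi_compare\<close>.\<close>
  define g where "g = exp (- t * (\<bar>M\<bar> * \<Delta>)) / (B * B)"
  have g: "0 < g" using B(1) by (simp add: g_def)
  have e1: "exp (- t * (\<bar>M\<bar> * \<Delta>)) \<le> 1" using t_nonneg[OF t] \<Delta>0 by simp
  have "c * g \<le> (\<Sum>\<^sub>\<infinity>w\<in>W n x \<inter> W n y. min (kernel t m n w x) (kernel t m n w y))"
    if x: "x \<in> K" and y: "y \<in> K" for m n x y
  proof -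
    note p = Z_pos[OF t x, of n] Z_pos[OF t y, of n]
    have s: "(\<lambda>w. exp (- t * \<Phi> w x)) summable_on W n x \<inter> W n y"
      by (rule summable_on_subset[OF summable[OF t x, of n]]) simp
    have sm: "(\<lambda>w. min (kernel t m n w x) (kernel t m n w y)) summable_on W n x \<inter> W n y"
      by (rule summable_on_comparison_test[OF summable_on_subset[OF kernel_sum(1)[OF t x, of m n], of "W n x \<inter> W n y"]])
        (use kernel_nonneg[OF t] x y in auto)
    have le: "g / Z t n x * exp (- t * \<Phi> w x) \<le> min (kernel t m n w x) (kernel t m n w y)" if w: "w \<in> W n x \<inter> W n y" for w
    proof (rule min.boundedI)
      have "g * B \<le> 1"
      proof -
        have "g * B = exp (- t * (\<bar>M\<bar> * \<Delta>)) / B" using B(1) by (simp add: g_def)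
        also have "\<dots> \<le> 1 / 1" using e1 B(1) by (intro frac_le) auto
        also have "\<dots> = 1" by simp
        finally show ?thesis .
      qed
      then have "g * B * exp (- t * \<Phi> w x) \<le> 1 * exp (- t * \<Phi> w x)"
        by (rule mult_right_mono) simp
      then have "g / Z t n x * exp (- t * \<Phi> w x) \<le> exp (- t * \<Phi> w x) / (B * Z t n x)"
        using p B(1) by (simp add: field_simps)
      also have "\<dots> \<le> kernel t m n w x" using kernel_bounds(2)[OF t B x] w by blast
      finally show "g / Z t n x * exp (- t * \<Phi> w x) \<le> kernel t m n w x" .
      have "exp (- t * (\<bar>M\<bar> * \<Delta>)) * exp (- t * \<Phi> w x) \<le> exp (- t * \<Phi> w y)"
        using Phi_compare[OF x y _ _ t_nonneg[OF t]] w by (simp add: words_def)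
      then have "g * (B * B) * exp (- t * \<Phi> w x) \<le> exp (- t * \<Phi> w y)" using B(1) by (simp add: g_def)
      then have "g * B * exp (- t * \<Phi> w x) * B * Z t n x \<le> exp (- t * \<Phi> w y) * Z t n x"
        using p by (simp add: mult_ac)
      moreover have "g * B * exp (- t * \<Phi> w x) * Z t n y \<le> g * B * exp (- t * \<Phi> w x) * (B * Z t n x)"
        using B(2)[OF y x] g B(1) by (intro mult_left_mono) simp_all
      ultimately have "g * B * exp (- t * \<Phi> w x) * Z t n y \<le> exp (- t * \<Phi> w y) * Z t n x"
        by (simp add: mult_ac)
      then have "g / Z t n x * exp (- t * \<Phi> w x) \<le> exp (- t * \<Phi> w y) / (B * Z t n y)"
        using p B(1) by (simp add: field_simps)
      also have "\<dots> \<le> kernel t m n w y" using kernel_bounds(2)[OF t B y] w by blast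
      finally show "g / Z t n x * exp (- t * \<Phi> w x) \<le> kernel t m n w y" .
    qed
    have "c * g = g / Z t n x * (c * Z t n x)" using p by simp
    also have "\<dots> \<le> g / Z t n x * (\<Sum>\<^sub>\<infinity>w\<in>W n x \<inter> W n y. exp (- t * \<Phi> w x))"
      using c(2)[OF x y] g p by (intro mult_left_mono) simp_all
    also have "\<dots> = (\<Sum>\<^sub>\<infinity>w\<in>W n x \<inter> W n y. g / Z t n x * exp (- t * \<Phi> w x))"
      by (rule infsum_cmult_right[symmetric]) (use s in auto)
    also have "\<dots> \<le> (\<Sum>\<^sub>\<infinity>w\<in>W n x \<inter> W n y. min (kernel t m n w x) (kernel t m n w y))"
      by (rule infsum_mono[OF summable_on_cmult_right[OF s] sm le])
    finally show ?thesis .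
  qed
  then show ?thesis using c(1) g by (intro exI[of _ "c * g"]) auto
qed

definition avg :: "real \<Rightarrow> nat \<Rightarrow> nat \<Rightarrow> ('x \<Rightarrow> complex) \<Rightarrow> 'x \<Rightarrow> complex" where
  "avg t m n u x = (\<Sum>\<^sub>\<infinity>w\<in>W n x. of_real (kernel t m n w x) * u (foldr act w x))"

text \<open>The truncated metric \<open>min 1 (dist x y / \<kappa>)\<close> is contracted by the Markov kernels of long blocks:
  far apart points because the kernels overlap, close ones because long words contract.\<close>

lemma kernel_contracts:
  assumes t: "\<delta> < t"
  obtains \<kappa> q n L where "0 < \<kappa>" "\<kappa> \<le> r0" "0 \<le> q" "q < 1" "0 < n" "0 \<le> L"
    "\<And>x y w. x \<in> K \<Longrightarrow> y \<in> K \<Longrightarrow> w \<in> W n x \<inter> W n y \<Longrightarrow> dist (foldr act w x) (foldr act w y) \<le> dist x y"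
    "\<And>m x y w. x \<in> K \<Longrightarrow> y \<in> K \<Longrightarrow> dist x y < \<kappa> \<Longrightarrow> w \<in> W n x \<Longrightarrow>
       \<bar>kernel t m n w x - kernel t m n w y\<bar> \<le> L * dist x y * kernel t m n w x"
    "\<And>m u v U x y. 0 \<le> v \<Longrightarrow> (\<And>x. x \<in> K \<Longrightarrow> norm (u x) \<le> U) \<Longrightarrow>
      (\<And>x y. x \<in> K \<Longrightarrow> y \<in> K \<Longrightarrow> norm (u x - u y) \<le> v * min 1 (dist x y / \<kappa>)) \<Longrightarrow> x \<in> K \<Longrightarrow> y \<in> K \<Longrightarrow>
      norm (avg t m n u x - avg t m n u y) \<le> q * v * min 1 (dist x y / \<kappa>)"
proof -
  obtain L where L: "0 \<le> L" "\<And>m x y. x \<in> K \<Longrightarrow> y \<in> K \<Longrightarrow> Z t m x \<le> exp (L * dist x y) * Z t m y"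
    using Z_log_Lipschitz[OF t] by blast
  obtain c where c: "c > 0" "\<And>m n x y. x \<in> K \<Longrightarrow> y \<in> K \<Longrightarrow>
      c \<le> (\<Sum>\<^sub>\<infinity>w\<in>W n x \<inter> W n y. min (kernel t m n w x) (kernel t m n w y))"
    using kernel_overlap[OF t] by blast
  define L' where "L' = t * \<bar>M\<bar> + 2 * L"
  have L': "0 \<le> L'" using t_nonneg[OF t] L(1) by (simp add: L'_def)
  \<comment> \<open>Below this distance the labels agree and the kernels differ by a factor of at
    most \<open>exp (1 / 4)\<close>.\<close>
  define \<kappa> where "\<kappa> = min r0 (1 / (4 * (L' + 1)))"
  have \<kappa>: "0 < \<kappa>" "\<kappa> \<le> r0" using r0(1) L' by (auto simp: \<kappa>_def)
  have \<kappa>L: "L' * \<kappa> \<le> 1 / 4"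
  proof -
    have "L' * \<kappa> \<le> L' * (1 / (4 * (L' + 1)))" using L' by (intro mult_left_mono) (auto simp: \<kappa>_def)
    also have "\<dots> \<le> 1 / 4" using L' by (simp add: field_simps)
    finally show ?thesis .
  qed
  have \<Delta>0: "0 \<le> \<Delta>" using K_bdd K_ne zero_le_dist order_trans by blast
  \<comment> \<open>The bound 1/4 serves points closer than \<kappa>. The other one lets a long word
    bring any two points it may be applied to within \<open>\<kappa> / 2\<close>.\<close>
  define \<theta> where "\<theta> = min (1 / 4) (\<kappa> / (2 * (\<Delta> + 1)))"
  have \<theta>: "0 < \<theta>" "\<theta> \<le> 1 / 4" using \<kappa> \<Delta>0 unfolding \<theta>_def by (simp_all only: min_less_iff_conj min.cobounded1) simp_all
  have \<theta>\<Delta>: "\<theta> * \<Delta> \<le> \<kappa> / 2"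
  proof -
    have "\<theta> * \<Delta> \<le> \<kappa> / (2 * (\<Delta> + 1)) * \<Delta>" using \<Delta>0 by (intro mult_right_mono) (auto simp: \<theta>_def)
    also have "\<dots> \<le> \<kappa> / 2" using \<Delta>0 \<kappa>(1) by (simp add: field_simps)
    finally show ?thesis .
  qed
  obtain N where N: "\<And>w x y. length w \<ge> N \<Longrightarrow> x \<in> K \<Longrightarrow> y \<in> K \<Longrightarrow>
       adm E gen w (lab x) \<Longrightarrow> adm E gen w (lab y) \<Longrightarrow> dist (foldr act w x) (foldr act w y) \<le> \<theta> * dist x y"
    using contracting[OF \<theta>(1)] by blast
  define n where "n = Suc N"
  have con: "dist (foldr act w x) (foldr act w y) \<le> \<theta> * dist x y" if "x \<in> K" "y \<in> K" "w \<in> W n x \<inter> W n y" for x y w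
    using N[of w x y] that by (auto simp: words_def n_def)
  have con1: "dist (foldr act w x) (foldr act w y) \<le> dist x y" if "x \<in> K" "y \<in> K" "w \<in> W n x \<inter> W n y" for x y w
  proof -
    have "\<theta> * dist x y \<le> 1 * dist x y" using \<theta> by (intro mult_right_mono) auto
    with con[OF that] show ?thesis by simp
  qed
  have kl: "kernel t m n w x \<le> exp (L' * dist x y) * kernel t m n w y"
    if "x \<in> K" "y \<in> K" "dist x y < \<kappa>" "w \<in> W n x" for m w x y
  proof -
    have l: "lab x = lab y" using r0(2)[OF that(1,2)] that(3) \<kappa>(2) by simp
    then have "w \<in> W n x \<inter> W n y" using that(4) by simp
    from kernel_Lipschitz[OF t L that(1,2) l that(4) con1[OF that(1,2) this], where m = m]
    show ?thesis by (simp add: L'_def)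
  qed
  have exple: "exp s - 1 \<le> 2 * s" if "0 \<le> s" "s \<le> 1" for s :: real
    using exp_bound[OF that] that by (simp add: power2_eq_square) (smt (verit) mult_left_le)
  have kd: "\<bar>kernel t m n w x - kernel t m n w y\<bar> \<le> 2 * L' * dist x y * kernel t m n w x"
    if xy: "x \<in> K" "y \<in> K" "dist x y < \<kappa>" "w \<in> W n x" for m w x y
  proof -
    let ?s = "L' * dist x y" and ?p = "kernel t m n w x" and ?q = "kernel t m n w y"
    have l: "lab x = lab y" using r0(2)[OF that(1,2)] that(3) \<kappa>(2) by simp
    have s: "0 \<le> ?s" "?s \<le> 1"
    proof -
      show "0 \<le> ?s" using L' by simp
      have "?s \<le> L' * \<kappa>" using L' xy(3) by (intro mult_left_mono) auto
      with \<kappa>L show "?s \<le> 1" by simp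
    qed
    have pq: "?p \<le> exp ?s * ?q" "?q \<le> exp ?s * ?p"
      using kl[OF xy(1-4)] kl[OF xy(2,1)] xy(3,4) l by (auto simp: dist_commute)
    have p0: "0 \<le> ?p" using kernel_nonneg[OF t xy(1,4)] .
    have "?q - ?p \<le> (exp ?s - 1) * ?p" using pq(2) by (simp add: algebra_simps)
    also have "\<dots> \<le> 2 * ?s * ?p" by (rule mult_right_mono[OF exple[OF s] p0])
    finally have 1: "?q - ?p \<le> 2 * ?s * ?p" .
    have "exp (- ?s) * ?p \<le> exp (- ?s) * (exp ?s * ?q)" by (rule mult_left_mono[OF pq(1)]) simp
    then have "exp (- ?s) * ?p \<le> ?q" by (simp add: mult.assoc[symmetric] exp_add[symmetric])
    moreover have "(1 - ?s) * ?p \<le> exp (- ?s) * ?p"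
      using exp_ge_add_one_self[of "- ?s"] p0 by (intro mult_right_mono) auto
    ultimately have "?p - ?q \<le> ?s * ?p" by (simp add: algebra_simps)
    also have "\<dots> \<le> 2 * ?s * ?p" using s p0 by (simp add: mult_right_mono)
    finally have 2: "?p - ?q \<le> 2 * ?s * ?p" .
    from 1 2 show ?thesis by (simp add: abs_le_iff mult_ac)
  qed
  \<comment> \<open>Close points lose 1/4 through the kernels and 1/4 through the contraction. For
    far points the matched mass, at least \<open>c\<close>, contributes only half, which leaves
    \<open>1 - c / 2\<close>.\<close>
  define q where "q = max (1 / 2) (1 - min c 1 / 2)"
  have q: "0 \<le> q" "q < 1" using c(1) by (auto simp: q_def)
  have "norm (avg t m n u x - avg t m n u y) \<le> q * v * min 1 (dist x y / \<kappa>)"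
    if v0: "0 \<le> v" and U: "\<And>x. x \<in> K \<Longrightarrow> norm (u x) \<le> U"
      and v: "\<And>x y. x \<in> K \<Longrightarrow> y \<in> K \<Longrightarrow> norm (u x - u y) \<le> v * min 1 (dist x y / \<kappa>)"
      and x: "x \<in> K" and y: "y \<in> K" for m u v U x y
  proof -
    have vD: "norm (u x - u y) \<le> v" if "x \<in> K" "y \<in> K" for x y
      using v[OF that] v0 mult_left_mono[of "min 1 (dist x y / \<kappa>)" 1 v] by simp
    have vd: "norm (u (foldr act w x) - u (foldr act w y)) \<le> v * \<theta> * dist x y / \<kappa>" if w: "w \<in> W n x \<inter> W n y" for w
    proof -
      have f: "foldr act w x \<in> K" "foldr act w y \<in> K" using foldr_act_W x y w by blast+
      have "v * min 1 (dist (foldr act w x) (foldr act w y) / \<kappa>) \<le> v * (\<theta> * dist x y / \<kappa>)"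
        using con[OF x y w] \<kappa>(1) v0 by (intro mult_left_mono) (auto simp: min_le_iff_disj divide_right_mono)
      with v[OF f] show ?thesis by simp
    qed
    have main: "norm (avg t m n u x - avg t m n u y) \<le> (1 - infsum c (W n x \<inter> W n y)) * v + infsum c (W n x \<inter> W n y) * D'"
      if c: "\<And>w. w \<in> W n x \<inter> W n y \<Longrightarrow> 0 \<le> c w \<and> c w \<le> kernel t m n w x \<and> c w \<le> kernel t m n w y"
        and D': "\<And>w. w \<in> W n x \<inter> W n y \<Longrightarrow> norm (u (foldr act w x) - u (foldr act w y)) \<le> D'" for c D'
      unfolding avg_def
      by (rule coupled_means_near[where U = U and u = "\<lambda>w. u (foldr act w x)" and v = "\<lambda>w. u (foldr act w y)"])
        (use kernel_sum[OF t] kernel_nonneg[OF t] x y c D' U vD foldr_act_W in auto)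
    show ?thesis
    proof (cases "dist x y < \<kappa>")
      case True
      then have l: "lab x = lab y" using r0(2)[OF x y] \<kappa>(2) by simp
      then have I: "W n x \<inter> W n y = W n x" by simp
      let ?s = "L' * dist x y"
      \<comment> \<open>Damped by this factor, the kernel at \<open>x\<close> lies below both
        kernels and has mass \<open>exp (- ?s)\<close>, so it serves as the common part of the
        coupling.\<close>
      let ?c = "\<lambda>w. exp (- ?s) * kernel t m n w x"
      have ic: "infsum ?c (W n x \<inter> W n y) = exp (- ?s)"
        unfolding I infsum_cmult_right[OF kernel_sum(1)[OF t x]] kernel_sum(2)[OF t x] by simp
      have s0: "0 \<le> ?s" using L' by simp
      have cw: "0 \<le> ?c w \<and> ?c w \<le> kernel t m n w x \<and> ?c w \<le> kernel t m n w y" if "w \<in> W n x \<inter> W n y" for w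
      proof -
        have w: "w \<in> W n x" using that by simp
        have k0: "0 \<le> kernel t m n w x" using kernel_nonneg[OF t x w] .
        have "exp (- ?s) * kernel t m n w x \<le> 1 * kernel t m n w x"
          using s0 k0 by (intro mult_right_mono) auto
        moreover have "exp (- ?s) * kernel t m n w x \<le> exp (- ?s) * (exp ?s * kernel t m n w y)"
          by (rule mult_left_mono[OF kl[OF x y True w]]) simp
        then have "exp (- ?s) * kernel t m n w x \<le> kernel t m n w y"
          by (simp add: mult.assoc[symmetric] exp_add[symmetric])
        ultimately show ?thesis using k0 by simp
      qed
      have "norm (avg t m n u x - avg t m n u y) \<le> (1 - exp (- ?s)) * v + exp (- ?s) * (v * \<theta> * dist x y / \<kappa>)"
        using main[of ?c, OF cw vd] unfolding ic .
      also have "(1 - exp (- ?s)) * v \<le> ?s * v"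
        using exp_ge_add_one_self[of "- ?s"] v0 by (intro mult_right_mono) auto
      also have "?s * v = (L' * \<kappa>) * (v * (dist x y / \<kappa>))" using \<kappa>(1) by simp
      also have "\<dots> \<le> 1 / 4 * (v * (dist x y / \<kappa>))"
        using \<kappa>L v0 \<kappa>(1) by (intro mult_right_mono) auto
      also have "exp (- ?s) * (v * \<theta> * dist x y / \<kappa>) \<le> 1 * (v * \<theta> * dist x y / \<kappa>)"
        using s0 v0 \<theta> \<kappa>(1) by (intro mult_right_mono) auto
      also have "1 * (v * \<theta> * dist x y / \<kappa>) = \<theta> * (v * (dist x y / \<kappa>))" by simp
      also have "\<dots> \<le> 1 / 4 * (v * (dist x y / \<kappa>))"
        using \<theta> v0 \<kappa>(1) by (intro mult_right_mono) auto
      finally have "norm (avg t m n u x - avg t m n u y) \<le> 1 / 2 * (v * (dist x y / \<kappa>))" by simp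
      also have "\<dots> \<le> q * (v * (dist x y / \<kappa>))"
        using v0 \<kappa>(1) by (intro mult_right_mono) (auto simp: q_def)
      also have "dist x y / \<kappa> = min 1 (dist x y / \<kappa>)" using True \<kappa>(1) by (simp add: min_def)
      finally show ?thesis by simp
    next
      case False
      let ?c = "\<lambda>w. min (kernel t m n w x) (kernel t m n w y)"
      let ?C = "infsum ?c (W n x \<inter> W n y)"
      have D1: "min 1 (dist x y / \<kappa>) = 1" using False \<kappa>(1) by (simp add: min_def)
      have C: "c \<le> ?C" by (rule c(2)[OF x y])
      have D': "norm (u (foldr act w x) - u (foldr act w y)) \<le> v / 2" if "w \<in> W n x \<inter> W n y" for w
      proof -
        have "\<theta> * dist x y \<le> \<theta> * \<Delta>" using K_bdd[OF x y] \<theta> by (intro mult_left_mono) auto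
        with \<theta>\<Delta> have "\<theta> * dist x y / \<kappa> \<le> 1 / 2" using \<kappa>(1) by (simp add: field_simps)
        from mult_left_mono[OF this v0] have "v * \<theta> * dist x y / \<kappa> \<le> v / 2" by (simp add: mult.assoc)
        with vd[OF that] show ?thesis by linarith
      qed
      have "norm (avg t m n u x - avg t m n u y) \<le> (1 - ?C) * v + ?C * (v / 2)"
        by (rule main) (use kernel_nonneg[OF t] x y D' in auto)
      also have "\<dots> = (1 - ?C / 2) * v" by (simp add: algebra_simps)
      also have "\<dots> \<le> q * v" using C v0 by (intro mult_right_mono) (auto simp: q_def)
      finally show ?thesis by (simp only: D1 mult_1_right)
    qed
  qed
  note step = this
  have n0: "0 < n" and L0: "0 \<le> 2 * L'" using L' by (simp_all add: n_def)
  show thesis by (rule that[OF \<kappa> q n0 L0 con1 kd step])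
qed

end

section \<open>Analyticity of the pressure\<close>

context word_system begin

definition Zc :: "complex \<Rightarrow> nat \<Rightarrow> 'x \<Rightarrow> complex" where
  "Zc z n x = (\<Sum>\<^sub>\<infinity>w\<in>W n x. exp (- (z * of_real (\<Phi> w x))))"

lemma Zc_summable: "\<delta> < Re z \<Longrightarrow> x \<in> K \<Longrightarrow> (\<lambda>w. exp (- (z * of_real (\<Phi> w x)))) summable_on W n x"
  by (rule infsum_dominated(1)[OF summable[of "Re z" x n], where U = 1]) auto

lemma Zc_of_real: "\<delta> < t \<Longrightarrow> x \<in> K \<Longrightarrow> Zc (of_real t) n x = of_real (Z t n x)"
proof -
  assume *: "\<delta> < t" "x \<in> K"
  have "((\<lambda>w. complex_of_real (exp (- t * \<Phi> w x))) has_sum of_real (Z t n x)) (W n x)"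
    unfolding Z_def using summable[OF *, of n] by (intro has_sum_of_real) (simp add: has_sum_infsum)
  then show ?thesis unfolding Zc_def by (intro infsumI) (simp flip: exp_of_real)
qed

lemma Zc_split:
  assumes z: "\<delta> < Re z" and x: "x \<in> K"
  shows "Zc z (m + n) x = (\<Sum>\<^sub>\<infinity>w\<in>W n x. exp (- (z * of_real (\<Phi> w x))) * Zc z m (foldr act w x))"
proof -
  have "Zc z (m + n) x = (\<Sum>\<^sub>\<infinity>w\<in>W n x. \<Sum>\<^sub>\<infinity>u\<in>words E gen m (lead gen w (lab x)). exp (- (z * of_real (\<Phi> (u @ w) x))))"
    unfolding Zc_def by (rule infsum_words_split) (rule Zc_summable[OF z x])
  also have "\<dots> = (\<Sum>\<^sub>\<infinity>w\<in>W n x. exp (- (z * of_real (\<Phi> w x))) * Zc z m (foldr act w x))"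
  proof (rule infsum_cong)
    fix w assume w: "w \<in> W n x"
    let ?y = "foldr act w x"
    have y: "?y \<in> K" "lab ?y = lead gen w (lab x)"
      using foldr_act_K[OF x, of w] w by (auto simp: words_def)
    have eq: "exp (- (z * of_real (\<Phi> (u @ w) x))) = exp (- (z * of_real (\<Phi> w x))) * exp (- (z * of_real (\<Phi> u ?y)))" for u
      by (simp add: cocycle_append algebra_simps exp_add[symmetric])
    show "(\<Sum>\<^sub>\<infinity>u\<in>words E gen m (lead gen w (lab x)). exp (- (z * of_real (\<Phi> (u @ w) x)))) = exp (- (z * of_real (\<Phi> w x))) * Zc z m ?y"
      unfolding eq Zc_def y(2)[symmetric] by (rule infsum_cmult_right) (rule Zc_summable[OF z y(1)])
  qed
  finally show ?thesis .
qed

text \<open>Near \<open>z0\<close> every term is dominated by a multiple of the weight at the real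
  exponent \<open>Re z0 - r\<close>, which still exceeds \<delta>. The bound \<open>c0\<close> takes
  care of the words on which \<Phi> is negative.\<close>

lemma Zc_holomorphic:
  assumes x: "x \<in> K"
  shows "(\<lambda>z. Zc z n x) holomorphic_on {z. \<delta> < Re z}"
proof (rule holomorphic_onI)
  fix z0 assume "z0 \<in> {z. \<delta> < Re z}"
  then have z0: "\<delta> < Re z0" by simp
  define r where "r = (Re z0 - \<delta>) / 2"
  have r: "0 < r" "\<delta> < Re z0 - r" using z0 by (auto simp: r_def field_simps)
  have bound: "norm (exp (- (z * of_real (\<Phi> w x)))) \<le> exp (2 * r * \<bar>c0\<bar>) * exp (- (Re z0 - r) * \<Phi> w x)"
    if w: "w \<in> W n x" and z: "z \<in> cball z0 r" for w z
  proof -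
    have "\<bar>Re (z0 - z)\<bar> \<le> r" using abs_Re_le_cmod[of "z0 - z"] z by (simp add: dist_norm)
    then have h: "0 \<le> Re z - (Re z0 - r)" "Re z - (Re z0 - r) \<le> 2 * r" by auto
    have "- c0 \<le> \<Phi> w x" using Phi_lower[OF x] w by (simp add: words_def)
    then have "- \<Phi> w x \<le> \<bar>c0\<bar>" by simp
    from mult_left_mono[OF this h(1)] mult_right_mono[OF h(2), of "\<bar>c0\<bar>"]
    have "- (Re z * \<Phi> w x) \<le> 2 * r * \<bar>c0\<bar> + - (Re z0 - r) * \<Phi> w x" by (simp add: algebra_simps)
    then show ?thesis by (simp add: exp_add[symmetric])
  qed
  have "uniform_limit (cball z0 r) (\<lambda>X z. \<Sum>w\<in>X. exp (- (z * of_real (\<Phi> w x)))) (\<lambda>z. Zc z n x) (finite_subsets_at_top (W n x))"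
    unfolding Zc_def
    by (rule Weierstrass_m_test_general[OF bound summable_on_cmult_right[OF summable[OF r(2) x]]])
  moreover have "\<forall>\<^sub>F X in finite_subsets_at_top (W n x).
     continuous_on (cball z0 r) (\<lambda>z. \<Sum>w\<in>X. exp (- (z * of_real (\<Phi> w x)))) \<and>
     (\<lambda>z. \<Sum>w\<in>X. exp (- (z * of_real (\<Phi> w x)))) holomorphic_on ball z0 r"
    by (intro always_eventually allI conjI continuous_intros holomorphic_intros)
  ultimately have "(\<lambda>z. Zc z n x) holomorphic_on ball z0 r"
    by (elim holomorphic_uniform_limit[rotated]) auto
  then have "(\<lambda>z. Zc z n x) field_differentiable at z0"
    using r(1) by (auto simp: holomorphic_on_open field_differentiable_def)
  then show "(\<lambda>z. Zc z n x) field_differentiable at z0 within {z. \<delta> < Re z}"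
    by (rule field_differentiable_at_within)
qed

text \<open>The weights belong to the exponent \<open>t + z\<close>, while the normalisation stays
  at \<open>t\<close>.\<close>

definition avgp :: "real \<Rightarrow> nat \<Rightarrow> nat \<Rightarrow> complex \<Rightarrow> ('x \<Rightarrow> complex) \<Rightarrow> 'x \<Rightarrow> complex" where
  "avgp t m n z u x = (\<Sum>\<^sub>\<infinity>w\<in>W n x. of_real (kernel t m n w x) * (exp (- (z * of_real (\<Phi> w x))) * u (foldr act w x)))"

text \<open>Exponential moments of \<Phi> under the kernels are, up to a constant, sums at the
  smaller exponent \<open>t - 2 * r\<close>; \<open>kernel_bounds\<close> makes this uniform in
  \<open>m\<close>.\<close>

lemma kernel_tail:
  assumes t: "\<delta> < t - 2 * r" and r: "0 \<le> r"
  shows "\<exists>H\<ge>0. \<forall>m. \<forall>x\<in>K. (\<lambda>w. kernel t m n w x * exp (2 * r * \<bar>\<Phi> w x\<bar>)) summable_on W n x \<and>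
     (\<Sum>\<^sub>\<infinity>w\<in>W n x. kernel t m n w x * exp (2 * r * \<bar>\<Phi> w x\<bar>)) \<le> H"
proof -
  have t': "\<delta> < t" using t r by simp
  obtain B where B: "B \<ge> 1" "\<And>m x y. x \<in> K \<Longrightarrow> y \<in> K \<Longrightarrow> Z t m x \<le> B * Z t m y"
    using Z_comparable[OF t'] by blast
  have "\<exists>C. \<forall>x\<in>K. Z (t - 2 * r) n x \<le> C" using weight_summable[OF t, of n] by (elim ex_forward) blast
  then obtain C where C: "\<And>x. x \<in> K \<Longrightarrow> Z (t - 2 * r) n x \<le> C" by blast
  obtain y where y: "y \<in> K" using K_ne by blast
  define b where "b = Z t n y / B"
  have b: "0 < b" "\<And>x. x \<in> K \<Longrightarrow> b \<le> Z t n x"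
    using B(2)[OF y] B(1) Z_pos[OF t' y, of n] by (auto simp: b_def field_simps)
  have C0: "0 \<le> C" using C[OF y] Z_pos[OF t y, of n] by simp
  \<comment> \<open>The exponent \<open>4 * r * \<bar>c0\<bar>\<close> stems from \<bar>\<Phi>\<bar>
    \<le> \<Phi> + 2\<bar>c0\<bar>, multiplied by \<open>2 * r\<close>.\<close>
  define A where "A = B / b * exp (4 * r * \<bar>c0\<bar>)"
  have A: "0 \<le> A" using B(1) b by (simp add: A_def)
  have le: "kernel t m n w x * exp (2 * r * \<bar>\<Phi> w x\<bar>) \<le> A * exp (- (t - 2 * r) * \<Phi> w x)"
    if x: "x \<in> K" and w: "w \<in> W n x" for m w x
  proof -
    have "- c0 \<le> \<Phi> w x" using Phi_lower[OF x] w by (simp add: words_def)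
    then have "\<bar>\<Phi> w x\<bar> \<le> \<Phi> w x + 2 * \<bar>c0\<bar>" by (simp add: abs_le_iff)
    from mult_left_mono[OF this, of "2 * r"] r
    have "exp (2 * r * \<bar>\<Phi> w x\<bar>) \<le> exp (4 * r * \<bar>c0\<bar> + 2 * r * \<Phi> w x)" by (simp add: algebra_simps)
    moreover have "kernel t m n w x \<le> B / b * exp (- t * \<Phi> w x)"
    proof -
      have "kernel t m n w x \<le> B * exp (- t * \<Phi> w x) / Z t n x" by (rule kernel_bounds(1)[OF t' B x w])
      also have "\<dots> \<le> B * exp (- t * \<Phi> w x) / b"
        using b(1) b(2)[OF x] B(1) by (intro divide_left_mono) auto
      finally show ?thesis by simp
    qed
    ultimately have "kernel t m n w x * exp (2 * r * \<bar>\<Phi> w x\<bar>) \<le> (B / b * exp (- t * \<Phi> w x)) * exp (4 * r * \<bar>c0\<bar> + 2 * r * \<Phi> w x)"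
      using kernel_nonneg[OF t' x w] B(1) b(1) by (intro mult_mono) auto
    also have "\<dots> = A * (exp (- t * \<Phi> w x) * exp (2 * r * \<Phi> w x))"
      by (simp add: A_def exp_add mult_ac)
    also have "exp (- t * \<Phi> w x) * exp (2 * r * \<Phi> w x) = exp (- (t - 2 * r) * \<Phi> w x)"
      by (simp add: exp_add[symmetric] algebra_simps)
    finally show ?thesis .
  qed
  have "(\<lambda>w. kernel t m n w x * exp (2 * r * \<bar>\<Phi> w x\<bar>)) summable_on W n x \<and>
     (\<Sum>\<^sub>\<infinity>w\<in>W n x. kernel t m n w x * exp (2 * r * \<bar>\<Phi> w x\<bar>)) \<le> A * C" if x: "x \<in> K" for m x
  proof
    have s: "(\<lambda>w. A * exp (- (t - 2 * r) * \<Phi> w x)) summable_on W n x"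
      by (rule summable_on_cmult_right[OF summable[OF t x]])
    show s': "(\<lambda>w. kernel t m n w x * exp (2 * r * \<bar>\<Phi> w x\<bar>)) summable_on W n x"
      by (rule summable_on_comparison_test[OF s le[OF x]]) (use kernel_nonneg[OF t' x] in auto)
    have "(\<Sum>\<^sub>\<infinity>w\<in>W n x. kernel t m n w x * exp (2 * r * \<bar>\<Phi> w x\<bar>)) \<le> (\<Sum>\<^sub>\<infinity>w\<in>W n x. A * exp (- (t - 2 * r) * \<Phi> w x))"
      by (rule infsum_mono[OF s' s le[OF x]])
    also have "\<dots> = A * Z (t - 2 * r) n x"
      unfolding Z_def by (rule infsum_cmult_right) (use summable[OF t x] in auto)
    also have "\<dots> \<le> A * C" by (rule mult_left_mono[OF C[OF x] A])
    finally show "(\<Sum>\<^sub>\<infinity>w\<in>W n x. kernel t m n w x * exp (2 * r * \<bar>\<Phi> w x\<bar>)) \<le> A * C" .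
  qed
  then show ?thesis using A C0 by (intro exI[of _ "A * C"]) auto
qed

text \<open>The difference of the two points telescopes through the kernel, the exponential and
  \<open>u\<close>, each term being controlled by an exponential moment of \<Phi>. Both bounds are
  of order \<open>norm z\<close>, so for small \<open>z\<close> the contraction of
  \<open>avg\<close> can absorb them.\<close>

lemma perturbation:
  assumes t: "\<delta> < t" and \<kappa>: "0 < \<kappa>" "\<kappa> \<le> r0" and L: "0 \<le> L"
    and con: "\<forall>x\<in>K. \<forall>y\<in>K. \<forall>w\<in>W n x \<inter> W n y. dist (foldr act w x) (foldr act w y) \<le> dist x y"
    and kd: "\<forall>m. \<forall>x\<in>K. \<forall>y\<in>K. \<forall>w\<in>W n x. dist x y < \<kappa> \<longrightarrow>
       \<bar>kernel t m n w x - kernel t m n w y\<bar> \<le> L * dist x y * kernel t m n w x"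
  obtains r H where "0 < r" "0 \<le> H" "\<delta> < t - r"
    "\<And>m z u v U. norm z \<le> r \<Longrightarrow> 0 \<le> v \<Longrightarrow> 0 \<le> U \<Longrightarrow> (\<And>x. x \<in> K \<Longrightarrow> norm (u x) \<le> U) \<Longrightarrow>
     (\<And>x y. x \<in> K \<Longrightarrow> y \<in> K \<Longrightarrow> norm (u x - u y) \<le> v * min 1 (dist x y / \<kappa>)) \<Longrightarrow>
     (\<forall>x\<in>K. norm (avgp t m n z u x - avg t m n u x) \<le> norm z * H * U) \<and>
     (\<forall>x\<in>K. \<forall>y\<in>K. norm ((avgp t m n z u x - avg t m n u x) - (avgp t m n z u y - avg t m n u y))
        \<le> norm z * H * (U + v) * min 1 (dist x y / \<kappa>))"
proof -
  \<comment> \<open>The exponent \<open>t - 2 * r\<close> of \<open>kernel_tail\<close> becomes the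
    midpoint between \<delta> and \<open>t\<close>.\<close>
  define r where "r = (t - \<delta>) / 4"
  have r: "0 < r" "\<delta> < t - 2 * r" "\<delta> < t - r" using t by (auto simp: r_def field_simps)
  obtain H where H': "0 \<le> H \<and> (\<forall>m. \<forall>x\<in>K. (\<lambda>w. kernel t m n w x * exp (2 * r * \<bar>\<Phi> w x\<bar>)) summable_on W n x \<and>
     (\<Sum>\<^sub>\<infinity>w\<in>W n x. kernel t m n w x * exp (2 * r * \<bar>\<Phi> w x\<bar>)) \<le> H)"
    using kernel_tail[OF r(2) less_imp_le[OF r(1)]] by (rule exE)
  have H: "0 \<le> H" "\<And>m x. x \<in> K \<Longrightarrow> (\<lambda>w. kernel t m n w x * exp (2 * r * \<bar>\<Phi> w x\<bar>)) summable_on W n x"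
     "\<And>m x. x \<in> K \<Longrightarrow> (\<Sum>\<^sub>\<infinity>w\<in>W n x. kernel t m n w x * exp (2 * r * \<bar>\<Phi> w x\<bar>)) \<le> H"
    using H' by blast+
  define G where "G m w x = kernel t m n w x * exp (2 * r * \<bar>\<Phi> w x\<bar>)" for m w x
  define he where "he z w x = exp (- (z * of_real (\<Phi> w x))) - 1" for z :: complex and w x
  define S where "S = exp (r * \<bar>M\<bar> * \<kappa>)"
  \<comment> \<open>One summand for each term of the telescoped difference \<open>eq\<close> below;
    the last one also serves the supremum bound.\<close>
  define A where "A = L * \<kappa> / r + \<bar>M\<bar> * \<kappa> * S + 1 / r"
  have S: "0 < S" by (simp add: S_def)
  have A: "1 / r \<le> A" "L * \<kappa> / r \<le> A" "0 \<le> A" using r \<kappa> L S by (auto simp: A_def)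
  \<comment> \<open>The linear factor \<bar>\<Phi>\<bar> is absorbed into a second copy of the
    exponential, hence \<open>2 * r\<close>.\<close>
  have he1: "norm (he z w x) \<le> norm z / r * exp (2 * r * \<bar>\<Phi> w x\<bar>)" if z: "norm z \<le> r" for z w x
  proof -
    let ?P = "\<bar>\<Phi> w x\<bar>"
    have "norm (he z w x) \<le> (norm z * ?P) * exp (norm z * ?P)"
      using norm_exp_minus_1_le[of "- (z * of_real (\<Phi> w x))"] by (simp add: he_def norm_mult)
    also have "\<dots> \<le> (norm z * ?P) * exp (r * ?P)"
      using z by (intro mult_left_mono) (auto intro: mult_right_mono)
    also have "norm z * ?P = norm z / r * (r * ?P)" using r by simp
    also have "\<dots> \<le> norm z / r * exp (r * ?P)"
      using exp_ge_add_one_self[of "r * ?P"] r by (intro mult_left_mono) (auto simp del: exp_ge_add_one_self)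
    finally have "norm (he z w x) \<le> norm z / r * exp (r * ?P) * exp (r * ?P)" by simp
    also have "\<dots> = norm z / r * exp (2 * r * ?P)" by (simp add: exp_add[symmetric])
    finally show ?thesis .
  qed
  have he2: "norm (he z w x - he z w y) \<le> norm z * \<bar>M\<bar> * dist x y * S * exp (2 * r * \<bar>\<Phi> w y\<bar>)"
    if z: "norm z \<le> r" and xy: "x \<in> K" "y \<in> K" "dist x y < \<kappa>" and w: "w \<in> W n x" "w \<in> W n y" for z w x y
  proof -
    let ?d = "\<Phi> w x - \<Phi> w y"
    have d: "\<bar>?d\<bar> \<le> \<bar>M\<bar> * dist x y"
      using Phi_Lipschitz[OF xy(1,2), of w] w mult_right_mono[OF abs_ge_self[of M], of "dist x y"]
      by (auto simp: words_def)
    have "exp (- (z * of_real (\<Phi> w x))) = exp (- (z * of_real (\<Phi> w y))) * exp (- (z * of_real ?d))"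
      by (simp add: exp_add[symmetric] algebra_simps)
    then have "he z w x - he z w y = exp (- (z * of_real (\<Phi> w y))) * (exp (- (z * of_real ?d)) - 1)"
      by (simp add: he_def algebra_simps)
    then have "norm (he z w x - he z w y) = norm (exp (- (z * of_real (\<Phi> w y)))) * norm (exp (- (z * of_real ?d)) - 1)"
      by (simp only: norm_mult)
    also have "\<dots> \<le> exp (2 * r * \<bar>\<Phi> w y\<bar>) * (norm z * (\<bar>M\<bar> * dist x y) * S)"
    proof (rule mult_mono)
      have "- (Re z * \<Phi> w y) \<le> \<bar>Re z\<bar> * \<bar>\<Phi> w y\<bar>" by (metis abs_ge_minus_self abs_mult)
      also have "\<dots> \<le> 2 * r * \<bar>\<Phi> w y\<bar>"
        using abs_Re_le_cmod[of z] z r(1) by (intro mult_right_mono) auto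
      finally show "norm (exp (- (z * of_real (\<Phi> w y)))) \<le> exp (2 * r * \<bar>\<Phi> w y\<bar>)" by simp
      have "norm (exp (- (z * of_real ?d)) - 1) \<le> (norm z * \<bar>?d\<bar>) * exp (norm z * \<bar>?d\<bar>)"
        using norm_exp_minus_1_le[of "- (z * of_real ?d)"] unfolding norm_minus_cancel norm_mult norm_of_real .
      also have "\<dots> \<le> (norm z * (\<bar>M\<bar> * dist x y)) * S"
      proof (rule mult_mono)
        have "norm z * \<bar>?d\<bar> \<le> r * (\<bar>M\<bar> * \<kappa>)"
          using z d xy(3) r(1) by (intro mult_mono order_trans[OF d] mult_left_mono) auto
        then show "exp (norm z * \<bar>?d\<bar>) \<le> S" by (simp add: S_def mult_ac)
      qed (use d in \<open>auto intro: mult_left_mono\<close>)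
      finally show "norm (exp (- (z * of_real ?d)) - 1) \<le> norm z * (\<bar>M\<bar> * dist x y) * S" .
    qed auto
    finally show ?thesis by (simp add: mult_ac)
  qed
  {
    fix m and z :: complex and u :: "'x \<Rightarrow> complex" and v U :: real
    assume z: "norm z \<le> r" and v0: "0 \<le> v" and U0: "0 \<le> U" and U: "\<And>x. x \<in> K \<Longrightarrow> norm (u x) \<le> U"
      and v: "\<And>x y. x \<in> K \<Longrightarrow> y \<in> K \<Longrightarrow> norm (u x - u y) \<le> v * min 1 (dist x y / \<kappa>)"
    have uf: "norm (u (foldr act w x)) \<le> U" if "x \<in> K" "w \<in> W n x" for x w
      using U foldr_act_W that by blast
    define g where "g x w = of_real (kernel t m n w x) * (he z w x * u (foldr act w x))" for x w
    have gb: "norm (g x w) \<le> norm z / r * U * G m w x" if x: "x \<in> K" and w: "w \<in> W n x" for x w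
    proof -
      have "norm (g x w) = kernel t m n w x * (norm (he z w x) * norm (u (foldr act w x)))"
        using kernel_nonneg[OF t x w, of m] by (simp add: g_def norm_mult)
      also have "\<dots> \<le> kernel t m n w x * ((norm z / r * exp (2 * r * \<bar>\<Phi> w x\<bar>)) * U)"
        using kernel_nonneg[OF t x w] r(1) by (intro mult_left_mono mult_mono he1[OF z] uf[OF x w]) auto
      finally show ?thesis by (simp add: G_def mult_ac)
    qed
    have Gs: "G m w x \<ge> 0" "(\<lambda>w. G m w x) summable_on W n x" "(\<Sum>\<^sub>\<infinity>w\<in>W n x. G m w x) \<le> H" if "x \<in> K" "w \<in> W n x" for x w
      using H that kernel_nonneg[OF t that] by (auto simp: G_def)
    have gs: "g x summable_on W n x" and gn: "norm (infsum (g x) (W n x)) \<le> norm z * (A * H) * U" if x: "x \<in> K" for x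
    proof -
      obtain w0 where w0: "w0 \<in> W n x" using words_ne by blast
      show "g x summable_on W n x" by (rule infsum_dominated(1)[OF Gs(2)[OF x w0] gb[OF x]])
      have "norm (infsum (g x) (W n x)) \<le> norm z / r * U * (\<Sum>\<^sub>\<infinity>w\<in>W n x. G m w x)"
        by (rule infsum_dominated(2)[OF Gs(2)[OF x w0] gb[OF x]])
      also have "\<dots> \<le> norm z / r * U * H" using Gs(3)[OF x w0] U0 r(1) by (intro mult_left_mono) auto
      also have "\<dots> = 1 / r * (norm z * U * H)" by simp
      also have "\<dots> \<le> A * (norm z * U * H)" using A(1) U0 H(1) by (intro mult_right_mono) auto
      finally show "norm (infsum (g x) (W n x)) \<le> norm z * (A * H) * U" by (simp add: mult_ac)
    qed
    have diff: "avgp t m n z u x - avg t m n u x = infsum (g x) (W n x)" if x: "x \<in> K" for x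
    proof -
      have s: "(\<lambda>w. of_real (kernel t m n w x) * u (foldr act w x)) summable_on W n x"
        by (rule infsum_dominated(1)[OF kernel_sum(1)[OF t x, of m n], where U = U])
          (use kernel_nonneg[OF t x] uf[OF x] in \<open>auto intro: norm_weight_le\<close>)
      have "avgp t m n z u x = (\<Sum>\<^sub>\<infinity>w\<in>W n x. g x w + of_real (kernel t m n w x) * u (foldr act w x))"
        unfolding avgp_def g_def he_def by (simp add: algebra_simps)
      also have "\<dots> = infsum (g x) (W n x) + avg t m n u x"
        unfolding avg_def by (rule infsum_add[OF gs[OF x] s])
      finally show ?thesis by simp
    qed
    have "norm ((avgp t m n z u x - avg t m n u x) - (avgp t m n z u y - avg t m n u y))
        \<le> norm z * (2 * (A * H)) * (U + v) * min 1 (dist x y / \<kappa>)" if x: "x \<in> K" and y: "y \<in> K" for x y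
    proof (cases "dist x y < \<kappa>")
      case False
      then have "min 1 (dist x y / \<kappa>) = 1" using \<kappa>(1) by (simp add: min_def)
      moreover have "norm (infsum (g x) (W n x) - infsum (g y) (W n y)) \<le> norm z * (A * H) * U + norm z * (A * H) * U"
        using norm_triangle_ineq4 gn[OF x] gn[OF y] by (smt (verit, best))
      moreover have "norm z * (A * H) * U \<le> norm z * (A * H) * (U + v)"
        using A H(1) v0 by (intro mult_left_mono) auto
      ultimately have "norm (infsum (g x) (W n x) - infsum (g y) (W n y)) \<le> 2 * (norm z * (A * H) * (U + v)) * min 1 (dist x y / \<kappa>)"
        by linarith
      also have "2 * (norm z * (A * H) * (U + v)) = norm z * (2 * (A * H)) * (U + v)" by (simp only: mult_ac)
      finally show ?thesis unfolding diff[OF x] diff[OF y] .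
    next
      case True
      then have l: "lab x = lab y" using r0(2)[OF x y] \<kappa>(2) by simp
      let ?D = "dist x y / \<kappa>"
      have D: "min 1 ?D = ?D" using True \<kappa>(1) by (simp add: min_def)
      obtain w0 where w0: "w0 \<in> W n x" using words_ne by blast
      have "norm (g x w - g y w) \<le> norm z * A * (U + v) * ?D * (G m w x + G m w y)" if w: "w \<in> W n x" for w
      proof -
        have w': "w \<in> W n y" using w l by simp
        let ?px = "kernel t m n w x" and ?py = "kernel t m n w y" and ?ux = "u (foldr act w x)" and ?uy = "u (foldr act w y)"
        have px: "0 \<le> ?px" "0 \<le> ?py" using kernel_nonneg[OF t] x y w w' by auto
        have G0: "0 \<le> G m w x" "0 \<le> G m w y" using Gs(1) x y w w' by auto
        have D0: "0 \<le> ?D" using \<kappa>(1) by simp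
        have dd: "norm (?ux - ?uy) \<le> v * ?D"
        proof -
          have f: "foldr act w x \<in> K" "foldr act w y \<in> K" using foldr_act_W x y w w' by blast+
          have "v * min 1 (dist (foldr act w x) (foldr act w y) / \<kappa>) \<le> v * ?D"
            using con[rule_format, OF x y, of w] w w' \<kappa>(1) v0 by (intro mult_left_mono) (auto simp: min_le_iff_disj divide_right_mono)
          with v[OF f] show ?thesis by simp
        qed
        \<comment> \<open>Change the kernel, then the exponential, then the function value.\<close>
        have eq: "g x w - g y w = of_real (?px - ?py) * (he z w x * ?ux) + of_real ?py * ((he z w x - he z w y) * ?ux)
           + of_real ?py * (he z w y * (?ux - ?uy))"
          by (simp add: g_def algebra_simps)
        have 1: "norm (of_real (?px - ?py) * (he z w x * ?ux)) \<le> L * \<kappa> / r * (norm z * U * ?D * G m w x)"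
        proof -
          have "norm (of_real (?px - ?py) * (he z w x * ?ux)) = \<bar>?px - ?py\<bar> * (norm (he z w x) * norm ?ux)"
            by (simp only: norm_mult norm_of_real)
          also have "\<dots> \<le> (L * dist x y * ?px) * ((norm z / r * exp (2 * r * \<bar>\<Phi> w x\<bar>)) * U)"
            using px L r(1) by (intro mult_mono kd[rule_format, OF x y w True] he1[OF z] uf[OF x w]) auto
          also have "\<dots> = L * \<kappa> / r * (norm z * U * ?D * G m w x)" using \<kappa>(1) by (simp add: G_def)
          finally show ?thesis .
        qed
        have 2: "norm (of_real ?py * ((he z w x - he z w y) * ?ux)) \<le> \<bar>M\<bar> * \<kappa> * S * (norm z * U * ?D * G m w y)"
        proof -
          have "norm (of_real ?py * ((he z w x - he z w y) * ?ux)) = ?py * (norm (he z w x - he z w y) * norm ?ux)"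
            using px by (simp only: norm_mult norm_of_real abs_of_nonneg)
          also have "\<dots> \<le> ?py * ((norm z * \<bar>M\<bar> * dist x y * S * exp (2 * r * \<bar>\<Phi> w y\<bar>)) * U)"
            using px S by (intro mult_left_mono mult_mono he2[OF z x y True w w'] uf[OF x w]) auto
          also have "\<dots> = \<bar>M\<bar> * \<kappa> * S * (norm z * U * ?D * G m w y)" using \<kappa>(1) by (simp add: G_def)
          finally show ?thesis .
        qed
        have 3: "norm (of_real ?py * (he z w y * (?ux - ?uy))) \<le> 1 / r * (norm z * v * ?D * G m w y)"
        proof -
          have "norm (of_real ?py * (he z w y * (?ux - ?uy))) = ?py * (norm (he z w y) * norm (?ux - ?uy))"
            using px by (simp only: norm_mult norm_of_real abs_of_nonneg)
          also have "\<dots> \<le> ?py * ((norm z / r * exp (2 * r * \<bar>\<Phi> w y\<bar>)) * (v * ?D))"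
            using px r(1) by (intro mult_left_mono mult_mono he1[OF z] dd) auto
          also have "\<dots> = 1 / r * (norm z * v * ?D * G m w y)" by (simp add: G_def)
          finally show ?thesis .
        qed
        let ?X = "norm z * (U + v) * ?D * (G m w x + G m w y)"
        have Xg: "norm z * U' * ?D * G' \<le> ?X" if "0 \<le> U'" "U' \<le> U + v" "0 \<le> G'" "G' \<le> G m w x + G m w y" for U' G'
          by (intro mult_mono that) (use U0 v0 D0 G0 \<kappa>(1) that in \<open>auto intro!: mult_nonneg_nonneg divide_nonneg_pos\<close>)
        have X: "norm z * U * ?D * G m w x \<le> ?X" "norm z * U * ?D * G m w y \<le> ?X" "norm z * v * ?D * G m w y \<le> ?X"
          by (rule Xg; use U0 v0 G0 in simp)+
        have "norm (g x w - g y w) \<le> L * \<kappa> / r * ?X + \<bar>M\<bar> * \<kappa> * S * ?X + 1 / r * ?X"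
          unfolding eq
          by (intro norm_triangle_mono order_trans[OF 1] order_trans[OF 2] order_trans[OF 3] mult_left_mono X)
            (use L \<kappa>(1) r(1) S in auto)
        also have "\<dots> = A * ?X" by (simp only: A_def distrib_right)
        finally show ?thesis by (simp add: mult_ac)
      qed
      note pointwise = this
      have s: "(\<lambda>w. G m w x + G m w y) summable_on W n x"
        using Gs(2)[OF x w0] Gs(2)[OF y, of w0] w0 l by (auto intro: summable_on_add)
      have GH: "(\<Sum>\<^sub>\<infinity>w\<in>W n x. G m w x + G m w y) \<le> 2 * H"
        using infsum_add[OF Gs(2)[OF x w0] Gs(2)[OF y, of w0, folded l]] Gs(3)[OF x w0] Gs(3)[OF y, of w0] w0 l by simp
      have "infsum (g x) (W n x) - infsum (g y) (W n y) = (\<Sum>\<^sub>\<infinity>w\<in>W n x. g x w) + (\<Sum>\<^sub>\<infinity>w\<in>W n x. - g y w)"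
        using l by (simp add: infsum_uminus)
      also have "\<dots> = (\<Sum>\<^sub>\<infinity>w\<in>W n x. g x w + - g y w)"
        using summable_on_uminus[THEN iffD2, OF gs[OF y]] l by (intro infsum_add[symmetric] gs x) auto
      finally have "norm (infsum (g x) (W n x) - infsum (g y) (W n y)) \<le> norm z * A * (U + v) * ?D * (\<Sum>\<^sub>\<infinity>w\<in>W n x. G m w x + G m w y)"
        using infsum_dominated(2)[OF s pointwise] by simp
      also have "\<dots> \<le> norm z * A * (U + v) * ?D * (2 * H)"
        using GH A U0 v0 \<kappa>(1) by (intro mult_left_mono) auto
      also have "\<dots> = norm z * (2 * (A * H)) * (U + v) * ?D" by (simp only: mult_ac)
      finally show ?thesis unfolding diff[OF x] diff[OF y] D .
    qed
    moreover have "norm (avgp t m n z u x - avg t m n u x) \<le> norm z * (2 * (A * H)) * U" if x: "x \<in> K" for x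
    proof -
      have "norm z * (A * H) * U \<le> norm z * (2 * (A * H)) * U"
        using A H(1) U0 by (intro mult_right_mono mult_left_mono) simp_all
      with gn[OF x] show ?thesis unfolding diff[OF x] by (rule order_trans)
    qed
    ultimately have "(\<forall>x\<in>K. norm (avgp t m n z u x - avg t m n u x) \<le> norm z * (2 * (A * H)) * U) \<and>
     (\<forall>x\<in>K. \<forall>y\<in>K. norm ((avgp t m n z u x - avg t m n u x) - (avgp t m n z u y - avg t m n u y))
        \<le> norm z * (2 * (A * H)) * (U + v) * min 1 (dist x y / \<kappa>))" by blast
  }
  note fin = this
  have "0 \<le> 2 * (A * H)" using A H(1) by simp
  from that[OF r(1) this r(3) fin] show thesis .
qed

end

section \<open>Absence of zeros and the limit of the logarithms\<close>

context word_system begin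

definition ratio :: "real \<Rightarrow> nat \<Rightarrow> complex \<Rightarrow> 'x \<Rightarrow> complex" where
  "ratio t n z x = Zc (of_real t + z) n x / of_real (Z t n x)"

text \<open>The \<open>n\<close> letters acting first are averaged, and the remaining
  \<open>m\<close> letters form the ratio at the image point. Dividing by the real sums turns the
  real part of the weights into \<open>kernel\<close>.\<close>

lemma ratio_step:
  assumes t: "\<delta> < t" "\<delta> < t + Re z" and x: "x \<in> K"
  shows "ratio t (m + n) z x = avgp t m n z (ratio t m z) x"
proof -
  have z: "\<delta> < Re (of_real t + z)" using t by simp
  have "ratio t (m + n) z x = Zc (of_real t + z) (m + n) x * inverse (of_real (Z t (m + n) x))"
    by (simp add: ratio_def divide_inverse)
  also have "\<dots> = (\<Sum>\<^sub>\<infinity>w\<in>W n x. exp (- ((of_real t + z) * of_real (\<Phi> w x))) * Zc (of_real t + z) m (foldr act w x) * inverse (of_real (Z t (m + n) x)))"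
    unfolding Zc_split[OF z x] by (rule infsum_cmult_left'[symmetric])
  also have "\<dots> = avgp t m n z (ratio t m z) x"
    unfolding avgp_def
  proof (rule infsum_cong)
    fix w assume w: "w \<in> W n x"
    have nz: "Z t m (foldr act w x) \<noteq> 0" using Z_pos[OF t(1) foldr_act_W[OF x w], of m] by simp
    have e: "exp (- ((of_real t + z) * of_real (\<Phi> w x))) = of_real (exp (- t * \<Phi> w x)) * exp (- (z * of_real (\<Phi> w x)))"
      by (simp add: algebra_simps exp_add[symmetric] flip: exp_of_real)
    show "exp (- ((of_real t + z) * of_real (\<Phi> w x))) * Zc (of_real t + z) m (foldr act w x) * inverse (of_real (Z t (m + n) x))
      = of_real (kernel t m n w x) * (exp (- (z * of_real (\<Phi> w x))) * ratio t m z (foldr act w x))"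
      unfolding e using nz by (simp add: kernel_def ratio_def field_simps)
  qed
  finally show ?thesis .
qed

lemma Zc_0: "Zc z 0 x = 1"
proof -
  have "Zc z 0 x = (\<Sum>w\<in>{[]}. exp (- (z * of_real (\<Phi> w x))))" unfolding Zc_def words_0 by (rule infsum_finite) simp
  then show ?thesis by simp
qed

lemma ratio_0: "ratio t 0 z x = 1"
  unfolding ratio_def Zc_0 Z_0 by simp

text \<open>For \<open>z\<close> near 0 the complex partition functions have no zeros: the normalised functions
  stay in a narrow complex cone around the constants, uniformly in the number of blocks.\<close>

lemma zero_free:
  assumes t: "\<delta> < t"
  shows "\<exists>r n. 0 < r \<and> 0 < n \<and> \<delta> < t - r \<and> (\<forall>z k. \<forall>x\<in>K. norm z < r \<longrightarrow>
    ratio t (n * k) z x \<noteq> 0 \<and> norm (ratio t (n * Suc k) z x / ratio t (n * k) z x - 1) \<le> 1 / 2)"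
proof -
  obtain \<kappa> q n L where *: "0 < \<kappa>" "\<kappa> \<le> r0" "0 \<le> q" "q < 1" "0 < n" "0 \<le> L"
    "\<And>x y w. x \<in> K \<Longrightarrow> y \<in> K \<Longrightarrow> w \<in> W n x \<inter> W n y \<Longrightarrow> dist (foldr act w x) (foldr act w y) \<le> dist x y"
    "\<And>m x y w. x \<in> K \<Longrightarrow> y \<in> K \<Longrightarrow> dist x y < \<kappa> \<Longrightarrow> w \<in> W n x \<Longrightarrow>
       \<bar>kernel t m n w x - kernel t m n w y\<bar> \<le> L * dist x y * kernel t m n w x"
    "\<And>m u v U x y. 0 \<le> v \<Longrightarrow> (\<And>x. x \<in> K \<Longrightarrow> norm (u x) \<le> U) \<Longrightarrow>
      (\<And>x y. x \<in> K \<Longrightarrow> y \<in> K \<Longrightarrow> norm (u x - u y) \<le> v * min 1 (dist x y / \<kappa>)) \<Longrightarrow> x \<in> K \<Longrightarrow> y \<in> K \<Longrightarrow>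
      norm (avg t m n u x - avg t m n u y) \<le> q * v * min 1 (dist x y / \<kappa>)"
    by (fact kernel_contracts[OF t])
  have con: "\<forall>x\<in>K. \<forall>y\<in>K. \<forall>w\<in>W n x \<inter> W n y. dist (foldr act w x) (foldr act w y) \<le> dist x y"
    using *(7) by blast
  have kd: "\<forall>m. \<forall>x\<in>K. \<forall>y\<in>K. \<forall>w\<in>W n x. dist x y < \<kappa> \<longrightarrow>
       \<bar>kernel t m n w x - kernel t m n w y\<bar> \<le> L * dist x y * kernel t m n w x"
    using *(8) by blast
  obtain r' H where r': "0 < r'" "0 \<le> H" "\<delta> < t - r'" and
    pert: "\<And>m z u v U. norm z \<le> r' \<Longrightarrow> 0 \<le> v \<Longrightarrow> 0 \<le> U \<Longrightarrow> (\<And>x. x \<in> K \<Longrightarrow> norm (u x) \<le> U) \<Longrightarrow>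
     (\<And>x y. x \<in> K \<Longrightarrow> y \<in> K \<Longrightarrow> norm (u x - u y) \<le> v * min 1 (dist x y / \<kappa>)) \<Longrightarrow>
     (\<forall>x\<in>K. norm (avgp t m n z u x - avg t m n u x) \<le> norm z * H * U) \<and>
     (\<forall>x\<in>K. \<forall>y\<in>K. norm ((avgp t m n z u x - avg t m n u x) - (avgp t m n z u y - avg t m n u y))
        \<le> norm z * H * (U + v) * min 1 (dist x y / \<kappa>))"
    by (fact perturbation[OF t *(1,2,6) con kd])
  \<comment> \<open>The aperture of the cone. The contraction constant becomes
    \<open>1 - 4 * \<epsilon>\<close>, and this slack pays for the perturbation and for the drift of
    the base value.\<close>
  define \<epsilon> where "\<epsilon> = (1 - q) / 4"
  have \<epsilon>: "0 < \<epsilon>" "\<epsilon> \<le> 1 / 4" "q = 1 - 4 * \<epsilon>" using *(3,4) by (simp_all add: \<epsilon>_def field_simps)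
  \<comment> \<open>Keeps the strength \<open>norm z * H\<close> of the perturbation below the
    square of \<epsilon>; the summand 1 guards against \<open>H = 0\<close>.\<close>
  define r where "r = min r' (\<epsilon>\<^sup>2 / (H + 1))"
  have r: "0 < r" "r \<le> r'" using r' \<epsilon>(1) by (auto simp: r_def)
  have \<eta>: "norm z * H \<le> \<epsilon>\<^sup>2" if "norm z < r" for z :: complex
  proof -
    have "norm z * H \<le> \<epsilon>\<^sup>2 / (H + 1) * H" using that r'(2) by (intro mult_right_mono) (auto simp: r_def)
    also have "\<dots> \<le> \<epsilon>\<^sup>2" using r'(2) by (simp add: field_simps)
    finally show ?thesis .
  qed
  have main: "ratio t (n * k) z x0 \<noteq> 0 \<and>
      (\<forall>x\<in>K. \<forall>y\<in>K. norm (ratio t (n * k) z x - ratio t (n * k) z y) \<le> \<epsilon> * norm (ratio t (n * k) z x0) * min 1 (dist x y / \<kappa>)) \<and>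
      norm (ratio t (n * Suc k) z x0 - ratio t (n * k) z x0) \<le> 1 / 2 * norm (ratio t (n * k) z x0)"
    if z: "norm z < r" and x0: "x0 \<in> K" for z k x0
  proof -
    define R where "R k = ratio t (n * k) z" for k
    have step: "R (Suc k) x = avgp t (n * k) n z (R k) x" if "x \<in> K" for k x
    proof -
      have "\<bar>Re z\<bar> \<le> norm z" by (rule abs_Re_le_cmod)
      then have "\<delta> < t + Re z" using z r r'(3) by linarith
      from ratio_step[OF t this that, of "n * k" n] show ?thesis
        by (simp add: R_def add.commute)
    qed
    have z': "norm z \<le> r'" using z r by simp
    note \<eta> = \<eta>[OF z]
    have small: "norm (R k x) \<le> (1 + \<epsilon>) * \<rho>"
      if "\<And>x y. x \<in> K \<Longrightarrow> y \<in> K \<Longrightarrow> norm (R k x - R k y) \<le> \<epsilon> * \<rho> * min 1 (dist x y / \<kappa>)" "\<rho> = norm (R k x0)" "x \<in> K" for k \<rho> x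
    proof -
      have "\<epsilon> * \<rho> * min 1 (dist x x0 / \<kappa>) \<le> \<epsilon> * \<rho> * 1" using that(2) \<epsilon> by (intro mult_left_mono) auto
      with that(1)[OF that(3) x0] have "norm (R k x - R k x0) \<le> \<epsilon> * \<rho>" by simp
      moreover have "norm (R k x) \<le> norm (R k x - R k x0) + norm (R k x0)"
        using norm_triangle_ineq[of "R k x - R k x0" "R k x0"] by simp
      ultimately show ?thesis using that(2) by (simp add: algebra_simps)
    qed
    \<comment> \<open>The cone is preserved. The seminorm is measured relative to the modulus at
      \<open>x0\<close>, which in one step moves by at most the fraction
      \<open>\<epsilon> + \<epsilon>\<^sup>2 * (1 + \<epsilon>)\<close>.\<close>
    have ind: "R (Suc k) x0 \<noteq> 0 \<and>
        (\<forall>x\<in>K. \<forall>y\<in>K. norm (R (Suc k) x - R (Suc k) y) \<le> \<epsilon> * norm (R (Suc k) x0) * min 1 (dist x y / \<kappa>)) \<and>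
        norm (R (Suc k) x0 - R k x0) \<le> 1 / 2 * norm (R k x0)"
      if nz: "R k x0 \<noteq> 0" and lip: "\<And>x y. x \<in> K \<Longrightarrow> y \<in> K \<Longrightarrow> norm (R k x - R k y) \<le> \<epsilon> * norm (R k x0) * min 1 (dist x y / \<kappa>)" for k
    proof -
      define \<rho> where "\<rho> = norm (R k x0)"
      have \<rho>: "0 < \<rho>" using nz by (simp add: \<rho>_def)
      let ?U = "(1 + \<epsilon>) * \<rho>" and ?v = "\<epsilon> * \<rho>"
      let ?A = "avg t (n * k) n (R k)"
      have U: "norm (R k x) \<le> ?U" if "x \<in> K" for x using small[OF lip _ that] by (simp add: \<rho>_def)
      have v: "norm (R k x - R k y) \<le> ?v * min 1 (dist x y / \<kappa>)" if "x \<in> K" "y \<in> K" for x y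
        using lip[OF that] by (simp add: \<rho>_def)
      have v0: "0 \<le> ?v" and U0: "0 \<le> ?U" using \<rho> \<epsilon> by auto
      have A: "norm (?A x - ?A y) \<le> q * ?v * min 1 (dist x y / \<kappa>)" if "x \<in> K" "y \<in> K" for x y
        by (rule *(9)[OF v0 U v that])
      have P1: "norm (R (Suc k) x - ?A x) \<le> norm z * H * ?U" if "x \<in> K" for x
        using pert[OF z' v0 U0 U v, of "n * k"] step[OF that, of k] that by simp
      have P2: "norm ((R (Suc k) x - ?A x) - (R (Suc k) y - ?A y)) \<le> norm z * H * (?U + ?v) * min 1 (dist x y / \<kappa>)"
        if "x \<in> K" "y \<in> K" for x y
        using pert[OF z' v0 U0 U v, of "n * k"] step[OF that(1), of k] step[OF that(2), of k] that by simp
      have A0: "norm (?A x0 - R k x0) \<le> \<epsilon> * \<rho>"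
      proof -
        have d: "norm (R k (foldr act w x0) - R k x0) \<le> \<epsilon> * \<rho>" if w: "w \<in> W n x0" for w
        proof -
          let ?y = "foldr act w x0"
          have "\<epsilon> * \<rho> * min 1 (dist ?y x0 / \<kappa>) \<le> \<epsilon> * \<rho> * 1" using \<rho> \<epsilon> by (intro mult_left_mono) auto
          with v[OF foldr_act_W[OF x0 w] x0] show ?thesis by simp
        qed
        have "norm ((\<Sum>\<^sub>\<infinity>w\<in>W n x0. of_real (kernel t (n * k) n w x0) * R k (foldr act w x0))
            - of_real (\<Sum>\<^sub>\<infinity>w\<in>W n x0. kernel t (n * k) n w x0) * R k x0)
          \<le> \<epsilon> * \<rho> * (\<Sum>\<^sub>\<infinity>w\<in>W n x0. kernel t (n * k) n w x0)"
          by (rule weighted_mean_near(2)[OF kernel_sum(1)[OF t x0] kernel_nonneg[OF t x0] U d])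
            (use foldr_act_W[OF x0] in auto)
        then show ?thesis unfolding avg_def kernel_sum(2)[OF t x0] by simp
      qed
      have near: "norm (R (Suc k) x0 - R k x0) \<le> (\<epsilon> + \<epsilon>\<^sup>2 * (1 + \<epsilon>)) * \<rho>"
      proof -
        have "norm (R (Suc k) x0 - R k x0) \<le> norm (R (Suc k) x0 - ?A x0) + norm (?A x0 - R k x0)"
          using norm_triangle_ineq[of "R (Suc k) x0 - ?A x0" "?A x0 - R k x0"] by simp
        also have "\<dots> \<le> norm z * H * ?U + \<epsilon> * \<rho>" using P1[OF x0] A0 by linarith
        also have "norm z * H * ?U \<le> \<epsilon>\<^sup>2 * ?U" by (rule mult_right_mono[OF \<eta> U0])
        finally show ?thesis by (simp add: algebra_simps)
      qed
      have e2: "\<epsilon>\<^sup>2 \<le> \<epsilon> / 4" using \<epsilon>(1,2) by (simp add: power2_eq_square)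
      have e3: "\<epsilon>\<^sup>2 * (1 + \<epsilon>) \<le> \<epsilon> / 4 * (5 / 4)" using e2 \<epsilon>(1,2) by (intro mult_mono) auto
      have half: "\<epsilon> + \<epsilon>\<^sup>2 * (1 + \<epsilon>) \<le> 1 / 2" using e3 \<epsilon>(2) by linarith
      have near2: "norm (R (Suc k) x0 - R k x0) \<le> 1 / 2 * \<rho>"
        using near mult_right_mono[OF half, of \<rho>] \<rho> by linarith
      have lower: "(1 - (\<epsilon> + \<epsilon>\<^sup>2 * (1 + \<epsilon>))) * \<rho> \<le> norm (R (Suc k) x0)"
        using near norm_triangle_ineq2[of "R k x0" "R (Suc k) x0"] by (simp add: \<rho>_def norm_minus_commute algebra_simps)
      have nz': "R (Suc k) x0 \<noteq> 0"
        using near2 \<rho> by (auto simp: \<rho>_def)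
      have "norm (R (Suc k) x - R (Suc k) y) \<le> \<epsilon> * norm (R (Suc k) x0) * min 1 (dist x y / \<kappa>)"
        if xy: "x \<in> K" "y \<in> K" for x y
      proof -
        let ?D = "min 1 (dist x y / \<kappa>)"
        have D: "0 \<le> ?D" using *(1) by simp
        have "norm (R (Suc k) x - R (Suc k) y) \<le> norm ((R (Suc k) x - ?A x) - (R (Suc k) y - ?A y)) + norm (?A x - ?A y)"
          using norm_triangle_ineq[of "(R (Suc k) x - ?A x) - (R (Suc k) y - ?A y)" "?A x - ?A y"] by simp
        also have "\<dots> \<le> norm z * H * (?U + ?v) * ?D + q * ?v * ?D"
          by (intro add_mono P2 A xy)
        also have "\<dots> \<le> \<epsilon>\<^sup>2 * (?U + ?v) * ?D + q * ?v * ?D"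
          using \<eta> U0 v0 D by (intro add_right_mono mult_right_mono) auto
        also have "\<epsilon>\<^sup>2 * (?U + ?v) * ?D + q * ?v * ?D = (\<epsilon>\<^sup>2 * (1 + 2 * \<epsilon>) + q * \<epsilon>) * \<rho> * ?D"
          by (simp add: algebra_simps)
        also have "\<dots> \<le> \<epsilon> * (1 - (\<epsilon> + \<epsilon>\<^sup>2 * (1 + \<epsilon>))) * \<rho> * ?D"
        proof -
          have "\<epsilon> * (\<epsilon>\<^sup>2 * (1 + \<epsilon>)) \<le> \<epsilon> * (\<epsilon> / 4 * (5 / 4))"
            using e3 \<epsilon>(1) by (intro mult_left_mono) auto
          moreover have "\<epsilon>\<^sup>2 * \<epsilon> \<le> \<epsilon>\<^sup>2 * (1 / 4)" using \<epsilon>(2) by (intro mult_left_mono) auto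
          \<comment> \<open>Divided by \<epsilon>, this amounts to \<open>2 * \<epsilon> + 3 *
            \<epsilon>\<^sup>2 + \<epsilon> ^ 3 \<le> 4 * \<epsilon>\<close>, true for \<epsilon>
            \<le> 1/4.\<close>
          ultimately have "\<epsilon>\<^sup>2 * (1 + 2 * \<epsilon>) + q * \<epsilon> \<le> \<epsilon> * (1 - (\<epsilon> + \<epsilon>\<^sup>2 * (1 + \<epsilon>)))"
            unfolding \<epsilon>(3) power2_eq_square
            by (simp add: algebra_simps) (use zero_le_square[of \<epsilon>] in linarith)
          then show ?thesis using \<rho> D by (intro mult_right_mono) auto
        qed
        also have "\<dots> = \<epsilon> * ((1 - (\<epsilon> + \<epsilon>\<^sup>2 * (1 + \<epsilon>))) * \<rho>) * ?D" by simp
        also have "\<dots> \<le> \<epsilon> * norm (R (Suc k) x0) * ?D"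
          using lower \<epsilon>(1) D by (intro mult_right_mono mult_left_mono) auto
        finally show ?thesis .
      qed
      then show ?thesis using nz' near2 by (simp add: \<rho>_def)
    qed
    have "R k x0 \<noteq> 0 \<and> (\<forall>x\<in>K. \<forall>y\<in>K. norm (R k x - R k y) \<le> \<epsilon> * norm (R k x0) * min 1 (dist x y / \<kappa>))" for k
    proof (induction k)
      case 0
      show ?case using *(1) \<epsilon>(1) by (simp add: R_def ratio_0)
    next
      case (Suc k)
      then show ?case using ind[of k] by blast
    qed
    then show ?thesis using ind[of k] unfolding R_def by blast
  qed
  have "norm (ratio t (n * Suc k) z x / ratio t (n * k) z x - 1) \<le> 1 / 2" if "norm z < r" "x \<in> K" for z k x
  proof -
    have nz: "ratio t (n * k) z x \<noteq> 0" using main[OF that] by blast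
    then have "ratio t (n * Suc k) z x / ratio t (n * k) z x - 1 = (ratio t (n * Suc k) z x - ratio t (n * k) z x) / ratio t (n * k) z x"
      by (simp add: field_simps)
    then have "norm (ratio t (n * Suc k) z x / ratio t (n * k) z x - 1) = norm (ratio t (n * Suc k) z x - ratio t (n * k) z x) / norm (ratio t (n * k) z x)"
      by (simp only: norm_divide)
    also have "\<dots> \<le> 1 / 2" using main[OF that, of k] nz by (simp add: field_simps)
    finally show ?thesis .
  qed
  moreover have "\<delta> < t - r" using r r' by simp
  ultimately show ?thesis using r(1) *(5) main by (intro exI[of _ r] exI[of _ n]) auto
qed

text \<open>Montel gives a limit along a subsequence only. At real parameters, however, the whole
  sequence converges by \<open>pressure_limit\<close>, which identifies the limit there with the
  increment of the pressure; its Taylor series at 0 is the required expansion.\<close>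

theorem pressure_analytic: "real_analytic_on pressure {\<delta><..}"
  unfolding real_analytic_on_def
proof
  fix t assume "t \<in> {\<delta><..}"
  then have t: "\<delta> < t" by simp
  obtain x where x: "x \<in> K" using K_ne by blast
  obtain r n where rn: "0 < r" "0 < n" "\<delta> < t - r" and zf: "\<And>z k. norm z < r \<Longrightarrow>
    ratio t (n * k) z x \<noteq> 0 \<and> norm (ratio t (n * Suc k) z x / ratio t (n * k) z x - 1) \<le> 1 / 2"
    using zero_free[OF t] x by blast
  define R where "R k z = ratio t (n * k) z x" for k z
  define q where "q k z = R (Suc k) z / R k z" for k z
  have R: "R k z \<noteq> 0" "norm (q k z - 1) \<le> 1 / 2" if "norm z < r" for k z
    using zf[OF that, of k] by (auto simp: R_def q_def)
  have qc: "q k z \<in> cball 1 (1 / 2)" if "norm z < r" for k z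
    using R(2)[OF that] by (simp add: dist_norm norm_minus_commute)
  \<comment> \<open>Ratios in this disk avoid the negative axis, so their principal logarithms are
    holomorphic and bounded.\<close>
  have Re_pos: "0 < Re w" if "w \<in> cball (1::complex) (1 / 2)" for w
    using abs_Re_le_cmod[of "1 - w"] that by (auto simp: dist_norm)
  have slit: "w \<notin> \<real>\<^sub>\<le>\<^sub>0" if "w \<in> cball (1::complex) (1 / 2)" for w
    using Re_pos[OF that] by (auto simp: complex_nonpos_Reals_iff)
  have "compact (Ln ` cball (1::complex) (1 / 2))"
    by (intro compact_continuous_image continuous_intros) (use slit in auto)
  then obtain C where C: "\<And>w. w \<in> cball (1::complex) (1 / 2) \<Longrightarrow> norm (Ln w) \<le> C"
    using compact_imp_bounded bounded_iff by (metis imageI)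
  have C0: "0 \<le> C" using C[of 1] by simp
  have Rhol: "R k holomorphic_on ball 0 r" for k
  proof -
    have "(\<lambda>z. Zc z (n * k) x) \<circ> (\<lambda>z. of_real t + z) holomorphic_on ball 0 r"
    proof (rule holomorphic_on_compose_gen[OF _ Zc_holomorphic[OF x]])
      show "(+) (complex_of_real t) ` ball 0 r \<subseteq> {z. \<delta> < Re z}"
      proof (rule image_subsetI)
        fix z :: complex assume "z \<in> ball 0 r"
        then have "\<delta> < t + Re z" using abs_Re_le_cmod[of z] rn(3) by simp
        then show "of_real t + z \<in> {z. \<delta> < Re z}" by simp
      qed
    qed (intro holomorphic_intros)
    then have "(\<lambda>z. Zc (of_real t + z) (n * k) x / of_real (Z t (n * k) x)) holomorphic_on ball 0 r"
      using Z_pos[OF t x, of "n * k"] by (intro holomorphic_intros) (auto simp: o_def)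
    then show ?thesis unfolding R_def ratio_def .
  qed
  \<comment> \<open>Formally the sum telescopes to a logarithm of \<open>R k\<close>. Taking
    logarithms ratio by ratio avoids choosing a branch for \<open>R k\<close>, which may wind around
    0.\<close>
  define f where "f k z = (\<Sum>j<k. Ln (q j z)) / of_nat (n * k)" for k z
  have fhol: "f k holomorphic_on ball 0 r" for k
  proof (cases "k = 0")
    case False
    have "q j holomorphic_on ball 0 r" for j
      unfolding q_def using R(1) by (intro holomorphic_intros Rhol) auto
    then show ?thesis unfolding f_def using False rn(2) slit[OF qc] by (intro holomorphic_intros) auto
  next
    case True
    then have "f k = (\<lambda>_. 0)" by (auto simp: f_def)
    then show ?thesis by simp
  qed
  have fb: "norm (f k z) \<le> C" if "z \<in> ball 0 r" for k z
  proof (cases "k = 0")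
    case False
    have "norm (\<Sum>j<k. Ln (q j z)) \<le> (\<Sum>j<k. C)"
      using that by (intro sum_norm_le C qc) auto
    also have "\<dots> = real k * C" by simp
    finally have "norm (f k z) \<le> real k * C / real (n * k)"
      unfolding f_def norm_divide by (simp add: divide_right_mono del: of_nat_mult)
    also have "\<dots> = C / real n" using False by simp
    also have "\<dots> \<le> C / 1" using rn(2) C0 by (intro divide_left_mono) auto
    finally show ?thesis by simp
  qed (use C0 in \<open>simp add: f_def\<close>)
  obtain g s where g: "g holomorphic_on ball 0 r" and s: "strict_mono (s :: nat \<Rightarrow> nat)"
     and lim: "\<And>z. z \<in> ball 0 r \<Longrightarrow> (\<lambda>k. f (s k) z) \<longlonglongrightarrow> g z"
  proof (rule Montel[of "ball 0 r" "range f" f])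
    show "\<And>h. h \<in> range f \<Longrightarrow> h holomorphic_on ball 0 r" using fhol by auto
    show "\<And>A. compact A \<Longrightarrow> A \<subseteq> ball 0 r \<Longrightarrow> \<exists>B. \<forall>h\<in>range f. \<forall>z\<in>A. norm (h z) \<le> B"
      using fb by blast
  qed (use that in \<open>auto simp: that\<close>)
  have real_values: "g (of_real h) = of_real (pressure (t + h) - pressure t)" if h: "\<bar>h\<bar> < r" for h
  proof -
    have th: "\<delta> < t + h" using h rn(3) by linarith
    define \<rho> where "\<rho> k = Z (t + h) (n * k) x / Z t (n * k) x" for k
    have \<rho>: "0 < \<rho> k" for k using Z_pos[OF t x] Z_pos[OF th x] by (simp add: \<rho>_def)
    have R\<rho>: "R k (of_real h) = of_real (\<rho> k)" for k
      using Zc_of_real[OF th x, of "n * k"] by (simp add: R_def ratio_def \<rho>_def)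
    \<comment> \<open>At real parameters everything is positive, so the principal logarithms do
      telescope.\<close>
    have "(\<Sum>j<k. Ln (q j (of_real h))) = of_real (ln (\<rho> k))" for k
    proof (induction k)
      case 0
      show ?case by (simp add: \<rho>_def)
    next
      case (Suc k)
      have "Ln (q k (of_real h)) = of_real (ln (\<rho> (Suc k) / \<rho> k))"
        using \<rho> by (simp add: q_def R\<rho> Ln_of_real flip: of_real_divide)
      also have "ln (\<rho> (Suc k) / \<rho> k) = ln (\<rho> (Suc k)) - ln (\<rho> k)" using \<rho>[of k] \<rho>[of "Suc k"] by (simp add: ln_div)
      finally show ?case using Suc by simp
    qed
    then have feq: "f k (of_real h) = of_real (ln (\<rho> k) / real (n * k))" for k
      by (simp add: f_def)
    have sub: "filterlim (\<lambda>k. n * s k) sequentially sequentially"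
    proof -
      have "strict_mono (\<lambda>k. n * s k)" using s rn(2) by (simp add: strict_mono_def)
      then show ?thesis by (rule filterlim_subseq)
    qed
    have "(\<lambda>k. ln (Z (t + h) (n * s k) x) / real (n * s k) - ln (Z t (n * s k) x) / real (n * s k)) \<longlonglongrightarrow> pressure (t + h) - pressure t"
      using filterlim_compose[OF pressure_limit[OF th x] sub] filterlim_compose[OF pressure_limit[OF t x] sub]
      by (intro tendsto_diff)
    moreover have "ln (Z (t + h) (n * s k) x) / real (n * s k) - ln (Z t (n * s k) x) / real (n * s k) = ln (\<rho> (s k)) / real (n * s k)" for k
      using Z_pos[OF t x, of "n * s k"] Z_pos[OF th x, of "n * s k"]
      by (simp add: \<rho>_def ln_div diff_divide_distrib)
    ultimately have "(\<lambda>k. ln (\<rho> (s k)) / real (n * s k)) \<longlonglongrightarrow> pressure (t + h) - pressure t" by simp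
    then have "(\<lambda>k. f (s k) (of_real h)) \<longlonglongrightarrow> of_real (pressure (t + h) - pressure t)"
      unfolding feq by (rule tendsto_of_real)
    moreover have "(\<lambda>k. f (s k) (of_real h)) \<longlonglongrightarrow> g (of_real h)" using h by (intro lim) simp
    ultimately show ?thesis using LIMSEQ_unique by blast
  qed
  define a where "a j = (deriv ^^ j) g 0 / fact j" for j
  \<comment> \<open>\<open>g\<close> describes the increment from \<open>pressure t\<close>, so the
    constant term is put back. Real parts suffice because \<open>g\<close> is real on the real
    segment.\<close>
  define c where "c j = Re (a j) + (if j = 0 then pressure t else 0)" for j
  have "(\<lambda>j. c j * (y - t) ^ j) sums pressure y" if y: "\<bar>y - t\<bar> < r" for y
  proof -
    have "(\<lambda>j. a j * (of_real (y - t) - 0) ^ j) sums g (of_real (y - t))"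
      unfolding a_def by (rule holomorphic_power_series[OF g]) (use y in \<open>simp del: of_real_diff\<close>)
    then have "(\<lambda>j. Re (a j * of_real (y - t) ^ j)) sums Re (g (of_real (y - t)))"
      using bounded_linear.sums[OF bounded_linear_Re] by fastforce
    moreover have Re_mult_real: "Re (z * of_real c) = Re z * c" for z c by simp
    have "Re (a j * of_real (y - t) ^ j) = Re (a j) * (y - t) ^ j" for j
      unfolding of_real_power[symmetric] Re_mult_real ..
    ultimately have 1: "(\<lambda>j. Re (a j) * (y - t) ^ j) sums (pressure y - pressure t)"
      using real_values[OF y] by simp
    have 2: "(\<lambda>j. if j = 0 then pressure t else 0) sums pressure t"
      using sums_single[of 0 "\<lambda>_. pressure t"] by simp
    have "Re (a j) * (y - t) ^ j + (if j = 0 then pressure t else 0) = c j * (y - t) ^ j" for j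
      by (simp add: c_def)
    then show ?thesis using sums_add[OF 1 2] by simp
  qed
  then show "\<exists>r>0. \<exists>c. \<forall>y. \<bar>y - t\<bar> < r \<longrightarrow> (\<lambda>n. c n * (y - t) ^ n) sums pressure y"
    using rn(1) by (intro exI[of _ r]) blast
qed

end

section \<open>Disk automorphisms\<close>

text \<open>Together with \<open>disk_b\<close> this is the first row of twice the matrix in SU(1,1)
  conjugate to \<open>A\<close>. The scaling is the source of the factors 2 and 4 below;
  \<open>Re (disk_a A)\<close> is the trace of \<open>A\<close>.\<close>

definition disk_a :: "real^2^2 \<Rightarrow> complex" where
  "disk_a A = Complex (A$1$1 + A$2$2) (A$1$2 - A$2$1)"

definition disk_b :: "real^2^2 \<Rightarrow> complex" where
  "disk_b A = Complex (A$1$1 - A$2$2) (- (A$1$2 + A$2$1))"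

definition disk_num :: "real^2^2 \<Rightarrow> complex \<Rightarrow> complex" where
  "disk_num A z = disk_a A * z + disk_b A"

definition disk_den :: "real^2^2 \<Rightarrow> complex \<Rightarrow> complex" where
  "disk_den A z = cnj (disk_b A) * z + cnj (disk_a A)"

text \<open>The derivative of the disk automorphism at \<open>z\<close> has modulus \<open>1 / (stretch A z)\<^sup>2\<close>.\<close>

definition stretch :: "real^2^2 \<Rightarrow> complex \<Rightarrow> real" where
  "stretch A z = norm (disk_den A z) / 2"

text \<open>The fixed points are the roots of this quadratic polynomial; it is linear in \<open>A\<close> and vanishes
  for scalar matrices.\<close>

definition displacement :: "real^2^2 \<Rightarrow> complex \<Rightarrow> complex" where
  "displacement A z = z * disk_den A z - disk_num A z"

lemma mobius_disk_eq: "mobius_disk A z = disk_num A z / disk_den A z"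
  by (simp add: mobius_disk_def Let_def disk_num_def disk_den_def disk_a_def disk_b_def)

lemma norm_disk_ab: "(norm (disk_a A))\<^sup>2 - (norm (disk_b A))\<^sup>2 = 4 * det A"
  unfolding disk_a_def disk_b_def cmod_power2
  by (simp add: det_2 power2_eq_square algebra_simps)

lemma disk_ab_cnj: "det A = 1 \<Longrightarrow> disk_a A * cnj (disk_a A) - disk_b A * cnj (disk_b A) = 4"
  using norm_disk_ab[of A] unfolding complex_norm_square[symmetric]
  by (metis mult.right_neutral of_real_diff of_real_numeral)

lemma norm_disk_b_less:
  assumes "det A = 1"
  shows "norm (disk_b A) < norm (disk_a A)" "2 \<le> norm (disk_a A)"
proof -
  have eq: "(norm (disk_a A))\<^sup>2 = 4 + (norm (disk_b A))\<^sup>2" using norm_disk_ab[of A] assms by simp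
  then have "(norm (disk_b A))\<^sup>2 < (norm (disk_a A))\<^sup>2" by simp
  then show "norm (disk_b A) < norm (disk_a A)" by (rule power2_less_imp_less) simp
  have "2\<^sup>2 \<le> (norm (disk_a A))\<^sup>2" using eq by simp
  then show "2 \<le> norm (disk_a A)" by (rule power2_le_imp_le) simp
qed

lemma disk_den_nonzero:
  assumes A: "det A = 1" and z: "norm z \<le> 1"
  shows "disk_den A z \<noteq> 0"
proof
  assume "disk_den A z = 0"
  then have "cnj (disk_a A) = - (cnj (disk_b A) * z)" by (simp add: disk_den_def add_eq_0_iff)
  then have "norm (disk_a A) = norm (disk_b A) * norm z"
    by (metis complex_mod_cnj norm_minus_cancel norm_mult)
  also have "\<dots> \<le> norm (disk_b A) * 1" using z by (intro mult_left_mono) auto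
  finally show False using norm_disk_b_less(1)[OF A] by simp
qed

lemma stretch_pos: "det A = 1 \<Longrightarrow> norm z \<le> 1 \<Longrightarrow> 0 < stretch A z"
  using disk_den_nonzero by (simp add: stretch_def)

lemma disk_ab_mult:
  "2 * disk_a (A ** B) = disk_a A * disk_a B + disk_b A * cnj (disk_b B)"
  "2 * disk_b (A ** B) = disk_a A * disk_b B + disk_b A * cnj (disk_a B)"
  by (simp_all add: disk_a_def disk_b_def complex_eq_iff matrix_matrix_mult_def sum_2 algebra_simps)

lemma disk_num_den_mult:
  "2 * disk_num (A ** B) z = disk_a A * disk_num B z + disk_b A * disk_den B z"
  "2 * disk_den (A ** B) z = cnj (disk_b A) * disk_num B z + cnj (disk_a A) * disk_den B z"
proof -
  have "2 * disk_num (A ** B) z = (2 * disk_a (A ** B)) * z + 2 * disk_b (A ** B)"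
    by (simp add: disk_num_def algebra_simps)
  then show "2 * disk_num (A ** B) z = disk_a A * disk_num B z + disk_b A * disk_den B z"
    unfolding disk_ab_mult by (simp add: disk_num_def disk_den_def algebra_simps)
  have "2 * disk_den (A ** B) z = cnj (2 * disk_b (A ** B)) * z + cnj (2 * disk_a (A ** B))"
    by (simp add: disk_den_def algebra_simps)
  then show "2 * disk_den (A ** B) z = cnj (disk_b A) * disk_num B z + cnj (disk_a A) * disk_den B z"
    unfolding disk_ab_mult by (simp add: disk_num_def disk_den_def algebra_simps)
qed

lemma disk_num_den_comp:
  assumes B: "det B = 1" and z: "norm z \<le> 1"
  shows "2 * disk_num (A ** B) z = disk_num A (mobius_disk B z) * disk_den B z"
    "2 * disk_den (A ** B) z = disk_den A (mobius_disk B z) * disk_den B z"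
  using disk_den_nonzero[OF B z] unfolding disk_num_den_mult
  by (simp_all add: disk_num_def[of A] disk_den_def[of A] mobius_disk_eq field_simps)

lemma mobius_disk_mult:
  assumes B: "det B = 1" and z: "norm z \<le> 1"
  shows "mobius_disk (A ** B) z = mobius_disk A (mobius_disk B z)"
proof -
  have "mobius_disk (A ** B) z = (2 * disk_num (A ** B) z) / (2 * disk_den (A ** B) z)"
    by (simp add: mobius_disk_eq)
  also have "\<dots> = mobius_disk A (mobius_disk B z)"
    unfolding disk_num_den_comp[OF assms] using disk_den_nonzero[OF assms] by (simp add: mobius_disk_eq[of A])
  finally show ?thesis .
qed

lemma stretch_mult:
  assumes "det B = 1" "norm z \<le> 1"
  shows "stretch (A ** B) z = stretch A (mobius_disk B z) * stretch B z"
proof -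
  have "norm (2 * disk_den (A ** B) z) = norm (disk_den A (mobius_disk B z)) * norm (disk_den B z)"
    unfolding disk_num_den_comp[OF assms] by (rule norm_mult)
  then show ?thesis by (simp add: stretch_def norm_mult)
qed

text \<open>Clearing denominators leaves \<open>z - w\<close> times the determinant, which is 4 in
  this scaling.\<close>

lemma mobius_disk_diff:
  assumes A: "det A = 1" and z: "norm z \<le> 1" and w: "norm w \<le> 1"
  shows "norm (mobius_disk A z - mobius_disk A w) = norm (z - w) / (stretch A z * stretch A w)"
proof -
  have "disk_num A z * disk_den A w - disk_num A w * disk_den A z = (disk_a A * cnj (disk_a A) - disk_b A * cnj (disk_b A)) * (z - w)"
    by (simp add: disk_num_def disk_den_def algebra_simps)
  then have "disk_num A z * disk_den A w - disk_num A w * disk_den A z = 4 * (z - w)" unfolding disk_ab_cnj[OF A] .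
  then have "mobius_disk A z - mobius_disk A w = 4 * (z - w) / (disk_den A z * disk_den A w)"
    using disk_den_nonzero[OF A z] disk_den_nonzero[OF A w] by (simp add: mobius_disk_eq field_simps)
  then have "norm (mobius_disk A z - mobius_disk A w) = 4 * norm (z - w) / (norm (disk_den A z) * norm (disk_den A w))"
    by (simp only: norm_divide norm_mult norm_numeral)
  then show ?thesis by (simp add: stretch_def)
qed

text \<open>Invariance of the Hermitian form of signature (1,1), in affine coordinates.\<close>

lemma one_minus_norm_mobius:
  assumes A: "det A = 1" and z: "norm z \<le> 1"
  shows "1 - (norm (mobius_disk A z))\<^sup>2 = (1 - (norm z)\<^sup>2) / (stretch A z)\<^sup>2"
proof -
  have "of_real ((norm (disk_den A z))\<^sup>2 - (norm (disk_num A z))\<^sup>2) =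
      (disk_a A * cnj (disk_a A) - disk_b A * cnj (disk_b A)) * (1 - z * cnj z)"
    by (simp only: of_real_diff complex_norm_square) (simp add: disk_num_def disk_den_def algebra_simps)
  also have "1 - z * cnj z = of_real (1 - (norm z)\<^sup>2)"
    by (simp only: of_real_diff complex_norm_square of_real_1)
  also have "(disk_a A * cnj (disk_a A) - disk_b A * cnj (disk_b A)) * of_real (1 - (norm z)\<^sup>2) = of_real (4 * (1 - (norm z)\<^sup>2))"
    unfolding disk_ab_cnj[OF A] by simp
  finally have eq: "(norm (disk_den A z))\<^sup>2 - (norm (disk_num A z))\<^sup>2 = 4 * (1 - (norm z)\<^sup>2)"
    by (simp only: of_real_eq_iff)
  have "1 - (norm (mobius_disk A z))\<^sup>2 = ((norm (disk_den A z))\<^sup>2 - (norm (disk_num A z))\<^sup>2) / (norm (disk_den A z))\<^sup>2"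
    using disk_den_nonzero[OF A z] by (simp add: mobius_disk_eq norm_divide power_divide diff_divide_distrib)
  then show ?thesis unfolding eq by (simp add: stretch_def power_divide)
qed

lemma norm_mobius_disk:
  assumes A: "det A = 1"
  shows "norm z = 1 \<Longrightarrow> norm (mobius_disk A z) = 1" "norm z < 1 \<Longrightarrow> norm (mobius_disk A z) < 1"
proof -
  show "norm (mobius_disk A z) = 1" if "norm z = 1"
  proof -
    have "(norm (mobius_disk A z))\<^sup>2 = 1" using one_minus_norm_mobius[OF A, of z] that by simp
    then show ?thesis by (metis norm_ge_zero power2_eq_1_iff neg_0_le_iff_le not_one_le_zero)
  qed
  show "norm (mobius_disk A z) < 1" if "norm z < 1"
  proof -
    have "(norm z)\<^sup>2 < 1" using that by (simp add: power_less_one_iff abs_square_less_1)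
    then have "0 < 1 - (norm (mobius_disk A z))\<^sup>2"
      using one_minus_norm_mobius[OF A, of z] stretch_pos[OF A, of z] that by simp
    then show ?thesis by (simp add: abs_square_less_1)
  qed
qed

lemma stretch_0: "stretch A 0 = norm (disk_a A) / 2"
  by (simp add: stretch_def disk_den_def)

lemma stretch_0_ge_1: "det A = 1 \<Longrightarrow> 1 \<le> stretch A 0"
  using norm_disk_b_less(2)[of A] by (simp add: stretch_0)

text \<open>The zero of the numerator, that is, the preimage of 0. Its reflection in the unit circle
  is the pole of the automorphism.\<close>

definition disk_center :: "real^2^2 \<Rightarrow> complex" where
  "disk_center A = - disk_b A / disk_a A"

text \<open>On the circle, numerator and denominator have equal modulus, and the numerator vanishes
  at the center.\<close>

lemma stretch_sphere:
  assumes A: "det A = 1" and z: "norm z = 1"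
  shows "stretch A z = stretch A 0 * norm (z - disk_center A)"
proof -
  have a: "disk_a A \<noteq> 0" using norm_disk_b_less(2)[OF A] by auto
  have zc: "z * cnj z = 1" using z by (simp add: complex_norm_square[symmetric])
  have "norm (disk_den A z) = norm (cnj (disk_den A z)) * norm z" using z by simp
  also have "\<dots> = norm (disk_b A * (z * cnj z) + disk_a A * z)"
    unfolding norm_mult[symmetric] by (simp add: disk_den_def algebra_simps)
  also have "disk_b A * (z * cnj z) + disk_a A * z = disk_a A * (z - disk_center A)"
    unfolding zc using a by (simp add: disk_center_def algebra_simps)
  finally have "norm (disk_den A z) = norm (disk_a A) * norm (z - disk_center A)"
    by (simp only: norm_mult)
  then show ?thesis unfolding stretch_def[of A z] stretch_0 by simp
qed

lemma norm_disk_center: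
  assumes A: "det A = 1"
  shows "1 - (norm (disk_center A))\<^sup>2 = 1 / (stretch A 0)\<^sup>2" "norm (disk_center A) < 1"
proof -
  have a: "disk_a A \<noteq> 0" using norm_disk_b_less(2)[OF A] by auto
  have "1 - (norm (disk_center A))\<^sup>2 = ((norm (disk_a A))\<^sup>2 - (norm (disk_b A))\<^sup>2) / (norm (disk_a A))\<^sup>2"
    using a by (simp add: disk_center_def norm_divide power_divide diff_divide_distrib)
  then show eq: "1 - (norm (disk_center A))\<^sup>2 = 1 / (stretch A 0)\<^sup>2"
    unfolding norm_disk_ab A by (simp add: stretch_0 power_divide)
  have "0 < stretch A 0" using stretch_0_ge_1[OF A] by simp
  then have "0 < 1 / (stretch A 0)\<^sup>2" by simp
  then have "(norm (disk_center A))\<^sup>2 < 1" using eq by linarith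
  then show "norm (disk_center A) < 1" by (simp add: abs_square_less_1)
qed

lemma stretch_le: "det A = 1 \<Longrightarrow> norm z = 1 \<Longrightarrow> stretch A z \<le> 2 * stretch A 0"
proof -
  assume A: "det A = 1" and z: "norm z = 1"
  have "norm (z - disk_center A) \<le> 2" using norm_triangle_ineq4[of z "disk_center A"] norm_disk_center(2)[OF A] z by simp
  then show ?thesis
    using mult_left_mono[of "norm (z - disk_center A)" 2 "stretch A 0"] stretch_0_ge_1[OF A]
    by (simp add: stretch_sphere[OF A z])
qed

text \<open>With \<open>\<zeta>\<close> the center, \<open>\<bar>\<theta> - \<zeta>\<bar> * \<bar>A \<theta> - A 0\<bar> = 1 - \<bar>\<zeta>\<bar>\<^sup>2\<close> on the circle. So whichever \<open>\<eta>\<^sub>i\<close> is not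
  mapped close to \<open>A 0\<close> lies within a multiple of \<open>1 - \<bar>\<zeta>\<bar> \<le> \<bar>\<eta> - \<zeta>\<bar>\<close> of \<open>\<zeta>\<close>. Ping-pong supplies
  the two points \<open>\<eta>\<^sub>1\<close>, \<open>\<eta>\<^sub>2\<close>.\<close>

lemma center_separated:
  assumes A: "det A = 1" and e: "0 < e"
    and \<xi>: "norm \<eta>\<^sub>1 = 1" "norm \<eta>\<^sub>2 = 1" "e \<le> norm (mobius_disk A \<eta>\<^sub>1 - mobius_disk A \<eta>\<^sub>2)"
    and \<eta>: "norm \<eta> = 1" "e \<le> norm (\<eta> - \<eta>\<^sub>1)" "e \<le> norm (\<eta> - \<eta>\<^sub>2)"
  shows "e / (1 + 4 / e) \<le> norm (\<eta> - disk_center A)"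
proof -
  let ?\<zeta> = "disk_center A" and ?s = "stretch A 0"
  have s: "0 < ?s" using stretch_0_ge_1[OF A] by simp
  have c: "norm ?\<zeta> < 1" by (rule norm_disk_center[OF A])
  have est: "norm (\<theta> - ?\<zeta>) * norm (mobius_disk A \<theta> - mobius_disk A 0) = 1 - (norm ?\<zeta>)\<^sup>2" if "norm \<theta> = 1" for \<theta>
  proof -
    have ne: "norm (\<theta> - ?\<zeta>) \<noteq> 0" using that c by auto
    have "norm (mobius_disk A \<theta> - mobius_disk A 0) = 1 / (?s * norm (\<theta> - ?\<zeta>) * ?s)"
      using mobius_disk_diff[OF A, of \<theta> 0] stretch_sphere[OF A that] that by simp
    then show ?thesis unfolding norm_disk_center(1)[OF A] using s ne by (simp add: power2_eq_square field_simps)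
  qed
  \<comment> \<open>Points at distance at least \<open>e\<close> cannot both be closer than
    \<open>e / 2\<close> to the image of 0.\<close>
  have "\<exists>\<theta>. norm \<theta> = 1 \<and> e \<le> norm (\<eta> - \<theta>) \<and> e / 2 \<le> norm (mobius_disk A \<theta> - mobius_disk A 0)"
  proof (cases "e / 2 \<le> norm (mobius_disk A \<eta>\<^sub>1 - mobius_disk A 0)")
    case False
    have "norm (mobius_disk A \<eta>\<^sub>1 - mobius_disk A \<eta>\<^sub>2) \<le>
       norm (mobius_disk A \<eta>\<^sub>1 - mobius_disk A 0) + norm (mobius_disk A \<eta>\<^sub>2 - mobius_disk A 0)"
      using norm_triangle_ineq4[of "mobius_disk A \<eta>\<^sub>1 - mobius_disk A 0" "mobius_disk A \<eta>\<^sub>2 - mobius_disk A 0"] by simp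
    with False \<xi> \<eta> show ?thesis by (intro exI[of _ \<eta>\<^sub>2]) auto
  qed (use \<xi> \<eta> in auto)
  then obtain \<theta> where \<theta>: "norm \<theta> = 1" "e \<le> norm (\<eta> - \<theta>)" "e / 2 \<le> norm (mobius_disk A \<theta> - mobius_disk A 0)"
    by blast
  have low: "1 - norm ?\<zeta> \<le> norm (\<eta> - ?\<zeta>)" using norm_triangle_ineq2[of \<eta> ?\<zeta>] \<eta>(1) by simp
  have "norm (\<theta> - ?\<zeta>) * (e / 2) \<le> norm (\<theta> - ?\<zeta>) * norm (mobius_disk A \<theta> - mobius_disk A 0)"
    using \<theta>(3) by (rule mult_left_mono) simp
  also have "\<dots> = (1 - norm ?\<zeta>) * (1 + norm ?\<zeta>)"
    unfolding est[OF \<theta>(1)] by (simp add: power2_eq_square algebra_simps)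
  also have "\<dots> \<le> norm (\<eta> - ?\<zeta>) * 2"
    using low c by (intro mult_mono) auto
  finally have "norm (\<theta> - ?\<zeta>) \<le> 4 / e * norm (\<eta> - ?\<zeta>)" using e by (simp add: field_simps)
  moreover have "norm (\<eta> - \<theta>) \<le> norm (\<eta> - ?\<zeta>) + norm (\<theta> - ?\<zeta>)"
    using norm_triangle_ineq4[of "\<eta> - ?\<zeta>" "\<theta> - ?\<zeta>"] by simp
  ultimately have "e \<le> (1 + 4 / e) * norm (\<eta> - ?\<zeta>)" using \<theta>(2) by (simp add: algebra_simps)
  then show ?thesis using e by (subst pos_divide_le_eq) (auto simp: mult.commute add_pos_pos)
qed

section \<open>Fixed points and displacement\<close>

lemma displacement_linear:
  "displacement (u *\<^sub>R A + v *\<^sub>R mat 1) z = of_real u * displacement A z"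
  "disk_b (u *\<^sub>R A + v *\<^sub>R mat 1) = of_real u * disk_b A"
  by (simp_all add: displacement_def disk_num_def disk_den_def disk_a_def disk_b_def mat_def complex_eq_iff algebra_simps)

lemma mobius_disk_fixed_iff: "det A = 1 \<Longrightarrow> norm z \<le> 1 \<Longrightarrow> mobius_disk A z = z \<longleftrightarrow> displacement A z = 0"
  using disk_den_nonzero[of A z] by (auto simp: mobius_disk_eq displacement_def field_simps)

lemma displacement_eq: "displacement A z = cnj (disk_b A) * z\<^sup>2 - 2 * \<i> * of_real (Im (disk_a A)) * z - disk_b A"
proof -
  have "cnj (disk_a A) - disk_a A = - (2 * \<i> * of_real (Im (disk_a A)))" by (simp add: complex_eq_iff)
  then have "(cnj (disk_a A) - disk_a A) * z = - (2 * \<i> * of_real (Im (disk_a A)) * z)" by simp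
  then show ?thesis by (simp add: displacement_def disk_num_def disk_den_def power2_eq_square algebra_simps)
qed

lemma disk_a_trace: "det A = 1 \<Longrightarrow> (Re (disk_a A))\<^sup>2 + (Im (disk_a A))\<^sup>2 = 4 + (norm (disk_b A))\<^sup>2"
  using norm_disk_ab[of A] by (simp add: cmod_power2[of "disk_a A"])

text \<open>Dividing the fixed point equation by \<open>z\<close> bounds
  \<open>Im (disk_a A)\<close> by \<open>norm (disk_b A)\<close>; in view of
  \<open>disk_a_trace\<close> this is the exclusion of elliptic elements.\<close>

lemma fixed_point_trace:
  assumes A: "det A = 1" and z: "norm z = 1" "displacement A z = 0"
  shows "4 \<le> (Re (disk_a A))\<^sup>2"
proof -
  have zc: "z * cnj z = 1" using z(1) by (simp add: complex_norm_square[symmetric])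
  have "0 = displacement A z * cnj z" using z(2) by simp
  also have "\<dots> = cnj (disk_b A) * z * (z * cnj z) - 2 * \<i> * of_real (Im (disk_a A)) * (z * cnj z) - disk_b A * cnj z"
    unfolding displacement_eq by (simp add: power2_eq_square algebra_simps)
  finally have "2 * \<i> * of_real (Im (disk_a A)) = cnj (disk_b A) * z - disk_b A * cnj z"
    unfolding zc by (simp add: algebra_simps)
  then have "norm (2 * \<i> * of_real (Im (disk_a A))) \<le> norm (cnj (disk_b A) * z) + norm (disk_b A * cnj z)"
    by (metis norm_triangle_ineq4)
  then have "\<bar>Im (disk_a A)\<bar> \<le> norm (disk_b A)" using z(1) by (simp add: norm_mult)
  then have "(Im (disk_a A))\<^sup>2 \<le> (norm (disk_b A))\<^sup>2" by (simp add: abs_le_square_iff[symmetric])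
  with disk_a_trace[OF A] show ?thesis by linarith
qed

text \<open>The quadratic formula for \<open>displacement_eq\<close>, whose discriminant is a
  multiple of trace squared minus 4. With its square root \<open>s\<close> as a parameter, both
  fixed points are covered.\<close>

lemma boundary_fixed_points:
  assumes A: "det A = 1" and b: "disk_b A \<noteq> 0" and tr: "4 \<le> (Re (disk_a A))\<^sup>2" and s: "s\<^sup>2 = (Re (disk_a A))\<^sup>2 - 4"
  defines "z \<equiv> (\<i> * of_real (Im (disk_a A)) + of_real s) / cnj (disk_b A)"
  shows "norm z = 1" "displacement A z = 0"
proof -
  let ?I = "Im (disk_a A)"
  have eq: "?I\<^sup>2 + s\<^sup>2 = (norm (disk_b A))\<^sup>2" using disk_a_trace[OF A] s by simp
  have "(norm (\<i> * of_real ?I + of_real s))\<^sup>2 = ?I\<^sup>2 + s\<^sup>2" by (simp add: cmod_power2)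
  then have "(norm z)\<^sup>2 = (?I\<^sup>2 + s\<^sup>2) / (norm (disk_b A))\<^sup>2"
    by (simp only: z_def norm_divide power_divide complex_mod_cnj)
  then have "(norm z)\<^sup>2 = 1" using b unfolding eq by simp
  then show "norm z = 1" by (metis norm_ge_zero power2_eq_1_iff neg_0_le_iff_le not_one_le_zero)
  have "displacement A z * cnj (disk_b A) = (\<i> * of_real ?I + of_real s)\<^sup>2 - 2 * \<i> * of_real ?I * (\<i> * of_real ?I + of_real s) - disk_b A * cnj (disk_b A)"
    unfolding displacement_eq z_def using b by (simp add: field_simps power2_eq_square)
  also have "\<dots> = of_real (?I\<^sup>2 + s\<^sup>2) - disk_b A * cnj (disk_b A)"
    by (simp add: power2_eq_square algebra_simps)
  also have "\<dots> = 0" unfolding eq complex_norm_square by simp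
  finally show "displacement A z = 0" using b by simp
qed

text \<open>For trace \<plusminus>2 the quadratic is, up to a factor, a perfect square, and its
  double root has modulus 1.\<close>

lemma displacement_interior:
  assumes A: "det A = 1" and b: "disk_b A \<noteq> 0" and tr: "(Re (disk_a A))\<^sup>2 = 4" and z: "norm z < 1"
  shows "displacement A z \<noteq> 0"
proof
  assume 0: "displacement A z = 0"
  let ?I = "Im (disk_a A)"
  have eq: "?I\<^sup>2 = (norm (disk_b A))\<^sup>2" using disk_a_trace[OF A] tr by simp
  have "disk_b A * cnj (disk_b A) = of_real (?I\<^sup>2)" unfolding eq complex_norm_square ..
  then have "displacement A z * cnj (disk_b A) = (cnj (disk_b A) * z)\<^sup>2 - 2 * \<i> * of_real ?I * (cnj (disk_b A) * z) - of_real (?I\<^sup>2)"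
    unfolding displacement_eq by (simp add: algebra_simps power2_eq_square)
  also have "\<dots> = (cnj (disk_b A) * z - \<i> * of_real ?I)\<^sup>2"
    by (simp add: algebra_simps power2_eq_square)
  finally have "cnj (disk_b A) * z = \<i> * of_real ?I" using 0 by simp
  then have "norm (disk_b A) * norm z = \<bar>?I\<bar>" by (metis complex_mod_cnj norm_ii mult_1 norm_mult norm_of_real)
  also have "\<bar>?I\<bar> = norm (disk_b A)" using eq by (metis abs_norm_cancel power2_eq_iff abs_minus_cancel)
  finally show False using b z by simp
qed

text \<open>The distance to the image depends on \<open>A\<close> only through
  \<open>displacement\<close>, so for powers it suffices to know how that scales.\<close>

lemma hdist_mobius:
  assumes A: "det A = 1" and z: "norm z < 1"
  shows "hdist z (mobius_disk A z) = arcosh (1 + (norm (displacement A z))\<^sup>2 / (2 * (1 - (norm z)\<^sup>2)\<^sup>2))"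
proof -
  have z1: "norm z \<le> 1" using z by simp
  have d: "disk_den A z \<noteq> 0" by (rule disk_den_nonzero[OF A z1])
  have "z - mobius_disk A z = displacement A z / disk_den A z"
    using d by (simp add: displacement_def mobius_disk_eq field_simps)
  then have n: "norm (z - mobius_disk A z) = norm (displacement A z) / norm (disk_den A z)" by (simp add: norm_divide)
  have "(norm z)\<^sup>2 < 1" using z by (simp add: abs_square_less_1)
  then have zz: "1 - (norm z)\<^sup>2 \<noteq> 0" by simp
  have "2 * (D / N)\<^sup>2 / (q * (q / (N / 2)\<^sup>2)) = D\<^sup>2 / (2 * q\<^sup>2)" if "N \<noteq> 0" "q \<noteq> 0" for D N q :: real
    using that by (simp add: field_simps power2_eq_square)
  from this[of "norm (disk_den A z)" "1 - (norm z)\<^sup>2" "norm (displacement A z)"] show ?thesis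
    unfolding hdist_def one_minus_norm_mobius[OF A z1] n stretch_def using d zz by simp
qed

section \<open>The action of PSL(2,R)\<close>

lemma carrier_PSL2R: "X \<in> carrier PSL2R \<longleftrightarrow> (\<exists>A. det A = 1 \<and> X = {A, - A})"
proof -
  have m: "(- mat 1) ** A = - A" for A :: "real^2^2"
    by (simp add: vec_eq_iff matrix_matrix_mult_def mat_def sum_2 forall_2)
  show ?thesis
    by (auto simp: PSL2R_def FactGroup_def RCOSETS_def r_coset_def SL2R_def m)
qed

lemma det_uminus_2: "det (- A) = det A" for A :: "real^2^2"
  by (simp add: det_2)

lemma stretch_uminus: "stretch (- A) = stretch A"
proof
  fix z
  have "disk_a (- A) = - disk_a A" "disk_b (- A) = - disk_b A" by (simp_all add: disk_a_def disk_b_def complex_eq_iff)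
  then have "disk_den (- A) z = - disk_den A z" by (simp add: disk_den_def)
  then show "stretch (- A) z = stretch A z" by (simp add: stretch_def)
qed

lemma mobius_disk_uminus': "mobius_disk (- A) = mobius_disk A"
  by (rule ext) (rule mobius_disk_uminus)

definition psl_rep :: "(real^2^2) set \<Rightarrow> real^2^2" where
  "psl_rep X = (SOME A. A \<in> X)"

definition psl_stretch :: "(real^2^2) set \<Rightarrow> complex \<Rightarrow> real" where
  "psl_stretch X = stretch (psl_rep X)"

lemma psl_rep:
  assumes "X \<in> carrier PSL2R"
  shows "det (psl_rep X) = 1" "X = {psl_rep X, - psl_rep X}"
proof -
  obtain A where A: "det A = 1" "X = {A, - A}" using assms carrier_PSL2R by blast
  then have "psl_rep X \<in> X" unfolding psl_rep_def by (metis insertI1 someI)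
  then have "psl_rep X = A \<or> psl_rep X = - A" using A by simp
  then show "det (psl_rep X) = 1" "X = {psl_rep X, - psl_rep X}" using A by (auto simp: det_uminus_2)
qed

lemma psl_mem:
  assumes "X \<in> carrier PSL2R" "A \<in> X"
  shows "det A = 1" "psl_act X = mobius_disk A" "psl_stretch X = stretch A" "X = {A, - A}"
proof -
  have "A = psl_rep X \<or> A = - psl_rep X" using psl_rep(2)[OF assms(1)] assms(2) by blast
  then have "det A = det (psl_rep X) \<and> mobius_disk A = mobius_disk (psl_rep X) \<and> stretch A = stretch (psl_rep X)
      \<and> {A, - A} = {psl_rep X, - psl_rep X}"
    by (auto simp: det_uminus_2 mobius_disk_uminus' stretch_uminus)
  then show "det A = 1" "psl_act X = mobius_disk A" "psl_stretch X = stretch A" "X = {A, - A}"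
    using psl_rep(1)[OF assms(1)] psl_rep(2)[OF assms(1), symmetric]
    by (simp_all add: psl_act_def psl_stretch_def psl_rep_def[symmetric])
qed

lemma psl_mult_mem: "A \<in> X \<Longrightarrow> B \<in> Y \<Longrightarrow> A ** B \<in> X \<otimes>\<^bsub>PSL2R\<^esub> Y"
  by (auto simp: PSL2R_def set_mult_def SL2R_def)

interpretation PSL: group PSL2R by (rule group_PSL2R)

lemma psl_one_mem: "mat 1 \<in> \<one>\<^bsub>PSL2R\<^esub>"
  by (simp add: PSL2R_def)

lemma psl_act_mult:
  assumes "X \<in> carrier PSL2R" "Y \<in> carrier PSL2R" "norm z \<le> 1"
  shows "psl_act (X \<otimes>\<^bsub>PSL2R\<^esub> Y) z = psl_act X (psl_act Y z)"
    "psl_stretch (X \<otimes>\<^bsub>PSL2R\<^esub> Y) z = psl_stretch X (psl_act Y z) * psl_stretch Y z"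
proof -
  obtain A B where AB: "A \<in> X" "B \<in> Y" using psl_rep(2)[OF assms(1)] psl_rep(2)[OF assms(2)] by blast
  note X = psl_mem[OF assms(1) AB(1)] and Y = psl_mem[OF assms(2) AB(2)]
  note XY = psl_mem[OF PSL.m_closed[OF assms(1,2)] psl_mult_mem[OF AB]]
  show "psl_act (X \<otimes>\<^bsub>PSL2R\<^esub> Y) z = psl_act X (psl_act Y z)"
    unfolding X(2) Y(2) XY(2) by (rule mobius_disk_mult[OF Y(1) assms(3)])
  show "psl_stretch (X \<otimes>\<^bsub>PSL2R\<^esub> Y) z = psl_stretch X (psl_act Y z) * psl_stretch Y z"
    unfolding X(3) Y(2,3) XY(3) by (rule stretch_mult[OF Y(1) assms(3)])
qed

lemma psl_act_one: "psl_act \<one>\<^bsub>PSL2R\<^esub> z = z" "psl_stretch \<one>\<^bsub>PSL2R\<^esub> z = 1"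
proof -
  note 1 = psl_mem[OF PSL.one_closed psl_one_mem]
  have "disk_a (mat 1) = 2" "disk_b (mat 1) = 0" by (simp_all add: disk_a_def disk_b_def mat_def complex_eq_iff)
  then show "psl_act \<one>\<^bsub>PSL2R\<^esub> z = z" "psl_stretch \<one>\<^bsub>PSL2R\<^esub> z = 1"
    unfolding 1(2,3) by (simp_all add: mobius_disk_eq stretch_def disk_num_def disk_den_def)
qed

lemma psl_act_inv:
  assumes X: "X \<in> carrier PSL2R" and z: "norm z \<le> 1"
  shows "psl_act X (psl_act (inv\<^bsub>PSL2R\<^esub> X) z) = z"
proof -
  have "psl_act (X \<otimes>\<^bsub>PSL2R\<^esub> inv\<^bsub>PSL2R\<^esub> X) z = z" using X by (simp add: psl_act_one)
  then show ?thesis using psl_act_mult(1)[OF X PSL.inv_closed[OF X] z] by simp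
qed

lemma norm_psl_act:
  assumes "X \<in> carrier PSL2R"
  shows "norm z = 1 \<Longrightarrow> norm (psl_act X z) = 1" "norm z < 1 \<Longrightarrow> norm (psl_act X z) < 1"
proof -
  have eq: "psl_act X = mobius_disk (psl_rep X)" by (simp add: psl_act_def psl_rep_def)
  show "norm z = 1 \<Longrightarrow> norm (psl_act X z) = 1" "norm z < 1 \<Longrightarrow> norm (psl_act X z) < 1"
    unfolding eq by (rule norm_mobius_disk[OF psl_rep(1)[OF assms]]; assumption)+
qed

lemma psl_rep_mem: "X \<in> carrier PSL2R \<Longrightarrow> psl_rep X \<in> X"
  using psl_rep(2) by blast

text \<open>The inverse as adjugate, written as trace minus \<open>A\<close> so that it stays in the
  span of \<open>A\<close> and the identity.\<close>

lemma adjugate_2: "det A = 1 \<Longrightarrow> (Re (disk_a A) *\<^sub>R mat 1 - A) ** A = mat 1" for A :: "real^2^2"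
proof -
  assume "det A = 1"
  then have d: "A$1$1 * A$2$2 - A$1$2 * A$2$1 = 1" by (simp add: det_2)
  show ?thesis
    by (simp add: vec_eq_iff matrix_matrix_mult_def mat_def sum_2 forall_2 disk_a_def) (intro conjI; insert d; simp add: algebra_simps)
qed

lemma det_adjugate_2: "det (Re (disk_a A) *\<^sub>R mat 1 - A) = det A" for A :: "real^2^2"
  by (simp add: mat_def det_2 disk_a_def algebra_simps)

lemma psl_inv_mem:
  assumes X: "X \<in> carrier PSL2R" and A: "A \<in> X"
  shows "Re (disk_a A) *\<^sub>R mat 1 - A \<in> inv\<^bsub>PSL2R\<^esub> X"
proof -
  let ?B = "Re (disk_a A) *\<^sub>R mat 1 - A"
  note X' = psl_mem[OF X A]
  have Y: "{?B, - ?B} \<in> carrier PSL2R" using det_adjugate_2[of A] X'(1) by (auto simp: carrier_PSL2R)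
  have "?B ** A \<in> {?B, - ?B} \<otimes>\<^bsub>PSL2R\<^esub> X" by (rule psl_mult_mem[OF _ A]) simp
  then have "mat 1 \<in> {?B, - ?B} \<otimes>\<^bsub>PSL2R\<^esub> X" using adjugate_2[OF X'(1)] by simp
  then have "{?B, - ?B} \<otimes>\<^bsub>PSL2R\<^esub> X = {mat 1, - mat 1}"
    using psl_mem(4)[OF PSL.m_closed[OF Y X]] by blast
  moreover have "\<one>\<^bsub>PSL2R\<^esub> = {mat 1, - mat 1}"
    using psl_mem(4)[OF PSL.one_closed psl_one_mem] .
  ultimately have "inv\<^bsub>PSL2R\<^esub> X = {?B, - ?B}"
    using X Y by (intro PSL.inv_equality) auto
  then show ?thesis by simp
qed

text \<open>This keeps the powers of \<open>A\<close> in the span of \<open>A\<close> and the identity, on which \<open>displacement\<close> and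
  \<open>disk_b\<close> are linear.\<close>

lemma cayley_hamilton_2: "det A = 1 \<Longrightarrow> A ** A = Re (disk_a A) *\<^sub>R A - mat 1" for A :: "real^2^2"
proof -
  assume "det A = 1"
  then have d: "A$1$1 * A$2$2 - A$1$2 * A$2$1 = 1" by (simp add: det_2)
  show ?thesis
    by (simp add: vec_eq_iff matrix_matrix_mult_def mat_def sum_2 forall_2 disk_a_def) (intro conjI; insert d; simp add: algebra_simps)
qed

lemma span_mult: "det A = 1 \<Longrightarrow> (u *\<^sub>R A + v *\<^sub>R mat 1) ** A = (u * Re (disk_a A) + v) *\<^sub>R A + (- u) *\<^sub>R mat 1"
  for A :: "real^2^2"
proof -
  assume A: "det A = 1"
  have "(u *\<^sub>R A + v *\<^sub>R mat 1) ** A = u *\<^sub>R (A ** A) + v *\<^sub>R A"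
    by (simp add: vec_eq_iff matrix_matrix_mult_def mat_def sum_2 forall_2 algebra_simps)
  then show ?thesis unfolding cayley_hamilton_2[OF A] by (simp add: algebra_simps)
qed

text \<open>The coefficients are Chebyshev polynomials in the trace: a step sends
  \<open>(u, v)\<close> to \<open>(u * trace + v, - u)\<close>. As \<bar>trace\<bar> \<ge> 2, the
  inequality \<open>\<bar>v\<bar> + 1 \<le> \<bar>u\<bar>\<close> propagates and lets
  \<open>\<bar>u\<bar>\<close> grow by at least 1. For trace \<plusminus>2 the formula for
  \<open>v\<close> fixes its sign, and the growth is exactly 1.\<close>

lemma psl_nat_pow_span:
  assumes X: "X \<in> carrier PSL2R" and A: "A \<in> X" and tr: "4 \<le> (Re (disk_a A))\<^sup>2"
  shows "\<exists>u v. u *\<^sub>R A + v *\<^sub>R mat 1 \<in> X [^]\<^bsub>PSL2R\<^esub> (Suc n) \<and> real (Suc n) \<le> \<bar>u\<bar> \<and> \<bar>v\<bar> + 1 \<le> \<bar>u\<bar> \<and>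
     ((Re (disk_a A))\<^sup>2 = 4 \<longrightarrow> \<bar>u\<bar> = real (Suc n) \<and> 2 * v = - Re (disk_a A) * u * (real n / real (Suc n)))"
proof (induction n)
  case 0
  show ?case using A PSL.r_one by (intro exI[of _ 1] exI[of _ 0]) (use X in simp)
next
  case (Suc n)
  let ?t = "Re (disk_a A)"
  note X' = psl_mem[OF X A]
  obtain u v where uv: "u *\<^sub>R A + v *\<^sub>R mat 1 \<in> X [^]\<^bsub>PSL2R\<^esub> (Suc n)" "real (Suc n) \<le> \<bar>u\<bar>" "\<bar>v\<bar> + 1 \<le> \<bar>u\<bar>"
     "?t\<^sup>2 = 4 \<Longrightarrow> \<bar>u\<bar> = real (Suc n) \<and> 2 * v = - ?t * u * (real n / real (Suc n))" using Suc by blast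
  have "2 \<le> \<bar>?t\<bar>" using tr abs_le_square_iff[of 2 ?t] by simp
  then have "2 * \<bar>u\<bar> \<le> \<bar>u * ?t\<bar>" using mult_right_mono[of 2 "\<bar>?t\<bar>" "\<bar>u\<bar>"] by (simp add: abs_mult mult.commute)
  then have big: "\<bar>u\<bar> + 1 \<le> \<bar>u * ?t + v\<bar>" using uv(3) by linarith
  have "(u * ?t + v) *\<^sub>R A + (- u) *\<^sub>R mat 1 \<in> X [^]\<^bsub>PSL2R\<^esub> (Suc n) \<otimes>\<^bsub>PSL2R\<^esub> X"
    using psl_mult_mem[OF uv(1) A] unfolding span_mult[OF X'(1)] .
  moreover have "\<bar>u * ?t + v\<bar> = real (Suc (Suc n)) \<and> 2 * (- u) = - ?t * (u * ?t + v) * (real (Suc n) / real (Suc (Suc n)))"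
    if t: "?t\<^sup>2 = 4"
  proof -
    have t2: "\<bar>?t\<bar> = 2" using t abs_square_eq_1[of "?t / 2"] by (simp add: power_divide)
    have "2 * v = - ?t * u * (real n / real (Suc n))" using uv(4)[OF t] by blast
    then have v: "v = - ?t * u * (real n / real (Suc n)) / 2"
      by (metis nonzero_mult_div_cancel_left zero_neq_numeral)
    have eq: "u * ?t + v = u * ?t * (real (Suc (Suc n)) / (2 * real (Suc n)))"
      unfolding v by (simp add: field_simps)
    have "\<bar>u * ?t + v\<bar> = real (Suc (Suc n))"
      unfolding eq abs_mult t2 using uv(4)[OF t] by (simp add: field_simps)
    moreover have "?t * (u * ?t + v) * (real (Suc n) / real (Suc (Suc n))) = ?t\<^sup>2 * u / 2"
    proof -
      have "T * (u * T * (b / (2 * a))) * (a / b) = T\<^sup>2 * u / 2" if "a \<noteq> 0" "b \<noteq> 0" for T a b :: real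
        using that by (simp add: power2_eq_square)
      from this[of "real (Suc n)" "real (Suc (Suc n))" ?t] show ?thesis unfolding eq by simp
    qed
    ultimately show ?thesis using t by simp
  qed
  ultimately show ?case using big uv(2)
    by (intro exI[of _ "u * ?t + v"] exI[of _ "- u"]) auto
qed

text \<open>Negative powers come from the adjugate, which only changes the sign of the coefficient
  of \<open>A\<close>.\<close>

lemma psl_int_pow_span:
  assumes X: "X \<in> carrier PSL2R" and A: "A \<in> X" and tr: "4 \<le> (Re (disk_a A))\<^sup>2"
  shows "\<exists>u v. u *\<^sub>R A + v *\<^sub>R mat 1 \<in> X [^]\<^bsub>PSL2R\<^esub> (k::int) \<and> \<bar>of_int k\<bar> \<le> \<bar>u\<bar> \<and>
     ((Re (disk_a A))\<^sup>2 = 4 \<longrightarrow> \<bar>u\<bar> = \<bar>of_int k\<bar>)"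
proof (cases "k = 0")
  case True
  then show ?thesis using psl_one_mem by (intro exI[of _ 0] exI[of _ 1]) simp
next
  case False
  define n where "n = nat \<bar>k\<bar> - 1"
  have n: "int (Suc n) = \<bar>k\<bar>" using False by (simp add: n_def)
  then have nk: "real (Suc n) = \<bar>of_int k\<bar>" by (metis of_int_abs of_int_of_nat_eq)
  obtain u v where uv: "u *\<^sub>R A + v *\<^sub>R mat 1 \<in> X [^]\<^bsub>PSL2R\<^esub> (Suc n)" "real (Suc n) \<le> \<bar>u\<bar>"
     "(Re (disk_a A))\<^sup>2 = 4 \<Longrightarrow> \<bar>u\<bar> = real (Suc n)" using psl_nat_pow_span[OF assms, of n] by blast
  show ?thesis
  proof (cases "0 < k")
    case True
    then have "X [^]\<^bsub>PSL2R\<^esub> k = X [^]\<^bsub>PSL2R\<^esub> (Suc n)" using n int_pow_int[of PSL2R X "Suc n"] by simp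
    then show ?thesis using uv nk by auto
  next
    case f: False
    then have k: "k = - int (Suc n)" using n False by simp
    have "X [^]\<^bsub>PSL2R\<^esub> k = inv\<^bsub>PSL2R\<^esub> (X [^]\<^bsub>PSL2R\<^esub> (Suc n))"
      unfolding k by (rule PSL.int_pow_neg_int[OF X])
    moreover have "Re (disk_a B) *\<^sub>R mat 1 - B \<in> inv\<^bsub>PSL2R\<^esub> (X [^]\<^bsub>PSL2R\<^esub> (Suc n))" if "B \<in> X [^]\<^bsub>PSL2R\<^esub> (Suc n)" for B
      by (rule psl_inv_mem[OF PSL.nat_pow_closed[OF X] that])
    from this[OF uv(1)] have "(- u) *\<^sub>R A + (Re (disk_a (u *\<^sub>R A + v *\<^sub>R mat 1)) - v) *\<^sub>R mat 1 \<in> inv\<^bsub>PSL2R\<^esub> (X [^]\<^bsub>PSL2R\<^esub> (Suc n))"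
      by (simp add: algebra_simps)
    ultimately show ?thesis using uv nk by (metis abs_minus_cancel)
  qed
qed

lemma boundary_fix_eq:
  assumes X: "X \<in> carrier PSL2R" and A: "A \<in> X"
  shows "boundary_fix X = {z. norm z = 1 \<and> displacement A z = 0}"
  using mobius_disk_fixed_iff[OF psl_mem(1)[OF X A]] unfolding boundary_fix_def psl_mem(2)[OF X A] by auto

text \<open>A boundary fixed point excludes elliptic elements through the trace. If
  \<open>disk_b A\<close> vanished, it would moreover force the whole circle to be fixed, an
  infinite set, whose \<open>card\<close> is 0.\<close>

lemma fixing_element:
  assumes X: "X \<in> carrier PSL2R" and A: "A \<in> X" and c: "card (boundary_fix X) \<noteq> 0"
  shows "disk_b A \<noteq> 0" "4 \<le> (Re (disk_a A))\<^sup>2"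
proof -
  have fin: "finite (boundary_fix X)" using c by (rule contrapos_np) simp
  have ne: "boundary_fix X \<noteq> {}" using c by auto
  then obtain z where z: "norm z = 1" "displacement A z = 0" using boundary_fix_eq[OF X A] by auto
  show "4 \<le> (Re (disk_a A))\<^sup>2" by (rule fixed_point_trace[OF psl_mem(1)[OF X A] z])
  show "disk_b A \<noteq> 0"
  proof
    assume b: "disk_b A = 0"
    then have "Im (disk_a A) = 0" using z unfolding displacement_eq by auto
    with b have "displacement A w = 0" for w unfolding displacement_eq by simp
    then have "boundary_fix X = sphere 0 1" unfolding boundary_fix_eq[OF X A] by (auto simp: sphere_def)
    moreover have "connected (sphere (0::complex) 1)" by (simp add: connected_sphere_eq)
    ultimately have "sphere (0::complex) 1 = {} \<or> (\<exists>a. sphere (0::complex) 1 = {a})"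
      using fin connected_finite_iff_sing by metis
    moreover have "(1::complex) \<in> sphere 0 1" "(-1::complex) \<in> sphere 0 1" by auto
    ultimately show False by (metis empty_iff singletonD one_neq_neg_one)
  qed
qed

text \<open>Otherwise the two square roots of trace squared minus 4 would give two boundary fixed
  points.\<close>

lemma parabolic_trace:
  assumes "is_parabolic X" and A: "A \<in> X"
  shows "(Re (disk_a A))\<^sup>2 = 4"
proof (rule ccontr)
  assume ne: "(Re (disk_a A))\<^sup>2 \<noteq> 4"
  have X: "X \<in> carrier PSL2R" and c: "card (boundary_fix X) = 1" using assms by (auto simp: is_parabolic_def)
  have "card (boundary_fix X) \<noteq> 0" using c by simp
  note f = fixing_element[OF X A this]
  define s where "s = sqrt ((Re (disk_a A))\<^sup>2 - 4)"
  have s: "s\<^sup>2 = (Re (disk_a A))\<^sup>2 - 4" "(- s)\<^sup>2 = (Re (disk_a A))\<^sup>2 - 4" "s \<noteq> 0"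
    using f(2) ne by (auto simp: s_def)
  let ?z = "\<lambda>s. (\<i> * of_real (Im (disk_a A)) + of_real s) / cnj (disk_b A)"
  have "{?z s, ?z (- s)} \<subseteq> boundary_fix X"
    unfolding boundary_fix_eq[OF X A]
    using boundary_fixed_points[OF psl_mem(1)[OF X A] f(1,2) s(1)] boundary_fixed_points[OF psl_mem(1)[OF X A] f(1,2) s(2)] by auto
  moreover have "?z s \<noteq> ?z (- s)"
  proof
    assume "?z s = ?z (- s)"
    then have "?z s * cnj (disk_b A) = ?z (- s) * cnj (disk_b A)" by (rule arg_cong)
    then show False using s(3) f(1) by simp
  qed
  ultimately have "2 \<le> card (boundary_fix X)"
    using card_mono[of "boundary_fix X" "{?z s, ?z (- s)}"] c by (simp add: card_ge_0_finite)
  then show False using c by simp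
qed

section \<open>Hyperbolic distance and Busemann functions\<close>

lemma arcosh_bounds:
  fixes x :: real
  assumes "1 \<le> x"
  shows "ln x \<le> arcosh x" "arcosh x \<le> ln (2 * x)"
proof -
  have "sqrt (x\<^sup>2 - 1) \<le> sqrt (x\<^sup>2)" by (rule real_sqrt_le_mono) simp
  then have s: "0 \<le> sqrt (x\<^sup>2 - 1)" "sqrt (x\<^sup>2 - 1) \<le> x" using assms by (auto intro: real_sqrt_ge_zero)
  show "ln x \<le> arcosh x" "arcosh x \<le> ln (2 * x)"
    unfolding arcosh_real_def[OF assms] using assms by (auto intro!: ln_mono add_pos_nonneg s)
qed

text \<open>The displacement of the \<open>k\<close>-th power is that of \<open>X\<close> times
  \<plusminus>k, so the hyperbolic cosine of the distance is exactly
  \<open>1 + c * k\<^sup>2\<close>. Here \<open>c\<close> is positive because a parabolic element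
  fixes no point of the disk.\<close>

lemma parabolic_hdist:
  assumes "is_parabolic X" and z: "norm z < 1"
  shows "\<exists>C. \<forall>k::int. k \<noteq> 0 \<longrightarrow> \<bar>hdist z (psl_act (X [^]\<^bsub>PSL2R\<^esub> k) z) - 2 * ln \<bar>of_int k\<bar>\<bar> \<le> C"
proof -
  have X: "X \<in> carrier PSL2R" and "card (boundary_fix X) \<noteq> 0" using assms by (auto simp: is_parabolic_def)
  obtain A where A: "A \<in> X" using psl_rep_mem[OF X] by blast
  note X' = psl_mem[OF X A]
  note f = fixing_element[OF X A \<open>card (boundary_fix X) \<noteq> 0\<close>]
  note tr = parabolic_trace[OF assms(1) A]
  define c where "c = (norm (displacement A z))\<^sup>2 / (2 * (1 - (norm z)\<^sup>2)\<^sup>2)"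
  have "1 - (norm z)\<^sup>2 > 0" using z by (simp add: abs_square_less_1)
  then have c: "0 < c" using displacement_interior[OF X'(1) f(1) tr z] by (simp add: c_def)
  have eq: "hdist z (psl_act (X [^]\<^bsub>PSL2R\<^esub> k) z) = arcosh (1 + c * (of_int k)\<^sup>2)" for k :: int
  proof -
    obtain u v where uv: "u *\<^sub>R A + v *\<^sub>R mat 1 \<in> X [^]\<^bsub>PSL2R\<^esub> k" "\<bar>u\<bar> = \<bar>of_int k\<bar>"
      using psl_int_pow_span[OF X A f(2), of k] tr by blast
    note K = psl_mem[OF PSL.int_pow_closed[OF X] uv(1)]
    have "(norm (displacement (u *\<^sub>R A + v *\<^sub>R mat 1) z))\<^sup>2 = u\<^sup>2 * (norm (displacement A z))\<^sup>2"
      unfolding displacement_linear by (simp add: norm_mult power_mult_distrib)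
    also have "u\<^sup>2 = (of_int k)\<^sup>2" using uv(2) by (metis power2_abs)
    finally show ?thesis unfolding K(2) hdist_mobius[OF K(1) z] by (simp add: c_def mult.commute)
  qed
  have "\<bar>hdist z (psl_act (X [^]\<^bsub>PSL2R\<^esub> k) z) - 2 * ln \<bar>of_int k\<bar>\<bar> \<le> \<bar>ln c\<bar> + ln (2 * (1 + c))" if k: "k \<noteq> 0" for k :: int
  proof -
    let ?k = "\<bar>of_int k\<bar> :: real"
    have "1 \<le> \<bar>k\<bar>" using k by simp
    then have "of_int 1 \<le> (of_int \<bar>k\<bar> :: real)" by (simp only: of_int_le_iff)
    then have k1: "1 \<le> ?k" by simp
    have k2: "1 \<le> ?k\<^sup>2" using k1 by (rule one_le_power)
    have lnq: "ln (s * q\<^sup>2) = ln s + 2 * ln q" if "0 < s" "1 \<le> q" for s q :: real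
      using that by (simp add: ln_mult ln_realpow)
    have ge1: "1 \<le> 1 + c * (of_int k)\<^sup>2" using c by simp
    have "ln (c * ?k\<^sup>2) \<le> ln (1 + c * (of_int k)\<^sup>2)" using c k1 by (intro ln_mono) (auto intro!: mult_pos_pos)
    moreover have "ln (c * ?k\<^sup>2) = ln c + 2 * ln ?k" by (rule lnq[OF c k1])
    moreover have "ln (2 * (1 + c * (of_int k)\<^sup>2)) \<le> ln ((2 * (1 + c)) * ?k\<^sup>2)"
      using c k2 by (intro ln_mono) (auto simp: algebra_simps add_pos_nonneg)
    moreover have "ln ((2 * (1 + c)) * ?k\<^sup>2) = ln (2 * (1 + c)) + 2 * ln ?k"
      by (rule lnq[OF _ k1]) (use c in simp)
    moreover have "0 \<le> ln (2 * (1 + c))" using c by simp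
    ultimately show ?thesis unfolding eq using arcosh_bounds[OF ge1] by linarith
  qed
  then show ?thesis by blast
qed

text \<open>Splitting off \<open>ln e\<close> isolates the divergence of a distance when
  \<open>e\<close>, later \<open>1 - (norm z)\<^sup>2\<close>, tends to 0.\<close>

lemma arcosh_quotient:
  fixes p e :: real
  assumes "0 < e" "e \<le> p"
  shows "arcosh (p / e) = ln (p + sqrt (p\<^sup>2 - e\<^sup>2)) - ln e"
proof -
  have "(p / e)\<^sup>2 - 1 = (p\<^sup>2 - e\<^sup>2) / e\<^sup>2" using assms by (simp add: power_divide diff_divide_distrib)
  then have "sqrt ((p / e)\<^sup>2 - 1) = sqrt (p\<^sup>2 - e\<^sup>2) / e" using assms by (simp add: real_sqrt_divide)
  moreover have "e\<^sup>2 \<le> p\<^sup>2" using assms by (intro power_mono) auto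
  then have "0 < p + sqrt (p\<^sup>2 - e\<^sup>2)" using assms by (intro add_pos_nonneg) auto
  moreover have "1 \<le> p / e" using assms by simp
  ultimately show ?thesis using assms by (simp add: arcosh_real_def add_divide_distrib[symmetric] ln_div)
qed

text \<open>In the difference of the two distances the diverging terms \<open>ln (e z)\<close>
  cancel, and the rest extends continuously to \<xi>. The result is the logarithm of the Poisson
  kernel.\<close>

lemma busemann_eq:
  assumes \<xi>: "norm \<xi> = 1" and y: "norm y < 1"
  shows "busemann \<xi> 0 y = ln ((1 - (norm y)\<^sup>2) / (norm (\<xi> - y))\<^sup>2)"
proof -
  define e where "e z = 1 - (norm z)\<^sup>2" for z :: complex
  define p where "p z = e z + 2 * (norm z)\<^sup>2" for z
  define q where "q z = e z + 2 * (norm (y - z))\<^sup>2 / e y" for z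
  define c where "c = 2 * (norm (y - \<xi>))\<^sup>2 / e y"
  have ey: "0 < e y" using y by (simp add: e_def abs_square_less_1)
  have y\<xi>: "y \<noteq> \<xi>" using \<xi> y by auto
  have c: "0 < c" using ey y\<xi> by (simp add: c_def)
  let ?F = "at \<xi> within ball 0 1"
  have "((\<lambda>z. ln (p z + sqrt ((p z)\<^sup>2 - (e z)\<^sup>2)) - ln (q z + sqrt ((q z)\<^sup>2 - (e z)\<^sup>2))) \<longlongrightarrow>
      ln (2 + sqrt (2\<^sup>2 - 0\<^sup>2)) - ln (c + sqrt (c\<^sup>2 - 0\<^sup>2))) ?F"
  proof -
    have e: "(e \<longlongrightarrow> 0) ?F"
    proof -
      have "((\<lambda>z. 1 - (norm z)\<^sup>2) \<longlongrightarrow> 1 - (norm \<xi>)\<^sup>2) ?F" by (intro tendsto_intros)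
      then show ?thesis using \<xi> by (simp add: e_def[abs_def])
    qed
    have "((\<lambda>z. e z + 2 * (norm z)\<^sup>2) \<longlongrightarrow> 0 + 2 * (norm \<xi>)\<^sup>2) ?F" by (intro tendsto_intros e)
    then have p: "(p \<longlongrightarrow> 2) ?F" using \<xi> by (simp add: p_def[abs_def])
    have "((\<lambda>z. e z + 2 * (norm (y - z))\<^sup>2 / e y) \<longlongrightarrow> 0 + 2 * (norm (y - \<xi>))\<^sup>2 / e y) ?F"
      using ey by (intro tendsto_intros e) auto
    then have q: "(q \<longlongrightarrow> c) ?F" by (simp add: q_def[abs_def] c_def)
    show ?thesis using c by (intro tendsto_intros p q e) auto
  qed
  moreover have "ln (2 + sqrt (2\<^sup>2 - 0\<^sup>2)) - ln (c + sqrt (c\<^sup>2 - 0\<^sup>2)) = ln ((1 - (norm y)\<^sup>2) / (norm (\<xi> - y))\<^sup>2)"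
  proof -
    have "ln (2 + sqrt (2\<^sup>2 - 0\<^sup>2)) - ln (c + sqrt (c\<^sup>2 - 0\<^sup>2)) = ln 4 - ln (2 * c)" using c by simp
    also have "\<dots> = ln (4 / (2 * c))" using c by (subst ln_div) auto
    also have "4 / (2 * c) = e y / (norm (\<xi> - y))\<^sup>2" by (simp add: c_def norm_minus_commute)
    finally show ?thesis by (simp add: e_def)
  qed
  moreover have "\<forall>\<^sub>F z in ?F. ln (p z + sqrt ((p z)\<^sup>2 - (e z)\<^sup>2)) - ln (q z + sqrt ((q z)\<^sup>2 - (e z)\<^sup>2)) = hdist 0 z - hdist y z"
  proof -
    have "ln (p z + sqrt ((p z)\<^sup>2 - (e z)\<^sup>2)) - ln (q z + sqrt ((q z)\<^sup>2 - (e z)\<^sup>2)) = hdist 0 z - hdist y z"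
      if z: "z \<in> ball 0 1" for z
    proof -
      have ez: "0 < e z" using z by (simp add: e_def abs_square_less_1)
      have "p z / e z = 1 + 2 * (norm z)\<^sup>2 / e z" using ez by (simp add: p_def add_divide_distrib)
      then have "hdist 0 z = arcosh (p z / e z)" by (simp add: hdist_def e_def)
      also have "\<dots> = ln (p z + sqrt ((p z)\<^sup>2 - (e z)\<^sup>2)) - ln (e z)"
        by (rule arcosh_quotient[OF ez]) (simp add: p_def)
      finally have 1: "hdist 0 z = ln (p z + sqrt ((p z)\<^sup>2 - (e z)\<^sup>2)) - ln (e z)" .
      have "q z / e z = 1 + 2 * (norm (y - z))\<^sup>2 / (e y * e z)" using ez by (simp add: q_def add_divide_distrib)
      then have "hdist y z = arcosh (q z / e z)" by (simp add: hdist_def e_def)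
      also have "\<dots> = ln (q z + sqrt ((q z)\<^sup>2 - (e z)\<^sup>2)) - ln (e z)"
        by (rule arcosh_quotient[OF ez]) (use ey in \<open>simp add: q_def\<close>)
      finally show ?thesis using 1 by simp
    qed
    then show ?thesis by (simp add: eventually_at_filter)
  qed
  ultimately have "((\<lambda>z. hdist 0 z - hdist y z) \<longlongrightarrow> ln ((1 - (norm y)\<^sup>2) / (norm (\<xi> - y))\<^sup>2)) ?F"
    using tendsto_cong by force
  moreover have "\<not> trivial_limit ?F" using \<xi> by (simp add: trivial_limit_within islimpt_ball)
  ultimately show ?thesis unfolding busemann_def by (rule tendsto_Lim[rotated])
qed

text \<open>The Poisson kernel of the image of 0 at the image of \<eta> is the inverse of the
  boundary derivative at \<eta>.\<close>

lemma busemann_psl: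
  assumes X: "X \<in> carrier PSL2R" and \<eta>: "norm \<eta> = 1"
  shows "busemann (psl_act X \<eta>) 0 (psl_act X 0) = 2 * ln (psl_stretch X \<eta>)"
proof -
  note A = psl_mem[OF X psl_rep_mem[OF X]]
  let ?A = "psl_rep X"
  have p: "0 < stretch ?A 0" "0 < stretch ?A \<eta>" using stretch_pos[OF A(1)] \<eta> by auto
  have n: "norm (psl_act X \<eta>) = 1" "norm (psl_act X 0) < 1" using norm_psl_act[OF X] \<eta> by auto
  have "(1 - (norm (psl_act X 0))\<^sup>2) / (norm (psl_act X \<eta> - psl_act X 0))\<^sup>2 = (psl_stretch X \<eta>)\<^sup>2"
  proof -
    have d: "norm (mobius_disk ?A \<eta> - mobius_disk ?A 0) = 1 / (stretch ?A \<eta> * stretch ?A 0)"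
      using mobius_disk_diff[OF A(1), of \<eta> 0] \<eta> by simp
    have o: "1 - (norm (mobius_disk ?A 0))\<^sup>2 = 1 / (stretch ?A 0)\<^sup>2"
      using one_minus_norm_mobius[OF A(1), of 0] by simp
    show ?thesis unfolding A(2,3) d o using p by (simp add: power_divide power_mult_distrib)
  qed
  then show ?thesis unfolding busemann_eq[OF n] A(3) using p by (simp add: ln_realpow)
qed

text \<open>Discreteness makes the points of \<open>D\<close> isolated without making
  \<open>D\<close> closed. Closure under quotients repairs this: along a convergent sequence the
  quotients of consecutive terms tend to the identity, hence eventually equal it, and the sequence
  becomes constant.\<close>

lemma discrete_bounded_finite:
  fixes D :: "(real^2^2) set"
  assumes D: "discrete D" "\<And>A. A \<in> D \<Longrightarrow> det A = 1"
    "\<And>A B. A \<in> D \<Longrightarrow> B \<in> D \<Longrightarrow> (Re (disk_a A) *\<^sub>R mat 1 - A) ** B \<in> D"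
  shows "finite {A \<in> D. norm A \<le> R}"
proof (rule ccontr)
  let ?S = "{A \<in> D. norm A \<le> R}"
  assume inf: "infinite ?S"
  have "bounded ?S" by (auto simp: bounded_iff)
  with inf obtain l where l: "l islimpt ?S" using bounded_infinite_imp_islimpt by blast
  then obtain f where f: "\<And>n. f n \<in> ?S - {l}" "f \<longlonglongrightarrow> l" using islimpt_sequential[of l ?S] by blast
  define g where "g n = (Re (disk_a (f n)) *\<^sub>R mat 1 - f n) ** f (Suc n)" for n
  have ent: "(\<lambda>n. f n $ i $ j) \<longlonglongrightarrow> l $ i $ j" "(\<lambda>n. f (Suc n) $ i $ j) \<longlonglongrightarrow> l $ i $ j" for i j
    by (intro tendsto_vec_nth f(2) LIMSEQ_Suc)+
  have "(\<lambda>n. det (f n)) \<longlonglongrightarrow> det l" unfolding det_2 by (intro tendsto_intros ent)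
  moreover have "(\<lambda>n. det (f n)) = (\<lambda>n. 1)" using f(1) D(2) by auto
  ultimately have dl: "det l = 1" using LIMSEQ_unique[OF _ tendsto_const] by auto
  have "(\<lambda>n. g n $ i $ j) \<longlonglongrightarrow> ((Re (disk_a l) *\<^sub>R mat 1 - l) ** l) $ i $ j" for i j
    unfolding g_def matrix_matrix_mult_def disk_a_def by (simp add: sum_2 mat_def) (intro conjI impI tendsto_intros ent)
  then have g: "g \<longlonglongrightarrow> mat 1" unfolding adjugate_2[OF dl] by (intro vec_tendstoI)
  have one: "mat 1 \<in> D" using D(3)[of "f 0" "f 0"] adjugate_2[of "f 0"] D(2)[of "f 0"] f(1)[of 0] by auto
  then obtain U where U: "open U" "U \<inter> D = {mat 1}" using D(1) by (auto simp: discrete_def isolated_in_def)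
  then have "mat 1 \<in> U" by blast
  then have "\<forall>\<^sub>F n in sequentially. g n \<in> U" using g U(1) topological_tendstoD by blast
  then obtain N where N: "\<And>n. n \<ge> N \<Longrightarrow> g n \<in> U" by (auto simp: eventually_sequentially)
  have step: "f (Suc n) = f n" if "n \<ge> N" for n
  proof -
    have fD: "f n \<in> D" "f (Suc n) \<in> D" using f(1) by blast+
    have "g n \<in> D" unfolding g_def by (rule D(3)[OF fD])
    then have "g n = mat 1" using N[OF that] U(2) by blast
    moreover have "f n ** g n = f (Suc n)"
    proof -
      have "f n ** (Re (disk_a (f n)) *\<^sub>R mat 1 - f n) = mat 1"
        using adjugate_2[OF D(2)[OF fD(1)]] matrix_left_right_inverse by blast
      then show ?thesis unfolding g_def matrix_mul_assoc by simp
    qed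
    ultimately show ?thesis by simp
  qed
  have "f n = f N" if "n \<ge> N" for n using that by (induction rule: dec_induct) (auto simp: step)
  then have "\<forall>\<^sub>F n in sequentially. f n = f N" unfolding eventually_sequentially by blast
  then have "f \<longlonglongrightarrow> f N" by (rule tendsto_eventually)
  then have "l = f N" using f(2) LIMSEQ_unique by blast
  then show False using f(1)[of N] by simp
qed

lemma norm_matrix_le: "det A = 1 \<Longrightarrow> norm A \<le> 8 * stretch A 0" for A :: "real^2^2"
proof -
  assume A: "det A = 1"
  let ?s = "stretch A 0"
  have ab: "norm (disk_a A) = 2 * ?s" "norm (disk_b A) \<le> 2 * ?s"
    using norm_disk_b_less(1)[OF A] by (simp_all add: stretch_0)
  have "\<bar>A$1$1 + A$2$2\<bar> \<le> 2 * ?s" "\<bar>A$1$2 - A$2$1\<bar> \<le> 2 * ?s" "\<bar>A$1$1 - A$2$2\<bar> \<le> 2 * ?s" "\<bar>A$1$2 + A$2$1\<bar> \<le> 2 * ?s"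
    using abs_Re_le_cmod[of "disk_a A"] abs_Im_le_cmod[of "disk_a A"] abs_Re_le_cmod[of "disk_b A"] abs_Im_le_cmod[of "disk_b A"] ab
    by (auto simp: disk_a_def disk_b_def)
  then have e: "\<bar>A$1$1\<bar> \<le> 2 * ?s" "\<bar>A$1$2\<bar> \<le> 2 * ?s" "\<bar>A$2$1\<bar> \<le> 2 * ?s" "\<bar>A$2$2\<bar> \<le> 2 * ?s" by linarith+
  have "norm A \<le> (\<Sum>i\<in>UNIV. norm (A$i))" unfolding norm_vec_def by (rule L2_set_le_sum) simp
  also have "\<dots> \<le> (\<Sum>i\<in>UNIV. \<Sum>j\<in>UNIV. \<bar>A$i$j\<bar>)" by (intro sum_mono norm_le_l1_cart)
  also have "\<dots> \<le> 8 * ?s" using e by (simp add: sum_2)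
  finally show ?thesis .
qed

text \<open>The stretch at 0 controls the norm of both representing matrices, which reduces the
  claim to bounded sets of matrices.\<close>

lemma discrete_group_finite:
  assumes \<Gamma>: "subgroup \<Gamma> PSL2R" and d: "discrete (\<Union>\<Gamma>)"
  shows "finite {X \<in> \<Gamma>. psl_stretch X 0 \<le> R}"
proof -
  have sub: "X \<in> carrier PSL2R" if "X \<in> \<Gamma>" for X using subgroup.subset[OF \<Gamma>] that by blast
  have "finite {A \<in> \<Union>\<Gamma>. norm A \<le> 8 * R}"
  proof (rule discrete_bounded_finite[OF d])
    show "det A = 1" if "A \<in> \<Union>\<Gamma>" for A using that psl_mem(1)[OF sub] by blast
    fix A B assume "A \<in> \<Union>\<Gamma>" "B \<in> \<Union>\<Gamma>"
    then obtain X Y where XY: "X \<in> \<Gamma>" "A \<in> X" "Y \<in> \<Gamma>" "B \<in> Y" by blast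
    have "inv\<^bsub>PSL2R\<^esub> X \<otimes>\<^bsub>PSL2R\<^esub> Y \<in> \<Gamma>"
      using XY \<Gamma> by (simp add: subgroup.m_inv_closed subgroup.m_closed)
    then show "(Re (disk_a A) *\<^sub>R mat 1 - A) ** B \<in> \<Union>\<Gamma>"
      using psl_mult_mem[OF psl_inv_mem[OF sub[OF XY(1)] XY(2)] XY(4)] by blast
  qed
  moreover have "{X \<in> \<Gamma>. psl_stretch X 0 \<le> R} \<subseteq> (\<lambda>A. {A, - A}) ` {A \<in> \<Union>\<Gamma>. norm A \<le> 8 * R}"
  proof
    fix X assume X: "X \<in> {X \<in> \<Gamma>. psl_stretch X 0 \<le> R}"
    then have c: "X \<in> carrier PSL2R" using sub by blast
    note m = psl_mem[OF c psl_rep_mem[OF c]]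
    have "norm (psl_rep X) \<le> 8 * R" using norm_matrix_le[OF m(1)] X m(3) by simp
    then show "X \<in> (\<lambda>A. {A, - A}) ` {A \<in> \<Union>\<Gamma>. norm A \<le> 8 * R}"
      using m(4) psl_rep_mem[OF c] X by (intro image_eqI[of _ _ "psl_rep X"]) auto
  qed
  ultimately show ?thesis by (rule finite_surj)
qed

section \<open>Schottky groups\<close>

lemma adm_subset: "adm E gen w l \<Longrightarrow> set w \<subseteq> E"
  by (induction w) auto

lemma adm_last: "adm E gen w l \<Longrightarrow> w \<noteq> [] \<Longrightarrow> gen (last w) \<noteq> l"
proof (induction w)
  case (Cons e w)
  then show ?case by (cases w) auto
qed simp

lemma lead_ne: "w \<noteq> [] \<Longrightarrow> lead gen w l = gen (hd w)"
  by (cases w) auto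

text \<open>There is one set \<open>C a\<close> per generator; for a hyperbolic one it will be the
  union of the neighborhoods of its two fixed points. In this form ping-pong reads the same for
  hyperbolic and parabolic generators.\<close>

locale schottky = group G for G :: "('g, 'm) monoid_scheme" (structure) +
  fixes \<rho> :: "'g \<Rightarrow> (real^2^2) set" and \<A> :: "'g set" and C :: "'g \<Rightarrow> complex set"
  assumes hom: "\<rho> \<in> hom G PSL2R" and disc: "discrete (\<Union>(\<rho> ` carrier G))"
    and gens: "\<A> \<subseteq> carrier G" "finite \<A>"
    and three: "\<And>a b. \<exists>c\<in>\<A>. c \<noteq> a \<and> c \<noteq> b"
    and C: "\<And>a. a \<in> \<A> \<Longrightarrow> compact (C a)" "\<And>a. a \<in> \<A> \<Longrightarrow> C a \<subseteq> sphere 0 1" "\<And>a. a \<in> \<A> \<Longrightarrow> C a \<noteq> {}"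
      "\<And>a b. a \<in> \<A> \<Longrightarrow> b \<in> \<A> \<Longrightarrow> a \<noteq> b \<Longrightarrow> C a \<inter> C b = {}"
    and ping: "\<And>a n z. a \<in> \<A> \<Longrightarrow> n \<noteq> 0 \<Longrightarrow> norm z = 1 \<Longrightarrow> z \<notin> C a \<Longrightarrow> psl_act (\<rho> (a [^] (n::int))) z \<in> C a"
begin

abbreviation "E \<equiv> alphabet \<A>"

definition letter :: "'g \<times> int \<Rightarrow> 'g" where
  "letter e = fst e [^] snd e"

definition word :: "('g \<times> int) list \<Rightarrow> 'g" where
  "word w = foldr (\<lambda>e g. letter e \<otimes> g) w \<one>"

definition bact :: "'g \<times> int \<Rightarrow> complex \<Rightarrow> complex" where
  "bact e z = psl_act (\<rho> (letter e)) z"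

definition st :: "('g \<times> int) list \<Rightarrow> complex \<Rightarrow> real" where
  "st w z = psl_stretch (\<rho> (word w)) z"

text \<open>Minus the logarithm of the boundary derivative. It becomes the geometric potential when
  \<open>z\<close> is the limit point of the shifted sequence.\<close>

definition pot :: "'g \<times> int \<Rightarrow> complex \<Rightarrow> real" where
  "pot e z = 2 * ln (psl_stretch (\<rho> (letter e)) z)"

sublocale hom: group_hom G PSL2R \<rho>
  using hom by unfold_locales (simp add: group_PSL2R)

lemma letter_closed: "e \<in> E \<Longrightarrow> letter e \<in> carrier G"
  using gens(1) by (auto simp: letter_def alphabet_def)

lemma word_simps [simp]: "word [] = \<one>" "word (e # w) = letter e \<otimes> word w"
  by (simp_all add: word_def)

lemma word_closed: "set w \<subseteq> E \<Longrightarrow> word w \<in> carrier G"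
  by (induction w) (auto simp: letter_closed)

lemma \<rho>_closed: "g \<in> carrier G \<Longrightarrow> \<rho> g \<in> carrier PSL2R"
  by (rule hom.hom_closed)

lemma psl_act_hom:
  assumes "g \<in> carrier G" "h \<in> carrier G" "norm z \<le> 1"
  shows "psl_act (\<rho> (g \<otimes> h)) z = psl_act (\<rho> g) (psl_act (\<rho> h) z)"
    "psl_stretch (\<rho> (g \<otimes> h)) z = psl_stretch (\<rho> g) (psl_act (\<rho> h) z) * psl_stretch (\<rho> h) z"
  using psl_act_mult[of "\<rho> g" "\<rho> h" z] assms by (simp_all add: \<rho>_closed)

lemma norm_act:
  assumes "g \<in> carrier G"
  shows "norm z = 1 \<Longrightarrow> norm (psl_act (\<rho> g) z) = 1" "norm z < 1 \<Longrightarrow> norm (psl_act (\<rho> g) z) < 1"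
    "norm z \<le> 1 \<Longrightarrow> norm (psl_act (\<rho> g) z) \<le> 1"
proof -
  show 1: "norm z = 1 \<Longrightarrow> norm (psl_act (\<rho> g) z) = 1" by (rule norm_psl_act[OF \<rho>_closed[OF assms]])
  show 2: "norm z < 1 \<Longrightarrow> norm (psl_act (\<rho> g) z) < 1" by (rule norm_psl_act[OF \<rho>_closed[OF assms]])
  show "norm z \<le> 1 \<Longrightarrow> norm (psl_act (\<rho> g) z) \<le> 1" using 1 2 by linarith
qed

lemma psl_stretch_pos: "g \<in> carrier G \<Longrightarrow> norm z \<le> 1 \<Longrightarrow> 0 < psl_stretch (\<rho> g) z"
  using stretch_pos[OF psl_rep(1)[OF \<rho>_closed]] by (simp add: psl_stretch_def)

lemma foldr_bact: "set w \<subseteq> E \<Longrightarrow> norm z \<le> 1 \<Longrightarrow> foldr bact w z = psl_act (\<rho> (word w)) z"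
proof (induction w)
  case (Cons e w)
  then show ?case
    using psl_act_hom(1)[OF letter_closed word_closed, of e w z] unfolding word_simps by (simp add: bact_def)
qed (simp add: psl_act_one)

lemma cocycle_pot: "set w \<subseteq> E \<Longrightarrow> norm z \<le> 1 \<Longrightarrow> cocycle bact pot w z = 2 * ln (st w z)"
proof (induction w)
  case Nil
  then show ?case by (simp add: st_def psl_act_one)
next
  case (Cons e w)
  then have w: "set w \<subseteq> E" and e: "e \<in> E" by auto
  have "st (e # w) z = psl_stretch (\<rho> (letter e)) (psl_act (\<rho> (word w)) z) * st w z"
    unfolding st_def word_simps by (rule psl_act_hom(2)[OF letter_closed[OF e] word_closed[OF w] Cons.prems(2)])
  moreover have "0 < psl_stretch (\<rho> (letter e)) (psl_act (\<rho> (word w)) z)" "0 < st w z"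
    unfolding st_def using norm_act(3)[OF word_closed[OF w]] Cons.prems(2) by (auto intro!: psl_stretch_pos letter_closed[OF e] word_closed[OF w])
  ultimately show ?case
    using Cons w by (simp add: pot_def foldr_bact ln_mult)
qed

lemma hd_last_gen: "adm E fst w l \<Longrightarrow> w \<noteq> [] \<Longrightarrow> fst (hd w) \<in> \<A> \<and> fst (last w) \<in> \<A>"
proof -
  assume "adm E fst w l" "w \<noteq> []"
  then have "hd w \<in> E" "last w \<in> E" using adm_subset[of E fst w l] by auto
  then show ?thesis by (auto simp: alphabet_def)
qed

lemma act_letter: "e \<in> E \<Longrightarrow> norm z = 1 \<Longrightarrow> z \<notin> C (fst e) \<Longrightarrow> bact e z \<in> C (fst e)"
  using ping by (auto simp: bact_def letter_def alphabet_def)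

lemma C_norm: "a \<in> \<A> \<Longrightarrow> z \<in> C a \<Longrightarrow> norm z = 1"
  using C(2) by fastforce

lemma C_disj: "a \<in> \<A> \<Longrightarrow> b \<in> \<A> \<Longrightarrow> z \<in> C a \<Longrightarrow> z \<in> C b \<Longrightarrow> a = b"
  using C(4) by blast

text \<open>Ping-pong: consecutive letters have different generators, so each one finds the point
  outside its own neighborhood.\<close>

lemma act_word:
  "adm E fst w l \<Longrightarrow> w \<noteq> [] \<Longrightarrow> norm z = 1 \<Longrightarrow> z \<notin> C (fst (last w)) \<Longrightarrow> foldr bact w z \<in> C (fst (hd w))"
proof (induction w)
  case (Cons e w)
  show ?case
  proof (cases "w = []")
    case True
    then show ?thesis using Cons.prems by (simp add: act_letter)
  next
    case False
    then have IH: "foldr bact w z \<in> C (fst (hd w))" using Cons by simp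
    have m: "fst (hd w) \<in> \<A>" "fst e \<in> \<A>" "fst e \<noteq> fst (hd w)"
      using hd_last_gen[of w l] hd_last_gen[of "e # w" l] Cons.prems False by (auto simp: lead_ne)
    then have "foldr bact w z \<notin> C (fst e)" using C_disj IH by blast
    then show ?thesis using act_letter[of e "foldr bact w z"] C_norm[OF m(1) IH] Cons.prems by simp
  qed
qed simp

lemma act_word_adm:
  assumes "adm E fst w l" "l \<in> \<A>" "z \<in> C l"
  shows "foldr bact w z \<in> C (lead fst w l)"
proof (cases "w = []")
  case False
  have "fst (last w) \<noteq> l" using adm_last[OF assms(1) False] .
  then have "z \<notin> C (fst (last w))" using hd_last_gen[OF assms(1) False] C_disj assms(2,3) by blast
  from act_word[OF assms(1) False C_norm[OF assms(2,3)] this] False show ?thesis by (simp add: lead_ne)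
qed (use assms in simp)

lemma separation: "\<exists>e>0. \<forall>a\<in>\<A>. \<forall>b\<in>\<A>. a \<noteq> b \<longrightarrow> (\<forall>x\<in>C a. \<forall>y\<in>C b. e \<le> norm (x - y))"
proof -
  have "\<exists>e>0. \<forall>x\<in>C a. \<forall>y\<in>C b. e \<le> norm (x - y)" if "a \<in> \<A>" "b \<in> \<A>" "a \<noteq> b" for a b
    using separate_compact_closed[OF C(1)[OF that(1)] compact_imp_closed[OF C(1)[OF that(2)]] C(4)[OF that]]
    by (auto simp: dist_norm)
  then have "\<forall>p\<in>{(a, b). a \<in> \<A> \<and> b \<in> \<A> \<and> a \<noteq> b}. \<exists>e>0. \<forall>x\<in>C (fst p). \<forall>y\<in>C (snd p). e \<le> norm (x - y)" by auto
  from bchoice[OF this] obtain f where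
    f0: "\<forall>p\<in>{(a, b). a \<in> \<A> \<and> b \<in> \<A> \<and> a \<noteq> b}. 0 < f p \<and> (\<forall>x\<in>C (fst p). \<forall>y\<in>C (snd p). f p \<le> norm (x - y))" ..
  have f: "0 < f (a, b) \<and> (\<forall>x\<in>C a. \<forall>y\<in>C b. f (a, b) \<le> norm (x - y))" if "a \<in> \<A>" "b \<in> \<A>" "a \<noteq> b" for a b
    using bspec[OF f0, of "(a, b)"] that by simp
  let ?P = "{(a, b). a \<in> \<A> \<and> b \<in> \<A> \<and> a \<noteq> b}"
  have fin: "finite (insert 1 (f ` ?P))"
    by (intro finite.insertI finite_imageI finite_subset[OF _ finite_cartesian_product[OF gens(2) gens(2)]]) auto
  define e where "e = Min (insert 1 (f ` ?P))"
  have "0 < e" unfolding e_def using fin f by (subst Min_gr_iff) auto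
  moreover have "e \<le> norm (x - y)" if "a \<in> \<A>" "b \<in> \<A>" "a \<noteq> b" "x \<in> C a" "y \<in> C b" for a b x y
  proof -
    have "e \<le> f (a, b)" unfolding e_def using fin that by (intro Min_le) auto
    with f[OF that(1-3)] that(4,5) show ?thesis by force
  qed
  ultimately show ?thesis by blast
qed

definition size :: "('g \<times> int) list \<Rightarrow> real" where
  "size w = st w 0"

definition pole :: "('g \<times> int) list \<Rightarrow> complex" where
  "pole w = disk_center (psl_rep (\<rho> (word w)))"

lemma rep_facts:
  assumes "set w \<subseteq> E"
  shows "det (psl_rep (\<rho> (word w))) = 1" "psl_act (\<rho> (word w)) = mobius_disk (psl_rep (\<rho> (word w)))"
    "\<And>z. st w z = stretch (psl_rep (\<rho> (word w))) z"
proof -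
  have c: "\<rho> (word w) \<in> carrier PSL2R" by (intro \<rho>_closed word_closed assms)
  note m = psl_mem[OF c psl_rep_mem[OF c]]
  show "det (psl_rep (\<rho> (word w))) = 1" "psl_act (\<rho> (word w)) = mobius_disk (psl_rep (\<rho> (word w)))"
    "\<And>z. st w z = stretch (psl_rep (\<rho> (word w))) z" using m by (simp_all add: st_def)
qed

lemma st_size: "set w \<subseteq> E \<Longrightarrow> norm z = 1 \<Longrightarrow> st w z = size w * norm (z - pole w)"
  using stretch_sphere[OF rep_facts(1)] by (simp add: rep_facts(3) size_def pole_def)

lemma size_ge_1: "set w \<subseteq> E \<Longrightarrow> 1 \<le> size w"
  using stretch_0_ge_1[OF rep_facts(1)] by (simp add: rep_facts(3) size_def)

text \<open>Two points in distinct neighborhoods other than that of the head letter have preimages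
  in the neighborhood of the last letter. These preimages are far from \<open>z\<close> while their
  images are far apart, which is the situation of \<open>center_separated\<close>. The bound
  \<epsilon> \<le> 1 serves the empty word in \<open>word_estimates\<close>.\<close>

lemma pole_separated: "\<exists>\<epsilon>>0. \<epsilon> \<le> 1 \<and> (\<forall>w l z. w \<noteq> [] \<longrightarrow> l \<in> \<A> \<longrightarrow> adm E fst w l \<longrightarrow> z \<in> C l \<longrightarrow> \<epsilon> \<le> norm (z - pole w))"
proof -
  obtain e where e: "0 < e" "\<And>a b x y. a \<in> \<A> \<Longrightarrow> b \<in> \<A> \<Longrightarrow> a \<noteq> b \<Longrightarrow> x \<in> C a \<Longrightarrow> y \<in> C b \<Longrightarrow> e \<le> norm (x - y)"
    using separation by blast
  define \<epsilon> where "\<epsilon> = min 1 (e / (1 + 4 / e))"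
  have "0 < \<epsilon>" using e(1) by (simp add: \<epsilon>_def add_pos_pos)
  moreover have "\<epsilon> \<le> norm (z - pole w)" if w: "w \<noteq> []" "adm E fst w l" and l: "l \<in> \<A>" and z: "z \<in> C l" for w l z
  proof -
    let ?X = "\<rho> (word w)" and ?a = "fst (hd w)" and ?b = "fst (last w)"
    note ab = hd_last_gen[OF w(2,1)] and sw = adm_subset[OF w(2)]
    have X: "?X \<in> carrier PSL2R" by (intro \<rho>_closed word_closed sw)
    have bl: "?b \<noteq> l" by (rule adm_last[OF w(2,1)])
    obtain c1 where c1: "c1 \<in> \<A>" "c1 \<noteq> ?a" using three by blast
    obtain c2 where c2: "c2 \<in> \<A>" "c2 \<noteq> ?a" "c2 \<noteq> c1" using three by blast
    obtain \<xi>1 \<xi>2 where \<xi>: "\<xi>1 \<in> C c1" "\<xi>2 \<in> C c2" using C(3) c1(1) c2(1) by blast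
    \<comment> \<open>Were the preimage outside \<open>C ?b\<close>, the word would send it into
      \<open>C ?a\<close>, which is disjoint from \<open>C c\<close>.\<close>
    have pre: "\<exists>\<eta>. \<eta> \<in> C ?b \<and> psl_act ?X \<eta> = \<xi>" if c: "c \<in> \<A>" "c \<noteq> ?a" "\<xi> \<in> C c" for c \<xi>
    proof (intro exI conjI)
      let ?\<eta> = "psl_act (inv\<^bsub>PSL2R\<^esub> ?X) \<xi>"
      have n: "norm \<xi> = 1" by (rule C_norm[OF c(1,3)])
      have n': "norm ?\<eta> = 1" by (rule norm_psl_act(1)[OF PSL.inv_closed[OF X] n])
      show eq: "psl_act ?X ?\<eta> = \<xi>" by (rule psl_act_inv[OF X]) (use n in simp)
      show "?\<eta> \<in> C ?b"
      proof (rule ccontr)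
        assume "?\<eta> \<notin> C ?b"
        from act_word[OF w(2,1) n' this] have "\<xi> \<in> C ?a" using foldr_bact[OF sw, of ?\<eta>] n' eq by simp
        then show False using C_disj[OF _ c(1) _ c(3)] ab c(2) by blast
      qed
    qed
    obtain \<eta>1 where \<eta>1: "\<eta>1 \<in> C ?b" "psl_act ?X \<eta>1 = \<xi>1" using pre[OF c1 \<xi>(1)] by blast
    obtain \<eta>2 where \<eta>2: "\<eta>2 \<in> C ?b" "psl_act ?X \<eta>2 = \<xi>2" using pre[OF c2(1,2) \<xi>(2)] by blast
    have "e / (1 + 4 / e) \<le> norm (z - disk_center (psl_rep ?X))"
    proof (rule center_separated[OF rep_facts(1)[OF sw] e(1), of \<eta>1 \<eta>2])
      show "norm \<eta>1 = 1" "norm \<eta>2 = 1" "norm z = 1" using C_norm ab \<eta>1 \<eta>2 l z by blast+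
      show "e \<le> norm (mobius_disk (psl_rep ?X) \<eta>1 - mobius_disk (psl_rep ?X) \<eta>2)"
        using e(2)[OF c1(1) c2(1) c2(3)[symmetric] \<xi>] \<eta>1(2) \<eta>2(2) rep_facts(2)[OF sw] by simp
      show "e \<le> norm (z - \<eta>1)" "e \<le> norm (z - \<eta>2)" using e(2)[OF l _ bl[symmetric] z] ab \<eta>1(1) \<eta>2(1) by blast+
    qed
    then show ?thesis by (simp add: \<epsilon>_def pole_def)
  qed
  moreover have "\<epsilon> \<le> 1" by (simp add: \<epsilon>_def)
  ultimately show ?thesis by blast
qed

lemma act_diff:
  assumes "set w \<subseteq> E" "norm z \<le> 1" "norm z' \<le> 1"
  shows "norm (foldr bact w z - foldr bact w z') = norm (z - z') / (st w z * st w z')"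
  using mobius_disk_diff[OF rep_facts(1)[OF assms(1)] assms(2,3)] assms
  by (simp add: foldr_bact rep_facts(2,3))

text \<open>A point outside all neighborhoods detects the head letter. The neighborhood that is
  reached reveals its generator; if the exponents differed, a nontrivial power of it would map one
  point outside its neighborhood to another such point.\<close>

lemma word_inj:
  assumes z: "norm z = 1" "\<forall>a\<in>\<A>. z \<notin> C a"
  shows "adm E fst u l \<Longrightarrow> adm E fst v l' \<Longrightarrow> foldr bact u z = foldr bact v z \<Longrightarrow> u = v"
proof (induction u arbitrary: v)
  case Nil
  show ?case
  proof (rule ccontr)
    assume "[] \<noteq> v"
    then have "foldr bact v z \<in> C (fst (hd v))" "fst (hd v) \<in> \<A>"
      using act_word[OF Nil(2) _ z(1)] z(2) hd_last_gen[OF Nil(2)] by auto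
    with Nil z show False by simp
  qed
next
  case (Cons e u)
  have inC: "foldr bact w z \<in> C (fst (hd w))" "fst (hd w) \<in> \<A>" if "adm E fst w l" "w \<noteq> []" for w l
    using act_word[OF that z(1)] z(2) hd_last_gen[OF that] by auto
  have ne: "v \<noteq> []"
  proof
    assume "v = []"
    then show False using Cons.prems inC[OF Cons.prems(1)] z by simp
  qed
  then obtain f v' where v: "v = f # v'" by (cases v) auto
  have e: "e \<in> E" "fst e \<in> \<A>" and f: "f \<in> E" "fst f \<in> \<A>" and adm: "adm E fst u l" "adm E fst v' l'"
    using Cons.prems v inC[OF Cons.prems(1)] inC[OF Cons.prems(2)] by auto
  have fe: "fst e = fst f" using C_disj[OF e(2) f(2)] inC[OF Cons.prems(1)] inC[OF Cons.prems(2)] Cons.prems(3) v by simp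
  let ?x = "foldr bact u z" and ?y = "foldr bact v' z"
  have out: "foldr bact w z \<notin> C (fst g)" "norm (foldr bact w z) = 1" if "adm E fst (g # w) k" for g w k
  proof -
    show "norm (foldr bact w z) = 1"
      using that foldr_bact[OF adm_subset[of E fst w k]] z(1) norm_act(1)[OF word_closed[OF adm_subset[of E fst w k]]] by auto
    have g: "fst g \<in> \<A>" using hd_last_gen[OF that] by simp
    show "foldr bact w z \<notin> C (fst g)"
    proof (cases "w = []")
      case False
      have "foldr bact w z \<in> C (fst (hd w))" "fst (hd w) \<in> \<A>" using inC[of w k] that False by auto
      then show ?thesis using C_disj[OF _ g, of "fst (hd w)" "foldr bact w z"] that False by (auto simp: lead_ne)
    qed (use z(2) g in simp)
  qed
  note x = out[OF Cons.prems(1)] and y = out[OF Cons.prems(2)[unfolded v]]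
  have eq: "bact e ?x = bact f ?y" using Cons.prems(3) v by simp
  have a: "fst e \<in> carrier G" using e(2) gens(1) by blast
  have "psl_act (\<rho> (fst e [^] (snd e - snd f))) ?x = ?y"
  proof -
    have "fst e [^] (snd e - snd f) = fst e [^] (- snd f) \<otimes> (fst e [^] snd e)"
      using int_pow_mult[OF a, of "- snd f" "snd e"] by simp
    then have "psl_act (\<rho> (fst e [^] (snd e - snd f))) ?x = psl_act (\<rho> (fst e [^] (- snd f))) (bact e ?x)"
      using psl_act_hom(1)[of "fst e [^] (- snd f)" "fst e [^] snd e" ?x] a x by (simp add: bact_def letter_def)
    also have "\<dots> = psl_act (\<rho> (fst e [^] (- snd f))) (psl_act (\<rho> (fst e [^] snd f)) ?y)"
      unfolding eq by (simp add: bact_def letter_def fe)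
    also have "\<dots> = psl_act (\<rho> (fst e [^] (- snd f) \<otimes> fst e [^] snd f)) ?y"
      using psl_act_hom(1)[of "fst e [^] (- snd f)" "fst e [^] snd f" ?y] a y by simp
    also have "fst e [^] (- snd f) \<otimes> fst e [^] snd f = \<one>"
      using int_pow_mult[OF a, of "- snd f" "snd f"] by simp
    finally show ?thesis by (simp add: psl_act_one)
  qed
  then have "snd e = snd f"
    using ping[OF e(2), of "snd e - snd f" ?x] x y fe by (cases "snd e = snd f") auto
  with fe have ef: "e = f" by (simp add: prod_eq_iff)
  have "?x = ?y"
  proof -
    have l: "letter e \<in> carrier G" by (rule letter_closed[OF e(1)])
    have X: "\<rho> (letter e) \<in> carrier PSL2R" by (rule \<rho>_closed[OF l])
    have "psl_act (\<rho> (inv (letter e) \<otimes> letter e)) t = psl_act (\<rho> (inv (letter e))) (bact e t)" if "norm t = 1" for t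
      unfolding bact_def using that l by (intro psl_act_hom(1)) auto
    then have "t = psl_act (\<rho> (inv (letter e))) (bact e t)" if "norm t = 1" for t
      using that l by (simp add: psl_act_one)
    from this[OF x(2)] this[OF y(2)] eq ef show ?thesis by simp
  qed
  from Cons.IH[OF adm this] ef v show ?case by simp
qed

text \<open>The connected circle is not a disjoint union of finitely many, at least two, nonempty
  closed sets.\<close>

lemma free_point: "\<exists>z. norm z = 1 \<and> (\<forall>a\<in>\<A>. z \<notin> C a)"
proof (rule ccontr)
  assume "\<nexists>z. norm z = 1 \<and> (\<forall>a\<in>\<A>. z \<notin> C a)"
  then have cover: "\<exists>a\<in>\<A>. z \<in> C a" if "norm z = 1" for z using that by blast
  obtain a where a: "a \<in> \<A>" using three by blast
  obtain b where b: "b \<in> \<A>" "b \<noteq> a" using three by blast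
  let ?B = "\<Union>c\<in>\<A> - {a}. C c"
  have "closed ?B" using gens(2) C(1) by (intro closed_UN) (auto intro: compact_imp_closed)
  moreover have "closed (C a)" using C(1)[OF a] by (rule compact_imp_closed)
  moreover have "sphere 0 1 \<subseteq> C a \<union> ?B" using cover by fastforce
  moreover have "C a \<inter> ?B \<inter> sphere 0 1 = {}" using C(4)[OF a] by blast
  moreover have "C a \<inter> sphere 0 1 \<noteq> {}" using C(2,3)[OF a] by blast
  moreover have "?B \<inter> sphere 0 1 \<noteq> {}" using C(2,3)[OF b(1)] b by blast
  moreover have "connected (sphere (0::complex) 1)" by (simp add: connected_sphere_eq)
  ultimately show False unfolding connected_closed by blast
qed

text \<open>There are finitely many elements of bounded size, and by \<open>word_inj\<close> each of
  them is represented by at most one admissible word; so words of bounded size have bounded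
  length.\<close>

lemma size_large: "\<exists>N. \<forall>w l. adm E fst w l \<longrightarrow> N \<le> length w \<longrightarrow> R < size w"
proof -
  obtain z where z: "norm z = 1" "\<forall>a\<in>\<A>. z \<notin> C a" using free_point by blast
  let ?S = "{w. (\<exists>l. adm E fst w l) \<and> size w \<le> R}"
  have "subgroup (\<rho> ` carrier G) PSL2R" by (rule hom.img_is_subgroup)
  from discrete_group_finite[OF this disc] have fin: "finite {X \<in> \<rho> ` carrier G. psl_stretch X 0 \<le> R}" .
  have "inj_on (\<lambda>w. \<rho> (word w)) ?S"
  proof (rule inj_onI)
    fix u v assume u: "u \<in> ?S" and v: "v \<in> ?S" and eq: "\<rho> (word u) = \<rho> (word v)"
    then obtain l l' where a: "adm E fst u l" "adm E fst v l'" by blast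
    have "foldr bact u z = foldr bact v z"
      using foldr_bact[OF adm_subset[OF a(1)], of z] foldr_bact[OF adm_subset[OF a(2)], of z] z(1) eq by simp
    then show "u = v" by (rule word_inj[OF z a])
  qed
  moreover have "(\<lambda>w. \<rho> (word w)) ` ?S \<subseteq> {X \<in> \<rho> ` carrier G. psl_stretch X 0 \<le> R}"
    using word_closed[OF adm_subset[of E fst]] by (auto simp: size_def st_def)
  ultimately have "finite ?S" using fin by (meson inj_on_finite)
  then have "finite (length ` ?S)" by (rule finite_imageI)
  then obtain N where N: "\<And>w. w \<in> ?S \<Longrightarrow> length w < N"
    by (metis (no_types, lifting) finite_nat_set_iff_bounded imageI)
  show ?thesis
  proof (intro exI[of _ N] allI impI)
    fix w l assume w: "adm E fst w l" "N \<le> length w"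
    show "R < size w"
    proof (rule ccontr)
      assume "\<not> R < size w"
      with w(1) have "w \<in> ?S" by auto
      from N[OF this] w(2) show False by simp
    qed
  qed
qed

end

section \<open>Coding of limit points and the geometric potential\<close>

context schottky begin

lemma word_append: "set u \<subseteq> E \<Longrightarrow> set v \<subseteq> E \<Longrightarrow> word (u @ v) = word u \<otimes> word v"
  by (induction u) (auto simp: word_closed letter_closed m_assoc)

lemma shift_E: "x \<in> markov_shift \<A> \<Longrightarrow> x i \<in> E"
  by (simp add: markov_shift_def)

lemma map_E: "x \<in> markov_shift \<A> \<Longrightarrow> set (map x xs) \<subseteq> E"
  using shift_E by auto

lemma word_prod_eq: "x \<in> markov_shift \<A> \<Longrightarrow> word_prod G x k = word (map x [0..<k])"
proof (induction k)
  case (Suc k)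
  have "word (map x [0..<Suc k]) = word (map x [0..<k]) \<otimes> word [x k]"
  proof -
    have "set [x k] \<subseteq> E" using shift_E[OF Suc.prems] by simp
    from word_append[OF map_E[OF Suc.prems] this, of "[0..<k]"] show ?thesis by (simp only: upt_Suc) simp
  qed
  then show ?case using Suc letter_closed[OF shift_E[OF Suc.prems]] by (simp add: letter_def)
qed simp

lemma shift_adm:
  assumes x: "x \<in> markov_shift \<A>"
  shows "k \<le> m \<Longrightarrow> adm E fst (map x [k..<m]) (fst (x m)) \<and> lead fst (map x [k..<m]) (fst (x m)) = fst (x k)"
proof (induction rule: inc_induct)
  case (step n)
  have "[n..<m] = n # [Suc n..<m]" using step by (simp add: upt_conv_Cons)
  moreover have "fst (x n) \<noteq> fst (x (Suc n))" using x by (simp add: markov_shift_def)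
  ultimately show ?case using step shift_E[OF x, of n] by simp
qed simp

lemma shift_fst: "x \<in> markov_shift \<A> \<Longrightarrow> fst (x i) \<in> \<A>"
  using shift_E[of x i] by (auto simp: alphabet_def)

text \<open>The orbit of 0 is compared with boundary points: a prefix brings 0 and any point of the
  next neighborhood within a distance of order \<open>1 / size\<close>, and every longer prefix
  factors through such points.\<close>

lemma coded_point_limit:
  assumes x: "x \<in> markov_shift \<A>"
  shows "(\<lambda>k. psl_act (\<rho> (word_prod G x k)) 0) \<longlonglongrightarrow> coded_point G \<rho> x" "coded_point G \<rho> x \<in> C (fst (x 0))"
proof -
  obtain \<epsilon> where \<epsilon>: "0 < \<epsilon>" "\<And>w l z. w \<noteq> [] \<Longrightarrow> l \<in> \<A> \<Longrightarrow> adm E fst w l \<Longrightarrow> z \<in> C l \<Longrightarrow> \<epsilon> \<le> norm (z - pole w)"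
    using pole_separated by blast
  define pre where "pre k = map x [0..<k]" for k
  define p where "p k = psl_act (\<rho> (word_prod G x k)) 0" for k
  define s where "s k = size (pre k)" for k
  have "\<forall>m. \<exists>z. z \<in> C (fst (x m))" using C(3)[OF shift_fst[OF x]] by blast
  from choice[OF this] obtain \<eta> where \<eta>: "\<And>m. \<eta> m \<in> C (fst (x m))" by blast
  \<comment> \<open>For \<open>k \<le> m\<close> this is also the image, under the prefix of length
    \<open>k\<close>, of a point of \<open>C (fst (x k))\<close>; hence all later \<open>q m\<close>
    stay close to \<open>p k\<close>.\<close>
  define q where "q m = foldr bact (pre m) (\<eta> m)" for m
  have preE: "set (pre k) \<subseteq> E" for k unfolding pre_def by (rule map_E[OF x])
  have p: "p k = foldr bact (pre k) 0" for k
    unfolding p_def word_prod_eq[OF x] pre_def[symmetric] using foldr_bact[OF preE, of 0] by simp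
  have s1: "1 \<le> s k" for k unfolding s_def by (rule size_ge_1[OF preE])
  have adm: "adm E fst (pre k) (fst (x k))" for k using shift_adm[OF x, of 0 k] by (simp add: pre_def)
  have inner: "foldr bact (map x [k..<m]) (\<eta> m) \<in> C (fst (x k))" if "k \<le> m" for k m
    using act_word_adm[of "map x [k..<m]" "fst (x m)" "\<eta> m"] shift_adm[OF x that] \<eta> shift_fst[OF x] by simp
  have split: "q m = foldr bact (pre k) (foldr bact (map x [k..<m]) (\<eta> m))" if "k \<le> m" for k m
    using that upt_add_eq_append[of 0 k "m - k"] by (simp add: q_def pre_def)
  have pq: "norm (p k - q m) \<le> 1 / (\<epsilon> * s k)" if "k \<le> m" "0 < k" for k m
  proof -
    let ?z = "foldr bact (map x [k..<m]) (\<eta> m)"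
    have z: "?z \<in> C (fst (x k))" by (rule inner[OF that(1)])
    have nz: "norm ?z = 1" by (rule C_norm[OF shift_fst[OF x] z])
    have "\<epsilon> \<le> norm (?z - pole (pre k))"
      by (rule \<epsilon>(2)[OF _ shift_fst[OF x] adm z]) (use that in \<open>simp add: pre_def\<close>)
    then have "\<epsilon> * s k \<le> st (pre k) ?z"
      using st_size[OF preE nz, of k] s1[of k] by (simp add: s_def mult.commute mult_left_mono)
    moreover from this have "0 \<le> st (pre k) ?z" using s1[of k] \<epsilon>(1) mult_nonneg_nonneg[of \<epsilon> "s k"] by linarith
    ultimately have "\<epsilon> * s k * 1 \<le> st (pre k) ?z * s k" using s1[of k] by (intro mult_mono) auto
    then have "1 / (st (pre k) ?z * s k) \<le> 1 / (\<epsilon> * s k)" using s1[of k] \<epsilon>(1) by (intro divide_left_mono mult_pos_pos) auto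
    then show ?thesis
      unfolding p split[OF that(1)] using act_diff[OF preE, of 0 ?z k] nz by (simp add: s_def size_def mult.commute)
  qed
  have s_large: "\<exists>N>0. \<forall>k\<ge>N. 1 / (\<epsilon> * s k) < e" if "0 < e" for e
  proof -
    obtain N where N: "\<And>w l. adm E fst w l \<Longrightarrow> N \<le> length w \<Longrightarrow> 1 / (\<epsilon> * e) < size w"
      using size_large by blast
    have "1 / (\<epsilon> * s k) < e" if "k \<ge> N" for k
    proof -
      have "1 / (\<epsilon> * e) < s k" unfolding s_def by (rule N[OF adm]) (use that in \<open>simp add: pre_def\<close>)
      then show ?thesis using \<epsilon>(1) \<open>0 < e\<close> s1[of k] by (simp add: field_simps)
    qed
    then show ?thesis by (intro exI[of _ "Suc N"]) auto
  qed
  have "Cauchy p"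
  proof (rule metric_CauchyI)
    fix e :: real assume "0 < e"
    then obtain N where N: "0 < N" "\<And>k. k \<ge> N \<Longrightarrow> 1 / (\<epsilon> * s k) < e / 2" using s_large[of "e / 2"] by auto
    have le: "norm (p k - p m) < e" if "k \<ge> N" "k \<le> m" for k m
    proof -
      have "norm (p k - p m) \<le> norm (p k - q m) + norm (p m - q m)"
        using norm_triangle_ineq4[of "p k - q m" "p m - q m"] by simp
      also have "\<dots> < e / 2 + e / 2"
        using pq[of k m] pq[of m m] N(2)[of k] N(2)[of m] that N(1) by linarith
      finally show ?thesis by simp
    qed
    show "\<exists>N. \<forall>m\<ge>N. \<forall>n\<ge>N. dist (p m) (p n) < e"
      unfolding dist_norm using le by (intro exI[of _ N] allI impI) (metis le_cases norm_minus_commute)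
  qed
  then have "convergent p" by (simp add: Cauchy_convergent_iff)
  then have lim: "p \<longlonglongrightarrow> coded_point G \<rho> x"
    unfolding coded_point_def p_def[abs_def] by (simp add: convergent_LIMSEQ_iff)
  then show "(\<lambda>k. psl_act (\<rho> (word_prod G x k)) 0) \<longlonglongrightarrow> coded_point G \<rho> x" by (simp add: p_def[abs_def])
  have "(\<lambda>k. p k - q k) \<longlonglongrightarrow> 0"
  proof (rule LIMSEQ_I)
    fix e :: real assume "0 < e"
    then obtain N where N: "0 < N" "\<And>k. k \<ge> N \<Longrightarrow> 1 / (\<epsilon> * s k) < e" using s_large by blast
    have "norm (p k - q k - 0) < e" if "k \<ge> N" for k using pq[of k k] N(2)[OF that] N(1) that by simp
    then show "\<exists>N. \<forall>n\<ge>N. norm (p n - q n - 0) < e" by blast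
  qed
  from tendsto_diff[OF lim this] have "q \<longlonglongrightarrow> coded_point G \<rho> x" by simp
  moreover have "q m \<in> C (fst (x 0))" for m using inner[of 0 m] by (simp add: q_def pre_def)
  ultimately show "coded_point G \<rho> x \<in> C (fst (x 0))"
    using closed_sequentially[OF compact_imp_closed[OF C(1)[OF shift_fst[OF x]]]] by blast
qed

lemma shift_in: "x \<in> markov_shift \<A> \<Longrightarrow> shift x \<in> markov_shift \<A>"
  by (simp add: markov_shift_def shift_def)

lemma tendsto_psl_act:
  assumes X: "X \<in> carrier PSL2R" and f: "(f \<longlongrightarrow> l) F" and l: "norm l \<le> 1"
  shows "((\<lambda>k. psl_act X (f k)) \<longlongrightarrow> psl_act X l) F"
proof -
  note m = psl_mem[OF X psl_rep_mem[OF X]]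
  have "((\<lambda>k. disk_num (psl_rep X) (f k) / disk_den (psl_rep X) (f k)) \<longlongrightarrow> disk_num (psl_rep X) l / disk_den (psl_rep X) l) F"
    using disk_den_nonzero[OF m(1) l] unfolding disk_num_def disk_den_def by (intro tendsto_intros f)
  then show ?thesis unfolding m(2) mobius_disk_eq .
qed

lemma coded_point_shift:
  assumes x: "x \<in> markov_shift \<A>"
  shows "coded_point G \<rho> x = bact (x 0) (coded_point G \<rho> (shift x))"
proof -
  note y = shift_in[OF x]
  have l: "letter (x 0) \<in> carrier G" by (rule letter_closed[OF shift_E[OF x]])
  have w: "word_prod G x (Suc k) = letter (x 0) \<otimes> word_prod G (shift x) k" for k
  proof -
    have "map x [0..<Suc k] = x 0 # map (shift x) [0..<k]"
      by (simp add: shift_def upt_conv_Cons map_Suc_upt[symmetric] del: upt_Suc)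
    then show ?thesis unfolding word_prod_eq[OF x] word_prod_eq[OF y] by simp
  qed
  have n: "norm (coded_point G \<rho> (shift x)) = 1"
    by (rule C_norm[OF shift_fst[OF y] coded_point_limit(2)[OF y]])
  have "psl_act (\<rho> (word_prod G x (Suc k))) 0 = psl_act (\<rho> (letter (x 0))) (psl_act (\<rho> (word_prod G (shift x) k)) 0)" for k
    unfolding w by (rule psl_act_hom(1)[OF l]) (use word_closed[OF map_E[OF y]] in \<open>simp_all add: word_prod_eq[OF y]\<close>)
  moreover have "(\<lambda>k. psl_act (\<rho> (letter (x 0))) (psl_act (\<rho> (word_prod G (shift x) k)) 0)) \<longlonglongrightarrow> bact (x 0) (coded_point G \<rho> (shift x))"
    unfolding bact_def by (rule tendsto_psl_act[OF \<rho>_closed[OF l] coded_point_limit(1)[OF y]]) (use n in simp)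
  ultimately have "(\<lambda>k. psl_act (\<rho> (word_prod G x (Suc k))) 0) \<longlonglongrightarrow> bact (x 0) (coded_point G \<rho> (shift x))" by simp
  then show ?thesis using LIMSEQ_unique[OF LIMSEQ_Suc[OF coded_point_limit(1)[OF x]]] by blast
qed

text \<open>The limit point is the image, under the first letter, of the limit point of the shifted
  sequence, so \<open>busemann_psl\<close> applies to that letter.\<close>

lemma geometric_potential_eq:
  assumes x: "x \<in> markov_shift \<A>"
  shows "geometric_potential G \<rho> x = pot (x 0) (coded_point G \<rho> (shift x))"
proof -
  note y = shift_in[OF x]
  have X: "\<rho> (letter (x 0)) \<in> carrier PSL2R" by (rule \<rho>_closed[OF letter_closed[OF shift_E[OF x]]])
  have n: "norm (coded_point G \<rho> (shift x)) = 1"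
    by (rule C_norm[OF shift_fst[OF y] coded_point_limit(2)[OF y]])
  have "geometric_potential G \<rho> x = busemann (psl_act (\<rho> (letter (x 0))) (coded_point G \<rho> (shift x))) 0 (psl_act (\<rho> (letter (x 0))) 0)"
    unfolding geometric_potential_def coded_point_shift[OF x] bact_def letter_def ..
  then show ?thesis unfolding busemann_psl[OF X n] pot_def .
qed

end

section \<open>Power sums and pairs of representations\<close>

lemma summable_abs_powr:
  fixes s :: real
  assumes s: "1 < s"
  shows "(\<lambda>n::int. \<bar>of_int n\<bar> powr (- s)) summable_on {n. n \<noteq> 0}"
proof -
  let ?f = "\<lambda>n::int. \<bar>of_int n\<bar> powr (- s) :: real"
  have "summable (\<lambda>n. real n powr (- s))" using s by (simp add: summable_real_powr_iff)
  then have 1: "(\<lambda>n. real n powr (- s)) summable_on (UNIV :: nat set)"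
    by (simp add: summable_on_UNIV_nonneg_real_iff)
  have "?f summable_on (range int)" "?f summable_on (range (\<lambda>n. - int n))"
    using 1 by (subst summable_on_reindex; simp add: inj_on_def o_def)+
  then have sum: "?f summable_on (range int \<union> range (\<lambda>n. - int n))" by (rule summable_on_union)
  have "n \<in> range int \<union> range (\<lambda>n. - int n)" for n :: int
  proof (cases "0 \<le> n")
    case True
    then have "n = int (nat n)" by simp
    then show ?thesis by blast
  next
    case False
    then have "n = - int (nat (- n))" by simp
    then show ?thesis by blast
  qed
  then show ?thesis by (intro summable_on_subset[OF sum]) blast
qed

text \<open>Both representations use the same generators, so a word acts on both circles at once.
  Linear growth along powers is a bound that parabolic and hyperbolic generators share.\<close>

locale schottky_pair = s1: schottky G \<rho>\<^sub>1 \<A> C\<^sub>1 + s2: schottky G \<rho>\<^sub>2 \<A> C\<^sub>2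
  for G :: "('g, 'm) monoid_scheme" (structure) and \<rho>\<^sub>1 \<rho>\<^sub>2 \<A> C\<^sub>1 C\<^sub>2 +
  fixes a b c :: real
  assumes ab: "0 \<le> a" "0 \<le> b" "0 < a + b" and c: "0 < c"
    and growth: "\<And>g n. g \<in> \<A> \<Longrightarrow> c * \<bar>of_int n\<bar> \<le> psl_stretch (\<rho>\<^sub>1 (g [^] (n::int))) 0"
      "\<And>g n. g \<in> \<A> \<Longrightarrow> c * \<bar>of_int n\<bar> \<le> psl_stretch (\<rho>\<^sub>2 (g [^] (n::int))) 0"
begin

abbreviation "E \<equiv> alphabet \<A>"

definition K :: "(complex \<times> complex) set" where
  "K = (\<Union>g\<in>\<A>. C\<^sub>1 g \<times> C\<^sub>2 g)"

text \<open>Read off from the first coordinate; on \<open>K\<close> the second one lies in the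
  neighborhood of the same generator.\<close>

definition lab :: "complex \<times> complex \<Rightarrow> 'g" where
  "lab x = (THE g. g \<in> \<A> \<and> fst x \<in> C\<^sub>1 g)"

definition act :: "'g \<times> int \<Rightarrow> complex \<times> complex \<Rightarrow> complex \<times> complex" where
  "act e x = (s1.bact e (fst x), s2.bact e (snd x))"

definition \<phi> :: "'g \<times> int \<Rightarrow> complex \<times> complex \<Rightarrow> real" where
  "\<phi> e x = a * s1.pot e (fst x) + b * s2.pot e (snd x)"

text \<open>The \<open>n\<close>-th power of a parabolic generator has weight of order
  \<open>\<bar>n\<bar> powr (- 2 * t * (a + b))\<close>; here the exponent is -1.\<close>

definition critical :: real where
  "critical = 1 / (2 * (a + b))"

lemma lab_eq: "g \<in> \<A> \<Longrightarrow> fst x \<in> C\<^sub>1 g \<Longrightarrow> lab x = g"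
  unfolding lab_def using s1.C_disj by (intro the_equality) auto

lemma K_lab: "x \<in> K \<longleftrightarrow> lab x \<in> \<A> \<and> fst x \<in> C\<^sub>1 (lab x) \<and> snd x \<in> C\<^sub>2 (lab x)"
proof
  assume "x \<in> K"
  then obtain g where g: "g \<in> \<A>" "fst x \<in> C\<^sub>1 g" "snd x \<in> C\<^sub>2 g" unfolding K_def by (auto simp: mem_Times_iff)
  from lab_eq[OF g(1,2)] g show "lab x \<in> \<A> \<and> fst x \<in> C\<^sub>1 (lab x) \<and> snd x \<in> C\<^sub>2 (lab x)" by simp
next
  assume "lab x \<in> \<A> \<and> fst x \<in> C\<^sub>1 (lab x) \<and> snd x \<in> C\<^sub>2 (lab x)"
  then show "x \<in> K" unfolding K_def by (intro UN_I[of "lab x"]) (simp_all add: mem_Times_iff)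
qed

lemma KD:
  assumes "x \<in> K"
  shows "lab x \<in> \<A>" "fst x \<in> C\<^sub>1 (lab x)" "snd x \<in> C\<^sub>2 (lab x)" "norm (fst x) = 1" "norm (snd x) = 1"
proof -
  have k: "lab x \<in> \<A>" "fst x \<in> C\<^sub>1 (lab x)" "snd x \<in> C\<^sub>2 (lab x)" using assms unfolding K_lab by blast+
  then show "lab x \<in> \<A>" "fst x \<in> C\<^sub>1 (lab x)" "snd x \<in> C\<^sub>2 (lab x)" "norm (fst x) = 1" "norm (snd x) = 1"
    using s1.C_norm[OF k(1,2)] s2.C_norm[OF k(1,3)] by auto
qed

lemma foldr_act: "foldr act w x = (foldr s1.bact w (fst x), foldr s2.bact w (snd x))"
  by (induction w) (simp_all add: act_def)

lemma cocycle_\<phi>: "cocycle act \<phi> w x = a * cocycle s1.bact s1.pot w (fst x) + b * cocycle s2.bact s2.pot w (snd x)"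
  by (induction w) (simp_all add: \<phi>_def foldr_act algebra_simps)

lemma cocycle_st:
  assumes "set w \<subseteq> E" "x \<in> K"
  shows "cocycle act \<phi> w x = a * (2 * ln (s1.st w (fst x))) + b * (2 * ln (s2.st w (snd x)))"
  unfolding cocycle_\<phi> using s1.cocycle_pot[OF assms(1)] s2.cocycle_pot[OF assms(1)] KD(4,5)[OF assms(2)] by simp

lemma letter_stretch:
  assumes "e \<in> E"
  shows "s1.size [e] = psl_stretch (\<rho>\<^sub>1 (fst e [^] snd e)) 0" "s2.size [e] = psl_stretch (\<rho>\<^sub>2 (fst e [^] snd e)) 0"
  using assms s1.letter_closed[OF assms] by (simp_all add: s1.size_def s2.size_def s1.st_def s2.st_def s1.letter_def)

end

section \<open>Uniform estimates for words\<close>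

context schottky begin

text \<open>On the circle the stretch is the size times the distance to \<open>pole w\<close>. The
  size cancels in the difference of logarithms, and the logarithm of a distance of at least
  \<epsilon> has Lipschitz constant \<open>1 / \<epsilon>\<close>.\<close>

lemma ln_st_Lipschitz:
  assumes \<epsilon>: "0 < \<epsilon>" "\<epsilon> \<le> norm (z - pole w)" "\<epsilon> \<le> norm (z' - pole w)"
    and w: "set w \<subseteq> E" and z: "norm z = 1" "norm z' = 1"
  shows "\<bar>ln (st w z) - ln (st w z')\<bar> \<le> norm (z - z') / \<epsilon>"
proof -
  have half: "ln (st w u) - ln (st w v) \<le> norm (u - v) / \<epsilon>"
    if "\<epsilon> \<le> norm (u - pole w)" "\<epsilon> \<le> norm (v - pole w)" "norm u = 1" "norm v = 1" for u v
  proof -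
    have s: "0 < size w" using size_ge_1[OF w] by simp
    have p: "0 < norm (u - pole w)" "0 < norm (v - pole w)" using that \<epsilon>(1) by linarith+
    have "ln (st w u) - ln (st w v) = ln (norm (u - pole w) / norm (v - pole w))"
      unfolding st_size[OF w that(3)] st_size[OF w that(4)] using s p by (simp add: ln_mult ln_div)
    also have "\<dots> \<le> norm (u - pole w) / norm (v - pole w) - 1"
      using p by (intro ln_le_minus_one) simp
    also have "\<dots> = (norm (u - pole w) - norm (v - pole w)) / norm (v - pole w)"
      using p by (simp add: diff_divide_distrib)
    also have "\<dots> \<le> norm (u - v) / norm (v - pole w)"
      using norm_triangle_ineq2[of "u - pole w" "v - pole w"] by (intro divide_right_mono) auto
    also have "\<dots> \<le> norm (u - v) / \<epsilon>" using that(2) \<epsilon>(1) p by (intro divide_left_mono) auto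
    finally show ?thesis .
  qed
  from half[OF \<epsilon>(2,3) z] half[OF \<epsilon>(3,2) z(2,1)] show ?thesis by (simp add: abs_le_iff norm_minus_commute)
qed

text \<open>The labels \<open>l\<close> and \<open>l'\<close> may differ, as long as the word may be
  applied to both points. The empty word has no pole estimate and is treated directly, using
  \<epsilon> \<le> 1.\<close>

lemma word_estimates:
  obtains \<epsilon> where "0 < \<epsilon>" "\<And>w l l' z z'. adm E fst w l \<Longrightarrow> adm E fst w l' \<Longrightarrow> l \<in> \<A> \<Longrightarrow> l' \<in> \<A> \<Longrightarrow> z \<in> C l \<Longrightarrow> z' \<in> C l' \<Longrightarrow>
     \<bar>ln (st w z) - ln (st w z')\<bar> \<le> norm (z - z') / \<epsilon> \<and> \<epsilon> * size w \<le> st w z \<and>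
     norm (foldr bact w z - foldr bact w z') \<le> norm (z - z') / (\<epsilon> * size w)\<^sup>2"
proof -
  obtain \<epsilon> where \<epsilon>: "0 < \<epsilon>" "\<epsilon> \<le> 1" "\<And>w l z. w \<noteq> [] \<Longrightarrow> l \<in> \<A> \<Longrightarrow> adm E fst w l \<Longrightarrow> z \<in> C l \<Longrightarrow> \<epsilon> \<le> norm (z - pole w)"
    using pole_separated by blast
  have "\<bar>ln (st w z) - ln (st w z')\<bar> \<le> norm (z - z') / \<epsilon> \<and> \<epsilon> * size w \<le> st w z \<and>
     norm (foldr bact w z - foldr bact w z') \<le> norm (z - z') / (\<epsilon> * size w)\<^sup>2"
    if *: "adm E fst w l" "adm E fst w l'" "l \<in> \<A>" "l' \<in> \<A>" "z \<in> C l" "z' \<in> C l'" for w l l' z z'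
  proof -
    have w: "set w \<subseteq> E" by (rule adm_subset[OF *(1)])
    have n: "norm z = 1" "norm z' = 1" using C_norm * by blast+
    have s: "1 \<le> size w" by (rule size_ge_1[OF w])
    have low: "\<epsilon> * size w \<le> st w u" if "adm E fst w k" "k \<in> \<A>" "u \<in> C k" for u k
    proof (cases "w = []")
      case True
      then show ?thesis using \<epsilon>(2) by (simp add: size_def st_def psl_act_one)
    next
      case False
      then show ?thesis using \<epsilon>(3)[OF False that(2,1,3)] st_size[OF w C_norm[OF that(2,3)]] s by (simp add: mult.commute mult_left_mono)
    qed
    note l1 = low[OF *(1,3,5)] and l2 = low[OF *(2,4,6)]
    have "\<bar>ln (st w z) - ln (st w z')\<bar> \<le> norm (z - z') / \<epsilon>"
    proof (cases "w = []")
      case True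
      then show ?thesis using \<epsilon>(1) by (simp add: st_def psl_act_one)
    next
      case False
      from ln_st_Lipschitz[OF \<epsilon>(1) \<epsilon>(3)[OF False *(3,1,5)] \<epsilon>(3)[OF False *(4,2,6)] w n] show ?thesis .
    qed
    moreover have "norm (foldr bact w z - foldr bact w z') \<le> norm (z - z') / (\<epsilon> * size w)\<^sup>2"
    proof -
      have "0 < \<epsilon> * size w" using \<epsilon>(1) s by simp
      moreover from this have "0 < st w z" "0 < st w z'" using l1 l2 by linarith+
      moreover have "(\<epsilon> * size w)\<^sup>2 \<le> st w z * st w z'"
        unfolding power2_eq_square using l1 l2 calculation(1,2) by (intro mult_mono) auto
      ultimately show ?thesis
        using act_diff[OF w, of z z'] n by (auto intro!: divide_left_mono mult_pos_pos)
    qed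
    ultimately show ?thesis using l1 by blast
  qed
  from that[OF \<epsilon>(1) this] show ?thesis .
qed

lemma word_lower:
  obtains \<epsilon> where "0 < \<epsilon>" "\<And>w l z. adm E fst w l \<Longrightarrow> l \<in> \<A> \<Longrightarrow> z \<in> C l \<Longrightarrow> \<epsilon> * size w \<le> st w z"
proof -
  obtain \<epsilon> where \<epsilon>: "0 < \<epsilon>" "\<And>w l l' z z'. adm E fst w l \<Longrightarrow> adm E fst w l' \<Longrightarrow> l \<in> \<A> \<Longrightarrow> l' \<in> \<A> \<Longrightarrow> z \<in> C l \<Longrightarrow> z' \<in> C l' \<Longrightarrow>
     \<bar>ln (st w z) - ln (st w z')\<bar> \<le> norm (z - z') / \<epsilon> \<and> \<epsilon> * size w \<le> st w z \<and>
     norm (foldr bact w z - foldr bact w z') \<le> norm (z - z') / (\<epsilon> * size w)\<^sup>2"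
    by (fact word_estimates)
  have "\<epsilon> * size w \<le> st w z" if "adm E fst w l" "l \<in> \<A>" "z \<in> C l" for w l z
    using \<epsilon>(2)[OF that(1,1,2,2,3,3)] by blast
  from that[OF \<epsilon>(1) this] show ?thesis .
qed

end

section \<open>Words with prescribed letters\<close>

context word_system begin

text \<open>Putting \<open>s\<close> and a connector in front of a word costs a bounded factor. This
  relates sums with a prescribed first symbol to \<open>Z\<close>, at a length shifted by
  two.\<close>

lemma first_letter_sum:
  assumes t: "\<delta> < t" and s: "s \<in> E" and y: "y \<in> K"
  shows "\<exists>d>0. \<forall>n. d * Z t n y \<le> (\<Sum>\<^sub>\<infinity>w\<in>{w \<in> words E gen (Suc (Suc n)) (lab y). hd w = s}. exp (- t * \<Phi> w y))"
proof -
  obtain U where U: "\<And>x. x \<in> K \<Longrightarrow> gen s \<noteq> lab x \<Longrightarrow> \<phi> s x \<le> U" using letter_bound[OF s] by blast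
  obtain V where V: "\<And>e x. e \<in> F \<Longrightarrow> x \<in> K \<Longrightarrow> gen e \<noteq> lab x \<Longrightarrow> \<phi> e x \<le> V" using F_upper by blast
  define f where "f u = (SOME e. e \<in> F \<and> gen e \<noteq> gen s \<and> gen e \<noteq> lead gen u (lab y))" for u
  have f: "f u \<in> F \<and> gen (f u) \<noteq> gen s \<and> gen (f u) \<noteq> lead gen u (lab y)" for u
    unfolding f_def by (rule someI_ex) (use F(3) in blast)
  let ?d = "exp (- t * (U + V))"
  have "?d * Z t n y \<le> (\<Sum>\<^sub>\<infinity>w\<in>{w \<in> words E gen (Suc (Suc n)) (lab y). hd w = s}. exp (- t * \<Phi> w y))" for n
    unfolding Z_def
  proof (rule infsum_inj_le[where g = "\<lambda>u. s # f u # u"])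
    show "inj_on (\<lambda>u. s # f u # u) (W n y)" by (auto simp: inj_on_def)
    show "(\<lambda>u. s # f u # u) ` W n y \<subseteq> {w \<in> words E gen (Suc (Suc n)) (lab y). hd w = s}"
    proof (rule image_subsetI)
      fix u assume u: "u \<in> W n y"
      have "f u \<in> E" using f[of u] F(2) by blast
      moreover have "gen s \<noteq> gen (f u)" using f[of u] by metis
      ultimately show "s # f u # u \<in> {w \<in> words E gen (Suc (Suc n)) (lab y). hd w = s}"
        using u f[of u] s by (simp add: words_def)
    qed
    show "(\<lambda>w. exp (- t * \<Phi> w y)) summable_on {w \<in> words E gen (Suc (Suc n)) (lab y). hd w = s}"
      by (rule summable_on_subset[OF summable[OF t y, of "Suc (Suc n)"]]) blast
    show "(\<lambda>w. exp (- t * \<Phi> w y)) summable_on W n y" by (rule summable[OF t y])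
    fix u assume u: "u \<in> W n y"
    let ?z = "foldr act u y"
    have z: "?z \<in> K" "lab ?z = lead gen u (lab y)" using foldr_act_K[OF y] u by (auto simp: words_def)
    have fE: "f u \<in> E" using f[of u] F(2) by blast
    have z': "act (f u) ?z \<in> K" "lab (act (f u) ?z) = gen (f u)"
      using f[of u] z fE by (auto simp: act_K lab_act)
    have "\<phi> s (act (f u) ?z) \<le> U" using f[of u] z' by (intro U) auto
    moreover have "\<phi> (f u) ?z \<le> V" using f[of u] z by (intro V) auto
    ultimately have "\<Phi> (s # f u # u) y \<le> U + V + \<Phi> u y" by simp
    from mult_left_mono[OF this t_nonneg[OF t]] have "- t * (U + V) + - t * \<Phi> u y \<le> - t * \<Phi> (s # f u # u) y"
      by (simp only: distrib_left mult_minus_left)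
    then show "?d * exp (- t * \<Phi> u y) \<le> exp (- t * \<Phi> (s # f u # u) y)"
      unfolding exp_add[symmetric] by (simp only: exp_le_cancel_iff)
  qed simp
  then show ?thesis by (intro exI[of _ ?d]) simp
qed

lemma fixed_word_bounded: "\<exists>U. \<forall>x\<in>K. adm E gen w (lab x) \<longrightarrow> \<bar>\<Phi> w x\<bar> \<le> U"
proof (cases "\<exists>y\<in>K. adm E gen w (lab y)")
  case True
  then obtain y where y: "y \<in> K" "adm E gen w (lab y)" by blast
  have "\<bar>\<Phi> w x\<bar> \<le> \<bar>\<Phi> w y\<bar> + \<bar>M\<bar> * \<Delta>" if "x \<in> K" "adm E gen w (lab x)" for x
    using Phi_Lipschitz[OF that(1) y(1) that(2) y(2)] M\<Delta>[OF that(1) y(1)] by linarith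
  then show ?thesis by blast
qed blast

text \<open>These words, with \<open>q m\<close> the powers of a parabolic generator, already make the partition sums diverge
  below the critical exponent.\<close>

lemma word_family:
  assumes q: "\<And>m. m \<in> I \<Longrightarrow> q m \<in> E" "\<And>m. m \<in> I \<Longrightarrow> gen (q m) = g" "inj_on q I" and s: "s \<in> E" and n: "4 \<le> n"
    and h: "\<And>m x. m \<in> I \<Longrightarrow> x \<in> K \<Longrightarrow> lab x \<noteq> g \<Longrightarrow> \<bar>\<phi> (q m) x - h m\<bar> \<le> D"
  shows "\<exists>w D'. inj_on w I \<and> (\<forall>m\<in>I. w m \<in> words E gen n (gen s) \<and> hd (w m) = s \<and>
    (\<forall>x\<in>K. lab x = gen s \<longrightarrow> \<bar>\<Phi> (w m) x - h m\<bar> \<le> D'))"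
proof -
  obtain f where f: "f \<in> F" "gen f \<noteq> gen s" "gen f \<noteq> g" using F(3) by blast
  have fE: "f \<in> E" using f F(2) by blast
  \<comment> \<open>\<open>v\<close> fills the word up to length \<open>n\<close>. Since
    \<open>n\<close> is at least 4 it is nonempty, so its leading generator can be kept different
    from \<open>g\<close>.\<close>
  obtain v where v: "v \<in> words E gen (n - 3) (gen s)" "lead gen v (gen s) \<noteq> g"
    using word_exists[of "n - 3" "gen s" g] n by auto
  define w where "w m = [s, f] @ (q m # v)" for m
  have adm: "adm E gen (w m) (gen s)" if "m \<in> I" for m
    using f fE s q that v by (auto simp: w_def words_def)
  have len: "length (w m) = n" for m using v(1) n by (simp add: w_def words_def)
  obtain U1 where U1: "\<And>x. x \<in> K \<Longrightarrow> adm E gen [s, f] (lab x) \<Longrightarrow> \<bar>\<Phi> [s, f] x\<bar> \<le> U1" using fixed_word_bounded by blast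
  obtain U2 where U2: "\<And>x. x \<in> K \<Longrightarrow> adm E gen v (lab x) \<Longrightarrow> \<bar>\<Phi> v x\<bar> \<le> U2" using fixed_word_bounded by blast
  have "\<bar>\<Phi> (w m) x - h m\<bar> \<le> U1 + D + U2" if m: "m \<in> I" and x: "x \<in> K" "lab x = gen s" for m x
  proof -
    have a: "adm E gen v (lab x)" using v(1) x by (simp add: words_def)
    let ?z = "foldr act v x"
    have z: "?z \<in> K" "lab ?z \<noteq> g" using foldr_act_K[OF x(1) a] v(2) x(2) by auto
    have z': "act (q m) ?z \<in> K" "lab (act (q m) ?z) = g" using z q(1,2)[OF m] by (auto simp: act_K lab_act)
    have "\<Phi> (w m) x = \<Phi> [s, f] (act (q m) ?z) + \<phi> (q m) ?z + \<Phi> v x"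
      unfolding w_def cocycle_append by simp
    moreover have "adm E gen [s, f] (lab (act (q m) ?z))" using z'(2) f fE s by auto
    ultimately show ?thesis using U1[OF z'(1)] U2[OF x(1) a] h[OF m z] by linarith
  qed
  moreover have "inj_on w I" using q(3) by (auto simp: w_def inj_on_def)
  ultimately show ?thesis using adm len
    by (intro exI[of _ w] exI[of _ "U1 + D + U2"]) (auto simp: words_def w_def)
qed

end

section \<open>The pair of boundary actions as a word system\<close>

context schottky_pair begin

lemma dist_pair_le: "dist x y \<le> dist (fst x) (fst y) + dist (snd x) (snd y)" for x y :: "complex \<times> complex"
  by (simp add: dist_prod_def sqrt_sum_squares_le_sum)

lemma act_in_K:
  assumes x: "x \<in> K" and e: "e \<in> E" "fst e \<noteq> lab x"
  shows "act e x \<in> K" "lab (act e x) = fst e"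
proof -
  have g: "fst e \<in> \<A>" using e(1) by (auto simp: alphabet_def)
  have "fst x \<notin> C\<^sub>1 (fst e)" "snd x \<notin> C\<^sub>2 (fst e)"
    using s1.C_disj[OF g KD(1)[OF x]] s2.C_disj[OF g KD(1)[OF x]] KD(2,3)[OF x] e(2) by blast+
  then have m: "fst (act e x) \<in> C\<^sub>1 (fst e)" "snd (act e x) \<in> C\<^sub>2 (fst e)"
    using s1.act_letter[OF e(1) KD(4)[OF x]] s2.act_letter[OF e(1) KD(5)[OF x]] by (simp_all add: act_def)
  show l: "lab (act e x) = fst e" by (rule lab_eq[OF g m(1)])
  show "act e x \<in> K" unfolding K_lab l using g m by simp
qed

text \<open>Linear growth of the size in the exponent passes to the stretch on both circles through
  \<open>word_lower\<close>.\<close>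

lemma letter_lower: "\<exists>\<eta>>0. \<forall>e\<in>E. \<forall>x\<in>K. fst e \<noteq> lab x \<longrightarrow> 2 * (a + b) * ln (\<eta> * \<bar>of_int (snd e)\<bar>) \<le> \<phi> e x"
proof -
  obtain \<epsilon>1 where \<epsilon>1: "0 < \<epsilon>1" "\<And>w l z. adm E fst w l \<Longrightarrow> l \<in> \<A> \<Longrightarrow> z \<in> C\<^sub>1 l \<Longrightarrow> \<epsilon>1 * s1.size w \<le> s1.st w z"
    by (fact s1.word_lower)
  obtain \<epsilon>2 where \<epsilon>2: "0 < \<epsilon>2" "\<And>w l z. adm E fst w l \<Longrightarrow> l \<in> \<A> \<Longrightarrow> z \<in> C\<^sub>2 l \<Longrightarrow> \<epsilon>2 * s2.size w \<le> s2.st w z"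
    by (fact s2.word_lower)
  define \<eta> where "\<eta> = min \<epsilon>1 \<epsilon>2 * c"
  have \<eta>: "0 < \<eta>" using \<epsilon>1(1) \<epsilon>2(1) c by (simp add: \<eta>_def)
  have "2 * (a + b) * ln (\<eta> * \<bar>of_int (snd e)\<bar>) \<le> \<phi> e x" if e: "e \<in> E" and x: "x \<in> K" and ne: "fst e \<noteq> lab x" for e x
  proof -
    have g: "fst e \<in> \<A>" "snd e \<noteq> 0" using e by (auto simp: alphabet_def)
    let ?n = "\<bar>of_int (snd e)\<bar> :: real"
    have n: "0 < ?n" using g(2) by simp
    have adm: "adm E fst [e] (lab x)" using e ne by simp
    have "\<eta> * ?n \<le> \<epsilon>1 * (c * ?n)" using n c by (simp add: \<eta>_def mult.assoc mult_right_mono)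
    also have "\<dots> \<le> \<epsilon>1 * s1.size [e]" using growth(1)[OF g(1)] \<epsilon>1(1) unfolding letter_stretch(1)[OF e] by (intro mult_left_mono) auto
    also have "\<dots> \<le> s1.st [e] (fst x)" by (rule \<epsilon>1(2)[OF adm KD(1,2)[OF x]])
    finally have 1: "\<eta> * ?n \<le> s1.st [e] (fst x)" .
    have "\<eta> * ?n \<le> \<epsilon>2 * (c * ?n)" using n c by (simp add: \<eta>_def mult.assoc mult_right_mono)
    also have "\<dots> \<le> \<epsilon>2 * s2.size [e]" using growth(2)[OF g(1)] \<epsilon>2(1) unfolding letter_stretch(2)[OF e] by (intro mult_left_mono) auto
    also have "\<dots> \<le> s2.st [e] (snd x)" by (rule \<epsilon>2(2)[OF adm KD(1,3)[OF x]])
    finally have 2: "\<eta> * ?n \<le> s2.st [e] (snd x)" .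
    have p: "0 < \<eta> * ?n" using \<eta> n by simp
    have "ln (\<eta> * ?n) \<le> ln (s1.st [e] (fst x))" "ln (\<eta> * ?n) \<le> ln (s2.st [e] (snd x))"
      using 1 2 p by (auto intro!: ln_mono)
    then have "a * (2 * ln (\<eta> * ?n)) + b * (2 * ln (\<eta> * ?n)) \<le> cocycle act \<phi> [e] x"
      using ab e x by (subst cocycle_st) (auto intro!: add_mono mult_left_mono)
    then show ?thesis by (simp add: algebra_simps)
  qed
  then show ?thesis using \<eta> by blast
qed

lemma letter_upper:
  assumes e: "e \<in> E" and x: "x \<in> K"
  shows "\<phi> e x \<le> a * (2 * ln (2 * s1.size [e])) + b * (2 * ln (2 * s2.size [e]))"
proof -
  have E: "set [e] \<subseteq> E" using e by simp
  note r1 = s1.rep_facts[OF E] and r2 = s2.rep_facts[OF E]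
  have "s1.st [e] (fst x) \<le> 2 * s1.size [e]" "s2.st [e] (snd x) \<le> 2 * s2.size [e]"
    using stretch_le[OF r1(1) KD(4)[OF x]] stretch_le[OF r2(1) KD(5)[OF x]] by (simp_all add: s1.size_def s2.size_def r1(3) r2(3))
  moreover have "0 < s1.st [e] (fst x)" "0 < s2.st [e] (snd x)"
    unfolding r1(3) r2(3) using stretch_pos[OF r1(1), of "fst x"] stretch_pos[OF r2(1), of "snd x"] KD(4,5)[OF x] by simp_all
  ultimately have "ln (s1.st [e] (fst x)) \<le> ln (2 * s1.size [e])" "ln (s2.st [e] (snd x)) \<le> ln (2 * s2.size [e])"
    by (auto intro!: ln_mono)
  then have "cocycle act \<phi> [e] x \<le> a * (2 * ln (2 * s1.size [e])) + b * (2 * ln (2 * s2.size [e]))"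
    using ab by (subst cocycle_st[OF E x]) (auto intro!: add_mono mult_left_mono)
  then show ?thesis by simp
qed

text \<open>By \<open>letter_lower\<close> the weights are dominated, independently of
  \<open>x\<close>, by a power law with exponent \<open>2 * t * (a + b) > 1\<close> for each of the
  finitely many generators.\<close>

lemma letter_summable:
  assumes t: "critical < t"
  shows "\<exists>B. \<forall>x\<in>K. (\<lambda>e. exp (- t * \<phi> e x)) summable_on {e \<in> E. fst e \<noteq> lab x} \<and>
       (\<Sum>\<^sub>\<infinity>e\<in>{e \<in> E. fst e \<noteq> lab x}. exp (- t * \<phi> e x)) \<le> B"
proof -
  define s where "s = 2 * t * (a + b)"
  have s: "1 < s" using t ab by (simp add: s_def critical_def field_simps)
  have "0 \<le> critical" using ab by (simp add: critical_def)
  then have t0: "0 \<le> t" using t by linarith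
  obtain \<eta> where \<eta>: "0 < \<eta>" "\<And>e x. e \<in> E \<Longrightarrow> x \<in> K \<Longrightarrow> fst e \<noteq> lab x \<Longrightarrow> 2 * (a + b) * ln (\<eta> * \<bar>of_int (snd e)\<bar>) \<le> \<phi> e x"
    using letter_lower by blast
  let ?f = "\<lambda>e :: 'g \<times> int. \<eta> powr (- s) * \<bar>of_int (snd e)\<bar> powr (- s)"
  have ES: "E = \<A> \<times> {n. n \<noteq> 0}" by (auto simp: alphabet_def)
  have fs: "?f summable_on E"
    unfolding ES
  proof (rule summable_on_SigmaI)
    show "((\<lambda>y. ?f (x, y)) has_sum (\<eta> powr (- s) * (\<Sum>\<^sub>\<infinity>n\<in>{n. n \<noteq> 0}. \<bar>of_int n\<bar> powr (- s)))) {n. n \<noteq> 0}" for x :: 'g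
      using has_sum_infsum[OF summable_abs_powr[OF s]] by (simp add: has_sum_cmult_right)
    show "(\<lambda>x. \<eta> powr (- s) * (\<Sum>\<^sub>\<infinity>n\<in>{n. n \<noteq> 0}. \<bar>of_int n\<bar> powr (- s))) summable_on \<A>"
      using s1.gens(2) by (rule summable_on_finite)
  qed auto
  have le: "exp (- t * \<phi> e x) \<le> ?f e" if "e \<in> E" "x \<in> K" "fst e \<noteq> lab x" for e x
  proof -
    have n: "0 < \<bar>of_int (snd e) :: real\<bar>" using that(1) by (auto simp: alphabet_def)
    have "t * (2 * (a + b) * ln (\<eta> * \<bar>of_int (snd e)\<bar>)) \<le> t * \<phi> e x"
      by (rule mult_left_mono[OF \<eta>(2)[OF that] t0])
    then have "exp (- t * \<phi> e x) \<le> exp (- s * ln (\<eta> * \<bar>of_int (snd e)\<bar>))"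
      by (simp add: s_def mult_ac)
    also have "\<dots> = (\<eta> * \<bar>of_int (snd e)\<bar>) powr (- s)" using \<eta>(1) n by (simp add: powr_def)
    also have "\<dots> = ?f e" using \<eta>(1) by (simp add: powr_mult)
    finally show ?thesis .
  qed
  have "(\<lambda>e. exp (- t * \<phi> e x)) summable_on {e \<in> E. fst e \<noteq> lab x} \<and>
       (\<Sum>\<^sub>\<infinity>e\<in>{e \<in> E. fst e \<noteq> lab x}. exp (- t * \<phi> e x)) \<le> infsum ?f E" if x: "x \<in> K" for x
  proof
    have f': "?f summable_on {e \<in> E. fst e \<noteq> lab x}" by (rule summable_on_subset[OF fs]) blast
    show s': "(\<lambda>e. exp (- t * \<phi> e x)) summable_on {e \<in> E. fst e \<noteq> lab x}"
      by (rule summable_on_comparison_test[OF f']) (use le x in auto)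
    have "(\<Sum>\<^sub>\<infinity>e\<in>{e \<in> E. fst e \<noteq> lab x}. exp (- t * \<phi> e x)) \<le> infsum ?f {e \<in> E. fst e \<noteq> lab x}"
      by (rule infsum_mono[OF s' f']) (use le x in auto)
    also have "\<dots> \<le> infsum ?f E" by (rule infsum_mono2[OF f' fs]) auto
    finally show "(\<Sum>\<^sub>\<infinity>e\<in>{e \<in> E. fst e \<noteq> lab x}. exp (- t * \<phi> e x)) \<le> infsum ?f E" .
  qed
  then show ?thesis by blast
qed

text \<open>The diameter bound 4 allows 2 for each circle; the connectors are the generators
  themselves.\<close>

lemma word_system: "\<exists>M c0 r0. word_system K E fst lab act \<phi> ((\<lambda>g. (g, 1)) ` \<A>) critical M c0 r0 4"
proof -
  obtain \<epsilon>1 where \<epsilon>1: "0 < \<epsilon>1" and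
    w1: "\<And>w l l' z z'. adm E fst w l \<Longrightarrow> adm E fst w l' \<Longrightarrow> l \<in> \<A> \<Longrightarrow> l' \<in> \<A> \<Longrightarrow> z \<in> C\<^sub>1 l \<Longrightarrow> z' \<in> C\<^sub>1 l' \<Longrightarrow>
     \<bar>ln (s1.st w z) - ln (s1.st w z')\<bar> \<le> norm (z - z') / \<epsilon>1 \<and> \<epsilon>1 * s1.size w \<le> s1.st w z \<and>
     norm (foldr s1.bact w z - foldr s1.bact w z') \<le> norm (z - z') / (\<epsilon>1 * s1.size w)\<^sup>2"
    by (fact s1.word_estimates)
  obtain \<epsilon>2 where \<epsilon>2: "0 < \<epsilon>2" and
    w2: "\<And>w l l' z z'. adm E fst w l \<Longrightarrow> adm E fst w l' \<Longrightarrow> l \<in> \<A> \<Longrightarrow> l' \<in> \<A> \<Longrightarrow> z \<in> C\<^sub>2 l \<Longrightarrow> z' \<in> C\<^sub>2 l' \<Longrightarrow>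
     \<bar>ln (s2.st w z) - ln (s2.st w z')\<bar> \<le> norm (z - z') / \<epsilon>2 \<and> \<epsilon>2 * s2.size w \<le> s2.st w z \<and>
     norm (foldr s2.bact w z - foldr s2.bact w z') \<le> norm (z - z') / (\<epsilon>2 * s2.size w)\<^sup>2"
    by (fact s2.word_estimates)
  obtain r0 where r0: "0 < r0" "\<And>g h x y. g \<in> \<A> \<Longrightarrow> h \<in> \<A> \<Longrightarrow> g \<noteq> h \<Longrightarrow> x \<in> C\<^sub>1 g \<Longrightarrow> y \<in> C\<^sub>1 h \<Longrightarrow> r0 \<le> norm (x - y)"
    using s1.separation by blast
  define M where "M = 2 * a / \<epsilon>1 + 2 * b / \<epsilon>2"
  \<comment> \<open>Sizes are at least 1, so wherever a word may be applied its stretch is at least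
    \<open>\<epsilon>1\<close>, respectively \<open>\<epsilon>2\<close>.\<close>
  define c0 where "c0 = - (a * (2 * ln \<epsilon>1) + b * (2 * ln \<epsilon>2))"
  have n1: "norm (fst x - fst y) \<le> dist x y" and n2: "norm (snd x - snd y) \<le> dist x y" for x y :: "complex \<times> complex"
    using dist_fst_le[of x y] dist_snd_le[of x y] by (simp_all add: dist_norm)
  have "word_system K E fst lab act \<phi> ((\<lambda>g. (g, 1)) ` \<A>) critical M c0 r0 4"
  proof
    show "K \<noteq> {}"
    proof -
      obtain g where g: "g \<in> \<A>" using s1.three by blast
      then show ?thesis unfolding K_def using s1.C(3)[OF g] s2.C(3)[OF g] by blast
    qed
    show "dist x y \<le> 4" if "x \<in> K" "y \<in> K" for x y
    proof -
      have "dist (fst x) (fst y) \<le> 2" "dist (snd x) (snd y) \<le> 2"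
        using KD(4,5)[OF that(1)] KD(4,5)[OF that(2)] norm_triangle_ineq4[of "fst x" "fst y"] norm_triangle_ineq4[of "snd x" "snd y"]
        by (simp_all add: dist_norm)
      with dist_pair_le[of x y] show ?thesis by simp
    qed
    show "act e x \<in> K" "lab (act e x) = fst e" if "x \<in> K" "e \<in> E" "fst e \<noteq> lab x" for e x
      using act_in_K[OF that] by auto
    show "0 < r0" by (rule r0(1))
    show "lab x = lab y" if "x \<in> K" "y \<in> K" "dist x y < r0" for x y
    proof (rule ccontr)
      assume "lab x \<noteq> lab y"
      from r0(2)[OF KD(1)[OF that(1)] KD(1)[OF that(2)] this KD(2)[OF that(1)] KD(2)[OF that(2)]] n1[of x y] that(3)
      show False by simp
    qed
    show "finite ((\<lambda>g. (g, 1)) ` \<A>)" using s1.gens(2) by simp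
    show "(\<lambda>g. (g, 1)) ` \<A> \<subseteq> E" by (auto simp: alphabet_def)
    show "\<exists>e\<in>(\<lambda>g. (g, 1)) ` \<A>. fst e \<noteq> g \<and> fst e \<noteq> h" for g h using s1.three[of g h] by auto
    show "0 \<le> critical" using ab by (simp add: critical_def)
    show "\<bar>cocycle act \<phi> w x - cocycle act \<phi> w y\<bar> \<le> M * dist x y"
      if "x \<in> K" "y \<in> K" "adm E fst w (lab x)" "adm E fst w (lab y)" for w x y
    proof -
      have w: "set w \<subseteq> E" by (rule adm_subset[OF that(3)])
      let ?d1 = "ln (s1.st w (fst x)) - ln (s1.st w (fst y))" and ?d2 = "ln (s2.st w (snd x)) - ln (s2.st w (snd y))"
      have "cocycle act \<phi> w x - cocycle act \<phi> w y = 2 * a * ?d1 + 2 * b * ?d2"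
        unfolding cocycle_st[OF w that(1)] cocycle_st[OF w that(2)] by (simp add: algebra_simps)
      also have "\<bar>\<dots>\<bar> \<le> 2 * a * \<bar>?d1\<bar> + 2 * b * \<bar>?d2\<bar>"
        using ab abs_triangle_ineq[of "2 * a * ?d1" "2 * b * ?d2"] by (simp add: abs_mult)
      also have "\<dots> \<le> 2 * a * (dist x y / \<epsilon>1) + 2 * b * (dist x y / \<epsilon>2)"
      proof (intro add_mono mult_left_mono)
        have "\<bar>?d1\<bar> \<le> norm (fst x - fst y) / \<epsilon>1"
          using w1[OF that(3,4) KD(1)[OF that(1)] KD(1)[OF that(2)] KD(2)[OF that(1)] KD(2)[OF that(2)]] by blast
        also have "\<dots> \<le> dist x y / \<epsilon>1" using n1 \<epsilon>1 by (intro divide_right_mono) auto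
        finally show "\<bar>?d1\<bar> \<le> dist x y / \<epsilon>1" .
        have "\<bar>?d2\<bar> \<le> norm (snd x - snd y) / \<epsilon>2"
          using w2[OF that(3,4) KD(1)[OF that(1)] KD(1)[OF that(2)] KD(3)[OF that(1)] KD(3)[OF that(2)]] by blast
        also have "\<dots> \<le> dist x y / \<epsilon>2" using n2 \<epsilon>2 by (intro divide_right_mono) auto
        finally show "\<bar>?d2\<bar> \<le> dist x y / \<epsilon>2" .
      qed (use ab in auto)
      also have "\<dots> = M * dist x y" by (simp add: M_def algebra_simps)
      finally show ?thesis .
    qed
    show "- c0 \<le> cocycle act \<phi> w x" if "x \<in> K" "adm E fst w (lab x)" for w x
    proof -
      have w: "set w \<subseteq> E" by (rule adm_subset[OF that(2)])
      have "\<epsilon>1 * 1 \<le> \<epsilon>1 * s1.size w" "\<epsilon>2 * 1 \<le> \<epsilon>2 * s2.size w"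
        using s1.size_ge_1[OF w] s2.size_ge_1[OF w] \<epsilon>1 \<epsilon>2 by (intro mult_left_mono; simp)+
      then have "\<epsilon>1 \<le> s1.st w (fst x)" "\<epsilon>2 \<le> s2.st w (snd x)"
        using w1[OF that(2,2) KD(1,1,2,2)[OF that(1)]] w2[OF that(2,2) KD(1,1,3,3)[OF that(1)]] by linarith+
      then have "ln \<epsilon>1 \<le> ln (s1.st w (fst x))" "ln \<epsilon>2 \<le> ln (s2.st w (snd x))"
        using \<epsilon>1 \<epsilon>2 by (auto intro!: ln_mono)
      then have "a * (2 * ln \<epsilon>1) + b * (2 * ln \<epsilon>2) \<le> a * (2 * ln (s1.st w (fst x))) + b * (2 * ln (s2.st w (snd x)))"
        using ab by (intro add_mono mult_left_mono) auto
      then show ?thesis unfolding cocycle_st[OF w that(1)] c0_def by simp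
    qed
    show "\<exists>N. \<forall>w x y. length w \<ge> N \<longrightarrow> x \<in> K \<longrightarrow> y \<in> K \<longrightarrow>
       adm E fst w (lab x) \<longrightarrow> adm E fst w (lab y) \<longrightarrow> dist (foldr act w x) (foldr act w y) \<le> \<theta> * dist x y"
      if \<theta>: "0 < \<theta>" for \<theta>
    proof -
      \<comment> \<open>A size beyond \<open>R / \<epsilon>1\<close>, respectively
        \<open>R / \<epsilon>2\<close>, gives a contraction factor of at most
        \<open>\<theta> / 2\<close> on that circle; the two halves add up in the product
        metric.\<close>
      define R where "R = max 1 (2 / \<theta>)"
      obtain N1 where N1: "\<And>w l. adm E fst w l \<Longrightarrow> N1 \<le> length w \<Longrightarrow> R / \<epsilon>1 < s1.size w" using s1.size_large by blast
      obtain N2 where N2: "\<And>w l. adm E fst w l \<Longrightarrow> N2 \<le> length w \<Longrightarrow> R / \<epsilon>2 < s2.size w" using s2.size_large by blast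
      have sq: "d / X\<^sup>2 \<le> \<theta> / 2 * d" if "R < X" "0 \<le> d" for d X :: real
      proof -
        have X: "1 \<le> X" "2 / \<theta> \<le> X" using that(1) by (auto simp: R_def)
        have "X * 1 \<le> X * X" using X(1) by (intro mult_left_mono) auto
        with X(2) have "2 / \<theta> \<le> X\<^sup>2" by (simp add: power2_eq_square)
        then have "1 / X\<^sup>2 \<le> \<theta> / 2" using \<theta> X(1) by (simp add: field_simps)
        from mult_left_mono[OF this that(2)] show ?thesis by (simp add: mult.commute)
      qed
      have "dist (foldr act w x) (foldr act w y) \<le> \<theta> * dist x y"
        if "max N1 N2 \<le> length w" "x \<in> K" "y \<in> K" "adm E fst w (lab x)" "adm E fst w (lab y)" for w x y
      proof -
        have R1: "R < \<epsilon>1 * s1.size w" using N1[OF that(4)] that(1) \<epsilon>1 by (simp add: field_simps)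
        have R2: "R < \<epsilon>2 * s2.size w" using N2[OF that(4)] that(1) \<epsilon>2 by (simp add: field_simps)
        have "norm (foldr s1.bact w (fst x) - foldr s1.bact w (fst y)) \<le> norm (fst x - fst y) / (\<epsilon>1 * s1.size w)\<^sup>2"
          using w1[OF that(4,5) KD(1)[OF that(2)] KD(1)[OF that(3)] KD(2)[OF that(2)] KD(2)[OF that(3)]] by blast
        also have "\<dots> \<le> \<theta> / 2 * norm (fst x - fst y)" by (rule sq[OF R1]) simp
        also have "\<dots> \<le> \<theta> / 2 * dist x y" using n1 \<theta> by (intro mult_left_mono) auto
        finally have 1: "norm (foldr s1.bact w (fst x) - foldr s1.bact w (fst y)) \<le> \<theta> / 2 * dist x y" .
        have "norm (foldr s2.bact w (snd x) - foldr s2.bact w (snd y)) \<le> norm (snd x - snd y) / (\<epsilon>2 * s2.size w)\<^sup>2"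
          using w2[OF that(4,5) KD(1)[OF that(2)] KD(1)[OF that(3)] KD(3)[OF that(2)] KD(3)[OF that(3)]] by blast
        also have "\<dots> \<le> \<theta> / 2 * norm (snd x - snd y)" by (rule sq[OF R2]) simp
        also have "\<dots> \<le> \<theta> / 2 * dist x y" using n2 \<theta> by (intro mult_left_mono) auto
        finally have 2: "norm (foldr s2.bact w (snd x) - foldr s2.bact w (snd y)) \<le> \<theta> / 2 * dist x y" .
        have "dist (foldr act w x) (foldr act w y) \<le> norm (foldr s1.bact w (fst x) - foldr s1.bact w (fst y)) + norm (foldr s2.bact w (snd x) - foldr s2.bact w (snd y))"
          using dist_pair_le[of "foldr act w x" "foldr act w y"] by (simp add: foldr_act dist_norm)
        with 1 2 show ?thesis by simp
      qed
      then show ?thesis by blast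
    qed
    show "\<exists>B. \<forall>x\<in>K. (\<lambda>e. exp (- t * \<phi> e x)) summable_on {e \<in> E. fst e \<noteq> lab x} \<and>
       (\<Sum>\<^sub>\<infinity>e\<in>{e \<in> E. fst e \<noteq> lab x}. exp (- t * \<phi> e x)) \<le> B" if "critical < t" for t
      by (rule letter_summable[OF that])
    show "\<exists>U. \<forall>x\<in>K. fst e \<noteq> lab x \<longrightarrow> \<phi> e x \<le> U" if "e \<in> E" for e
      using letter_upper[OF that] by blast
  qed
  then show ?thesis by blast
qed

end

section \<open>Extended sums, power laws and growth of powers\<close>

lemma ennreal_sum_nonneg: "(\<And>x. x \<in> F \<Longrightarrow> 0 \<le> f x) \<Longrightarrow> ennreal (sum f F) = (\<Sum>x\<in>F. ennreal (f x))"
  by (simp add: sum_ennreal)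

lemma infsum_ennreal:
  fixes f :: "'i \<Rightarrow> real"
  assumes "f summable_on A" and f: "\<And>x. x \<in> A \<Longrightarrow> 0 \<le> f x"
  shows "(\<Sum>\<^sub>\<infinity>x\<in>A. ennreal (f x)) = ennreal (infsum f A)"
proof -
  have "(\<Sum>\<^sub>\<infinity>x\<in>A. ennreal (f x)) = (SUP F\<in>{F. finite F \<and> F \<subseteq> A}. \<Sum>x\<in>F. ennreal (f x))"
    by (rule nonneg_infsum_complete) simp
  also have "\<dots> = (SUP F\<in>{F. finite F \<and> F \<subseteq> A}. ennreal (sum f F))"
    by (intro SUP_cong refl ennreal_sum_nonneg[symmetric]) (use f in blast)
  also have "\<dots> = ennreal (infsum f A)"
    by (rule infsum_nonneg_is_SUPREMUM_ennreal[symmetric]) (use assms in auto)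
  finally show ?thesis .
qed

lemma infsum_ennreal_finite_iff:
  fixes f :: "'i \<Rightarrow> real"
  assumes f: "\<And>x. x \<in> A \<Longrightarrow> 0 \<le> f x"
  shows "(\<Sum>\<^sub>\<infinity>x\<in>A. ennreal (f x)) < \<infinity> \<longleftrightarrow> f summable_on A"
proof
  assume fin: "(\<Sum>\<^sub>\<infinity>x\<in>A. ennreal (f x)) < \<infinity>"
  let ?S = "\<Sum>\<^sub>\<infinity>x\<in>A. ennreal (f x)"
  have S: "?S = (SUP F\<in>{F. finite F \<and> F \<subseteq> A}. \<Sum>x\<in>F. ennreal (f x))" by (rule nonneg_infsum_complete) simp
  have "sum f F \<le> enn2real ?S" if "F \<subseteq> A" "finite F" for F
  proof -
    have "(\<Sum>x\<in>F. ennreal (f x)) \<le> ?S" unfolding S by (rule SUP_upper) (use that in simp)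
    moreover have "ennreal (sum f F) = (\<Sum>x\<in>F. ennreal (f x))" by (rule ennreal_sum_nonneg) (use f that in blast)
    moreover have "?S = ennreal (enn2real ?S)" using fin by simp
    ultimately have "ennreal (sum f F) \<le> ennreal (enn2real ?S)" by simp
    then show ?thesis by (simp add: ennreal_le_iff)
  qed
  then have "bdd_above (sum f ` {F. F \<subseteq> A \<and> finite F})" by (intro bdd_aboveI2[where M = "enn2real ?S"]) blast
  then show "f summable_on A" using f by (intro nonneg_bdd_above_summable_on)
qed (simp add: infsum_ennreal f)

lemma abs_powr_summable_iff: "(\<lambda>n::int. \<bar>of_int n\<bar> powr (- s)) summable_on {n. n \<noteq> 0} \<longleftrightarrow> 1 < (s::real)"
proof
  assume sum: "(\<lambda>n::int. \<bar>of_int n\<bar> powr (- s)) summable_on {n. n \<noteq> 0}"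
  have "(\<lambda>n::int. \<bar>of_int n\<bar> powr (- s)) summable_on (int ` {0<..})"
    by (rule summable_on_subset[OF sum]) auto
  then have "(\<lambda>n. real n powr (- s)) summable_on {0<..}"
    by (subst (asm) summable_on_reindex) (simp_all add: inj_on_def o_def)
  then have "(\<lambda>n. real n powr (- s)) summable_on UNIV"
    by (rule summable_on_cong_neutral[THEN iffD1, rotated -1]) auto
  then show "1 < s" by (simp add: summable_on_UNIV_nonneg_real_iff summable_real_powr_iff)
qed (rule summable_abs_powr)

text \<open>A bounded error in \<open>h\<close> changes the terms only by bounded factors, for
  either sign of \<open>t\<close>.\<close>

lemma power_law_summable:
  fixes h :: "int \<Rightarrow> real"
  assumes h: "\<And>n. n \<noteq> 0 \<Longrightarrow> \<bar>h n - r * ln \<bar>of_int n\<bar>\<bar> \<le> C"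
  shows "(\<lambda>n. exp (- t * h n)) summable_on {n. n \<noteq> 0} \<longleftrightarrow> 1 < t * r"
proof -
  let ?p = "\<lambda>n::int. \<bar>of_int n\<bar> powr (- (t * r)) :: real"
  have bd: "exp (- t * h n) \<le> exp (\<bar>t\<bar> * C) * ?p n" "?p n \<le> exp (\<bar>t\<bar> * C) * exp (- t * h n)" if n: "n \<noteq> 0" for n
  proof -
    have p: "?p n = exp (- t * (r * ln \<bar>of_int n\<bar>))" using n by (simp add: powr_def algebra_simps)
    have "\<bar>t * (h n - r * ln \<bar>of_int n\<bar>)\<bar> \<le> \<bar>t\<bar> * C" unfolding abs_mult by (rule mult_left_mono[OF h[OF n]]) simp
    then have "- t * h n \<le> \<bar>t\<bar> * C + - t * (r * ln \<bar>of_int n\<bar>)" "- t * (r * ln \<bar>of_int n\<bar>) \<le> \<bar>t\<bar> * C + - t * h n"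
      by (simp_all add: right_diff_distrib abs_le_iff)
    then show "exp (- t * h n) \<le> exp (\<bar>t\<bar> * C) * ?p n" "?p n \<le> exp (\<bar>t\<bar> * C) * exp (- t * h n)"
      unfolding p exp_add[symmetric] exp_le_cancel_iff .
  qed
  show ?thesis
    unfolding abs_powr_summable_iff[symmetric]
  proof
    assume "(\<lambda>n. exp (- t * h n)) summable_on {n. n \<noteq> 0}"
    from summable_on_cmult_right[OF this, of "exp (\<bar>t\<bar> * C)"] show "?p summable_on {n. n \<noteq> 0}"
      by (rule summable_on_comparison_test) (use bd in auto)
  next
    assume "?p summable_on {n. n \<noteq> 0}"
    from summable_on_cmult_right[OF this, of "exp (\<bar>t\<bar> * C)"] show "(\<lambda>n. exp (- t * h n)) summable_on {n. n \<noteq> 0}"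
      by (rule summable_on_comparison_test) (use bd in auto)
  qed
qed

text \<open>Powers lie in the span of \<open>A\<close> and the identity. \<open>disk_b\<close> sees
  only the coefficient of \<open>A\<close>, whose modulus is at least \<bar>k\<bar>, and it is
  dominated by \<open>disk_a\<close>.\<close>

lemma elementary_stretch_lower:
  assumes X: "X \<in> carrier PSL2R" and c: "card (boundary_fix X) \<noteq> 0"
  shows "\<exists>c>0. \<forall>k::int. c * \<bar>of_int k\<bar> \<le> psl_stretch (X [^]\<^bsub>PSL2R\<^esub> k) 0"
proof -
  obtain A where A: "A \<in> X" using psl_rep_mem[OF X] by blast
  note f = fixing_element[OF X A c]
  have "norm (disk_b A) / 2 * \<bar>of_int k\<bar> \<le> psl_stretch (X [^]\<^bsub>PSL2R\<^esub> k) 0" for k :: int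
  proof -
    obtain u v where uv: "u *\<^sub>R A + v *\<^sub>R mat 1 \<in> X [^]\<^bsub>PSL2R\<^esub> k" "\<bar>of_int k\<bar> \<le> \<bar>u\<bar>"
      using psl_int_pow_span[OF X A f(2), of k] by blast
    note K = psl_mem[OF PSL.int_pow_closed[OF X] uv(1)]
    have "\<bar>of_int k\<bar> * norm (disk_b A) \<le> \<bar>u\<bar> * norm (disk_b A)" using uv(2) by (rule mult_right_mono) simp
    also have "\<dots> = norm (disk_b (u *\<^sub>R A + v *\<^sub>R mat 1))" unfolding displacement_linear by (simp add: norm_mult)
    also have "\<dots> \<le> norm (disk_a (u *\<^sub>R A + v *\<^sub>R mat 1))" using norm_disk_b_less(1)[OF K(1)] by simp
    finally show ?thesis unfolding K(3) stretch_0 by (simp add: mult.commute)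
  qed
  then show ?thesis using f(1) by (intro exI[of _ "norm (disk_b A) / 2"]) simp
qed

text \<open>For trace \<plusminus>2 the coefficient of \<open>A\<close> has modulus exactly
  \<bar>k\<bar>, and \<open>disk_a\<close> exceeds \<open>disk_b\<close> in modulus by at most
  2.\<close>

lemma parabolic_stretch_upper:
  assumes "is_parabolic X"
  shows "\<exists>c>0. \<forall>k::int. k \<noteq> 0 \<longrightarrow> psl_stretch (X [^]\<^bsub>PSL2R\<^esub> k) 0 \<le> c * \<bar>of_int k\<bar>"
proof -
  have X: "X \<in> carrier PSL2R" and c: "card (boundary_fix X) \<noteq> 0" using assms by (auto simp: is_parabolic_def)
  obtain A where A: "A \<in> X" using psl_rep_mem[OF X] by blast
  note f = fixing_element[OF X A c]
  have "psl_stretch (X [^]\<^bsub>PSL2R\<^esub> k) 0 \<le> (1 + norm (disk_b A)) * \<bar>of_int k\<bar>" if k: "k \<noteq> 0" for k :: int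
  proof -
    obtain u v where uv: "u *\<^sub>R A + v *\<^sub>R mat 1 \<in> X [^]\<^bsub>PSL2R\<^esub> k" "\<bar>u\<bar> = \<bar>of_int k\<bar>"
      using psl_int_pow_span[OF X A f(2), of k] parabolic_trace[OF assms A] by blast
    let ?B = "u *\<^sub>R A + v *\<^sub>R mat 1"
    note K = psl_mem[OF PSL.int_pow_closed[OF X] uv(1)]
    have b: "norm (disk_b ?B) = \<bar>of_int k\<bar> * norm (disk_b A)" unfolding displacement_linear by (simp add: norm_mult uv(2))
    have eq: "(norm (disk_a ?B))\<^sup>2 = 4 + (norm (disk_b ?B))\<^sup>2" using norm_disk_ab[of ?B] K(1) by simp
    have "(norm (disk_a ?B))\<^sup>2 \<le> (2 + norm (disk_b ?B))\<^sup>2" unfolding eq power2_sum by simp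
    then have "norm (disk_a ?B) \<le> 2 + norm (disk_b ?B)" by (rule power2_le_imp_le) simp
    moreover have "of_int 1 \<le> (of_int \<bar>k\<bar> :: real)" using k by (simp only: of_int_le_iff)
    then have "1 \<le> \<bar>of_int k :: real\<bar>" by simp
    moreover have "0 \<le> \<bar>of_int k\<bar> * norm (disk_b A)" by simp
    ultimately have "norm (disk_a ?B) / 2 \<le> \<bar>of_int k\<bar> + \<bar>of_int k\<bar> * norm (disk_b A)" unfolding b by linarith
    then show ?thesis unfolding K(3) stretch_0 by (simp add: algebra_simps)
  qed
  moreover have "0 < 1 + norm (disk_b A)" by (simp add: add_pos_nonneg)
  ultimately show ?thesis by blast
qed

section \<open>Periodic sequences\<close>

lemma shift_funpow: "(shift ^^ n) x = (\<lambda>i. x (n + i))"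
proof (induction n arbitrary: x)
  case (Suc n)
  show ?case unfolding funpow_Suc_right o_def Suc.IH[of "shift x"] by (simp add: shift_def)
qed simp

lemma map_shift: "map x [0..<Suc n] = x 0 # map (shift x) [0..<n]"
  by (simp add: shift_def upt_conv_Cons map_Suc_upt[symmetric] del: upt_Suc)

lemma adm_nth:
  "adm E gen w l \<longleftrightarrow> (\<forall>i<length w. w ! i \<in> E \<and> gen (w ! i) \<noteq> (if Suc i < length w then gen (w ! Suc i) else l))"
proof (induction w)
  case (Cons e w)
  have lead: "lead gen w l = (if w = [] then l else gen (w ! 0))" by (cases w) auto
  show ?case unfolding adm.simps Cons.IH lead by (auto simp: All_less_Suc2)
qed simp

definition repeat :: "'e list \<Rightarrow> nat \<Rightarrow> 'e" where
  "repeat w i = w ! (i mod length w)"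

lemma periodic_mod:
  assumes "(shift ^^ n) x = x"
  shows "x (i mod n) = x i"
proof -
  have step: "x (n + i) = x i" for i using fun_cong[OF assms, of i] by (simp add: shift_funpow)
  have "x (k * n + j) = x j" for k j by (induction k) (simp_all add: step add.assoc)
  from this[of "i div n" "i mod n"] show ?thesis by simp
qed

text \<open>The label \<open>fst s\<close> in admissibility is the condition at the junction where
  the last letter of a period meets the first of the next.\<close>

lemma periodic_words:
  assumes n: "0 < n"
  shows "bij_betw repeat {w \<in> words (alphabet \<A>) fst n (fst s). hd w = s}
    {x \<in> markov_shift \<A>. (shift ^^ n) x = x \<and> x 0 = s}"
proof (rule bij_betwI[where g = "\<lambda>x. map x [0..<n]"])
  let ?W = "{w \<in> words (alphabet \<A>) fst n (fst s). hd w = s}" and ?X = "{x \<in> markov_shift \<A>. (shift ^^ n) x = x \<and> x 0 = s}"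
  show "repeat \<in> ?W \<rightarrow> ?X"
  proof
    fix w assume "w \<in> ?W"
    then have w: "length w = n" "adm (alphabet \<A>) fst w (fst s)" "w ! 0 = s" using n by (auto simp: words_def hd_conv_nth)
    have "repeat w i \<in> alphabet \<A> \<and> fst (repeat w i) \<noteq> fst (repeat w (Suc i))" for i
    proof -
      have "i mod n < n" using n by simp
      then have "w ! (i mod n) \<in> alphabet \<A> \<and> fst (w ! (i mod n)) \<noteq> (if Suc (i mod n) < n then fst (w ! Suc (i mod n)) else fst s)"
        using w(2) unfolding adm_nth w(1) by blast
      then show ?thesis using w(1,3) \<open>i mod n < n\<close> by (auto simp: repeat_def mod_Suc split: if_splits)
    qed
    then show "repeat w \<in> ?X" using w by (auto simp: markov_shift_def shift_funpow repeat_def)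
  qed
  show "(\<lambda>x. map x [0..<n]) \<in> ?X \<rightarrow> ?W"
  proof
    fix x assume "x \<in> ?X"
    then have x: "\<And>i. x i \<in> alphabet \<A>" "\<And>i. fst (x i) \<noteq> fst (x (Suc i))" "(shift ^^ n) x = x" "x 0 = s"
      by (auto simp: markov_shift_def)
    have "x n = s" using periodic_mod[OF x(3), of n] x(4) by simp
    then have ne: "fst (x i) \<noteq> (if Suc i < n then fst (x (Suc i)) else fst s)" if "i < n" for i
      using x(2)[of i] that by (cases "Suc i < n") (auto dest: le_antisym simp: not_less Suc_le_eq[symmetric])
    have "adm (alphabet \<A>) fst (map x [0..<n]) (fst s)"
      unfolding adm_nth
    proof (intro allI impI)
      fix i assume "i < length (map x [0..<n])"
      then show "map x [0..<n] ! i \<in> alphabet \<A> \<and> fst (map x [0..<n] ! i) \<noteq>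
          (if Suc i < length (map x [0..<n]) then fst (map x [0..<n] ! Suc i) else fst s)"
        using ne[of i] x(1)[of i] by (cases "Suc i < n") auto
    qed
    then show "map x [0..<n] \<in> ?W" using n x(4) by (simp add: words_def hd_map)
  qed
  show "map (repeat w) [0..<n] = w" if "w \<in> ?W" for w
    using that by (auto simp: words_def repeat_def intro!: nth_equalityI)
  show "repeat (map x [0..<n]) = x" if "x \<in> ?X" for x
    using that periodic_mod[of n x] n by (auto simp: repeat_def fun_eq_iff)
qed

section \<open>The pressure of the geometric potentials\<close>

context schottky_pair begin

definition limit_pair :: "(nat \<Rightarrow> 'g \<times> int) \<Rightarrow> complex \<times> complex" where
  "limit_pair x = (coded_point G \<rho>\<^sub>1 x, coded_point G \<rho>\<^sub>2 x)"

abbreviation potential :: "(nat \<Rightarrow> 'g \<times> int) \<Rightarrow> real" where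
  "potential x \<equiv> a * geometric_potential G \<rho>\<^sub>1 x + b * geometric_potential G \<rho>\<^sub>2 x"

abbreviation closed_words :: "'g \<times> int \<Rightarrow> nat \<Rightarrow> ('g \<times> int) list set" where
  "closed_words s n \<equiv> {w \<in> words E fst n (fst s). hd w = s}"

lemma limit_pair_K:
  assumes "x \<in> markov_shift \<A>"
  shows "limit_pair x \<in> K" "lab (limit_pair x) = fst (x 0)"
proof -
  have l: "fst (limit_pair x) \<in> C\<^sub>1 (fst (x 0))" "snd (limit_pair x) \<in> C\<^sub>2 (fst (x 0))"
    using s1.coded_point_limit(2)[OF assms] s2.coded_point_limit(2)[OF assms] by (simp_all add: limit_pair_def)
  show "lab (limit_pair x) = fst (x 0)" by (rule lab_eq[OF s1.shift_fst[OF assms] l(1)])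
  then show "limit_pair x \<in> K" unfolding K_lab using s1.shift_fst[OF assms] l by simp
qed

lemma foldr_act_limit_pair:
  "x \<in> markov_shift \<A> \<Longrightarrow> foldr act (map x [0..<n]) (limit_pair ((shift ^^ n) x)) = limit_pair x"
proof (induction n arbitrary: x)
  case (Suc n)
  have "foldr act (map (shift x) [0..<n]) (limit_pair ((shift ^^ n) (shift x))) = limit_pair (shift x)"
    by (rule Suc.IH[OF s1.shift_in[OF Suc.prems]])
  then have "foldr act (map x [0..<Suc n]) (limit_pair ((shift ^^ Suc n) x)) = act (x 0) (limit_pair (shift x))"
    unfolding map_shift funpow_Suc_right by simp
  also have "\<dots> = limit_pair x"
    using s1.coded_point_shift[OF Suc.prems] s2.coded_point_shift[OF Suc.prems] by (simp add: act_def limit_pair_def)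
  finally show ?case .
qed simp

lemma birkhoff_sum_potential:
  "x \<in> markov_shift \<A> \<Longrightarrow>
    birkhoff_sum (\<lambda>x. - t * potential x) n x = - t * cocycle act \<phi> (map x [0..<n]) (limit_pair ((shift ^^ n) x))"
proof (induction n arbitrary: x)
  case (Suc n)
  note y = s1.shift_in[OF Suc.prems]
  have pot: "potential x = \<phi> (x 0) (limit_pair (shift x))"
    using s1.geometric_potential_eq[OF Suc.prems] s2.geometric_potential_eq[OF Suc.prems]
    by (simp add: \<phi>_def limit_pair_def)
  have "birkhoff_sum (\<lambda>x. - t * potential x) (Suc n) x = - t * potential x + birkhoff_sum (\<lambda>x. - t * potential x) n (shift x)"
    unfolding birkhoff_sum_def sum.lessThan_Suc_shift by (simp add: funpow_Suc_right del: funpow.simps(2))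
  also have "\<dots> = - t * (\<phi> (x 0) (limit_pair (shift x)) + cocycle act \<phi> (map (shift x) [0..<n]) (limit_pair ((shift ^^ n) (shift x))))"
    unfolding Suc.IH[OF y] pot by (simp only: distrib_left)
  also have "\<dots> = - t * cocycle act \<phi> (map x [0..<Suc n]) (limit_pair ((shift ^^ Suc n) x))"
    unfolding map_shift funpow_Suc_right o_def cocycle.simps foldr_act_limit_pair[OF y] ..
  finally show ?case .
qed (simp add: birkhoff_sum_def)

text \<open>The base point \<open>y w\<close> is the limit point of the periodic sequence, a fixed
  point of the word. It varies with the word but not with \<open>t\<close>, and it stays in
  \<open>K\<close> with the label of \<open>s\<close>.\<close>

lemma partition_sum_words:
  assumes n: "0 < n"
  shows "\<exists>y. (\<forall>w\<in>closed_words s n. y w \<in> K \<and> lab (y w) = fst s) \<and>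
    (\<forall>t. partition_sum (markov_shift \<A>) (\<lambda>x. - t * potential x) s n =
      (\<Sum>\<^sub>\<infinity>w\<in>closed_words s n. ennreal (exp (- t * cocycle act \<phi> w (y w)))))"
proof (intro exI[of _ "\<lambda>w. limit_pair (repeat w)"] conjI ballI allI)
  note bij = periodic_words[OF n, of \<A> s]
  let ?X = "{x \<in> markov_shift \<A>. (shift ^^ n) x = x \<and> x 0 = s}"
  fix t
  have mem: "repeat w \<in> ?X" if "w \<in> closed_words s n" for w
    using bij_betwE[OF bij] that by blast
  have weight: "birkhoff_sum (\<lambda>x. - t * potential x) n (repeat w) = - t * cocycle act \<phi> w (limit_pair (repeat w))"
    if w: "w \<in> closed_words s n" for w
  proof -
    have "map (repeat w) [0..<n] = w" using w by (auto simp: words_def repeat_def intro!: nth_equalityI)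
    moreover have "repeat w \<in> markov_shift \<A>" "(shift ^^ n) (repeat w) = repeat w" using mem[OF w] by simp_all
    ultimately show ?thesis using birkhoff_sum_potential[of "repeat w" t n] by simp
  qed
  have "partition_sum (markov_shift \<A>) (\<lambda>x. - t * potential x) s n =
      (\<Sum>\<^sub>\<infinity>x\<in>?X. ennreal (exp (birkhoff_sum (\<lambda>x. - t * potential x) n x)))"
    unfolding partition_sum_def by (rule infsum_cong_neutral) auto
  also have "\<dots> = (\<Sum>\<^sub>\<infinity>w\<in>closed_words s n. ennreal (exp (birkhoff_sum (\<lambda>x. - t * potential x) n (repeat w))))"
    by (rule infsum_reindex_bij_betw[OF bij, symmetric])
  also have "\<dots> = (\<Sum>\<^sub>\<infinity>w\<in>closed_words s n. ennreal (exp (- t * cocycle act \<phi> w (limit_pair (repeat w)))))"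
    by (rule infsum_cong) (simp only: weight)
  finally show "partition_sum (markov_shift \<A>) (\<lambda>x. - t * potential x) s n =
      (\<Sum>\<^sub>\<infinity>w\<in>closed_words s n. ennreal (exp (- t * cocycle act \<phi> w (limit_pair (repeat w)))))" .
next
  fix w assume "w \<in> closed_words s n"
  then have "repeat w \<in> markov_shift \<A>" "repeat w 0 = s" using bij_betwE[OF periodic_words[OF n, of \<A> s]] by blast+
  then show "limit_pair (repeat w) \<in> K" "lab (limit_pair (repeat w)) = fst s" using limit_pair_K[of "repeat w"] by simp_all
qed

lemma generator_power:
  assumes "g \<in> \<A>"
  shows "\<rho>\<^sub>1 (g [^] (n::int)) = \<rho>\<^sub>1 g [^]\<^bsub>PSL2R\<^esub> n" "\<rho>\<^sub>2 (g [^] (n::int)) = \<rho>\<^sub>2 g [^]\<^bsub>PSL2R\<^esub> n"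
  using s1.gens(1) assms s1.hom.hom_int_pow[of g n] s2.hom.hom_int_pow[of g n] by auto

text \<open>The stretch of a parabolic power is linear in the exponent from below and from above, on
  both circles; the constants disappear in the bounded error.\<close>

lemma parabolic_letter_bounds:
  assumes q: "q \<in> \<A>" "is_parabolic (\<rho>\<^sub>1 q)" "is_parabolic (\<rho>\<^sub>2 q)"
  shows "\<exists>D. \<forall>m x. m \<noteq> 0 \<longrightarrow> x \<in> K \<longrightarrow> lab x \<noteq> q \<longrightarrow> \<bar>\<phi> (q, m) x - 2 * (a + b) * ln \<bar>of_int m\<bar>\<bar> \<le> D"
proof -
  obtain \<eta> where \<eta>: "0 < \<eta>" "\<And>e x. e \<in> E \<Longrightarrow> x \<in> K \<Longrightarrow> fst e \<noteq> lab x \<Longrightarrow> 2 * (a + b) * ln (\<eta> * \<bar>of_int (snd e)\<bar>) \<le> \<phi> e x"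
    using letter_lower by blast
  obtain c1 where c1: "0 < c1" "\<And>k::int. k \<noteq> 0 \<Longrightarrow> psl_stretch (\<rho>\<^sub>1 q [^]\<^bsub>PSL2R\<^esub> k) 0 \<le> c1 * \<bar>of_int k\<bar>"
    using parabolic_stretch_upper[OF q(2)] by blast
  obtain c2 where c2: "0 < c2" "\<And>k::int. k \<noteq> 0 \<Longrightarrow> psl_stretch (\<rho>\<^sub>2 q [^]\<^bsub>PSL2R\<^esub> k) 0 \<le> c2 * \<bar>of_int k\<bar>"
    using parabolic_stretch_upper[OF q(3)] by blast
  let ?U = "a * (2 * ln (2 * c1)) + b * (2 * ln (2 * c2))"
  have "\<bar>\<phi> (q, m) x - 2 * (a + b) * ln \<bar>of_int m\<bar>\<bar> \<le> \<bar>2 * (a + b) * ln \<eta>\<bar> + \<bar>?U\<bar>"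
    if m: "m \<noteq> 0" and x: "x \<in> K" "lab x \<noteq> q" for m x
  proof -
    have e: "(q, m) \<in> E" using q m by (simp add: alphabet_def)
    have p: "0 < \<bar>of_int m :: real\<bar>" using m by simp
    have "2 * (a + b) * (ln \<eta> + ln \<bar>of_int m\<bar>) \<le> \<phi> (q, m) x"
      using \<eta>(2)[OF e x(1)] x(2) \<eta>(1) p by (simp add: ln_mult)
    then have lower: "2 * (a + b) * ln \<eta> + 2 * (a + b) * ln \<bar>of_int m\<bar> \<le> \<phi> (q, m) x" by (simp only: distrib_left)
    have E: "set [(q, m)] \<subseteq> E" using e by simp
    have s: "s1.size [(q, m)] \<le> c1 * \<bar>of_int m\<bar>" "s2.size [(q, m)] \<le> c2 * \<bar>of_int m\<bar>"
      using c1(2)[OF m] c2(2)[OF m] unfolding letter_stretch[OF e] fst_conv snd_conv generator_power[OF q(1)] by simp_all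
    have lnm: "ln (2 * (d * \<bar>of_int m\<bar>)) = ln (2 * d) + ln \<bar>of_int m\<bar>" if "0 < d" for d :: real
      using that p by (simp add: ln_mult)
    have "ln (2 * s1.size [(q, m)]) \<le> ln (2 * (c1 * \<bar>of_int m\<bar>))" "ln (2 * s2.size [(q, m)]) \<le> ln (2 * (c2 * \<bar>of_int m\<bar>))"
      using s s1.size_ge_1[OF E] s2.size_ge_1[OF E] by (auto intro!: ln_mono)
    then have "ln (2 * s1.size [(q, m)]) \<le> ln (2 * c1) + ln \<bar>of_int m\<bar>" "ln (2 * s2.size [(q, m)]) \<le> ln (2 * c2) + ln \<bar>of_int m\<bar>"
      unfolding lnm[OF c1(1)] lnm[OF c2(1)] .
    then have "a * (2 * ln (2 * s1.size [(q, m)])) + b * (2 * ln (2 * s2.size [(q, m)]))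
        \<le> a * (2 * (ln (2 * c1) + ln \<bar>of_int m\<bar>)) + b * (2 * (ln (2 * c2) + ln \<bar>of_int m\<bar>))"
      using ab by (intro add_mono mult_left_mono) auto
    also have "\<dots> = ?U + 2 * (a + b) * ln \<bar>of_int m\<bar>" by (simp add: algebra_simps)
    finally have "\<phi> (q, m) x \<le> ?U + 2 * (a + b) * ln \<bar>of_int m\<bar>" using letter_upper[OF e x(1)] by linarith
    with lower show ?thesis by linarith
  qed
  then show ?thesis by blast
qed

text \<open>No asymptotics are involved: from length 4 on every partition sum is infinite, so the
  sequence is eventually constant.\<close>

theorem pressure_infinite:
  assumes q: "q \<in> \<A>" "is_parabolic (\<rho>\<^sub>1 q)" "is_parabolic (\<rho>\<^sub>2 q)" and t: "t < critical"
  shows "has_gurevich_pressure \<A> (\<lambda>x. - t * potential x) \<infinity>"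
  unfolding has_gurevich_pressure_def
proof
  fix s assume s: "s \<in> E"
  obtain M c0 r0 where "word_system K E fst lab act \<phi> ((\<lambda>g. (g, 1)) ` \<A>) critical M c0 r0 4"
    using word_system by blast
  then interpret W: word_system K E fst lab act \<phi> "(\<lambda>g. (g, 1)) ` \<A>" critical M c0 r0 4 .
  obtain D where D: "\<And>m x. m \<noteq> 0 \<Longrightarrow> x \<in> K \<Longrightarrow> lab x \<noteq> q \<Longrightarrow> \<bar>\<phi> (q, m) x - 2 * (a + b) * ln \<bar>of_int m\<bar>\<bar> \<le> D"
    using parabolic_letter_bounds[OF q] by blast
  have inf: "partition_sum (markov_shift \<A>) (\<lambda>x. - t * potential x) s n = \<infinity>" if n: "4 \<le> n" for n
  proof (rule ccontr)
    assume fin: "partition_sum (markov_shift \<A>) (\<lambda>x. - t * potential x) s n \<noteq> \<infinity>"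
    have n': "0 < n" using n by simp
    obtain y where y: "\<forall>w\<in>closed_words s n. y w \<in> K \<and> lab (y w) = fst s"
      and ps: "\<forall>t. partition_sum (markov_shift \<A>) (\<lambda>x. - t * potential x) s n =
        (\<Sum>\<^sub>\<infinity>w\<in>closed_words s n. ennreal (exp (- t * cocycle act \<phi> w (y w))))"
      using partition_sum_words[OF n', of s] by (elim exE conjE) auto
    have "(\<Sum>\<^sub>\<infinity>w\<in>closed_words s n. ennreal (exp (- t * cocycle act \<phi> w (y w)))) < \<infinity>"
      using fin unfolding ps[rule_format] by (simp add: less_top)
    then have sum: "(\<lambda>w. exp (- t * cocycle act \<phi> w (y w))) summable_on closed_words s n"
      by (subst (asm) infsum_ennreal_finite_iff) auto
    have "\<exists>w D'. inj_on w {m. m \<noteq> 0} \<and> (\<forall>m\<in>{m. m \<noteq> 0}. w m \<in> words E fst n (fst s) \<and> hd (w m) = s \<and>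
        (\<forall>x\<in>K. lab x = fst s \<longrightarrow> \<bar>cocycle act \<phi> (w m) x - 2 * (a + b) * ln \<bar>of_int m\<bar>\<bar> \<le> D'))"
      by (rule W.word_family[where q = "\<lambda>m. (q, m)" and g = q and D = D])
        (use q(1) s n D in \<open>auto simp: alphabet_def inj_on_def\<close>)
    then obtain w D' where w: "inj_on w {m::int. m \<noteq> 0}"
      and w': "\<forall>m\<in>{m. m \<noteq> 0}. w m \<in> words E fst n (fst s) \<and> hd (w m) = s \<and>
        (\<forall>x\<in>K. lab x = fst s \<longrightarrow> \<bar>cocycle act \<phi> (w m) x - 2 * (a + b) * ln \<bar>of_int m\<bar>\<bar> \<le> D')"
      by (elim exE conjE)
    have mem: "w m \<in> closed_words s n" if "m \<noteq> 0" for m using w' that by simp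
    have "(\<lambda>w. exp (- t * cocycle act \<phi> w (y w))) summable_on (w ` {m. m \<noteq> 0})"
      by (rule summable_on_subset[OF sum]) (use mem in blast)
    then have "(\<lambda>m. exp (- t * cocycle act \<phi> (w m) (y (w m)))) summable_on {m. m \<noteq> 0}"
      unfolding summable_on_reindex[OF w] o_def .
    moreover have "\<bar>cocycle act \<phi> (w m) (y (w m)) - 2 * (a + b) * ln \<bar>of_int m\<bar>\<bar> \<le> D'" if "m \<noteq> 0" for m
      using w' y mem[OF that] that by simp
    \<comment> \<open>Along the family the weights follow a power law in \<open>m\<close>, so their
      summability would place \<open>t\<close> above the critical value.\<close>
    ultimately have "1 < t * (2 * (a + b))" by (subst (asm) power_law_summable) auto
    then show False using t ab by (simp add: critical_def field_simps)
  qed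
  have "ereal (1 / real n) * ln_ennreal (partition_sum (markov_shift \<A>) (\<lambda>x. - t * potential x) s n) = \<infinity>" if "4 \<le> n" for n
    unfolding inf[OF that] using that by (simp add: ln_ennreal_def)
  then have "eventually (\<lambda>n. ereal (1 / real n) * ln_ennreal (partition_sum (markov_shift \<A>) (\<lambda>x. - t * potential x) s n) = \<infinity>) sequentially"
    by (intro eventually_sequentiallyI[of 4])
  then show "(\<lambda>n. ereal (1 / real n) * ln_ennreal (partition_sum (markov_shift \<A>) (\<lambda>x. - t * potential x) s n)) \<longlonglongrightarrow> \<infinity>"
    by (rule tendsto_eventually)
qed

end

text \<open>The lower bound loses two letters, a shift that vanishes after division by the
  length.\<close>

lemma ln_ratio_sandwich:
  fixes A Z :: "nat \<Rightarrow> real"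
  assumes lim: "(\<lambda>n. ln (Z n) / real n) \<longlonglongrightarrow> P" and Z: "\<And>n. 0 < Z n" and pos: "0 < u" "0 < v"
    and lower: "\<And>n. u * Z n \<le> A (n + 2)" and upper: "\<And>n. A (n + 2) \<le> v * Z (n + 2)"
  shows "(\<lambda>n. ln (A n) / real n) \<longlonglongrightarrow> P"
proof (rule LIMSEQ_offset[where k = 2], rule tendsto_sandwich)
  have frac: "(\<lambda>n. real n / real (n + 2)) \<longlonglongrightarrow> 1" by real_asymp
  have null: "(\<lambda>n. k / real (n + 2)) \<longlonglongrightarrow> 0" for k :: real by real_asymp
  have "(\<lambda>n. ln u / real (n + 2) + ln (Z n) / real n * (real n / real (n + 2))) \<longlonglongrightarrow> 0 + P * 1"
    by (intro tendsto_add tendsto_mult lim frac null)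
  then show "(\<lambda>n. ln u / real (n + 2) + ln (Z n) / real n * (real n / real (n + 2))) \<longlonglongrightarrow> P" by simp
  have "(\<lambda>n. ln v / real (n + 2) + ln (Z (n + 2)) / real (n + 2)) \<longlonglongrightarrow> 0 + P"
    by (intro tendsto_add LIMSEQ_ignore_initial_segment[OF lim] null)
  then show "(\<lambda>n. ln v / real (n + 2) + ln (Z (n + 2)) / real (n + 2)) \<longlonglongrightarrow> P" by simp
  show "\<forall>\<^sub>F n in sequentially. ln u / real (n + 2) + ln (Z n) / real n * (real n / real (n + 2)) \<le> ln (A (n + 2)) / real (n + 2)"
  proof (rule eventually_sequentiallyI)
    fix n :: nat assume "1 \<le> n"
    have "ln u + ln (Z n) = ln (u * Z n)" by (rule ln_mult_pos[OF pos(1) Z, symmetric])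
    also have "\<dots> \<le> ln (A (n + 2))" using lower[of n] pos(1) Z[of n] by (intro ln_mono) auto
    finally have "(ln u + ln (Z n)) / real (n + 2) \<le> ln (A (n + 2)) / real (n + 2)" by (rule divide_right_mono) simp
    then show "ln u / real (n + 2) + ln (Z n) / real n * (real n / real (n + 2)) \<le> ln (A (n + 2)) / real (n + 2)"
      using \<open>1 \<le> n\<close> by (simp add: add_divide_distrib)
  qed
  show "\<forall>\<^sub>F n in sequentially. ln (A (n + 2)) / real (n + 2) \<le> ln v / real (n + 2) + ln (Z (n + 2)) / real (n + 2)"
  proof (rule always_eventually, rule allI)
    fix n
    have "0 < A (n + 2)" using lower[of n] mult_pos_pos[OF pos(1) Z[of n]] by linarith
    then have "ln (A (n + 2)) \<le> ln (v * Z (n + 2))" using upper[of n] by (intro ln_mono)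
    also have "\<dots> = ln v + ln (Z (n + 2))" by (rule ln_mult_pos[OF pos(2) Z])
    finally have "ln (A (n + 2)) / real (n + 2) \<le> (ln v + ln (Z (n + 2))) / real (n + 2)" by (rule divide_right_mono) simp
    then show "ln (A (n + 2)) / real (n + 2) \<le> ln v / real (n + 2) + ln (Z (n + 2)) / real (n + 2)"
      by (simp only: add_divide_distrib)
  qed
qed

section \<open>Finite pressure and the Poincare series\<close>

context schottky_pair begin

text \<open>The periodic points at which closed words are weighed are replaced by one point
  \<open>x\<close> with the label of \<open>s\<close>, and the prescribed first letter is released
  by \<open>first_letter_sum\<close>. Both cost bounded factors, which leave the growth rate
  unchanged.\<close>

theorem pressure_finite:
  "\<exists>P. (\<forall>t>critical. has_gurevich_pressure \<A> (\<lambda>x. - t * potential x) (ereal (P t))) \<and> real_analytic_on P {critical<..}"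
proof -
  obtain M c0 r0 where "word_system K E fst lab act \<phi> ((\<lambda>g. (g, 1)) ` \<A>) critical M c0 r0 4"
    using word_system by blast
  then interpret W: word_system K E fst lab act \<phi> "(\<lambda>g. (g, 1)) ` \<A>" critical M c0 r0 4 .
  have "has_gurevich_pressure \<A> (\<lambda>x. - t * potential x) (ereal (W.pressure t))" if t: "critical < t" for t
    unfolding has_gurevich_pressure_def
  proof
    fix s assume s: "s \<in> E"
    then have g: "fst s \<in> \<A>" by (auto simp: alphabet_def)
    obtain z1 z2 where z: "z1 \<in> C\<^sub>1 (fst s)" "z2 \<in> C\<^sub>2 (fst s)" using s1.C(3)[OF g] s2.C(3)[OF g] by blast
    define x where "x = (z1, z2)"
    have lx: "lab x = fst s" by (rule lab_eq[OF g]) (simp add: x_def z)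
    have x: "x \<in> K" unfolding K_lab lx using g z by (simp add: x_def)
    have t0: "0 \<le> t" by (rule W.t_nonneg[OF t])
    \<comment> \<open>The variation of the cocycle of a word over the points it may be applied to is
      at most \<open>\<bar>M\<bar> * 4\<close>, where 4 bounds the diameter of
      \<open>K\<close>.\<close>
    define D where "D = t * (\<bar>M\<bar> * 4)"
    define B where "B n = (\<Sum>\<^sub>\<infinity>w\<in>closed_words s n. exp (- t * cocycle act \<phi> w x))" for n
    define A where "A n = enn2real (partition_sum (markov_shift \<A>) (\<lambda>x. - t * potential x) s n)" for n
    have sumB: "(\<lambda>w. exp (- t * cocycle act \<phi> w x)) summable_on closed_words s n" for n
      using W.summable[OF t x, of n] unfolding lx by (rule summable_on_subset) blast
    have AB: "partition_sum (markov_shift \<A>) (\<lambda>x. - t * potential x) s n = ennreal (A n) \<and>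
        exp (- D) * B n \<le> A n \<and> A n \<le> exp D * B n" if n: "0 < n" for n
    proof -
      obtain y where y: "\<forall>w\<in>closed_words s n. y w \<in> K \<and> lab (y w) = fst s"
        and ps: "\<forall>t. partition_sum (markov_shift \<A>) (\<lambda>x. - t * potential x) s n =
          (\<Sum>\<^sub>\<infinity>w\<in>closed_words s n. ennreal (exp (- t * cocycle act \<phi> w (y w))))"
        using partition_sum_words[OF n, of s] by (elim exE conjE) auto
      let ?f = "\<lambda>w. exp (- t * cocycle act \<phi> w (y w))" and ?g = "\<lambda>w. exp (- t * cocycle act \<phi> w x)"
      have cmp: "exp (- D) * ?g w \<le> ?f w" "?f w \<le> exp D * ?g w" if w: "w \<in> closed_words s n" for w
      proof -
        have yw: "y w \<in> K" "lab (y w) = fst s" using y w by blast+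
        have adm: "adm E fst w (fst s)" using w by (simp add: words_def)
        have "\<bar>cocycle act \<phi> w (y w) - cocycle act \<phi> w x\<bar> \<le> M * dist (y w) x"
          by (rule W.Phi_Lipschitz[OF yw(1) x]) (simp_all add: yw(2) lx adm)
        also have "\<dots> \<le> \<bar>M\<bar> * 4" by (rule W.M\<Delta>[OF yw(1) x])
        finally have "t * \<bar>cocycle act \<phi> w (y w) - cocycle act \<phi> w x\<bar> \<le> D"
          unfolding D_def by (rule mult_left_mono[OF _ t0])
        then have "\<bar>t * (cocycle act \<phi> w (y w) - cocycle act \<phi> w x)\<bar> \<le> D" using t0 by (simp add: abs_mult)
        then have "- D + - t * cocycle act \<phi> w x \<le> - t * cocycle act \<phi> w (y w)" "- t * cocycle act \<phi> w (y w) \<le> D + - t * cocycle act \<phi> w x"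
          by (simp_all add: right_diff_distrib abs_le_iff)
        then show "exp (- D) * ?g w \<le> ?f w" "?f w \<le> exp D * ?g w"
          unfolding exp_add[symmetric] exp_le_cancel_iff .
      qed
      have f: "?f summable_on closed_words s n"
        using summable_on_cmult_right[OF sumB, of "exp D"] by (rule summable_on_comparison_test) (use cmp in auto)
      have A: "A n = infsum ?f (closed_words s n)"
        unfolding A_def ps[rule_format] by (subst infsum_ennreal[OF f]) (simp_all add: infsum_nonneg del: mult_minus_left)
      have "exp (- D) * B n = (\<Sum>\<^sub>\<infinity>w\<in>closed_words s n. exp (- D) * ?g w)"
        unfolding B_def by (rule infsum_cmult_right[symmetric]) (rule sumB)
      also have "\<dots> \<le> A n" unfolding A
        by (rule infsum_mono[OF summable_on_cmult_right[OF sumB] f cmp(1)])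
      finally have 1: "exp (- D) * B n \<le> A n" .
      have "A n \<le> (\<Sum>\<^sub>\<infinity>w\<in>closed_words s n. exp D * ?g w)" unfolding A
        by (rule infsum_mono[OF f summable_on_cmult_right[OF sumB] cmp(2)])
      also have "\<dots> = exp D * B n" unfolding B_def by (rule infsum_cmult_right) (rule sumB)
      finally have 2: "A n \<le> exp D * B n" .
      have "partition_sum (markov_shift \<A>) (\<lambda>x. - t * potential x) s n = ennreal (A n)"
        unfolding A ps[rule_format] by (rule infsum_ennreal[OF f]) simp
      with 1 2 show ?thesis by blast
    qed
    obtain d where d: "0 < d" "\<And>n. d * W.Z t n x \<le> B (n + 2)"
      using W.first_letter_sum[OF t s x] unfolding lx B_def by auto
    have BZ: "B n \<le> W.Z t n x" for n
      unfolding B_def W.Z_def lx using sumB W.summable[OF t x, of n, unfolded lx] by (rule infsum_mono2) auto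
    have lower: "exp (- D) * d * W.Z t n x \<le> A (n + 2)" for n
    proof -
      have "exp (- D) * (d * W.Z t n x) \<le> exp (- D) * B (n + 2)" by (rule mult_left_mono[OF d(2)]) simp
      also have "\<dots> \<le> A (n + 2)" using AB[of "n + 2", OF trans_less_add2[OF zero_less_numeral]] by blast
      finally show ?thesis by (simp only: mult.assoc)
    qed
    have upper: "A (n + 2) \<le> exp D * W.Z t (n + 2) x" for n
    proof -
      have "A (n + 2) \<le> exp D * B (n + 2)" using AB[of "n + 2", OF trans_less_add2[OF zero_less_numeral]] by blast
      also have "\<dots> \<le> exp D * W.Z t (n + 2) x" by (rule mult_left_mono[OF BZ]) simp
      finally show ?thesis .
    qed
    have "(\<lambda>n. ln (A n) / real n) \<longlonglongrightarrow> W.pressure t"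
    proof (rule ln_ratio_sandwich)
      show "(\<lambda>n. ln (W.Z t n x) / real n) \<longlonglongrightarrow> W.pressure t" by (rule W.pressure_limit[OF t x])
      show "0 < W.Z t n x" for n by (rule W.Z_pos[OF t x])
      show "0 < exp (- D) * d" "0 < exp D" using d(1) by simp_all
    qed (rule lower upper)+
    then have lim: "(\<lambda>n. ereal (ln (A n) / real n)) \<longlonglongrightarrow> ereal (W.pressure t)" by simp
    have "ereal (ln (A n) / real n) = ereal (1 / real n) * ln_ennreal (partition_sum (markov_shift \<A>) (\<lambda>x. - t * potential x) s n)"
      if n: "2 \<le> n" for n
    proof -
      have "0 < exp (- D) * d * W.Z t (n - 2) x" using d(1) W.Z_pos[OF t x] by simp
      also have "\<dots> \<le> A n" using lower[of "n - 2"] unfolding le_add_diff_inverse2[OF n] .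
      finally have "0 < A n" .
      moreover have "partition_sum (markov_shift \<A>) (\<lambda>x. - t * potential x) s n = ennreal (A n)" using AB[of n] n by simp
      ultimately show ?thesis by (simp add: ln_ennreal_def)
    qed
    then have "\<forall>\<^sub>F n in sequentially. ereal (ln (A n) / real n) =
        ereal (1 / real n) * ln_ennreal (partition_sum (markov_shift \<A>) (\<lambda>x. - t * potential x) s n)"
      by (rule eventually_sequentiallyI)
    then show "(\<lambda>n. ereal (1 / real n) * ln_ennreal (partition_sum (markov_shift \<A>) (\<lambda>x. - t * potential x) s n)) \<longlonglongrightarrow> ereal (W.pressure t)"
      by (rule Lim_transform_eventually[OF lim])
  qed
  then show ?thesis using W.pressure_analytic by blast
qed

text \<open>Along the powers of \<open>p\<close> the distance is
  \<open>2 * (a + b) * ln \<bar>n\<bar>\<close> up to a bounded error, which is where the base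
  points enter. The series therefore converges exactly for \<open>t\<close> above
  \<open>critical\<close>.\<close>

lemma critical_exponent:
  assumes p: "p \<in> carrier G" "is_parabolic (\<rho>\<^sub>1 p)" "is_parabolic (\<rho>\<^sub>2 p)" and o: "norm o\<^sub>1 < 1" "norm o\<^sub>2 < 1"
  shows "cyclic_critical_exponent G (orbit_dist \<rho>\<^sub>1 \<rho>\<^sub>2 a b o\<^sub>1 o\<^sub>2) p = critical"
proof -
  let ?D = "\<lambda>n::int. orbit_dist \<rho>\<^sub>1 \<rho>\<^sub>2 a b o\<^sub>1 o\<^sub>2 (p [^] n)"
  obtain c1 where c1: "\<And>k::int. k \<noteq> 0 \<Longrightarrow> \<bar>hdist o\<^sub>1 (psl_act (\<rho>\<^sub>1 p [^]\<^bsub>PSL2R\<^esub> k) o\<^sub>1) - 2 * ln \<bar>of_int k\<bar>\<bar> \<le> c1"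
    using parabolic_hdist[OF p(2) o(1)] by blast
  obtain c2 where c2: "\<And>k::int. k \<noteq> 0 \<Longrightarrow> \<bar>hdist o\<^sub>2 (psl_act (\<rho>\<^sub>2 p [^]\<^bsub>PSL2R\<^esub> k) o\<^sub>2) - 2 * ln \<bar>of_int k\<bar>\<bar> \<le> c2"
    using parabolic_hdist[OF p(3) o(2)] by blast
  have D: "\<bar>?D n - 2 * (a + b) * ln \<bar>of_int n\<bar>\<bar> \<le> a * c1 + b * c2" if n: "n \<noteq> 0" for n
  proof -
    let ?h1 = "hdist o\<^sub>1 (psl_act (\<rho>\<^sub>1 p [^]\<^bsub>PSL2R\<^esub> n) o\<^sub>1) - 2 * ln \<bar>of_int n\<bar>"
      and ?h2 = "hdist o\<^sub>2 (psl_act (\<rho>\<^sub>2 p [^]\<^bsub>PSL2R\<^esub> n) o\<^sub>2) - 2 * ln \<bar>of_int n\<bar>"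
    have "?D n - 2 * (a + b) * ln \<bar>of_int n\<bar> = a * ?h1 + b * ?h2"
      unfolding orbit_dist_def s1.hom.hom_int_pow[OF p(1)] s2.hom.hom_int_pow[OF p(1)] by (simp add: algebra_simps)
    also have "\<bar>\<dots>\<bar> \<le> a * \<bar>?h1\<bar> + b * \<bar>?h2\<bar>" using ab abs_triangle_ineq[of "a * ?h1" "b * ?h2"] by (simp add: abs_mult)
    also have "\<dots> \<le> a * c1 + b * c2" using ab c1[OF n] c2[OF n] by (intro add_mono mult_left_mono)
    finally show ?thesis .
  qed
  have "cyclic_poincare_series G (orbit_dist \<rho>\<^sub>1 \<rho>\<^sub>2 a b o\<^sub>1 o\<^sub>2) p t < \<infinity> \<longleftrightarrow> critical < t" for t
  proof -
    have "cyclic_poincare_series G (orbit_dist \<rho>\<^sub>1 \<rho>\<^sub>2 a b o\<^sub>1 o\<^sub>2) p t < \<infinity> \<longleftrightarrow> (\<lambda>n. exp (- t * ?D n)) summable_on UNIV"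
      unfolding cyclic_poincare_series_def by (rule infsum_ennreal_finite_iff) simp
    also have "(UNIV :: int set) = insert 0 {n. n \<noteq> 0}" by auto
    also have "(\<lambda>n. exp (- t * ?D n)) summable_on \<dots> \<longleftrightarrow> (\<lambda>n. exp (- t * ?D n)) summable_on {n. n \<noteq> 0}"
      by (simp add: summable_on_insert_iff)
    also have "\<dots> \<longleftrightarrow> 1 < t * (2 * (a + b))" by (rule power_law_summable[OF D])
    also have "\<dots> \<longleftrightarrow> critical < t" using ab by (simp add: critical_def field_simps)
    finally show ?thesis .
  qed
  then have "{t. cyclic_poincare_series G (orbit_dist \<rho>\<^sub>1 \<rho>\<^sub>2 a b o\<^sub>1 o\<^sub>2) p t < \<infinity>} = {critical<..}" by auto
  then show ?thesis unfolding cyclic_critical_exponent_def by simp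
qed

end

section \<open>Extended Schottky groups\<close>

lemma iterate_into:
  assumes X: "X \<in> carrier PSL2R" and UV: "U \<subseteq> sphere 0 1" "U \<inter> V = {}" and into: "psl_act X ` (sphere 0 1 - V) \<subseteq> U"
  shows "z \<in> sphere 0 1 - V \<Longrightarrow> psl_act (X [^]\<^bsub>PSL2R\<^esub> Suc n) z \<in> U"
proof (induction n arbitrary: z)
  case 0
  then show ?case using into X by auto
next
  case (Suc n)
  have 1: "psl_act X z \<in> U" using into Suc.prems by blast
  have "psl_act (X [^]\<^bsub>PSL2R\<^esub> Suc n \<otimes>\<^bsub>PSL2R\<^esub> X) z = psl_act (X [^]\<^bsub>PSL2R\<^esub> Suc n) (psl_act X z)"
    by (rule psl_act_mult(1)[OF PSL.nat_pow_closed[OF X] X]) (use Suc.prems in simp)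
  moreover have "psl_act (X [^]\<^bsub>PSL2R\<^esub> Suc n) (psl_act X z) \<in> U" by (rule Suc.IH) (use 1 UV in blast)
  ultimately show ?case by (simp only: PSL.nat_pow_Suc)
qed

text \<open>Positive powers iterate the given inclusion. For negative ones, passing to complements
  shows that the inverse maps the complement of \<open>U\<close> into \<open>V\<close>.\<close>

lemma hyperbolic_ping:
  assumes X: "X \<in> carrier PSL2R" and U: "U \<subseteq> sphere 0 1" and V: "V \<subseteq> sphere 0 1" and UV: "U \<inter> V = {}"
    and into: "psl_act X ` (sphere 0 1 - V) \<subseteq> U"
    and z: "norm z = 1" "z \<notin> U" "z \<notin> V" and n: "n \<noteq> 0"
  shows "psl_act (X [^]\<^bsub>PSL2R\<^esub> (n::int)) z \<in> U \<union> V"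
proof (cases "n < 0")
  case False
  then obtain m where m: "n = int (Suc m)" using n by (metis not0_implies_Suc of_nat_0 int_cases2 nonneg_int_cases not_le)
  have "psl_act (X [^]\<^bsub>PSL2R\<^esub> Suc m) z \<in> U" by (rule iterate_into[OF X U UV into]) (use z in simp)
  then show ?thesis unfolding m int_pow_int by blast
next
  case True
  then obtain m where m: "n = - int (Suc m)" using negD by blast
  note X' = PSL.inv_closed[OF X]
  have "psl_act (inv\<^bsub>PSL2R\<^esub> X) ` (sphere 0 1 - U) \<subseteq> V"
  proof (rule image_subsetI, rule ccontr)
    fix u assume u: "u \<in> sphere 0 1 - U" and nV: "psl_act (inv\<^bsub>PSL2R\<^esub> X) u \<notin> V"
    have nu: "norm u = 1" using u by simp
    have "psl_act X (psl_act (inv\<^bsub>PSL2R\<^esub> X) u) = u" by (rule psl_act_inv[OF X]) (use nu in simp)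
    moreover have "psl_act (inv\<^bsub>PSL2R\<^esub> X) u \<in> sphere 0 1 - V" using norm_psl_act[OF X'] nu nV by simp
    ultimately have "u \<in> U" using into by force
    then show False using u by blast
  qed
  from iterate_into[OF X' V _ this, of z m] have "psl_act ((inv\<^bsub>PSL2R\<^esub> X) [^]\<^bsub>PSL2R\<^esub> Suc m) z \<in> V" using z UV by auto
  then show ?thesis unfolding m PSL.int_pow_neg_int[OF X] PSL.nat_pow_inv[OF X] by blast
qed

text \<open>Each generator receives the union of its neighborhoods; the growth constant is the
  minimum over the finitely many generators.\<close>

lemma extended_schottky_generators:
  fixes G :: "('g, 'm) monoid_scheme"
  defines "A \<equiv> \<lambda>N\<^sub>1 N\<^sub>2 hyp par. hyp ` {..<N\<^sub>1} \<union> par ` {..<N\<^sub>2}"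
  assumes G: "group G" and \<rho>: "fuchsian_rep G \<rho>" and A: "A N\<^sub>1 N\<^sub>2 hyp par \<subseteq> carrier G"
    and es: "extended_schottky (\<rho> ` carrier G) N\<^sub>1 (\<rho> \<circ> hyp) N\<^sub>2 (\<rho> \<circ> par)"
  shows "\<exists>C. schottky G \<rho> (A N\<^sub>1 N\<^sub>2 hyp par) C"
    and "\<exists>c>0. \<forall>g\<in>A N\<^sub>1 N\<^sub>2 hyp par. \<forall>n::int. c * \<bar>of_int n\<bar> \<le> psl_stretch (\<rho> (g [^]\<^bsub>G\<^esub> n)) 0"
proof -
  interpret G: group G by (rule G)
  have hom: "\<rho> \<in> hom G PSL2R" and disc: "discrete (\<Union> (\<rho> ` carrier G))" using \<rho> by (simp_all add: fuchsian_rep_def)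
  interpret hom: group_hom G PSL2R \<rho>
    using hom by unfold_locales (simp add: group_PSL2R)
  let ?A = "hyp ` {..<N\<^sub>1} \<union> par ` {..<N\<^sub>2}" and ?S = "sphere (0::complex) 1"
  have A': "?A \<subseteq> carrier G" using A by (simp add: A_def)
  have N: "3 \<le> N\<^sub>1 + N\<^sub>2" using es unfolding extended_schottky_def by (elim conjE)
  have es': "(\<forall>i<N\<^sub>1. is_hyperbolic ((\<rho> \<circ> hyp) i)) \<and> (\<forall>j<N\<^sub>2. is_parabolic ((\<rho> \<circ> par) j))"
    using es unfolding extended_schottky_def by (elim conjE) (intro conjI)
  have hyp: "\<And>i. i < N\<^sub>1 \<Longrightarrow> is_hyperbolic (\<rho> (hyp i))" and par: "\<And>j. j < N\<^sub>2 \<Longrightarrow> is_parabolic (\<rho> (par j))"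
    using es' by simp_all
  obtain Ca Cr Cp :: "nat \<Rightarrow> complex set" where
    Ch: "\<forall>i<N\<^sub>1. compact (Ca i) \<and> Ca i \<subseteq> ?S \<and>
           attracting_fixpoint ((\<rho> \<circ> hyp) i) \<in> (top_of_set ?S) interior_of (Ca i) \<and>
           compact (Cr i) \<and> Cr i \<subseteq> ?S \<and>
           repelling_fixpoint ((\<rho> \<circ> hyp) i) \<in> (top_of_set ?S) interior_of (Cr i) \<and>
           psl_act ((\<rho> \<circ> hyp) i) ` (?S - Cr i) \<subseteq> Ca i"
    and Cp: "\<forall>j<N\<^sub>2. compact (Cp j) \<and> Cp j \<subseteq> ?S \<and>
           boundary_fix ((\<rho> \<circ> par) j) \<subseteq> (top_of_set ?S) interior_of (Cp j) \<and>
           (\<forall>n::int. n \<noteq> 0 \<longrightarrow> psl_act ((\<rho> \<circ> par) j [^]\<^bsub>PSL2R\<^esub> n) ` (?S - Cp j) \<subseteq> Cp j)"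
    and disj: "disjoint_family_on (case_sum Ca (case_sum Cr Cp)) ({..<N\<^sub>1} <+> {..<N\<^sub>1} <+> {..<N\<^sub>2})"
    using es unfolding extended_schottky_def by (elim conjE exE) (rule that)
  let ?I = "{..<N\<^sub>1} <+> {..<N\<^sub>1} <+> {..<N\<^sub>2}"
  have I: "Inl i \<in> ?I \<longleftrightarrow> i < N\<^sub>1" "Inr (Inl i) \<in> ?I \<longleftrightarrow> i < N\<^sub>1" "Inr (Inr j) \<in> ?I \<longleftrightarrow> j < N\<^sub>2"
      "Inl i \<in> {..<N\<^sub>1} <+> {..<N\<^sub>2} \<longleftrightarrow> i < N\<^sub>1" "Inr j \<in> {..<N\<^sub>1} <+> {..<N\<^sub>2} \<longleftrightarrow> j < N\<^sub>2" for i j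
    by auto
  define D where "D = case_sum Ca (case_sum Cr Cp)"
  define gen where "gen = case_sum hyp (case_sum hyp par)"
  \<comment> \<open>Taking all indices that carry the generator \<open>g\<close> makes the sets of
    distinct generators disjoint at once.\<close>
  define C where "C g = (\<Union>m\<in>{m \<in> ?I. gen m = g}. D m)" for g
  have Ca: "compact (Ca i)" "Ca i \<subseteq> ?S" "compact (Cr i)" "Cr i \<subseteq> ?S" "psl_act (\<rho> (hyp i)) ` (?S - Cr i) \<subseteq> Ca i"
    and att: "attracting_fixpoint (\<rho> (hyp i)) \<in> Ca i" if "i < N\<^sub>1" for i
  proof -
    note c = Ch[THEN spec, THEN mp, OF that, unfolded o_def]
    show "compact (Ca i)" "Ca i \<subseteq> ?S" "compact (Cr i)" "Cr i \<subseteq> ?S" "psl_act (\<rho> (hyp i)) ` (?S - Cr i) \<subseteq> Ca i"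
      using c by - (elim conjE, assumption)+
    have "attracting_fixpoint (\<rho> (hyp i)) \<in> (top_of_set ?S) interior_of (Ca i)" using c by (elim conjE)
    with interior_of_subset show "attracting_fixpoint (\<rho> (hyp i)) \<in> Ca i" by (rule subsetD)
  qed
  have Cp': "compact (Cp j)" "Cp j \<subseteq> ?S" "boundary_fix (\<rho> (par j)) \<subseteq> Cp j"
      "n \<noteq> 0 \<Longrightarrow> psl_act (\<rho> (par j) [^]\<^bsub>PSL2R\<^esub> (n::int)) ` (?S - Cp j) \<subseteq> Cp j" if "j < N\<^sub>2" for j n
  proof -
    note c = Cp[THEN spec, THEN mp, OF that, unfolded o_def]
    show "compact (Cp j)" "Cp j \<subseteq> ?S" using c by - (elim conjE, assumption)+
    have "boundary_fix (\<rho> (par j)) \<subseteq> (top_of_set ?S) interior_of (Cp j)" using c by (elim conjE)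
    also note interior_of_subset
    finally show "boundary_fix (\<rho> (par j)) \<subseteq> Cp j" .
    have "\<forall>n::int. n \<noteq> 0 \<longrightarrow> psl_act (\<rho> (par j) [^]\<^bsub>PSL2R\<^esub> n) ` (?S - Cp j) \<subseteq> Cp j" using c by (elim conjE)
    then show "psl_act (\<rho> (par j) [^]\<^bsub>PSL2R\<^esub> n) ` (?S - Cp j) \<subseteq> Cp j" if "n \<noteq> 0" using that by blast
  qed
  have D: "compact (D m) \<and> D m \<subseteq> ?S" if "m \<in> ?I" for m
    using that by (elim PlusE) (simp_all add: D_def Ca Cp')
  have disj': "D m \<inter> D m' = {}" if "m \<in> ?I" "m' \<in> ?I" "m \<noteq> m'" for m m'
    using disjoint_family_onD[OF disj that] by (simp add: D_def)
  have hyp_in: "Ca i \<subseteq> C (hyp i)" "Cr i \<subseteq> C (hyp i)" if "i < N\<^sub>1" for i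
  proof -
    have "D (Inl i) \<subseteq> C (hyp i)" unfolding C_def by (rule UN_upper) (use that in \<open>simp add: gen_def I\<close>)
    moreover have "D (Inr (Inl i)) \<subseteq> C (hyp i)" unfolding C_def by (rule UN_upper) (use that in \<open>simp add: gen_def I\<close>)
    ultimately show "Ca i \<subseteq> C (hyp i)" "Cr i \<subseteq> C (hyp i)" by (simp_all add: D_def)
  qed
  have par_in: "Cp j \<subseteq> C (par j)" if "j < N\<^sub>2" for j
  proof -
    have "D (Inr (Inr j)) \<subseteq> C (par j)" unfolding C_def by (rule UN_upper) (use that in \<open>simp add: gen_def I\<close>)
    then show ?thesis by (simp add: D_def)
  qed
  have fix_par: "boundary_fix (\<rho> (par j)) \<subseteq> Cp j" "boundary_fix (\<rho> (par j)) \<noteq> {}" if "j < N\<^sub>2" for j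
    using Cp'(3)[OF that] par[OF that] by (auto simp: is_parabolic_def)
  \<comment> \<open>Hyperbolic and parabolic generators differ in the number of boundary fixed
    points, and two of the same kind have fixed points in disjoint sets. So the indices give at
    least three different generators.\<close>
  have inj: "inj_on (case_sum hyp par) ({..<N\<^sub>1} <+> {..<N\<^sub>2})"
  proof (rule inj_onI)
    fix m m' assume m: "m \<in> {..<N\<^sub>1} <+> {..<N\<^sub>2}" "m' \<in> {..<N\<^sub>1} <+> {..<N\<^sub>2}" and eq: "case_sum hyp par m = case_sum hyp par m'"
    have hp: "hyp i \<noteq> par j" if "i < N\<^sub>1" "j < N\<^sub>2" for i j
      using hyp[OF that(1)] par[OF that(2)] by (auto simp: is_hyperbolic_def is_parabolic_def)
    have hh: "i = i'" if "i < N\<^sub>1" "i' < N\<^sub>1" "hyp i = hyp i'" for i i'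
    proof (rule ccontr)
      assume "i \<noteq> i'"
      then have "Ca i \<inter> Ca i' = {}" using disj'[of "Inl i" "Inl i'"] that by (simp add: D_def I)
      then show False using att[OF that(1)] att[OF that(2)] that(3) by auto
    qed
    have pp: "j = j'" if "j < N\<^sub>2" "j' < N\<^sub>2" "par j = par j'" for j j'
    proof (rule ccontr)
      assume "j \<noteq> j'"
      then have "Cp j \<inter> Cp j' = {}" using disj'[of "Inr (Inr j)" "Inr (Inr j')"] that by (simp add: D_def I)
      then show False using fix_par[OF that(1)] fix_par[OF that(2)] that(3) by auto
    qed
    show "m = m'"
    proof (cases m; cases m')
      fix i i' assume "m = Inl i" "m' = Inl i'"
      then show ?thesis using m eq hh[of i i'] by (simp add: I)
    next
      fix i j assume "m = Inl i" "m' = Inr j"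
      then show ?thesis using m eq hp[of i j] by (simp add: I)
    next
      fix j i assume "m = Inr j" "m' = Inl i"
      then show ?thesis using m eq hp[of i j] by (simp add: I)
    next
      fix j j' assume "m = Inr j" "m' = Inr j'"
      then show ?thesis using m eq pp[of j j'] by (simp add: I)
    qed
  qed
  have "case_sum hyp par ` ({..<N\<^sub>1} <+> {..<N\<^sub>2}) = ?A" by (force simp: image_iff)
  with card_image[OF inj] have cardA: "3 \<le> card ?A" using N by (simp add: card_Plus)
  have "schottky G \<rho> ?A C"
  proof (intro schottky.intro schottky_axioms.intro)
    show "group G" by (rule G)
    show "\<rho> \<in> hom G PSL2R" by (rule hom)
    show "discrete (\<Union> (\<rho> ` carrier G))" by (rule disc)
    show "?A \<subseteq> carrier G" by (rule A')
    show "finite ?A" by simp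
    show "\<exists>c\<in>?A. c \<noteq> a \<and> c \<noteq> b" for a b
    proof (rule ccontr)
      assume "\<not> (\<exists>c\<in>?A. c \<noteq> a \<and> c \<noteq> b)"
      then have "?A \<subseteq> {a, b}" by blast
      from card_mono[OF _ this] have "card ?A \<le> card {a, b}" by simp
      also have "\<dots> \<le> 2" by (simp add: card_insert_if)
      finally show False using cardA by simp
    qed
    show "compact (C g)" for g
      unfolding C_def by (rule compact_UN) (use D in auto)
    show "C g \<subseteq> ?S" for g
      unfolding C_def using D by blast
    show "C g \<noteq> {}" if "g \<in> ?A" for g
      using that
    proof
      assume "g \<in> hyp ` {..<N\<^sub>1}"
      then show ?thesis using hyp_in(1) att by blast
    next
      assume "g \<in> par ` {..<N\<^sub>2}"
      then show ?thesis using par_in fix_par by blast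
    qed
    show "C g \<inter> C g' = {}" if "g \<noteq> g'" for g g'
    proof (rule ccontr)
      assume "C g \<inter> C g' \<noteq> {}"
      then obtain z m m' where "m \<in> ?I" "m' \<in> ?I" "gen m = g" "gen m' = g'" "z \<in> D m" "z \<in> D m'"
        unfolding C_def by blast
      then show False using disj'[of m m'] that by auto
    qed
    show "psl_act (\<rho> (g [^]\<^bsub>G\<^esub> n)) z \<in> C g" if g: "g \<in> ?A" and n: "n \<noteq> 0" and z: "norm z = 1" "z \<notin> C g" for g z and n :: int
      using g
    proof
      assume "g \<in> hyp ` {..<N\<^sub>1}"
      then obtain i where i: "i < N\<^sub>1" "g = hyp i" by blast
      have gc: "g \<in> carrier G" using g A' by blast
      have "Ca i \<inter> Cr i = {}" using disj'[of "Inl i" "Inr (Inl i)"] i by (simp add: D_def I)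
      moreover have "Ca i \<subseteq> ?S" "Cr i \<subseteq> ?S" "psl_act (\<rho> g) ` (?S - Cr i) \<subseteq> Ca i"
        unfolding i(2) by (rule Ca[OF i(1)])+
      moreover have "z \<notin> Ca i" "z \<notin> Cr i" using hyp_in[OF i(1)] z(2) i(2) by blast+
      ultimately have "psl_act (\<rho> g [^]\<^bsub>PSL2R\<^esub> n) z \<in> Ca i \<union> Cr i"
        using z(1) n by (intro hyperbolic_ping hom.hom_closed gc)
      then show ?thesis unfolding hom.hom_int_pow[OF gc] using hyp_in[OF i(1)] i(2) by blast
    next
      assume "g \<in> par ` {..<N\<^sub>2}"
      then obtain j where j: "j < N\<^sub>2" "g = par j" by blast
      have gc: "g \<in> carrier G" using g A' by blast
      have "psl_act (\<rho> g [^]\<^bsub>PSL2R\<^esub> n) ` (?S - Cp j) \<subseteq> Cp j" unfolding j(2) by (rule Cp'(4)[OF j(1) n])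
      moreover have "z \<in> ?S - Cp j" using par_in[OF j(1)] z j(2) by auto
      ultimately show ?thesis unfolding hom.hom_int_pow[OF gc] using par_in[OF j(1)] j(2) by blast
    qed
  qed
  then show "\<exists>C. schottky G \<rho> (A N\<^sub>1 N\<^sub>2 hyp par) C" unfolding A_def by blast
  have "\<forall>g\<in>?A. \<exists>c>0. \<forall>n::int. c * \<bar>of_int n\<bar> \<le> psl_stretch (\<rho> (g [^]\<^bsub>G\<^esub> n)) 0"
  proof
    fix g assume g: "g \<in> ?A"
    then have gc: "g \<in> carrier G" using A' by blast
    have "card (boundary_fix (\<rho> g)) \<noteq> 0" using g hyp par by (auto simp: is_hyperbolic_def is_parabolic_def)
    from elementary_stretch_lower[OF hom.hom_closed[OF gc] this]
    show "\<exists>c>0. \<forall>n::int. c * \<bar>of_int n\<bar> \<le> psl_stretch (\<rho> (g [^]\<^bsub>G\<^esub> n)) 0" unfolding hom.hom_int_pow[OF gc] .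
  qed
  from bchoice[OF this] obtain f where f: "\<forall>g\<in>?A. 0 < f g \<and> (\<forall>n::int. f g * \<bar>of_int n\<bar> \<le> psl_stretch (\<rho> (g [^]\<^bsub>G\<^esub> n)) 0)"
    by (elim exE)
  have ne: "?A \<noteq> {}" using cardA by auto
  have pos: "0 < Min (f ` ?A)" using f ne by (subst Min_gr_iff) auto
  have "Min (f ` ?A) * \<bar>of_int n\<bar> \<le> psl_stretch (\<rho> (g [^]\<^bsub>G\<^esub> n)) 0" if g: "g \<in> ?A" for g and n :: int
  proof -
    have "Min (f ` ?A) \<le> f g" using g by (intro Min_le) auto
    then have "Min (f ` ?A) * \<bar>of_int n\<bar> \<le> f g * \<bar>of_int n\<bar>" by (rule mult_right_mono) simp
    also have "\<dots> \<le> psl_stretch (\<rho> (g [^]\<^bsub>G\<^esub> n)) 0" using f g by blast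
    finally show ?thesis .
  qed
  with pos show "\<exists>c>0. \<forall>g\<in>A N\<^sub>1 N\<^sub>2 hyp par. \<forall>n::int. c * \<bar>of_int n\<bar> \<le> psl_stretch (\<rho> (g [^]\<^bsub>G\<^esub> n)) 0"
    unfolding A_def by blast
qed

theorem lemma4:
  fixes S :: "'s::topological_space set" and s\<^sub>0 :: 's
    and G :: "('g, 'm) monoid_scheme"
    and \<rho>\<^sub>1 \<rho>\<^sub>2 :: "'g \<Rightarrow> (real^2^2) set"
    and N\<^sub>1 N\<^sub>2 :: nat and hyp par :: "nat \<Rightarrow> 'g"
    and e :: int and a b :: real and o\<^sub>1 o\<^sub>2 :: complex and p :: 'g
  assumes "surface S" and "has_euler_characteristic S e" and "e < 0"
    and "s\<^sub>0 \<in> S" and "group G" and "G \<cong> fundamental_group S s\<^sub>0"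
    and "fuchsian_rep G \<rho>\<^sub>1" and "fuchsian_rep G \<rho>\<^sub>2"
    and "boundary_preserving G \<rho>\<^sub>1 \<rho>\<^sub>2"
    and "hyp ` {..<N\<^sub>1} \<union> par ` {..<N\<^sub>2} \<subseteq> carrier G"
    and "extended_schottky (\<rho>\<^sub>1 ` carrier G) N\<^sub>1 (\<rho>\<^sub>1 \<circ> hyp) N\<^sub>2 (\<rho>\<^sub>1 \<circ> par)"
    and "extended_schottky (\<rho>\<^sub>2 ` carrier G) N\<^sub>1 (\<rho>\<^sub>2 \<circ> hyp) N\<^sub>2 (\<rho>\<^sub>2 \<circ> par)"
    and "a \<ge> 0" and "b \<ge> 0" and "\<not> (a = 0 \<and> b = 0)"
    and "o\<^sub>1 \<in> ball 0 1" and "o\<^sub>2 \<in> ball 0 1"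
    and "p \<in> carrier G" and "is_parabolic (\<rho>\<^sub>1 p)" and "is_parabolic (\<rho>\<^sub>2 p)"
  shows
    "let \<A> = hyp ` {..<N\<^sub>1} \<union> par ` {..<N\<^sub>2};
         \<tau> = geometric_potential G \<rho>\<^sub>1;
         \<kappa> = geometric_potential G \<rho>\<^sub>2;
         \<delta> = cyclic_critical_exponent G (orbit_dist \<rho>\<^sub>1 \<rho>\<^sub>2 a b o\<^sub>1 o\<^sub>2) p;
         pressure = (\<lambda>t. has_gurevich_pressure \<A> (\<lambda>x. - t * (a * \<tau> x + b * \<kappa> x)))
     in (\<forall>t<\<delta>. pressure t \<infinity>) \<and>
        (\<exists>P :: real \<Rightarrow> real. (\<forall>t>\<delta>. pressure t (ereal (P t))) \<and> real_analytic_on P {\<delta><..})"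
proof -
  let ?A = "hyp ` {..<N\<^sub>1} \<union> par ` {..<N\<^sub>2}"
  note e1 = extended_schottky_generators[OF \<open>group G\<close> \<open>fuchsian_rep G \<rho>\<^sub>1\<close> assms(10,11)]
    and e2 = extended_schottky_generators[OF \<open>group G\<close> \<open>fuchsian_rep G \<rho>\<^sub>2\<close> assms(10,12)]
  obtain C\<^sub>1 where C1: "schottky G \<rho>\<^sub>1 ?A C\<^sub>1" using e1(1) by blast
  obtain C\<^sub>2 where C2: "schottky G \<rho>\<^sub>2 ?A C\<^sub>2" using e2(1) by blast
  obtain c\<^sub>1 where c1: "0 < c\<^sub>1" "\<And>g n. g \<in> ?A \<Longrightarrow> c\<^sub>1 * \<bar>of_int n\<bar> \<le> psl_stretch (\<rho>\<^sub>1 (g [^]\<^bsub>G\<^esub> (n::int))) 0" using e1(2) by blast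
  obtain c\<^sub>2 where c2: "0 < c\<^sub>2" "\<And>g n. g \<in> ?A \<Longrightarrow> c\<^sub>2 * \<bar>of_int n\<bar> \<le> psl_stretch (\<rho>\<^sub>2 (g [^]\<^bsub>G\<^esub> (n::int))) 0" using e2(2) by blast
  interpret schottky_pair G \<rho>\<^sub>1 \<rho>\<^sub>2 ?A C\<^sub>1 C\<^sub>2 a b "min c\<^sub>1 c\<^sub>2"
  proof (intro schottky_pair.intro schottky_pair_axioms.intro C1 C2)
    show "0 \<le> a" "0 \<le> b" by fact+
    show "0 < a + b" using \<open>a \<ge> 0\<close> \<open>b \<ge> 0\<close> \<open>\<not> (a = 0 \<and> b = 0)\<close> by linarith
    show "0 < min c\<^sub>1 c\<^sub>2" using c1 c2 by simp
    fix g and n :: int assume g: "g \<in> ?A"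
    have "min c\<^sub>1 c\<^sub>2 * \<bar>of_int n\<bar> \<le> c\<^sub>1 * \<bar>of_int n\<bar>" "min c\<^sub>1 c\<^sub>2 * \<bar>of_int n\<bar> \<le> c\<^sub>2 * \<bar>of_int n\<bar>"
      by (intro mult_right_mono; simp)+
    then show "min c\<^sub>1 c\<^sub>2 * \<bar>of_int n\<bar> \<le> psl_stretch (\<rho>\<^sub>1 (g [^]\<^bsub>G\<^esub> n)) 0"
      "min c\<^sub>1 c\<^sub>2 * \<bar>of_int n\<bar> \<le> psl_stretch (\<rho>\<^sub>2 (g [^]\<^bsub>G\<^esub> n)) 0"
      using c1(2)[OF g, of n] c2(2)[OF g, of n] by linarith+
  qed
  have crit: "cyclic_critical_exponent G (orbit_dist \<rho>\<^sub>1 \<rho>\<^sub>2 a b o\<^sub>1 o\<^sub>2) p = critical"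
    using assms(16,17) by (intro critical_exponent assms(18-20)) simp_all
  \<comment> \<open>The divergence needs a parabolic generator, whereas \<open>p\<close> is any
    parabolic element; by \<open>crit\<close> its exponent is the common value
    \<open>critical\<close>.\<close>
  have "0 < N\<^sub>2" using assms(11) by (simp add: extended_schottky_def)
  then have q: "par 0 \<in> ?A" "is_parabolic (\<rho>\<^sub>1 (par 0))" "is_parabolic (\<rho>\<^sub>2 (par 0))"
    using assms(11,12) by (auto simp: extended_schottky_def)
  show ?thesis
    unfolding Let_def crit
  proof (rule conjI)
    show "\<forall>t<critical. has_gurevich_pressure ?A (\<lambda>x. - t * potential x) \<infinity>"
      by (intro allI impI) (rule pressure_infinite[OF q])
    show "\<exists>P. (\<forall>t>critical. has_gurevich_pressure ?A (\<lambda>x. - t * potential x) (ereal (P t))) \<and> real_analytic_on P {critical<..}"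
      by (rule pressure_finite)
  qed
qed

end
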